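(* Let $k\ge 1$ be an integer, and let $\{\mathcal T_h\}$ be a shape-regular family of curved-edge quadrilateral partitions, so that $\Omega_h=\bigcup_{K^h\in\mathcal T_h}K^h$ is a shape-regular curved quadrilateral mesh approximation of the domain $\Omega$. Let $a_h(\cdot,\cdot)$ be the Robin finite volume element bilinear form on $\mathcal U_h^k\times\mathcal V_h$, let $\Pi_h^{k,*}:\mathcal U_h^k\to\mathcal V_h$ be the dual interpolation operator, and let $|||\cdot|||_{\Omega_h}$ be the energy norm, all as defined in the context. Then, for all sufficiently small $h$, there exists a constant $C>0$ independent of $h$ such that $$a_h(u_h,\Pi_h^{k,*}u_h)\ \ge\ C\,|||u_h|||_{\Omega_h}^2\qquad\forall\,u_h\in\mathcal U_h^k .$$
   Context: **Mesh.** $\Omega\subset\mathbb R^2$ is a bounded domain with (possibly curved) boundary $\Gamma$. $\mathcal T$ is a partition of $\Omega$ into curved-edge quadrilaterals $K$ with diameters $h_K$, $h=\max_K h_K$. $\widehat K=[-1,1]^2$. Each $K$ is approximated by $K^h=\Psi_K(\widehat K)$ with $\Psi_K(\xi,\eta)=(x(\xi,\eta),y(\xi,\eta))$ a diffeomorphism; $\mathcal T_h=\{K^h\}$ is a conforming partition of $\overline{\Omega_h}$, $\Omega_h=\bigcup K^h$, $\Gamma_h=\partial\Omega_h$. On an edge common to two elements the two induced edge parametrizations coincide up to orientation. $\mathbb J_K=D\Psi_K$, $J_K=\det\mathbb J_K$. **(Shape-)regular** means, with constants $c,C>0$ independent of $h$ and $K$: (i) the straight-edge quadrilaterals $K'$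 with the same four vertices as $K^h$ form a regular family; (ii) the distance between each non-vertex node of $K^h$ and the corresponding node of $K'$ (image of the same reference node under the bilinear map $\widehat K\to K'$) tends to $0$ as $h_K\to0$; (iii) $\|D^s\Psi_K\|_{\infty,\widehat K}\le C h_K^s$ for $1\le s\le\max(k+1,3)$; (iv) $c\,h_K^2\le|J_K|\le C h_K^2$ on $\widehat K$. **Trial space.** $\mathcal U_h^k=\{u_h\in C(\overline{\Omega_h}): \widehat u_h:=u_h|_{K^h}\circ\Psi_K\in\mathbb Q_k(\widehat K)\ \forall K^h\in\mathcal T_h\}$, $\mathbb Q_k$ = polynomials of degree $\le k$ in each variable. **Dual mesh and test space.** $\mathbb Z_k=\{1,\dots,k\}$, $\mathbb Z_k^0=\{0,\dots,k\}$. $g_1<\dots<g_k$ are the $k$ Gauss–Legendre points on $[-1,1]$ with weights $A_1,\dots,A_k$; $g_0=-1$, $g_{k+1}=1$. $l_{i,j}^{\widehat K}$, $i,j\in\mathbb Z_k^0$, are the standard tensor-product Lagrange nodes $(l_i,l_j)$ with $-1=l_0<\dots<l_k=1$ symmetric about $0$; $L_{i,j}^{K^h}=\Psi_K(l^{\widehat K}_{i,j})$; $\mathcal N$ is the set of all nodes $L^{K^h}_{i,j}$ and $\mathcal N^b=\mathcal N\cap\partial\Omega_h$. Put $K^{*,h}_{i,j}=\Psi_K([g_i,g_{i+1}]\times[g_j,g_{j+1}])$, $i,j\in\mathbb Z_k^0$. For $P\in\mathcal N$ the control volume is $K_P^{*,h}=\bigcup\{K^{*,h}_{i,j}: K^h\in\mathcal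 T_h,\ L^{K^h}_{i,j}=P\}$. $\mathcal V_h$ is the space of functions $v_h=\sum_{P\in\mathcal N}v_{K_P^{*,h}}\psi_{K_P^{*,h}}$ with constants $v_{K_P^{*,h}}\in\mathbb R$ and $\psi$ the characteristic function. Write $v^{K^h}_{i,j}=v_{K_P^{*,h}}$ for $P=L^{K^h}_{i,j}$. $\Gamma_{P,h}=\partial K_P^{*,h}\cap\Gamma_h$, $\partial_0K_P^{*,h}=\partial K_P^{*,h}\setminus\Gamma_{P,h}$. **Coefficients.** $\kappa\in W^{1,\infty}(\Omega)$, $\kappa\ge\kappa_0>0$ in $\Omega$; $\sigma\in W^{1,\infty}(\Omega)$, $0<\sigma_0\le\sigma\le\sigma_1$ on $\Gamma$. $\widetilde\Omega\supset\Omega\cup\Omega_h$ is a bounded domain independent of $h$; $\widetilde\kappa,\widetilde\sigma$ are bounded $W^{1,\infty}(\widetilde\Omega)$ extensions, with $\widetilde\kappa$ on $\Omega_h$ and $\widetilde\sigma$ on $\Gamma_h$ bounded below by positive constants independent of $h$; $\kappa_h=\widetilde\kappa|_{\Omega_h}$, $\sigma_h=\widetilde\sigma|_{\Gamma_h}$. **Bilinear form.** $a_h=a_{h,0}+r_h$, with $$a_{h,0}(u_h,v_h)=-\sum_{P\in\mathcal N}v_{K_P^{*,h}}\int_{\partial_0K_P^{*,h}}\kappa_h\frac{\partial u_h}{\partial\bm n}\,ds,\qquad r_h(u_h,v_h)=\sum_{P\in\mathcal N^b}v_{K_P^{*,h}}\int_{\Gamma_{P,h}}\sigma_hu_h\,ds,$$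 $\bm n$ the outward unit normal of $K_P^{*,h}$. **Energy norm.** $|||u_h|||_{\Omega_h}^2=|u_h|_{1,\Omega_h}^2+\|\sigma_h^{1/2}u_h\|_{0,\Gamma_h}^2$, where $|\cdot|_{1,\Omega_h}$ is the $H^1$ seminorm. **Dual interpolation.** For $u_h\in\mathcal U_h^k$, $v_h=\Pi_h^{k,*}u_h\in\mathcal V_h$ is the unique element such that on every $K^h$: $v_{0,0}^{K^h}=\widehat u_h(-1,-1)$; $v_{i,0}^{K^h}-v_{i-1,0}^{K^h}=A_i\,\partial_\xi\widehat u_h(g_i,-1)$ for $i\in\mathbb Z_k$; $v_{0,j}^{K^h}-v_{0,j-1}^{K^h}=A_j\,\partial_\eta\widehat u_h(-1,g_j)$ for $j\in\mathbb Z_k$; and $v_{i,j}^{K^h}+v_{i-1,j-1}^{K^h}-v_{i,j-1}^{K^h}-v_{i-1,j}^{K^h}=A_iA_j\,\partial_\xi\partial_\eta\widehat u_h(g_i,g_j)$ for $i,j\in\mathbb Z_k$. *)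

theory Defs
  imports "HOL-Analysis.Analysis" "HOL-Computational_Algebra.Polynomial"
begin

abbreviation pt :: "real \<Rightarrow> real \<Rightarrow> real^2" where
  "pt x y \<equiv> vector [x, y]"

definition ref_square :: "(real^2) set" where
  "ref_square = {pt x y | x y. x \<in> {-1..1} \<and> y \<in> {-1..1}}"

text \<open>Derivatives are taken within \<open>S\<close>, hence one-sided at boundary points of \<open>S\<close>;
  for \<open>S = UNIV\<close> this is the ordinary partial derivative.\<close>

definition pd :: "(real^2) set \<Rightarrow> 2 \<Rightarrow> (real^2 \<Rightarrow> 'b::real_normed_vector) \<Rightarrow> real^2 \<Rightarrow> 'b" where
  "pd S i f x = vector_derivative (\<lambda>t. f (x + t *\<^sub>R axis i 1))
                  (at 0 within {t. x + t *\<^sub>R axis i 1 \<in> S})"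

primrec pds :: "(real^2) set \<Rightarrow> 2 list \<Rightarrow> (real^2 \<Rightarrow> 'b::real_normed_vector) \<Rightarrow> real^2 \<Rightarrow> 'b" where
  "pds S [] f = f"
| "pds S (i # is) f = pd S i (pds S is f)"

definition Ck_on :: "nat \<Rightarrow> (real^2) set \<Rightarrow> (real^2 \<Rightarrow> 'b::real_normed_vector) \<Rightarrow> bool" where
  "Ck_on m S f \<longleftrightarrow>
     (\<forall>is. length is \<le> m \<longrightarrow> continuous_on S (pds S is f)) \<and>
     (\<forall>is. length is < m \<longrightarrow> (\<forall>i. \<forall>x\<in>S.
        (\<lambda>t. pds S is f (x + t *\<^sub>R axis i 1))
          differentiable (at 0 within {t. x + t *\<^sub>R axis i 1 \<in> S})))"

definition grad :: "(real^2 \<Rightarrow> real) \<Rightarrow> real^2 \<Rightarrow> real^2" where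
  "grad u x = (\<chi> i. pd UNIV i u x)"

definition test_function :: "(real^2) set \<Rightarrow> (real^2 \<Rightarrow> real) \<Rightarrow> bool" where
  "test_function U \<phi> \<longleftrightarrow> (\<forall>m. Ck_on m UNIV \<phi>) \<and>
     compact (closure {x. \<phi> x \<noteq> 0}) \<and> closure {x. \<phi> x \<noteq> 0} \<subseteq> U"

definition Linf :: "(real^2) set \<Rightarrow> (real^2 \<Rightarrow> real) \<Rightarrow> bool" where
  "Linf U f \<longleftrightarrow> set_borel_measurable lebesgue U f \<and>
     (\<exists>M. AE x in lebesgue. x \<in> U \<longrightarrow> \<bar>f x\<bar> \<le> M)"

definition weak_pd :: "(real^2) set \<Rightarrow> 2 \<Rightarrow> (real^2 \<Rightarrow> real) \<Rightarrow> (real^2 \<Rightarrow> real) \<Rightarrow> bool" where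
  "weak_pd U i f g \<longleftrightarrow> (\<forall>\<phi>. test_function U \<phi> \<longrightarrow>
     (LINT x:U|lebesgue. f x * pd UNIV i \<phi> x) = - (LINT x:U|lebesgue. g x * \<phi> x))"

text \<open>Every class in $W^{1,\infty}(U)$ has a (unique) continuous representative.  As the
  coefficients are integrated along curves, membership is stated for that representative.\<close>

definition W1inf :: "(real^2) set \<Rightarrow> (real^2 \<Rightarrow> real) \<Rightarrow> bool" where
  "W1inf U f \<longleftrightarrow> continuous_on U f \<and> Linf U f \<and> (\<forall>i. \<exists>g. Linf U g \<and> weak_pd U i f g)"

text \<open>Arc length \<open>ds\<close> on a subset of the plane is the one-dimensional Hausdorff measure
  (normalised by the diameter, so that it is the usual length on rectifiable arcs).\<close>

definition hausdorff1_pre :: "real \<Rightarrow> (real^2) set \<Rightarrow> ennreal" where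
  "hausdorff1_pre \<delta> S =
     (INF A\<in>{A :: nat \<Rightarrow> (real^2) set. S \<subseteq> (\<Union>n. A n) \<and>
                (\<forall>n. bounded (A n) \<and> diameter (A n) \<le> \<delta>)}.
        \<Sum>n. ennreal (diameter (A n)))"

definition hausdorff1_outer :: "(real^2) set \<Rightarrow> ennreal" where
  "hausdorff1_outer S = (SUP \<delta>\<in>{0<..}. hausdorff1_pre \<delta> S)"

definition arc_measure :: "(real^2) measure" where
  "arc_measure = measure_of UNIV (sets borel) hausdorff1_outer"

text \<open>\<open>n\<close> is the outward unit normal of \<open>S\<close> at \<open>x\<close> if to first order \<open>S\<close> is the half plane
  $\{y.\ n\cdot(y-x)\le 0\}$ near \<open>x\<close>.  Such an \<open>n\<close> is unique, and exists wherever the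
  boundary is locally a C1 curve with \<open>S\<close> on one side.\<close>

definition is_outward_normal :: "(real^2) set \<Rightarrow> real^2 \<Rightarrow> real^2 \<Rightarrow> bool" where
  "is_outward_normal S x n \<longleftrightarrow> norm n = 1 \<and>
     (\<forall>\<epsilon>>0. \<exists>\<delta>>0. \<forall>y\<in>ball x \<delta>.
        (y \<in> S \<longrightarrow> n \<bullet> (y - x) \<le> \<epsilon> * norm (y - x)) \<and>
        (y \<notin> S \<longrightarrow> n \<bullet> (y - x) \<ge> - \<epsilon> * norm (y - x)))"

definition outward_normal :: "(real^2) set \<Rightarrow> real^2 \<Rightarrow> real^2" where
  "outward_normal S x = (THE n. is_outward_normal S x n)"

text \<open>Legendre polynomials by Rodrigues' formula.\<close>

definition legendre :: "nat \<Rightarrow> real poly" where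
  "legendre k = smult (1 / (2 ^ k * fact k)) ((pderiv ^^ k) ([:-1, 0, 1:] ^ k))"

text \<open>\<open>gauss_pt k 0 = -1\<close> and \<open>gauss_pt k (k + 1) = 1\<close> are the added end points.\<close>

definition gauss_pt :: "nat \<Rightarrow> nat \<Rightarrow> real" where
  "gauss_pt k i = (if i = 0 then -1 else if i > k then 1
                   else sorted_list_of_set {x. poly (legendre k) x = 0} ! (i - 1))"

definition gauss_wt :: "nat \<Rightarrow> nat \<Rightarrow> real" where
  "gauss_wt k i = integral {-1..1}
     (\<lambda>x. \<Prod>m\<in>{1..k} - {i}. (x - gauss_pt k m) / (gauss_pt k i - gauss_pt k m))"

definition lagrange_nodes :: "nat \<Rightarrow> (nat \<Rightarrow> real) \<Rightarrow> bool" where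
  "lagrange_nodes k l \<longleftrightarrow> l 0 = -1 \<and> l k = 1 \<and> (\<forall>i<k. l i < l (Suc i)) \<and>
     (\<forall>i\<le>k. l (k - i) = - l i)"

text \<open>\<open>cells\<close> are the exact curved elements \<open>K\<close> partitioning the domain; \<open>emap M K\<close> is the
  map $\Psi_K$ that parametrises the approximating element $K^h$.\<close>

record mesh =
  cells :: "(real^2) set set"
  emap :: "(real^2) set \<Rightarrow> real^2 \<Rightarrow> real^2"

definition mesh_size :: "mesh \<Rightarrow> real" where
  "mesh_size M = Max (diameter ` cells M)"

definition elem :: "mesh \<Rightarrow> (real^2) set \<Rightarrow> (real^2) set" where
  "elem M K = emap M K ` ref_square"

definition Omega_h :: "mesh \<Rightarrow> (real^2) set" where
  "Omega_h M = (\<Union>K\<in>cells M. elem M K)"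

definition Gamma_h :: "mesh \<Rightarrow> (real^2) set" where
  "Gamma_h M = frontier (Omega_h M)"

definition curved_quadrilateral :: "(real^2) set \<Rightarrow> bool" where
  "curved_quadrilateral K \<longleftrightarrow> (\<exists>f g. homeomorphism ref_square K f g)"

definition partition_of_domain :: "(real^2) set \<Rightarrow> mesh \<Rightarrow> bool" where
  "partition_of_domain \<Omega> M \<longleftrightarrow> finite (cells M) \<and> \<Union>(cells M) = closure \<Omega> \<and>
     (\<forall>K\<in>cells M. curved_quadrilateral K) \<and>
     (\<forall>K\<in>cells M. \<forall>K'\<in>cells M. K \<noteq> K' \<longrightarrow> interior K \<inter> interior K' = {})"

definition diffeomorphism :: "(real^2) set \<Rightarrow> (real^2) set \<Rightarrow> (real^2 \<Rightarrow> real^2) \<Rightarrow> bool" where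
  "diffeomorphism S S' f \<longleftrightarrow> Ck_on 1 S f \<and>
     (\<exists>g. homeomorphism S S' f g \<and> f differentiable_on S \<and> g differentiable_on S')"

definition ref_vertices :: "(real^2) set" where
  "ref_vertices = {pt (-1) (-1), pt 1 (-1), pt 1 1, pt (-1) 1}"

definition ref_edges :: "(real \<Rightarrow> real^2) set" where
  "ref_edges = {\<lambda>t. pt t (-1), \<lambda>t. pt 1 t, \<lambda>t. pt t 1, \<lambda>t. pt (-1) t}"

definition conforming :: "mesh \<Rightarrow> bool" where
  "conforming M \<longleftrightarrow> (\<forall>K\<in>cells M. \<forall>K'\<in>cells M. K \<noteq> K' \<longrightarrow>
     elem M K \<inter> elem M K' = {} \<or>
     (\<exists>a\<in>ref_vertices. \<exists>a'\<in>ref_vertices.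
        emap M K a = emap M K' a' \<and> elem M K \<inter> elem M K' = {emap M K a}) \<or>
     (\<exists>e\<in>ref_edges. \<exists>e'\<in>ref_edges.
        elem M K \<inter> elem M K' = emap M K ` e ` {-1..1} \<and>
        elem M K \<inter> elem M K' = emap M K' ` e' ` {-1..1}))"

definition edge_params_agree :: "mesh \<Rightarrow> bool" where
  "edge_params_agree M \<longleftrightarrow> (\<forall>K\<in>cells M. \<forall>K'\<in>cells M. K \<noteq> K' \<longrightarrow>
     (\<forall>e\<in>ref_edges. \<forall>e'\<in>ref_edges.
        emap M K ` e ` {-1..1} = emap M K' ` e' ` {-1..1} \<longrightarrow>
          (\<forall>t\<in>{-1..1}. emap M K (e t) = emap M K' (e' t)) \<or>
          (\<forall>t\<in>{-1..1}. emap M K (e t) = emap M K' (e' (- t)))))"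

definition curved_mesh :: "(real^2) set \<Rightarrow> mesh \<Rightarrow> bool" where
  "curved_mesh \<Omega> M \<longleftrightarrow> partition_of_domain \<Omega> M \<and>
     (\<forall>K\<in>cells M. diffeomorphism ref_square (elem M K) (emap M K)) \<and>
     conforming M \<and> edge_params_agree M"

definition jacobian :: "mesh \<Rightarrow> (real^2) set \<Rightarrow> real^2 \<Rightarrow> real" where
  "jacobian M K x = det (\<chi> i j. pd ref_square j (emap M K) x $ i)"

text \<open>Bilinear map onto the straight quadrilateral with the vertices of $K^h$.\<close>

definition bilinear_map :: "mesh \<Rightarrow> (real^2) set \<Rightarrow> real^2 \<Rightarrow> real^2" where
  "bilinear_map M K x =
     ((1 - x$1) * (1 - x$2) / 4) *\<^sub>R emap M K (pt (-1) (-1)) +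
     ((1 + x$1) * (1 - x$2) / 4) *\<^sub>R emap M K (pt 1 (-1)) +
     ((1 + x$1) * (1 + x$2) / 4) *\<^sub>R emap M K (pt 1 1) +
     ((1 - x$1) * (1 + x$2) / 4) *\<^sub>R emap M K (pt (-1) 1)"

definition in_diameter :: "(real^2) set \<Rightarrow> real" where
  "in_diameter S = Sup {2 * r | r. 0 \<le> r \<and> (\<exists>x. cball x r \<subseteq> S)}"

text \<open>Regularity of quadrilaterals in the sense of Girault and Raviart: convexity (the
  diagonals cross) and a bound of the diameter by the inscribed-disc diameters of
  the four triangles spanned by three of the vertices.  Degenerate quadrilaterals are
  excluded by the two conditions together.\<close>

definition regular_quad :: "real \<Rightarrow> real^2 \<Rightarrow> real^2 \<Rightarrow> real^2 \<Rightarrow> real^2 \<Rightarrow> bool" where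
  "regular_quad C a b c d \<longleftrightarrow> open_segment a c \<inter> open_segment b d \<noteq> {} \<and>
     (\<forall>S\<in>{{a, b, c}, {b, c, d}, {c, d, a}, {d, a, b}}.
        diameter (convex hull {a, b, c, d}) \<le> C * in_diameter (convex hull S))"

text \<open>$\|D^s\Psi_K\|_\infty$ is measured by all partial derivatives of order \<open>s\<close>.\<close>

definition shape_regular :: "nat \<Rightarrow> (nat \<Rightarrow> real) \<Rightarrow> ('i \<Rightarrow> mesh) \<Rightarrow> bool" where
  "shape_regular k l T \<longleftrightarrow>
     (\<exists>C. \<forall>i. \<forall>K\<in>cells (T i).
        regular_quad C (emap (T i) K (pt (-1) (-1))) (emap (T i) K (pt 1 (-1)))
                       (emap (T i) K (pt 1 1)) (emap (T i) K (pt (-1) 1))) \<and>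
     (\<forall>\<epsilon>>0. \<exists>\<delta>>0. \<forall>i. \<forall>K\<in>cells (T i). diameter K < \<delta> \<longrightarrow>
        (\<forall>p\<le>k. \<forall>q\<le>k. \<not> (p \<in> {0, k} \<and> q \<in> {0, k}) \<longrightarrow>
           dist (emap (T i) K (pt (l p) (l q))) (bilinear_map (T i) K (pt (l p) (l q))) < \<epsilon>)) \<and>
     (\<exists>C. \<forall>i. \<forall>K\<in>cells (T i).
        Ck_on (max (k + 1) 3) ref_square (emap (T i) K) \<and>
        (\<forall>is. 1 \<le> length is \<and> length is \<le> max (k + 1) 3 \<longrightarrow>
           (\<forall>x\<in>ref_square. norm (pds ref_square is (emap (T i) K) x) \<le> C * diameter K ^ length is))) \<and>
     (\<exists>c>0. \<exists>C. \<forall>i. \<forall>K\<in>cells (T i). \<forall>x\<in>ref_square.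
        c * (diameter K)\<^sup>2 \<le> \<bar>jacobian (T i) K x\<bar> \<and> \<bar>jacobian (T i) K x\<bar> \<le> C * (diameter K)\<^sup>2)"

definition Qk :: "nat \<Rightarrow> (real^2 \<Rightarrow> real) set" where
  "Qk k = {p. \<exists>c :: nat \<Rightarrow> nat \<Rightarrow> real. \<forall>x. p x = (\<Sum>a\<le>k. \<Sum>b\<le>k. c a b * (x$1) ^ a * (x$2) ^ b)}"

text \<open>Elements are only relevant through their values on $\Omega_h$ (a closed set).\<close>

definition trial_space :: "nat \<Rightarrow> mesh \<Rightarrow> (real^2 \<Rightarrow> real) set" where
  "trial_space k M = {u. continuous_on (Omega_h M) u \<and>
     (\<forall>K\<in>cells M. \<exists>p\<in>Qk k. \<forall>x\<in>ref_square. u (emap M K x) = p x)}"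

definition node :: "(nat \<Rightarrow> real) \<Rightarrow> mesh \<Rightarrow> (real^2) set \<Rightarrow> nat \<Rightarrow> nat \<Rightarrow> real^2" where
  "node l M K i j = emap M K (pt (l i) (l j))"

definition nodes :: "nat \<Rightarrow> (nat \<Rightarrow> real) \<Rightarrow> mesh \<Rightarrow> (real^2) set" where
  "nodes k l M = {node l M K i j | K i j. K \<in> cells M \<and> i \<le> k \<and> j \<le> k}"

definition boundary_nodes :: "nat \<Rightarrow> (nat \<Rightarrow> real) \<Rightarrow> mesh \<Rightarrow> (real^2) set" where
  "boundary_nodes k l M = nodes k l M \<inter> Gamma_h M"

definition subcell :: "nat \<Rightarrow> mesh \<Rightarrow> (real^2) set \<Rightarrow> nat \<Rightarrow> nat \<Rightarrow> (real^2) set" where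
  "subcell k M K i j = emap M K ` {pt x y | x y.
     x \<in> {gauss_pt k i..gauss_pt k (i + 1)} \<and> y \<in> {gauss_pt k j..gauss_pt k (j + 1)}}"

definition control_volume :: "nat \<Rightarrow> (nat \<Rightarrow> real) \<Rightarrow> mesh \<Rightarrow> real^2 \<Rightarrow> (real^2) set" where
  "control_volume k l M P =
     \<Union>{subcell k M K i j | K i j. K \<in> cells M \<and> i \<le> k \<and> j \<le> k \<and> node l M K i j = P}"

definition Gamma_P :: "nat \<Rightarrow> (nat \<Rightarrow> real) \<Rightarrow> mesh \<Rightarrow> real^2 \<Rightarrow> (real^2) set" where
  "Gamma_P k l M P = frontier (control_volume k l M P) \<inter> Gamma_h M"

definition bd0_P :: "nat \<Rightarrow> (nat \<Rightarrow> real) \<Rightarrow> mesh \<Rightarrow> real^2 \<Rightarrow> (real^2) set" where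
  "bd0_P k l M P = frontier (control_volume k l M P) - Gamma_P k l M P"

definition dual_fun :: "nat \<Rightarrow> (nat \<Rightarrow> real) \<Rightarrow> mesh \<Rightarrow> (real^2 \<Rightarrow> real) \<Rightarrow> real^2 \<Rightarrow> real" where
  "dual_fun k l M v x = (\<Sum>P\<in>nodes k l M. v P * indicator (control_volume k l M P) x)"

definition test_space :: "nat \<Rightarrow> (nat \<Rightarrow> real) \<Rightarrow> mesh \<Rightarrow> (real^2 \<Rightarrow> real) set" where
  "test_space k l M = range (dual_fun k l M)"

text \<open>The constant $v_{K_P^{*,h}}$ of \<open>w\<close>; it is determined by \<open>w\<close>, as the control volumes
  have non-empty interior and overlap only along their boundaries.\<close>

definition cv_value :: "nat \<Rightarrow> (nat \<Rightarrow> real) \<Rightarrow> mesh \<Rightarrow> (real^2 \<Rightarrow> real) \<Rightarrow> real^2 \<Rightarrow> real" where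
  "cv_value k l M w P = (THE c. \<exists>v. w = dual_fun k l M v \<and> c = v P)"

definition is_dual_interp ::
    "nat \<Rightarrow> (nat \<Rightarrow> real) \<Rightarrow> mesh \<Rightarrow> (real^2 \<Rightarrow> real) \<Rightarrow> (real^2 \<Rightarrow> real) \<Rightarrow> bool" where
  "is_dual_interp k l M u w \<longleftrightarrow> w \<in> test_space k l M \<and>
     (\<forall>K\<in>cells M.
        let V = (\<lambda>i j. cv_value k l M w (node l M K i j));
            U = u \<circ> emap M K; g = gauss_pt k; A = gauss_wt k;
            D\<^sub>\<xi> = pd ref_square 1; D\<^sub>\<eta> = pd ref_square 2
        in V 0 0 = U (pt (-1) (-1)) \<and>
           (\<forall>i\<in>{1..k}. V i 0 - V (i - 1) 0 = A i * D\<^sub>\<xi> U (pt (g i) (-1))) \<and>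
           (\<forall>j\<in>{1..k}. V 0 j - V 0 (j - 1) = A j * D\<^sub>\<eta> U (pt (-1) (g j))) \<and>
           (\<forall>i\<in>{1..k}. \<forall>j\<in>{1..k}.
              V i j + V (i - 1) (j - 1) - V i (j - 1) - V (i - 1) j
                = A i * A j * D\<^sub>\<xi> (D\<^sub>\<eta> U) (pt (g i) (g j))))"

definition dual_interp ::
    "nat \<Rightarrow> (nat \<Rightarrow> real) \<Rightarrow> mesh \<Rightarrow> (real^2 \<Rightarrow> real) \<Rightarrow> real^2 \<Rightarrow> real" where
  "dual_interp k l M u = (THE w. is_dual_interp k l M u w)"

definition a_h0 :: "nat \<Rightarrow> (nat \<Rightarrow> real) \<Rightarrow> (real^2 \<Rightarrow> real) \<Rightarrow> mesh \<Rightarrow>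
    (real^2 \<Rightarrow> real) \<Rightarrow> (real^2 \<Rightarrow> real) \<Rightarrow> real" where
  "a_h0 k l \<kappa> M u w = - (\<Sum>P\<in>nodes k l M. cv_value k l M w P *
     (LINT x:bd0_P k l M P|arc_measure.
        \<kappa> x * (grad u x \<bullet> outward_normal (control_volume k l M P) x)))"

definition r_h :: "nat \<Rightarrow> (nat \<Rightarrow> real) \<Rightarrow> (real^2 \<Rightarrow> real) \<Rightarrow> mesh \<Rightarrow>
    (real^2 \<Rightarrow> real) \<Rightarrow> (real^2 \<Rightarrow> real) \<Rightarrow> real" where
  "r_h k l \<sigma> M u w = (\<Sum>P\<in>boundary_nodes k l M. cv_value k l M w P *
     (LINT x:Gamma_P k l M P|arc_measure. \<sigma> x * u x))"

definition a_h :: "nat \<Rightarrow> (nat \<Rightarrow> real) \<Rightarrow> (real^2 \<Rightarrow> real) \<Rightarrow> (real^2 \<Rightarrow> real) \<Rightarrow> mesh \<Rightarrow>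
    (real^2 \<Rightarrow> real) \<Rightarrow> (real^2 \<Rightarrow> real) \<Rightarrow> real" where
  "a_h k l \<kappa> \<sigma> M u w = a_h0 k l \<kappa> M u w + r_h k l \<sigma> M u w"

text \<open>Trial functions are continuous and piecewise smooth, so their weak gradient is the
  classical one, defined almost everywhere (off the element edges).\<close>

definition H1_seminorm :: "mesh \<Rightarrow> (real^2 \<Rightarrow> real) \<Rightarrow> real" where
  "H1_seminorm M u = sqrt (LINT x:Omega_h M|lebesgue. (norm (grad u x))\<^sup>2)"

definition L2_norm_Gamma_h :: "mesh \<Rightarrow> (real^2 \<Rightarrow> real) \<Rightarrow> real" where
  "L2_norm_Gamma_h M f = sqrt (LINT x:Gamma_h M|arc_measure. (f x)\<^sup>2)"

definition energy_norm :: "(real^2 \<Rightarrow> real) \<Rightarrow> mesh \<Rightarrow> (real^2 \<Rightarrow> real) \<Rightarrow> real" where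
  "energy_norm \<sigma> M u =
     sqrt ((H1_seminorm M u)\<^sup>2 + (L2_norm_Gamma_h M (\<lambda>x. sqrt (\<sigma> x) * u x))\<^sup>2)"

definition bounded_domain :: "(real^2) set \<Rightarrow> bool" where
  "bounded_domain U \<longleftrightarrow> open U \<and> connected U \<and> bounded U \<and> U \<noteq> {}"

text \<open>The values of \<open>\<sigma>\<close> on the boundary are those of its continuous extension to the closure.\<close>

definition robin_coefficients ::
    "(real^2) set \<Rightarrow> (real^2 \<Rightarrow> real) \<Rightarrow> (real^2 \<Rightarrow> real) \<Rightarrow> bool" where
  "robin_coefficients \<Omega> \<kappa> \<sigma> \<longleftrightarrow>
     W1inf \<Omega> \<kappa> \<and> (\<exists>\<kappa>\<^sub>0>0. \<forall>x\<in>\<Omega>. \<kappa>\<^sub>0 \<le> \<kappa> x) \<and>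
     W1inf \<Omega> \<sigma> \<and> continuous_on (closure \<Omega>) \<sigma> \<and>
     (\<exists>\<sigma>\<^sub>0>0. \<exists>\<sigma>\<^sub>1. \<forall>x\<in>frontier \<Omega>. \<sigma>\<^sub>0 \<le> \<sigma> x \<and> \<sigma> x \<le> \<sigma>\<^sub>1)"

definition admissible_extensions ::
    "(real^2) set \<Rightarrow> (real^2) set \<Rightarrow> ('i \<Rightarrow> mesh) \<Rightarrow> (real^2 \<Rightarrow> real) \<Rightarrow> (real^2 \<Rightarrow> real) \<Rightarrow>
     (real^2 \<Rightarrow> real) \<Rightarrow> (real^2 \<Rightarrow> real) \<Rightarrow> bool" where
  "admissible_extensions \<Omega> \<Omega>' T \<kappa> \<sigma> \<kappa>' \<sigma>' \<longleftrightarrow>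
     W1inf \<Omega>' \<kappa>' \<and> W1inf \<Omega>' \<sigma>' \<and> (\<forall>x\<in>\<Omega>. \<kappa>' x = \<kappa> x \<and> \<sigma>' x = \<sigma> x) \<and>
     (\<exists>c>0. \<forall>i. \<forall>x\<in>Omega_h (T i). c \<le> \<kappa>' x) \<and>
     (\<exists>c>0. \<forall>i. \<forall>x\<in>Gamma_h (T i). c \<le> \<sigma>' x)"

end

theory Submission
  imports Defs
begin

text \<open>The dual interpolation is built so that the jump of the test function across a Gauss
  line \<xi> = g_i is A_i times a one-dimensional dual interpolant (\<open>dI\<close>) of
  \<partial>_\<xi> u on that line. After summation by parts over the faces (\<open>a_h0_eq\<close>),
  the form on one element is a Gauss sum over lines of pairings \<open>dual_form k p q\<close>: the
  dual interpolant of a slice p of the derivative of u, integrated against the flux q through the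
  line.

  Everything rests on one fact about this pairing. If Q is an antiderivative of q, Abel summation
  and integration by parts show that \<open>dual_form k p q\<close> equals the integral of p q plus
  the Gauss quadrature error of p' Q (\<open>dual_form_aux\<close>). The error vanishes when q has
  degree at most k - 1 (\<open>dual_form_exact\<close>). For q = p the product p' Q has degree at
  most 2k and a nonnegative coefficient at 2k, and there the Gauss rule errs in the favourable
  direction (\<open>gauss_error\<close>, \<open>dual_form_self\<close>). On an affine element with
  constant coefficient the flux is \<beta> \<partial>_\<xi> u + \<gamma> \<partial>_\<eta> u: the
  normal part is overestimated, the tangential part is exact, and positivity of the coefficient
  matrix (\<open>form_positive\<close>) gives coercivity (\<open>flux_form_coercive\<close>). The
  Robin term is the same fact with p = q the trace of u on a boundary edge.

  A general element is a small perturbation of an affine one: its tangent vectors have size h and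
  vary by h^2 (\<open>A_near_0\<close>), the coefficients are locally Lipschitz
  (\<open>W1inf_local_lipschitz\<close>), and the flux coefficients, scaled by h, are uniformly
  continuous on a compact set independent of the mesh (\<open>coef_modulus_exists\<close>).
  Replacing the fluxes by frozen ones thus costs a small multiple of the discrete energy
  (\<open>flux_integral_approx\<close>, \<open>inner_element\<close>, \<open>boundary_edge\<close>),
  which is absorbed for small h. The energy norm is bounded by the discrete energies in
  \<open>H1_bound\<close> and \<open>Gamma_term_sum\<close>.

  Two layers connect this computation with the definitions. Arc length is Hausdorff measure; it is
  shown to be a measure on the Borel sets (\<open>emeasure_arc\<close>) and is compared with
  parameter integrals along nearly straight curves (\<open>arc_integral_approx\<close>). The
  frontiers of the control volumes are identified, up to finitely many points, by invariance of
  domain: a Gauss line separates two volumes, a shared edge is interior to a volume, and the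
  remaining edges make up \<Gamma>_h (\<open>bd0_iff\<close>, \<open>Gamma_P_iff\<close>). Finally
  \<open>dual_interp_eq\<close> computes the interpolant; neighbouring elements assign the same
  value to a common node because u is continuous and the Gauss rule is symmetric
  (\<open>Vn_node_unique\<close>).\<close>

section \<open>Legendre polynomials, Gauss points and the Gauss rule\<close>

lemma poly_integral:
  fixes p :: "real poly"
  assumes "a \<le> b"
  shows "integral {a..b} (poly (pderiv p)) = poly p b - poly p a"
  using assms by (intro integral_unique fundamental_theorem_of_calculus)
     (auto simp: has_real_derivative_iff_has_vector_derivative[symmetric] intro!: derivative_eq_intros)

lemma poly_integrable: "poly (p :: real poly) integrable_on {a..b}"
  by (intro integrable_continuous_interval continuous_intros)

lemma poly_integrable' [simp]: "(\<lambda>x. poly (p :: real poly) x) integrable_on {a..b}"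
  by (intro integrable_continuous_interval continuous_intros)

lemma antideriv_exists:
  fixes p :: "real poly"
  obtains P where "pderiv P = p" "degree P \<le> Suc (degree p)"
proof
  let ?P = "\<Sum>i\<le>degree p. monom (coeff p i / real (Suc i)) (Suc i)"
  have "pderiv ?P = (\<Sum>i\<le>degree p. monom (coeff p i) i)"
    by (simp add: higher_pderiv_sum[where n=1, simplified] pderiv_monom del: of_nat_Suc)
  then show "pderiv ?P = p" by (simp add: poly_as_sum_of_monoms)
  show "degree ?P \<le> Suc (degree p)"
    by (rule degree_sum_le) (auto intro: order.trans[OF degree_monom_le])
qed

text \<open>The intermediate derivatives in Rodrigues' formula. They are kept for all m because both
  orthogonality and the location of the roots are proved by induction on m.\<close>

definition leg_num :: "nat \<Rightarrow> nat \<Rightarrow> real poly" where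
  "leg_num k m = (pderiv ^^ m) ([:-1, 0, 1:] ^ k)"

lemma leg_num_Suc: "leg_num k (Suc m) = pderiv (leg_num k m)"
  by (simp add: leg_num_def)

lemma power_dvd_pderiv:
  fixes p q :: "real poly"
  assumes "p ^ Suc n dvd q"
  shows "p ^ n dvd pderiv q"
proof -
  obtain r where r: "q = p ^ Suc n * r" using assms by (elim dvdE)
  have "pderiv q = p ^ n * (p * pderiv r + smult (real (Suc n)) (pderiv p * r))"
    unfolding r pderiv_mult pderiv_power_Suc by (simp add: algebra_simps del: of_nat_Suc)
  then show ?thesis by simp
qed

text \<open>A derivative removes at most one factor x^2 - 1. Hence \<open>leg_num k m\<close> with m
  < k still vanishes at both end points, which kills the boundary terms below and feeds Rolle's
  theorem.\<close>

lemma leg_num_dvd: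
  assumes "m \<le> k"
  shows "[:-1, 0, 1:] ^ (k - m) dvd leg_num k m"
  using assms
proof (induction m)
  case 0 then show ?case by (simp add: leg_num_def)
next
  case (Suc m)
  then have "[:-1, 0, 1:] ^ Suc (k - Suc m) dvd leg_num k m"
    by (simp add: Suc_diff_Suc del: power_Suc)
  then show ?case unfolding leg_num_Suc by (rule power_dvd_pderiv)
qed

lemma leg_num_ends:
  assumes "m < k"
  shows "poly (leg_num k m) (-1) = 0" "poly (leg_num k m) 1 = 0"
proof -
  have "[:-1, 0, 1:] dvd leg_num k m"
    using leg_num_dvd[of m k] assms
    by (metis dvd_power dvd_trans less_imp_le zero_less_diff)
  then obtain r where "leg_num k m = [:-1, 0, 1:] * r" by (elim dvdE)
  then show "poly (leg_num k m) (-1) = 0" "poly (leg_num k m) 1 = 0" by auto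
qed

lemma degree_leg_num: "degree (leg_num k m) = 2 * k - m"
proof (induction m)
  case 0 then show ?case by (simp add: leg_num_def degree_power_eq)
next
  case (Suc m) then show ?case by (simp add: leg_num_Suc degree_pderiv)
qed

lemma leg_num_nz: "m \<le> k \<Longrightarrow> leg_num k m \<noteq> 0"
  using degree_leg_num[of k m] by (cases k) (auto simp: leg_num_def)

lemma legendre_leg_num: "legendre k = smult (1 / (2 ^ k * fact k)) (leg_num k k)"
  by (simp add: legendre_def leg_num_def)

lemma degree_legendre: "degree (legendre k) = k"
  by (simp add: legendre_leg_num degree_leg_num)

lemma legendre_nz: "legendre k \<noteq> 0"
  using leg_num_nz[of k k] by (simp add: legendre_leg_num)

text \<open>Repeated integration by parts moves the derivatives of (x^2 - 1)^k onto q, whose degree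
  drops each time. The alternative q = 0 is where the induction ends: for m = 0 it is the only case
  left.\<close>

lemma legendre_orthogonal:
  assumes "q = 0 \<or> degree q < k"
  shows "integral {-1..1} (poly (legendre k * q)) = 0"
proof -
  have *: "integral {-1..1} (poly (leg_num k m * q)) = 0"
    if "m \<le> k" "q = 0 \<or> degree q < m" for m q
    using that
  proof (induction m arbitrary: q)
    case 0 then show ?case by simp
  next
    case (Suc m)
    have q': "pderiv q = 0 \<or> degree (pderiv q) < m"
      using Suc.prems(2) by (cases "degree q = 0") (auto simp: degree_pderiv pderiv_eq_0_iff)
    have "leg_num k (Suc m) * q = pderiv (leg_num k m * q) - leg_num k m * pderiv q"
      by (simp add: leg_num_Suc pderiv_mult algebra_simps)
    then have "integral {-1..1} (poly (leg_num k (Suc m) * q))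
       = integral {-1..1} (\<lambda>x. poly (pderiv (leg_num k m * q)) x - poly (leg_num k m * pderiv q) x)"
      by (metis poly_diff)
    also have "\<dots> = integral {-1..1} (poly (pderiv (leg_num k m * q))) - integral {-1..1} (poly (leg_num k m * pderiv q))"
      by (rule integral_diff) (rule poly_integrable)+
    also have "\<dots> = 0"
      using Suc.IH[OF _ q'] Suc.prems(1) leg_num_ends[of m k] by (subst poly_integral) (auto simp del: poly_mult simp: poly_mult[where x="-1"] poly_mult[where x=1])
    finally show ?case .
  qed
  have "integral {-1..1} (poly (legendre k * q)) = integral {-1..1} (\<lambda>x. (1 / (2 ^ k * fact k)) *\<^sub>R poly (leg_num k k * q) x)"
    by (intro arg_cong[where f="integral _"]) (auto simp: legendre_leg_num)
  also have "\<dots> = 0" using *[of k q] assms by (subst integral_cmul) auto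
  finally show ?thesis .
qed

text \<open>Rolle's theorem between neighbouring zeros of \<open>leg_num k m\<close>, the end points
  included, produces m + 1 zeros of the next derivative. The enumeration r carries -1 and 1 at
  indices 0 and m + 1, the convention of \<open>gauss_pt\<close>.\<close>

lemma leg_num_roots:
  assumes "m \<le> k"
  shows "\<exists>r. (\<forall>i\<le>m. r i < r (Suc i)) \<and> r 0 = -1 \<and> r (Suc m) = 1 \<and>
             (\<forall>i\<in>{1..m}. poly (leg_num k m) (r i) = 0)"
  using assms
proof (induction m)
  case 0 show ?case by (rule exI[of _ "\<lambda>i. if i = 0 then -1 else 1"]) auto
next
  case (Suc m)
  then obtain r where r: "\<forall>i\<le>m. r i < r (Suc i)" "r 0 = -1" "r (Suc m) = 1"
     "\<forall>i\<in>{1..m}. poly (leg_num k m) (r i) = 0" by auto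
  have z: "poly (leg_num k m) (r i) = 0" if "i \<le> Suc m" for i
    using that r leg_num_ends[of m k] Suc.prems by (cases "i = 0 \<or> i = Suc m") auto
  have "\<exists>s. r i < s \<and> s < r (Suc i) \<and> poly (leg_num k (Suc m)) s = 0" if "i \<le> m" for i
  proof -
    have "\<exists>s>r i. s < r (Suc i) \<and> poly (leg_num k m) (r (Suc i)) - poly (leg_num k m) (r i)
             = (r (Suc i) - r i) * poly (pderiv (leg_num k m)) s"
      using r that by (intro poly_MVT) auto
    then show ?thesis using z[of i] z[of "Suc i"] that r unfolding leg_num_Suc by force
  qed
  then obtain s where s: "\<And>i. i \<le> m \<Longrightarrow> r i < s i \<and> s i < r (Suc i) \<and> poly (leg_num k (Suc m)) (s i) = 0"
    by metis
  let ?t = "\<lambda>i. if i = 0 then -1 else if i > Suc m then 1 else s (i - 1)"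
  have "?t i < ?t (Suc i)" if "i \<le> Suc m" for i
  proof -
    consider "i = 0" | "i = Suc m" | j where "i = Suc j" "Suc j \<le> m"
      using \<open>i \<le> Suc m\<close> by (cases i) force+
    then show ?thesis
    proof cases
      case 1 then show ?thesis using s[of 0] r by auto
    next
      case 2 then show ?thesis using s[of m] r by auto
    next
      case 3 then show ?thesis using s[of j] s[of "Suc j"] by auto
    qed
  qed
  moreover have "poly (leg_num k (Suc m)) (?t i) = 0" if "i \<in> {1..Suc m}" for i
    using s[of "i - 1"] that by auto
  ultimately show ?case by (intro exI[of _ ?t]) auto
qed

lemma strict_chain_less:
  fixes r :: "nat \<Rightarrow> real"
  assumes "\<forall>i\<le>m. r i < r (Suc i)" "i < j" "j \<le> Suc m"
  shows "r i < r j"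
  using assms(2,3)
proof (induction j)
  case (Suc j) then show ?case using assms(1) by (cases "i = j") (auto intro: less_trans)
qed simp

text \<open>\<open>gauss_pt\<close> sorts the root set of the Legendre polynomial. Rolle's
  enumeration supplies k increasing roots and the degree allows no more, so the sorted list is that
  enumeration.\<close>

lemma gauss_pt_facts:
  shows "\<forall>i\<le>k. gauss_pt k i < gauss_pt k (Suc i)"
    and "\<forall>i\<in>{1..k}. poly (legendre k) (gauss_pt k i) = 0"
    and "{x. poly (legendre k) x = 0} = gauss_pt k ` {1..k}"
proof -
  obtain r where r: "\<forall>i\<le>k. r i < r (Suc i)" "r 0 = -1" "r (Suc k) = 1"
     "\<forall>i\<in>{1..k}. poly (leg_num k k) (r i) = 0" using leg_num_roots[of k k] by auto
  have mono: "r i < r j" if "i < j" "j \<le> Suc k" for i j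
    using strict_chain_less[OF r(1) that] .
  let ?Z = "{x. poly (legendre k) x = 0}"
  have sub: "r ` {1..k} \<subseteq> ?Z" using r(4) by (auto simp: legendre_leg_num)
  have inj: "inj_on r {1..k}"
    by (rule linorder_inj_onI') (use mono in force)
  have fin: "finite ?Z" using legendre_nz by (rule poly_roots_finite)
  have "card ?Z \<le> k" using card_poly_roots_bound[OF legendre_nz[of k]] degree_legendre by simp
  then have Z: "?Z = r ` {1..k}"
    using sub fin card_image[OF inj] by (metis card_atLeastAtMost card_seteq diff_Suc_1)
  have "sorted_list_of_set ?Z = map r [1..<Suc k]"
  proof (rule sorted_distinct_set_unique)
    show "sorted (map r [1..<Suc k])"
      by (rule sorted_wrt_mono_rel[of _ "(<)"])
         (use mono in \<open>auto simp: sorted_wrt_iff_nth_less nth_append\<close>)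
    show "distinct (map r [1..<Suc k])"
      using inj by (auto simp: distinct_map atLeastLessThanSuc_atLeastAtMost simp del: upt_Suc)
    show "set (sorted_list_of_set ?Z) = set (map r [1..<Suc k])"
      using fin Z by (simp add: atLeastLessThanSuc_atLeastAtMost del: upt_Suc)
  qed simp_all
  then have g: "gauss_pt k i = r i" if "i \<le> Suc k" for i
    using that r unfolding gauss_pt_def by (auto simp del: upt_Suc simp: nth_upt le_Suc_eq)
  show "\<forall>i\<le>k. gauss_pt k i < gauss_pt k (Suc i)" using g r by auto
  show "\<forall>i\<in>{1..k}. poly (legendre k) (gauss_pt k i) = 0" using g r(4) by (auto simp: legendre_leg_num)
  show "?Z = gauss_pt k ` {1..k}" unfolding Z using g by (intro image_cong) auto
qed

lemma gauss_pt_less: "i < j \<Longrightarrow> j \<le> Suc k \<Longrightarrow> gauss_pt k i < gauss_pt k j"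
  using strict_chain_less gauss_pt_facts(1) by blast

lemma gauss_pt_le: "i \<le> j \<Longrightarrow> j \<le> Suc k \<Longrightarrow> gauss_pt k i \<le> gauss_pt k j"
  using gauss_pt_less[of i j k] by (cases "i = j") auto

lemma gauss_pt_inj: "i \<le> Suc k \<Longrightarrow> j \<le> Suc k \<Longrightarrow> gauss_pt k i = gauss_pt k j \<longleftrightarrow> i = j"
  using gauss_pt_less[of i j k] gauss_pt_less[of j i k] by (cases i j rule: linorder_cases) auto

lemma gauss_pt_0 [simp]: "gauss_pt k 0 = -1" and gauss_pt_end [simp]: "gauss_pt k (Suc k) = 1"
  by (simp_all add: gauss_pt_def)

lemma gauss_pt_bounds: "i \<le> Suc k \<Longrightarrow> -1 \<le> gauss_pt k i \<and> gauss_pt k i \<le> 1"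
  using gauss_pt_le[of 0 i k] gauss_pt_le[of i "Suc k" k] by auto

lemma gauss_pt_inner: "i \<in> {1..k} \<Longrightarrow> -1 < gauss_pt k i \<and> gauss_pt k i < 1"
  using gauss_pt_less[of 0 i k] gauss_pt_less[of i "Suc k" k] by auto

lemma gauss_interval_exists:
  assumes "-1 \<le> t" "t \<le> 1"
  shows "\<exists>j\<le>k. t \<in> {gauss_pt k j..gauss_pt k (Suc j)}"
proof (cases "t = 1")
  case True then show ?thesis using gauss_pt_bounds[of k k] by (intro exI[of _ k]) auto
next
  case False
  let ?j = "Max {j. j \<le> k \<and> gauss_pt k j \<le> t}"
  have m: "?j \<in> {j. j \<le> k \<and> gauss_pt k j \<le> t}" using assms by (intro Max_in) auto
  have "t < gauss_pt k (Suc ?j)"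
  proof (rule ccontr)
    assume a: "\<not> ?thesis"
    then have "Suc ?j \<le> k" using m False assms by (cases "?j = k") auto
    then have "Suc ?j \<le> ?j" using a by (intro Max_ge) auto
    then show False by simp
  qed
  then show ?thesis using m by auto
qed

lemma gauss_interval_unique:
  assumes "t \<in> {gauss_pt k j..gauss_pt k (Suc j)}" "t \<in> {gauss_pt k m..gauss_pt k (Suc m)}"
    "j \<le> k" "m \<le> k" "t \<notin> gauss_pt k ` {..Suc k}"
  shows "j = m"
proof -
  have "\<not> j < m" if "t \<in> {gauss_pt k j..gauss_pt k (Suc j)}" "t \<in> {gauss_pt k m..gauss_pt k (Suc m)}"
     "j \<le> k" "m \<le> k" for j m
  proof
    assume "j < m"
    then have "gauss_pt k (Suc j) \<le> gauss_pt k m" using that by (intro gauss_pt_le) auto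
    then have "t = gauss_pt k m" using that by auto
    then show False using assms(5) that by auto
  qed
  from this[of j m] this[of m j] assms show ?thesis by force
qed

definition lag :: "nat \<Rightarrow> nat \<Rightarrow> real poly" where
  "lag k i = (\<Prod>m\<in>{1..k} - {i}. smult (1 / (gauss_pt k i - gauss_pt k m)) [:- gauss_pt k m, 1:])"

lemma poly_lag: "poly (lag k i) x = (\<Prod>m\<in>{1..k} - {i}. (x - gauss_pt k m) / (gauss_pt k i - gauss_pt k m))"
  unfolding lag_def poly_prod by (intro prod.cong) (auto simp: diff_divide_distrib)

lemma gauss_wt_lag: "gauss_wt k i = integral {-1..1} (poly (lag k i))"
  unfolding gauss_wt_def poly_lag[abs_def] ..

lemma degree_lag: assumes "i \<in> {1..k}" shows "degree (lag k i) < k"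
proof -
  have "degree (lag k i) \<le> sum (degree \<circ> (\<lambda>m. smult (1 / (gauss_pt k i - gauss_pt k m)) [:- gauss_pt k m, 1:])) ({1..k} - {i})"
    unfolding lag_def by (rule degree_prod_sum_le) auto
  also have "\<dots> \<le> sum (\<lambda>_. 1) ({1..k} - {i})" by (intro sum_mono) auto
  also have "\<dots> < k" using assms by auto
  finally show ?thesis .
qed

lemma lag_pt:
  assumes "i \<in> {1..k}" "j \<in> {1..k}"
  shows "poly (lag k i) (gauss_pt k j) = (if i = j then 1 else 0)"
proof (cases "i = j")
  case True then show ?thesis unfolding poly_lag
    using gauss_pt_inj[of i k] assms by (auto intro!: prod.neutral)
next
  case False
  then have "\<exists>m\<in>{1..k} - {i}. (gauss_pt k j - gauss_pt k m) / (gauss_pt k i - gauss_pt k m) = 0"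
    using assms by (intro bexI[of _ j]) auto
  then show ?thesis unfolding poly_lag using False by (auto simp: prod_zero_iff)
qed

text \<open>The difference of the two sides has degree less than k and vanishes at the k distinct
  Gauss points.\<close>

lemma lagrange_interpolation:
  assumes "degree p < k"
  shows "p = (\<Sum>i\<in>{1..k}. smult (poly p (gauss_pt k i)) (lag k i))" (is "_ = ?r")
proof (rule ccontr)
  assume ne: "p \<noteq> ?r"
  have "degree ?r < k"
    using assms degree_lag by (intro degree_sum_less) (auto intro!: le_less_trans[OF degree_smult_le])
  then have d: "degree (p - ?r) < k" using assms by (simp add: degree_diff_less)
  have "gauss_pt k ` {1..k} \<subseteq> {x. poly (p - ?r) x = 0}"
  proof safe
    fix j assume j: "j \<in> {1..k}"
    have "poly ?r (gauss_pt k j) = (\<Sum>i\<in>{1..k}. if i = j then poly p (gauss_pt k j) else 0)"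
      unfolding poly_sum using j by (intro sum.cong) (auto simp: lag_pt)
    also have "\<dots> = poly p (gauss_pt k j)" using j by simp
    finally show "poly (p - ?r) (gauss_pt k j) = 0" by simp
  qed
  then have "card (gauss_pt k ` {1..k}) \<le> card {x. poly (p - ?r) x = 0}"
    using ne by (intro card_mono poly_roots_finite) auto
  also have "\<dots> \<le> degree (p - ?r)" using ne by (intro card_poly_roots_bound) auto
  finally have "k \<le> degree (p - ?r)"
    by (subst (asm) card_image) (auto simp: inj_on_def gauss_pt_inj)
  then show False using d by simp
qed

text \<open>\<open>Gq\<close> is the k-point Gauss rule and \<open>Iq\<close> below the exact
  integral over [-1, 1]; the sign of their difference is the source of coercivity.\<close>

definition Gq :: "nat \<Rightarrow> real poly \<Rightarrow> real" where
  "Gq k p = (\<Sum>i\<in>{1..k}. gauss_wt k i * poly p (gauss_pt k i))"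

abbreviation Iq :: "real poly \<Rightarrow> real" where "Iq p \<equiv> integral {-1..1} (poly p)"

lemma Iq_add: "Iq (p + q) = Iq p + Iq q"
  unfolding poly_add[abs_def] by (rule integral_add) auto
lemma Iq_diff: "Iq (p - q) = Iq p - Iq q"
  unfolding poly_diff[abs_def] by (rule integral_diff) auto
lemma Iq_smult: "Iq (smult c p) = c * Iq p"
  unfolding poly_smult[abs_def] by (rule integral_mult_right)
lemma Iq_sum: "finite A \<Longrightarrow> Iq (sum f A) = (\<Sum>i\<in>A. Iq (f i))"
  unfolding poly_sum[abs_def] by (rule integral_sum) auto
lemma Iq_sq_nonneg: "Iq (p * p) \<ge> 0"
  by (intro integral_nonneg) (auto simp del: poly_mult simp: poly_mult[of p p])
lemma Gq_add: "Gq k (p + q) = Gq k p + Gq k q" by (simp add: Gq_def algebra_simps sum.distrib)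
lemma Gq_diff: "Gq k (p - q) = Gq k p - Gq k q" by (simp add: Gq_def algebra_simps sum_subtractf)
lemma Gq_smult: "Gq k (smult c p) = c * Gq k p" by (simp add: Gq_def algebra_simps sum_distrib_left)

lemma Iq_sq_pos: assumes "p \<noteq> 0" shows "Iq (p * p) > 0"
proof (rule ccontr)
  assume "\<not> ?thesis"
  then have "Iq (p * p) = 0" using Iq_sq_nonneg[of p] by simp
  then have z: "poly (p * p) x = 0" if "x \<in> {-1..1}" for x
  proof -
    have "continuous_on {-1..1} (poly (p * p))" by (intro continuous_on_poly continuous_on_id)
    moreover have "poly (p * p) y \<ge> 0" for y by simp
    ultimately show ?thesis using integral_eq_0_iff[of "-1" 1 "poly (p * p)"] \<open>Iq (p * p) = 0\<close> that by simp
  qed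
  have "{-1..1::real} \<subseteq> {x. poly p x = 0}" using z by auto
  then have "finite {-1..1::real}" using poly_roots_finite[OF assms] finite_subset by blast
  then show False by (simp add: infinite_Icc)
qed

text \<open>Divide f by the Legendre polynomial. The multiple of it integrates to zero by
  orthogonality and vanishes at all nodes; the remainder has degree less than k and equals its
  Lagrange interpolant.\<close>

lemma gauss_exact:
  assumes "k \<ge> 1" "degree f \<le> 2 * k - 1"
  shows "Iq f = Gq k f"
proof -
  let ?P = "legendre k"
  define s where "s = f div ?P"
  define r where "r = f mod ?P"
  have f: "f = ?P * s + r" by (simp add: s_def r_def)
  have r: "degree r < k" using degree_mod_less[of ?P f] degree_legendre[of k] legendre_nz[of k] assms(1)
    unfolding r_def by (cases "f mod ?P = 0") auto
  have s: "s = 0 \<or> degree s < k"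
  proof (cases "s = 0")
    case False
    then have e: "degree (?P * s) = k + degree s" using legendre_nz[of k] degree_legendre[of k] by (simp add: degree_mult_eq)
    have "degree f = k + degree s" unfolding f
      by (subst degree_add_eq_left) (use e r in auto)
    then show ?thesis using assms by auto
  qed simp
  have "Iq f = Iq r" unfolding f Iq_add using legendre_orthogonal[OF s] by simp
  also have "\<dots> = Iq (\<Sum>i\<in>{1..k}. smult (poly r (gauss_pt k i)) (lag k i))"
    using lagrange_interpolation[OF r] by simp
  also have "\<dots> = Gq k r"
    unfolding Gq_def by (simp add: Iq_sum Iq_smult gauss_wt_lag mult.commute)
  also have "\<dots> = Gq k f"
    unfolding Gq_def f using gauss_pt_facts(2)[of k] by (intro sum.cong) auto
  finally show ?thesis .
qed

text \<open>The rule is exact for the square of a Lagrange basis polynomial, and there it returns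
  just the weight.\<close>

lemma gauss_wt_pos: assumes "i \<in> {1..k}" shows "gauss_wt k i > 0"
proof -
  have d: "degree (lag k i * lag k i) \<le> 2 * k - 1"
    using degree_mult_le[of "lag k i" "lag k i"] degree_lag[OF assms] by linarith
  have "lag k i \<noteq> 0" using lag_pt[OF assms assms] by auto
  then have "0 < Iq (lag k i * lag k i)" by (rule Iq_sq_pos)
  also have "\<dots> = Gq k (lag k i * lag k i)" using assms d by (intro gauss_exact) auto
  also have "\<dots> = (\<Sum>j\<in>{1..k}. if j = i then gauss_wt k i else 0)"
    unfolding Gq_def using assms by (intro sum.cong) (auto simp: lag_pt)
  also have "\<dots> = gauss_wt k i" using assms by simp
  finally show ?thesis .
qed

text \<open>Subtracting a multiple c of the squared Legendre polynomial removes the coefficient at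
  2k and leaves a polynomial that is integrated exactly. The rule gives 0 for the square while its
  integral is nonnegative, so the error has the sign of c, that is, of the top coefficient.\<close>

lemma gauss_error:
  assumes "k \<ge> 1" "degree f \<le> 2 * k" "coeff f (2 * k) \<ge> 0"
  shows "Gq k f \<le> Iq f"
proof -
  let ?P = "legendre k"
  define c where "c = coeff f (2 * k) / (lead_coeff ?P)\<^sup>2"
  define g where "g = f - smult c (?P * ?P)"
  have lp: "lead_coeff ?P \<noteq> 0" using legendre_nz by simp
  have d2: "degree (?P * ?P) = 2 * k" using legendre_nz[of k] degree_legendre[of k] by (simp add: degree_mult_eq)
  have "coeff (?P * ?P) (2 * k) = (lead_coeff ?P)\<^sup>2"
    using coeff_mult_degree_sum[of ?P ?P] by (simp add: degree_legendre mult_2 power2_eq_square)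
  then have c0: "coeff g (2 * k) = 0" unfolding g_def c_def using lp by simp
  have "degree g \<le> 2 * k" unfolding g_def
    using assms(2) d2 by (intro degree_diff_le) (auto intro: order.trans[OF degree_smult_le])
  then have "degree g \<le> 2 * k - 1"
    using c0 assms(1) by (cases "degree g = 2 * k") (auto, metis degree_0 leading_coeff_0_iff le0)
  then have "Iq g = Gq k g" using assms(1) by (intro gauss_exact) auto
  moreover have "Gq k (?P * ?P) = 0" unfolding Gq_def using gauss_pt_facts(2)[of k] by (intro sum.neutral) auto
  ultimately have "Iq f - Gq k f = c * Iq (?P * ?P)"
    unfolding g_def Iq_diff Gq_diff Iq_smult Gq_smult by simp
  moreover have "c \<ge> 0" unfolding c_def using assms(3) by simp
  ultimately show ?thesis using Iq_sq_nonneg[of ?P] by (metis diff_ge_0_iff_ge mult_nonneg_nonneg)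
qed

text \<open>x^2 - 1 is even and each derivative changes the parity; composition with
  \<open>[:0, -1:]\<close> is the reflection x -> -x.\<close>

lemma legendre_parity: "pcompose (leg_num k m) [:0, -1:] = smult ((-1) ^ m) (leg_num k m)"
proof (induction m)
  case 0 then show ?case
  proof -
    have "pcompose (p ^ n) r = pcompose p r ^ n" for p r :: "real poly" and n
      by (induction n) (auto simp: pcompose_mult pcompose_1)
    then show ?thesis by (simp add: leg_num_def) (simp add: pcompose_pCons)
  qed
next
  case (Suc m)
  have "pderiv (pcompose (leg_num k m) [:0, -1:]) = - pcompose (pderiv (leg_num k m)) [:0, -1:]"
    by (subst pderiv_pcompose) (simp add: pderiv_pCons)
  then have "pcompose (leg_num k (Suc m)) [:0, -1:] = - pderiv (smult ((-1) ^ m) (leg_num k m))"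
    unfolding leg_num_Suc using Suc by simp
  then show ?case by (simp add: leg_num_Suc pderiv_smult)
qed

text \<open>If the inner values of f are among those of g, then f i is preceded by at least as many
  values of g as its index says. Applied in both directions it shows that two increasing
  enumerations of one set agree.\<close>

lemma increasing_enum_le:
  fixes f g :: "nat \<Rightarrow> real"
  assumes f: "\<And>i j. i < j \<Longrightarrow> j \<le> Suc k \<Longrightarrow> f i < f j"
    and g: "\<And>i j. i < j \<Longrightarrow> j \<le> Suc k \<Longrightarrow> g i < g j"
    and "f 0 = g 0" "f (Suc k) = g (Suc k)" "f ` {1..k} \<subseteq> g ` {1..k}" "i \<le> Suc k"
  shows "g i \<le> f i"
  using \<open>i \<le> Suc k\<close>
proof (induction i)
  case 0 then show ?case using assms by simp
next
  case (Suc i)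
  show ?case
  proof (cases "Suc i = Suc k")
    case True then show ?thesis using assms by simp
  next
    case False
    then have "Suc i \<in> {1..k}" using Suc.prems by auto
    then have "f (Suc i) \<in> g ` {1..k}" using assms(5) by blast
    then obtain j where j: "j \<in> {1..k}" "f (Suc i) = g j" by auto
    have "g i \<le> f i" using Suc by simp
    also have "\<dots> < f (Suc i)" using Suc.prems by (intro f) auto
    finally have "i < j" using j g[of j i] Suc.prems by (cases i j rule: linorder_cases) auto
    then show ?thesis using j g[of "Suc i" j] by (cases "Suc i = j") auto
  qed
qed

text \<open>By parity the root set is symmetric, so the reflected and reversed enumeration is again
  increasing with the same values. The mirror index is k + 1 - i because the end points have the
  indices 0 and k + 1.\<close>

lemma gauss_pt_symm: assumes "i \<le> Suc k" shows "gauss_pt k (Suc k - i) = - gauss_pt k i"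
proof -
  let ?r = "\<lambda>i. - gauss_pt k (Suc k - i)"
  let ?Z = "{x. poly (legendre k) x = 0}"
  have Z: "poly (legendre k) (- x) = 0 \<longleftrightarrow> poly (legendre k) x = 0" for x
    using arg_cong[OF legendre_parity[of k k], of "\<lambda>p. poly p x"]
    by (auto simp: legendre_leg_num poly_pcompose)
  have sub: "?r ` {1..k} \<subseteq> gauss_pt k ` {1..k}"
  proof safe
    fix i assume "i \<in> {1..k}"
    then have "Suc k - i \<in> {1..k}" by auto
    then have "?r i \<in> ?Z" using gauss_pt_facts(2)[of k] Z by auto
    then show "?r i \<in> gauss_pt k ` {1..k}" using gauss_pt_facts(3)[of k] by blast
  qed
  have sup: "gauss_pt k ` {1..k} \<subseteq> ?r ` {1..k}"
  proof safe
    fix i assume "i \<in> {1..k}"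
    then have "gauss_pt k i \<in> ?Z" using gauss_pt_facts(2)[of k] by auto
    then have "- gauss_pt k i \<in> ?Z" using Z[of "- gauss_pt k i"] by auto
    then obtain j where j: "j \<in> {1..k}" "- gauss_pt k i = gauss_pt k j" using gauss_pt_facts(3)[of k] by blast
    then have "gauss_pt k i = ?r (Suc k - j)" "Suc k - j \<in> {1..k}" by auto
    then show "gauss_pt k i \<in> ?r ` {1..k}" by blast
  qed
  have r: "?r i < ?r j" if "i < j" "j \<le> Suc k" for i j
    using gauss_pt_less[of "Suc k - j" "Suc k - i" k] that by auto
  have "gauss_pt k i \<le> ?r i" "?r i \<le> gauss_pt k i"
    using increasing_enum_le[of k ?r "gauss_pt k" i, OF r gauss_pt_less _ _ sub assms]
      increasing_enum_le[of k "gauss_pt k" ?r i, OF gauss_pt_less r _ _ sup assms] by auto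
  then show ?thesis by linarith
qed

lemma Iq_reflect: "Iq (pcompose p [:0, -1:]) = Iq p"
proof -
  obtain P where P: "pderiv P = p" using antideriv_exists by metis
  have "pderiv (- pcompose P [:0, -1:]) = pcompose p [:0, -1:]"
    unfolding pderiv_minus pderiv_pcompose P by (simp add: pderiv_pCons)
  then have "Iq (pcompose p [:0, -1:]) = poly (- pcompose P [:0, -1:]) 1 - poly (- pcompose P [:0, -1:]) (-1)"
    using poly_integral[of "-1" 1 "- pcompose P [:0, -1:]"] by simp
  also have "\<dots> = poly P 1 - poly P (-1)" by (simp add: poly_pcompose)
  also have "\<dots> = Iq p" using poly_integral[of "-1" 1 P] P by simp
  finally show ?thesis .
qed

lemma sum_reflect: "(\<Sum>j\<in>{1..k}. f (Suc k - j)) = (\<Sum>j\<in>{1..k::nat}. f j)"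
  by (rule sum.reindex_bij_witness[of _ "\<lambda>j. Suc k - j" "\<lambda>j. Suc k - j"]) auto

text \<open>Reflecting \<open>lag k i\<close> does not change its integral, and the exact rule
  evaluates the reflected polynomial to the weight at the mirrored node.\<close>

lemma gauss_wt_symm: assumes "i \<in> {1..k}" shows "gauss_wt k (Suc k - i) = gauss_wt k i"
proof -
  have d: "degree (pcompose (lag k i) [:0, -1:]) \<le> 2 * k - 1"
    using degree_lag[OF assms] degree_pcompose_le[of "lag k i" "[:0,-1:]"] by simp
  have "gauss_wt k i = Iq (pcompose (lag k i) [:0, -1:])" unfolding Iq_reflect gauss_wt_lag ..
  also have "\<dots> = Gq k (pcompose (lag k i) [:0, -1:])" using assms d by (intro gauss_exact) auto
  also have "\<dots> = (\<Sum>j\<in>{1..k}. if j = Suc k - i then gauss_wt k (Suc k - i) else 0)"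
    unfolding Gq_def
  proof (intro sum.cong refl)
    fix j assume j: "j \<in> {1..k}"
    have "- gauss_pt k j = gauss_pt k (Suc k - j)" using gauss_pt_symm[of j k] j by simp
    moreover have "Suc k - j \<in> {1..k}" "i = Suc k - j \<longleftrightarrow> j = Suc k - i" using j assms by auto
    ultimately show "gauss_wt k j * poly (pcompose (lag k i) [:0, -1:]) (gauss_pt k j)
        = (if j = Suc k - i then gauss_wt k (Suc k - i) else 0)"
      using assms by (simp add: poly_pcompose lag_pt)
  qed
  also have "\<dots> = gauss_wt k (Suc k - i)" using assms by auto
  finally show ?thesis by simp
qed

section \<open>One-dimensional dual interpolation and its pairing with polynomials\<close>

text \<open>The one-dimensional dual interpolant of p: \<open>dI k p j\<close> is its constant value
  between the Gauss points j and j + 1. It starts at p(-1) and jumps by A_m p'(g_m) at g_m.\<close>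

definition dI :: "nat \<Rightarrow> real poly \<Rightarrow> nat \<Rightarrow> real" where
  "dI k p j = poly p (-1) + (\<Sum>m\<in>{1..j}. gauss_wt k m * poly (pderiv p) (gauss_pt k m))"

lemma dI_0 [simp]: "dI k p 0 = poly p (-1)" by (simp add: dI_def)
lemma dI_Suc: "dI k p (Suc j) = dI k p j + gauss_wt k (Suc j) * poly (pderiv p) (gauss_pt k (Suc j))"
  by (simp add: dI_def)

lemma dI_diff: "j \<ge> 1 \<Longrightarrow> dI k p j - dI k p (j - 1) = gauss_wt k j * poly (pderiv p) (gauss_pt k j)"
  by (cases j) (auto simp: dI_Suc)

text \<open>p' has degree at most k - 1, so the Gauss rule sums its jumps exactly to p(1) -
  p(-1).\<close>

lemma dI_end: assumes "k \<ge> 1" "degree p \<le> k" shows "dI k p k = poly p 1"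
proof -
  have "degree (pderiv p) \<le> 2 * k - 1" using assms by (simp add: degree_pderiv)
  then have "Gq k (pderiv p) = poly p 1 - poly p (-1)"
    using gauss_exact[OF assms(1)] poly_integral[of "-1" 1 p] by simp
  then show ?thesis by (simp add: dI_def Gq_def)
qed

text \<open>Points and weights of the rule are symmetric and the last value is exact, so the
  recursion may be run from the other end. This is what makes nodal values independent of the
  direction in which an edge is traversed.\<close>

lemma dI_reflect:
  assumes "k \<ge> 1" "degree p \<le> k" "j \<le> k"
  shows "dI k (pcompose p [:0, -1:]) (k - j) = dI k p j"
  using assms(3)
proof (induction j)
  case 0
  show ?case using dI_end[of k "pcompose p [:0, -1:]"] degree_pcompose_le[of p "[:0,-1:]"] assms by (simp add: poly_pcompose)
next
  case (Suc j)
  have "dI k (pcompose p [:0,-1:]) (k - j) = dI k (pcompose p [:0,-1:]) (k - Suc j)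
     + gauss_wt k (Suc (k - Suc j)) * poly (pderiv (pcompose p [:0,-1:])) (gauss_pt k (Suc (k - Suc j)))"
    using Suc.prems dI_Suc[of k _ "k - Suc j"] by (simp add: Suc_diff_Suc)
  moreover have "Suc (k - Suc j) = Suc k - Suc j" using Suc.prems by simp
  moreover have "gauss_wt k (Suc k - Suc j) = gauss_wt k (Suc j)" using Suc.prems by (intro gauss_wt_symm) auto
  moreover have "gauss_pt k (Suc k - Suc j) = - gauss_pt k (Suc j)" using Suc.prems by (intro gauss_pt_symm) auto
  moreover have "poly (pderiv (pcompose p [:0,-1:])) (- gauss_pt k (Suc j)) = - poly (pderiv p) (gauss_pt k (Suc j))"
    by (simp add: pderiv_pcompose pderiv_pCons poly_pcompose)
  ultimately show ?case using Suc by (simp add: dI_Suc)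
qed

text \<open>The integral over [-1, 1] of the piecewise constant dual interpolant of p times
  q.\<close>

definition dual_form :: "nat \<Rightarrow> real poly \<Rightarrow> real poly \<Rightarrow> real" where
  "dual_form k p q = (\<Sum>j\<le>k. dI k p j * integral {gauss_pt k j..gauss_pt k (Suc j)} (poly q))"

text \<open>Abel summation: the jumps of the dual interpolant at the Gauss points, multiplied by
  values of the antiderivative Q, form the Gauss sum of p' Q.\<close>

lemma dual_form_parts:
  assumes "pderiv Q = q"
  shows "dual_form k p q = dI k p k * poly Q 1 - poly p (-1) * poly Q (-1) - Gq k (pderiv p * Q)"
proof -
  have *: "(\<Sum>j\<le>n. dI k p j * (poly Q (gauss_pt k (Suc j)) - poly Q (gauss_pt k j)))
    = dI k p n * poly Q (gauss_pt k (Suc n)) - poly p (-1) * poly Q (-1)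
      - (\<Sum>i\<in>{1..n}. gauss_wt k i * poly (pderiv p * Q) (gauss_pt k i))" for n
    by (induction n) (auto simp: dI_Suc algebra_simps)
  have "dual_form k p q = (\<Sum>j\<le>k. dI k p j * (poly Q (gauss_pt k (Suc j)) - poly Q (gauss_pt k j)))"
    unfolding dual_form_def assms[symmetric]
    by (intro sum.cong refl) (auto simp: poly_integral gauss_pt_le)
  then show ?thesis using *[of k] by (simp add: Gq_def)
qed

text \<open>Integration by parts of p q has the same boundary terms, thanks to
  \<open>dI_end\<close>. What separates the pairing from the integral is therefore exactly the
  quadrature error of p' Q.\<close>

lemma dual_form_aux:
  assumes "k \<ge> 1" "degree p \<le> k" "pderiv Q = q"
  shows "dual_form k p q = Iq (p * q) + (Iq (pderiv p * Q) - Gq k (pderiv p * Q))"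
proof -
  have "poly (p * Q) 1 - poly (p * Q) (-1) = Iq (pderiv (p * Q))"
    by (rule poly_integral[symmetric]) simp
  also have "\<dots> = Iq (p * q) + Iq (pderiv p * Q)"
    unfolding pderiv_mult assms(3) Iq_add by (simp add: mult.commute)
  finally show ?thesis unfolding dual_form_parts[OF assms(3)] dI_end[OF assms(1,2)] by simp
qed

text \<open>Here p' Q has degree at most (k - 1) + k = 2k - 1.\<close>

lemma dual_form_exact:
  assumes "k \<ge> 1" "degree p \<le> k" "degree q \<le> k - 1"
  shows "dual_form k p q = Iq (p * q)"
proof -
  obtain Q where Q: "pderiv Q = q" "degree Q \<le> Suc (degree q)" using antideriv_exists by metis
  have "degree (pderiv p * Q) \<le> (k - 1) + k"
    using assms Q by (intro order.trans[OF degree_mult_le] add_mono) (auto simp: degree_pderiv)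
  then have "Iq (pderiv p * Q) = Gq k (pderiv p * Q)" using assms(1) by (intro gauss_exact) auto
  then show ?thesis using dual_form_aux[OF assms(1,2) Q(1)] by simp
qed

lemma coeff_mult_top:
  fixes p q :: "'a :: comm_semiring_0 poly"
  assumes "degree p \<le> m" "degree q \<le> n"
  shows "coeff (p * q) (m + n) = coeff p m * coeff q n"
proof (cases "degree p = m \<and> degree q = n")
  case True then show ?thesis using coeff_mult_degree_sum[of p q] by simp
next
  case False
  then have "degree p + degree q < m + n" using assms by linarith
  then have "coeff (p * q) (m + n) = 0" using degree_mult_le[of p q] by (intro coeff_eq_0) linarith
  moreover have "coeff p m * coeff q n = 0" using False assms coeff_eq_0[of p m] coeff_eq_0[of q n] by fastforce
  ultimately show ?thesis by simp
qed

text \<open>If a is the coefficient of Q at k + 1, then p = Q' has (k + 1) a at k and p' has k (k +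
  1) a at k - 1. The coefficient of p' Q at 2k is k (k + 1) a^2, which is nonnegative, and
  \<open>gauss_error\<close> applies.\<close>

lemma dual_form_self:
  assumes "k \<ge> 1" "degree p \<le> k"
  shows "dual_form k p p \<ge> Iq (p * p)"
proof -
  obtain Q where Q: "pderiv Q = p" "degree Q \<le> Suc (degree p)" using antideriv_exists by metis
  have d: "degree (pderiv p) \<le> k - 1" "degree Q \<le> k + 1" using assms Q by (auto simp: degree_pderiv)
  have dd: "degree (pderiv p * Q) \<le> (k - 1) + (k + 1)"
    using d by (intro order.trans[OF degree_mult_le] add_mono) auto
  have "coeff p k = real (k + 1) * coeff Q (k + 1)" using Q(1) coeff_pderiv[of Q k] by simp
  moreover have "coeff (pderiv p) (k - 1) = real k * coeff p k"
    using coeff_pderiv[of p "k - 1"] assms(1) by simp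
  moreover have "coeff (pderiv p * Q) ((k - 1) + (k + 1)) = coeff (pderiv p) (k - 1) * coeff Q (k + 1)"
    using d by (rule coeff_mult_top)
  ultimately have "coeff (pderiv p * Q) (2 * k) = real k * real (k + 1) * (coeff Q (k + 1))\<^sup>2"
    using assms(1) by (simp add: power2_eq_square mult_2)
  then have "coeff (pderiv p * Q) (2 * k) \<ge> 0" by simp
  then have "Gq k (pderiv p * Q) \<le> Iq (pderiv p * Q)" using dd assms(1) by (intro gauss_error) auto
  then show ?thesis using dual_form_aux[OF assms Q(1)] by simp
qed

text \<open>The coefficient of p^2 at 2k is a square, possibly zero.\<close>

lemma gauss_sq_le: assumes "k \<ge> 1" "degree p \<le> k" shows "Gq k (p * p) \<le> Iq (p * p)"
proof (rule gauss_error[OF assms(1)])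
  show "degree (p * p) \<le> 2 * k" using degree_mult_le[of p p] assms(2) by linarith
  show "coeff (p * p) (2 * k) \<ge> 0"
  proof (cases "degree p = k")
    case True then show ?thesis using coeff_mult_degree_sum[of p p] by (simp add: mult_2)
  next
    case False
    then have "degree (p * p) < 2 * k" using degree_mult_le[of p p] assms(2) by linarith
    then show ?thesis by (simp add: coeff_eq_0)
  qed
qed

lemma poly_bdd: "\<exists>B\<ge>0. \<forall>x\<in>{-1..1}. \<bar>poly (p :: real poly) x\<bar> \<le> B"
proof -
  have "compact (poly p ` {-1..1})" by (intro compact_continuous_image continuous_intros) auto
  then obtain B where "\<forall>x\<in>{-1..1}. \<bar>poly p x\<bar> \<le> B" by (auto dest!: compact_imp_bounded simp: bounded_iff)
  then show ?thesis by (intro exI[of _ "max B 0"]) (auto simp: max_def intro: order.trans)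
qed

text \<open>Exactness of the rule with \<open>k + 1\<close> nodes controls the nodal values by the integral,
  and Lagrange interpolation at these nodes does the rest.\<close>

lemma poly_sup_bound:
  "\<exists>C\<ge>0. \<forall>p. degree p \<le> k \<longrightarrow> (\<forall>x\<in>{-1..1}. \<bar>poly p x\<bar> \<le> C * sqrt (Iq (p * p)) \<and>
       \<bar>poly (pderiv p) x\<bar> \<le> C * sqrt (Iq (p * p)))"
proof -
  let ?n = "Suc k"
  obtain B where B: "\<And>i. B i \<ge> 0" "\<And>i x. x \<in> {-1..1} \<Longrightarrow> \<bar>poly (lag ?n i) x\<bar> \<le> B i"
    using choice[of "\<lambda>i B. B \<ge> 0 \<and> (\<forall>x\<in>{-1..1}. \<bar>poly (lag ?n i) x\<bar> \<le> B)"] poly_bdd by blast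
  obtain B' where B': "\<And>i. B' i \<ge> 0" "\<And>i x. x \<in> {-1..1} \<Longrightarrow> \<bar>poly (pderiv (lag ?n i)) x\<bar> \<le> B' i"
    using choice[of "\<lambda>i B. B \<ge> 0 \<and> (\<forall>x\<in>{-1..1}. \<bar>poly (pderiv (lag ?n i)) x\<bar> \<le> B)"] poly_bdd by blast
  define C where "C = (\<Sum>i\<in>{1..?n}. (B i + B' i) / sqrt (gauss_wt ?n i))"
  have C0: "C \<ge> 0" unfolding C_def using B B' gauss_wt_pos[of _ ?n]
    by (intro sum_nonneg divide_nonneg_nonneg add_nonneg_nonneg) (auto intro: less_imp_le)
  have "\<bar>poly p x\<bar> \<le> C * sqrt (Iq (p * p)) \<and> \<bar>poly (pderiv p) x\<bar> \<le> C * sqrt (Iq (p * p))"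
    if p: "degree p \<le> k" and x: "x \<in> {-1..1}" for p x
  proof -
    have d: "degree (p * p) \<le> 2 * ?n - 1" using degree_mult_le[of p p] p by simp
    have node: "\<bar>poly p (gauss_pt ?n i)\<bar> \<le> sqrt (Iq (p * p)) / sqrt (gauss_wt ?n i)" if i: "i \<in> {1..?n}" for i
    proof -
      have "gauss_wt ?n i * (poly p (gauss_pt ?n i))\<^sup>2 \<le> Gq ?n (p * p)"
        unfolding Gq_def using member_le_sum[of i "{1..?n}" "\<lambda>i. gauss_wt ?n i * poly (p * p) (gauss_pt ?n i)"]
          gauss_wt_pos[of _ ?n] i by (force simp: power2_eq_square less_imp_le)
      also have "\<dots> = Iq (p * p)" using d by (intro gauss_exact[symmetric]) auto
      finally have "(poly p (gauss_pt ?n i))\<^sup>2 \<le> Iq (p * p) / gauss_wt ?n i"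
        using gauss_wt_pos[OF i] by (simp add: field_simps)
      then show ?thesis using real_le_rsqrt real_sqrt_divide by (metis real_sqrt_abs real_sqrt_le_mono)
    qed
    have e: "p = (\<Sum>i\<in>{1..?n}. smult (poly p (gauss_pt ?n i)) (lag ?n i))"
      using p by (intro lagrange_interpolation) auto
    have e': "pderiv p = (\<Sum>i\<in>{1..?n}. smult (poly p (gauss_pt ?n i)) (pderiv (lag ?n i)))"
      using arg_cong[OF e, of pderiv] by (simp only: higher_pderiv_sum[where n=1, simplified] pderiv_smult)
    have gen: "\<bar>poly (\<Sum>i\<in>{1..?n}. smult (poly p (gauss_pt ?n i)) (L i)) x\<bar> \<le> C * sqrt (Iq (p * p))"
      if L: "\<And>i. i \<in> {1..?n} \<Longrightarrow> \<bar>poly (L i) x\<bar> \<le> B i + B' i" for L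
    proof -
      have "\<bar>poly (\<Sum>i\<in>{1..?n}. smult (poly p (gauss_pt ?n i)) (L i)) x\<bar>
          \<le> (\<Sum>i\<in>{1..?n}. \<bar>poly p (gauss_pt ?n i) * poly (L i) x\<bar>)"
        unfolding poly_sum poly_smult by (rule sum_abs)
      also have "\<dots> \<le> (\<Sum>i\<in>{1..?n}. sqrt (Iq (p * p)) / sqrt (gauss_wt ?n i) * (B i + B' i))"
        unfolding abs_mult using node L
        by (intro sum_mono mult_mono) (auto intro: order.trans[OF abs_ge_zero])
      also have "\<dots> = C * sqrt (Iq (p * p))" unfolding C_def sum_distrib_right by (simp add: mult.commute)
      finally show ?thesis .
    qed
    have "\<bar>poly (lag ?n i) x\<bar> \<le> B i + B' i" "\<bar>poly (pderiv (lag ?n i)) x\<bar> \<le> B i + B' i" for i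
      using B(2)[OF x, of i] B'(2)[OF x, of i] B(1)[of i] B'(1)[of i] by linarith+
    then show ?thesis using gen[of "lag ?n"] gen[of "\<lambda>i. pderiv (lag ?n i)"] e e' by metis
  qed
  then show ?thesis using C0 by blast
qed

lemma dI_bound:
  "\<exists>C\<ge>0. \<forall>p j. degree p \<le> k \<longrightarrow> j \<le> k \<longrightarrow> \<bar>dI k p j\<bar> \<le> C * sqrt (Iq (p * p))"
proof -
  obtain C where C: "C \<ge> 0" "\<And>p x. degree p \<le> k \<Longrightarrow> x \<in> {-1..1} \<Longrightarrow> \<bar>poly p x\<bar> \<le> C * sqrt (Iq (p * p)) \<and>
       \<bar>poly (pderiv p) x\<bar> \<le> C * sqrt (Iq (p * p))" using poly_sup_bound[of k] by metis
  define W where "W = (\<Sum>m\<in>{1..k}. gauss_wt k m)"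
  have W: "W \<ge> 0" unfolding W_def using gauss_wt_pos by (intro sum_nonneg) (auto intro: less_imp_le)
  have "\<bar>dI k p j\<bar> \<le> (C + W * C) * sqrt (Iq (p * p))" if "degree p \<le> k" "j \<le> k" for p j
  proof -
    have "\<bar>\<Sum>m\<in>{1..j}. gauss_wt k m * poly (pderiv p) (gauss_pt k m)\<bar>
       \<le> (\<Sum>m\<in>{1..j}. gauss_wt k m * (C * sqrt (Iq (p * p))))"
      using that C(2)[OF that(1)] gauss_wt_pos[of _ k] gauss_pt_bounds[of _ k]
      by (intro order.trans[OF sum_abs] sum_mono) (auto simp: abs_mult less_imp_le intro!: mult_left_mono)
    also have "\<dots> = (\<Sum>m\<in>{1..j}. gauss_wt k m) * (C * sqrt (Iq (p * p)))" by (simp add: sum_distrib_right)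
    also have "\<dots> \<le> W * (C * sqrt (Iq (p * p)))"
      unfolding W_def using that gauss_wt_pos[of _ k] C(1) Iq_sq_nonneg[of p]
      by (intro mult_right_mono sum_mono2) (auto intro: less_imp_le)
    finally show ?thesis using C(2)[OF that(1), of "-1"] unfolding dI_def by (auto simp: algebra_simps)
  qed
  then show ?thesis using C W by (intro exI[of _ "C + W * C"]) auto
qed

section \<open>The one-dimensional Hausdorff measure as a Borel measure\<close>

definition cover :: "real \<Rightarrow> (real^2) set \<Rightarrow> (nat \<Rightarrow> (real^2) set) \<Rightarrow> bool" where
  "cover \<delta> S A \<longleftrightarrow> S \<subseteq> (\<Union>n. A n) \<and> (\<forall>n. bounded (A n) \<and> diameter (A n) \<le> \<delta>)"

lemma pre_le: "cover \<delta> S A \<Longrightarrow> hausdorff1_pre \<delta> S \<le> (\<Sum>n. ennreal (diameter (A n)))"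
  unfolding hausdorff1_pre_def by (rule INF_lower) (auto simp: cover_def)

lemma pre_greatest:
  "(\<And>A. cover \<delta> S A \<Longrightarrow> c \<le> (\<Sum>n. ennreal (diameter (A n)))) \<Longrightarrow> c \<le> hausdorff1_pre \<delta> S"
  unfolding hausdorff1_pre_def by (rule INF_greatest) (auto simp: cover_def)

lemma pre_approx:
  assumes "hausdorff1_pre \<delta> S < top" "e > 0"
  obtains A where "cover \<delta> S A" "(\<Sum>n. ennreal (diameter (A n))) < hausdorff1_pre \<delta> S + ennreal e"
proof -
  have "\<exists>A\<in>{A. S \<subseteq> (\<Union>n. A n) \<and> (\<forall>n. bounded (A n) \<and> diameter (A n) \<le> \<delta>)}.
      (\<Sum>n. ennreal (diameter (A n))) < hausdorff1_pre \<delta> S + ennreal e"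
    by (rule INF_approx_ennreal[OF assms(2) hausdorff1_pre_def]) (use assms in auto)
  then show ?thesis using that unfolding cover_def by blast
qed

lemma pre_mono: "S \<subseteq> S' \<Longrightarrow> hausdorff1_pre \<delta> S \<le> hausdorff1_pre \<delta> S'"
  by (rule pre_greatest, rule pre_le) (auto simp: cover_def)

lemma pre_antimono: "\<delta> \<le> \<delta>' \<Longrightarrow> hausdorff1_pre \<delta>' S \<le> hausdorff1_pre \<delta> S"
  by (rule pre_greatest, rule pre_le) (auto simp: cover_def intro: order.trans)

lemma pre_le_outer: "\<delta> > 0 \<Longrightarrow> hausdorff1_pre \<delta> S \<le> hausdorff1_outer S"
  unfolding hausdorff1_outer_def by (rule SUP_upper) auto

lemma outer_mono: "S \<subseteq> S' \<Longrightarrow> hausdorff1_outer S \<le> hausdorff1_outer S'"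
  unfolding hausdorff1_outer_def by (rule SUP_mono) (auto intro: pre_mono)

lemma pre_subadditive:
  assumes "\<delta> > 0"
  shows "hausdorff1_pre \<delta> (\<Union>n. S n) \<le> (\<Sum>n. hausdorff1_pre \<delta> (S (n::nat)))"
proof (cases "(\<Sum>n. hausdorff1_pre \<delta> (S n)) = top")
  case True then show ?thesis by simp
next
  case False
  then have fin: "hausdorff1_pre \<delta> (S n) < top" for n
    by (metis ennreal_suminf_lessD less_top)
  show ?thesis
  proof (rule ennreal_le_epsilon)
    fix e :: real assume e: "0 < e"
    have "\<exists>A. cover \<delta> (S n) A \<and> (\<Sum>m. ennreal (diameter (A m))) \<le> hausdorff1_pre \<delta> (S n) + ennreal (e * (1/2) ^ Suc n)" for n
      using pre_approx[OF fin[of n], of "e * (1/2) ^ Suc n"] e by (metis less_imp_le mult_pos_pos zero_less_divide_1_iff zero_less_numeral zero_less_power)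
    then obtain A where A: "\<And>n. cover \<delta> (S n) (A n)"
      "\<And>n. (\<Sum>m. ennreal (diameter (A n m))) \<le> hausdorff1_pre \<delta> (S n) + ennreal (e * (1/2) ^ Suc n)"
      by metis
    let ?B = "\<lambda>i. case_prod A (prod_decode i)"
    have "cover \<delta> (\<Union>n. S n) ?B"
      unfolding cover_def
    proof (intro conjI allI subsetI)
      fix x assume "x \<in> (\<Union>n. S n)"
      then obtain n m where "x \<in> A n m" using A(1) by (auto simp: cover_def) blast
      then show "x \<in> (\<Union>i. ?B i)" by (intro UN_I[of "prod_encode (n, m)"]) auto
    qed (use A(1) in \<open>auto simp: cover_def split: prod.split\<close>)
    then have "hausdorff1_pre \<delta> (\<Union>n. S n) \<le> (\<Sum>i. ennreal (diameter (?B i)))" by (rule pre_le)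
    also have "(\<Sum>i. ennreal (diameter (?B i))) = (\<Sum>n. \<Sum>m. ennreal (diameter (A n m)))"
      by (rule suminf_ennreal_2dimen[of _ "\<lambda>p. ennreal (diameter (case_prod A p))"]) auto
    also have "\<dots> \<le> (\<Sum>n. hausdorff1_pre \<delta> (S n) + ennreal (e * (1/2) ^ Suc n))"
      using A(2) by (intro suminf_le) auto
    also have "\<dots> = (\<Sum>n. hausdorff1_pre \<delta> (S n)) + (\<Sum>n. ennreal (e * (1/2) ^ Suc n))"
      by (rule suminf_add[symmetric]) auto
    also have "(\<Sum>n. ennreal (e * (1/2) ^ Suc n)) = ennreal e"
      using sums_mult[OF power_half_series, of e] e by (subst suminf_ennreal2) (auto simp: sums_iff)
    finally show "hausdorff1_pre \<delta> (\<Union>n. S n) \<le> (\<Sum>n. hausdorff1_pre \<delta> (S n)) + ennreal e" .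
  qed
qed

lemma outer_subadditive: "hausdorff1_outer (\<Union>n. S n) \<le> (\<Sum>n. hausdorff1_outer (S (n::nat)))"
proof -
  have "hausdorff1_pre \<delta> (\<Union>n. S n) \<le> (\<Sum>n. hausdorff1_outer (S n))" if "\<delta> > 0" for \<delta>
  proof (rule order.trans[OF pre_subadditive[OF that]])
    show "(\<Sum>n. hausdorff1_pre \<delta> (S n)) \<le> (\<Sum>n. hausdorff1_outer (S n))"
      using that by (intro suminf_le pre_le_outer) auto
  qed
  then show ?thesis unfolding hausdorff1_outer_def[of "\<Union>n. S n"] by (intro SUP_least) auto
qed

lemma outer_finite_subset:
  assumes "finite S" shows "hausdorff1_outer S = 0"
proof -
  have "hausdorff1_pre \<delta> S \<le> 0" if "\<delta> > 0" for \<delta>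
  proof (cases "S = {}")
    case True
    have "hausdorff1_pre \<delta> S \<le> (\<Sum>n::nat. ennreal (diameter ({}::(real^2) set)))"
      using that by (intro pre_le) (auto simp: cover_def True)
    then show ?thesis by simp
  next
    case False
    then have "hausdorff1_pre \<delta> S \<le> (\<Sum>n::nat. ennreal (diameter {from_nat_into S n}))"
      using that assms
      by (intro pre_le) (auto simp: cover_def, metis countable_finite from_nat_into_surj)
    then show ?thesis by simp
  qed
  then show ?thesis unfolding hausdorff1_outer_def by (auto intro!: antisym SUP_least)
qed

lemma outer_empty: "hausdorff1_outer {} = 0" by (simp add: outer_finite_subset)

lemma outer_Un: "hausdorff1_outer (A \<union> B) \<le> hausdorff1_outer A + hausdorff1_outer B"
proof -
  let ?S = "\<lambda>n::nat. if n = 0 then A else if n = 1 then B else {}"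
  have eq: "A \<union> B = (\<Union>n. ?S n)"
  proof (intro equalityI subsetI)
    fix x assume "x \<in> A \<union> B"
    then show "x \<in> (\<Union>n. ?S n)"
    proof
      assume "x \<in> A" then show ?thesis by (intro UN_I[of 0]) auto
    next
      assume "x \<in> B" then show ?thesis by (intro UN_I[of 1]) auto
    qed
  qed (auto split: if_splits)
  have "hausdorff1_outer (A \<union> B) \<le> (\<Sum>n. hausdorff1_outer (?S n))" unfolding eq by (rule outer_subadditive)
  also have "\<dots> = (\<Sum>n<2. hausdorff1_outer (?S n))"
    by (rule suminf_finite) (auto simp: outer_empty)
  finally show ?thesis by (simp add: numeral_2_eq_2)
qed

text \<open>For \<delta> < r no set of diameter at most \<delta> meets both A and B. A cover of the
  union thus splits into a cover of A and one of B that share no nonempty set.\<close>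

lemma outer_metric:
  assumes r: "r > 0" and sep: "\<And>a b. a \<in> A \<Longrightarrow> b \<in> B \<Longrightarrow> dist a b \<ge> r"
  shows "hausdorff1_outer A + hausdorff1_outer B \<le> hausdorff1_outer (A \<union> B)"
proof -
  have step: "hausdorff1_pre \<delta> A + hausdorff1_pre \<delta> B \<le> hausdorff1_pre \<delta> (A \<union> B)"
    if d: "0 < \<delta>" "\<delta> < r" for \<delta>
  proof (rule pre_greatest)
    fix E assume E: "cover \<delta> (A \<union> B) E"
    let ?EA = "\<lambda>n. if E n \<inter> A = {} then {} else E n"
    let ?EB = "\<lambda>n. if E n \<inter> B = {} then {} else E n"
    have "cover \<delta> A ?EA" "cover \<delta> B ?EB" using E d unfolding cover_def by fastforce+
    then have "hausdorff1_pre \<delta> A + hausdorff1_pre \<delta> B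
       \<le> (\<Sum>n. ennreal (diameter (?EA n))) + (\<Sum>n. ennreal (diameter (?EB n)))"
      by (intro add_mono pre_le)
    also have "\<dots> = (\<Sum>n. ennreal (diameter (?EA n)) + ennreal (diameter (?EB n)))"
      by (rule suminf_add) auto
    also have "\<dots> \<le> (\<Sum>n. ennreal (diameter (E n)))"
    proof (intro suminf_le)
      fix n
      show "ennreal (diameter (?EA n)) + ennreal (diameter (?EB n)) \<le> ennreal (diameter (E n))"
      proof (cases "E n \<inter> A = {} \<or> E n \<inter> B = {}")
        case True then show ?thesis by auto
      next
        case False
        then obtain a b where ab: "a \<in> E n" "a \<in> A" "b \<in> E n" "b \<in> B" by auto
        have "dist a b \<le> diameter (E n)"
          using E ab by (intro diameter_bounded_bound) (auto simp: cover_def)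
        also have "\<dots> \<le> \<delta>" using E by (auto simp: cover_def)
        finally show ?thesis using sep[of a b] ab d by auto
      qed
    qed auto
    finally show "hausdorff1_pre \<delta> A + hausdorff1_pre \<delta> B \<le> (\<Sum>n. ennreal (diameter (E n)))" .
  qed
  \<comment> \<open>Along this sequence, decreasing to 0 and below r, the supremum over \<delta>
    becomes an increasing limit, which may be exchanged with the sum of the two measures.\<close>
  define s where "s n = r / (real n + 2)" for n
  have s: "0 < s n" "s n < r" for n
  proof -
    show "0 < s n" using r by (simp add: s_def)
    have "r * 1 < r * (real n + 2)" using r by (intro mult_strict_left_mono) auto
    then show "s n < r" by (simp add: s_def divide_less_eq)
  qed
  have sd: "s (Suc n) \<le> s n" for n using r unfolding s_def by (intro divide_left_mono) auto
  have sup: "hausdorff1_outer S = (SUP n. hausdorff1_pre (s n) S)" for S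
  proof (rule antisym)
    show "hausdorff1_outer S \<le> (SUP n. hausdorff1_pre (s n) S)"
      unfolding hausdorff1_outer_def
    proof (rule SUP_mono)
      fix \<delta> :: real assume "\<delta> \<in> {0<..}"
      then obtain n where "r / \<delta> < real n" using reals_Archimedean2 by blast
      then have "s n \<le> \<delta>" using \<open>\<delta> \<in> {0<..}\<close> r unfolding s_def
        by (auto simp: field_simps)
      then show "\<exists>m\<in>UNIV. hausdorff1_pre \<delta> S \<le> hausdorff1_pre (s m) S" using pre_antimono by blast
    qed
    show "(SUP n. hausdorff1_pre (s n) S) \<le> hausdorff1_outer S" using s by (intro SUP_least pre_le_outer)
  qed
  have inc: "incseq (\<lambda>n. hausdorff1_pre (s n) S)" for S by (intro incseq_SucI pre_antimono sd)
  have "hausdorff1_outer A + hausdorff1_outer B = (SUP n. hausdorff1_pre (s n) A + hausdorff1_pre (s n) B)"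
    unfolding sup by (rule ennreal_SUP_add[OF inc inc, symmetric])
  also have "\<dots> \<le> (SUP n. hausdorff1_pre (s n) (A \<union> B))" using s step by (intro SUP_mono) blast
  finally show ?thesis unfolding sup .
qed

text \<open>The strips \<open>R m\<close> at distance about \<open>1/m\<close> from \<open>F\<close> of the same parity are separated, so
  their measures sum to at most twice that of \<open>X\<close> and the far tail is negligible.\<close>

lemma outer_closed_caratheodory:
  assumes "closed F"
  shows "hausdorff1_outer (X \<inter> F) + hausdorff1_outer (X - F) = hausdorff1_outer X"
proof (rule antisym)
  show "hausdorff1_outer X \<le> hausdorff1_outer (X \<inter> F) + hausdorff1_outer (X - F)"
    using outer_Un[of "X \<inter> F" "X - F"] by (simp add: Int_Diff_Un)
  show "hausdorff1_outer (X \<inter> F) + hausdorff1_outer (X - F) \<le> hausdorff1_outer X"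
  proof (cases "hausdorff1_outer X = top \<or> F = {}")
    case True then show ?thesis by (auto simp: outer_empty)
  next
    case False
    then have fin: "hausdorff1_outer X < top" and F: "F \<noteq> {}" by (auto simp: less_top)
    define d where "d x = infdist x F" for x
    have dlip: "d x \<le> d y + dist x y" for x y unfolding d_def by (rule infdist_triangle)
    define q where "q n = 1 / (real n + 1)" for n
    have q: "q n > 0" for n by (simp add: q_def)
    have qless: "q n < q m" if "m < n" for m n using that by (simp add: q_def field_simps)
    have qle: "q n \<le> q m" if "m \<le> n" for m n using that by (simp add: q_def field_simps)
    define A where "A n = {x \<in> X. d x \<ge> q n}" for n
    define R where "R n = {x \<in> X. q (Suc n) \<le> d x \<and> d x < q n}" for n
    have par: "(\<Sum>m<N. hausdorff1_outer (R (2 * m + p))) \<le> hausdorff1_outer (\<Union>m<N. R (2 * m + p))" for N p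
    proof (induction N)
      case (Suc N)
      have "(\<Sum>m<Suc N. hausdorff1_outer (R (2 * m + p)))
        \<le> hausdorff1_outer (\<Union>m<N. R (2 * m + p)) + hausdorff1_outer (R (2 * N + p))"
        using Suc by (simp add: add_right_mono)
      also have "\<dots> \<le> hausdorff1_outer ((\<Union>m<N. R (2 * m + p)) \<union> R (2 * N + p))"
      proof (rule outer_metric)
        \<comment> \<open>For N = 0 the union is empty and any positive separation will do; the case
          distinction also avoids the truncated difference when 2 * N + p = 0.\<close>
        show "0 < (if N = 0 then 1 else q (2 * N + p - 1) - q (2 * N + p))"
          using qless[of "2 * N + p - 1" "2 * N + p"] by (cases "N = 0") auto
        fix a b assume a: "a \<in> (\<Union>m<N. R (2 * m + p))" and b: "b \<in> R (2 * N + p)"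
        then obtain m where m: "m < N" "a \<in> R (2 * m + p)" by auto
        have "q (2 * N + p - 1) \<le> q (Suc (2 * m + p))" using m by (intro qle) auto
        then show "(if N = 0 then 1 else q (2 * N + p - 1) - q (2 * N + p)) \<le> dist a b"
          using dlip[of a b] m b by (auto simp: R_def)
      qed
      also have "\<dots> = hausdorff1_outer (\<Union>m<Suc N. R (2 * m + p))" by (simp add: lessThan_Suc Un_commute)
      finally show ?case .
    qed (simp add: outer_empty)
    have parX: "(\<Sum>m. hausdorff1_outer (R (2 * m + p))) \<le> hausdorff1_outer X" for p
      by (intro suminf_le_const allI summableI order.trans[OF par] outer_mono) (auto simp: R_def)
    define a where "a p m = enn2real (hausdorff1_outer (R (2 * m + p)))" for p m
    have Rfin: "hausdorff1_outer (R m) < top" for m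
      by (rule le_less_trans[OF outer_mono fin]) (auto simp: R_def)
    have ae: "hausdorff1_outer (R (2 * m + p)) = ennreal (a p m)" for p m
      unfolding a_def using Rfin by simp
    have a0: "a p m \<ge> 0" for p m by (simp add: a_def)
    have asum: "summable (a p)" for p
    proof (rule summable_suminf_not_top)
      show "(\<Sum>i. ennreal (a p i)) \<noteq> top" unfolding ae[symmetric] using parX[of p] fin by auto
    qed (rule a0)
    show ?thesis
    proof (rule ennreal_le_epsilon)
      fix e :: real assume e: "0 < e"
      obtain N1 where N1: "\<And>n. n \<ge> N1 \<Longrightarrow> norm (\<Sum>i. a 0 (i + n)) < e / 2"
        using suminf_exist_split[OF _ asum, of "e/2"] e by (metis half_gt_zero)
      obtain N2 where N2: "\<And>n. n \<ge> N2 \<Longrightarrow> norm (\<Sum>i. a 1 (i + n)) < e / 2"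
        using suminf_exist_split[OF _ asum, of "e/2"] e by (metis half_gt_zero)
      define N where "N = max N1 N2"
      have tail: "hausdorff1_outer (\<Union>m. R (2 * (m + N) + p)) \<le> ennreal (e / 2)" if p: "p = 0 \<or> p = 1" for p
      proof -
        have "hausdorff1_outer (\<Union>m. R (2 * (m + N) + p)) \<le> (\<Sum>m. ennreal (a p (m + N)))"
          using outer_subadditive[of "\<lambda>m. R (2 * (m + N) + p)"] unfolding ae .
        also have "\<dots> = ennreal (\<Sum>m. a p (m + N))"
          using asum[of p] a0 by (intro suminf_ennreal2) (auto simp: summable_iff_shift)
        also have "\<dots> \<le> ennreal (e / 2)" using p N1[of N] N2[of N] unfolding N_def by (intro ennreal_leI) auto
        finally show ?thesis .
      qed
      have sub: "X - F \<subseteq> A (2 * N) \<union> ((\<Union>m. R (2 * (m + N) + 0)) \<union> (\<Union>m. R (2 * (m + N) + 1)))"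
      proof
        fix x assume x: "x \<in> X - F"
        then have dx: "d x > 0"
          unfolding d_def using assms F by (metis DiffD2 in_closed_iff_infdist_zero infdist_nonneg less_eq_real_def)
        show "x \<in> A (2 * N) \<union> ((\<Union>m. R (2 * (m + N) + 0)) \<union> (\<Union>m. R (2 * (m + N) + 1)))"
        proof (cases "d x \<ge> q (2 * N)")
          case True then show ?thesis using x by (auto simp: A_def)
        next
          case lt: False
          obtain n0 where "1 / d x < real n0" using reals_Archimedean2 by blast
          then have n0: "q n0 \<le> d x" unfolding q_def using dx
            by (simp add: field_simps)
          define n where "n = (LEAST n. q n \<le> d x)"
          have n: "q n \<le> d x" unfolding n_def using n0 by (rule LeastI)
          have nN: "n > 2 * N" using lt n qle[of n "2 * N"] by (force simp: not_le[symmetric])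
          then have "d x < q (n - 1)" using not_less_Least[of "n - 1" "\<lambda>n. q n \<le> d x"] unfolding n_def[symmetric] by auto
          then have xR: "x \<in> R (n - 1)" using n x nN by (auto simp: R_def)
          have "\<exists>m p. n - 1 = 2 * (m + N) + p \<and> (p = 0 \<or> p = 1)"
            using nN by (intro exI[of _ "(n - 1) div 2 - N"] exI[of _ "(n - 1) mod 2"]) auto
          then show ?thesis using xR by auto
        qed
      qed
      have "hausdorff1_outer (X - F) \<le> hausdorff1_outer (A (2 * N)) + (ennreal (e/2) + ennreal (e/2))"
        by (intro order.trans[OF outer_mono[OF sub]] order.trans[OF outer_Un] add_mono tail order.refl) auto
      also have "ennreal (e/2) + ennreal (e/2) = ennreal e" using e by (subst ennreal_plus[symmetric]) auto
      finally have "hausdorff1_outer (X \<inter> F) + hausdorff1_outer (X - F)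
         \<le> hausdorff1_outer (X \<inter> F) + (hausdorff1_outer (A (2 * N)) + ennreal e)" by (intro add_left_mono)
      also have "\<dots> = (hausdorff1_outer (X \<inter> F) + hausdorff1_outer (A (2 * N))) + ennreal e" by (simp add: add.assoc)
      also have "hausdorff1_outer (X \<inter> F) + hausdorff1_outer (A (2 * N)) \<le> hausdorff1_outer (X \<inter> F \<union> A (2 * N))"
      proof (rule outer_metric[OF q[of "2 * N"]])
        fix x y assume x: "x \<in> X \<inter> F" and y: "y \<in> A (2 * N)"
        have "d x = 0" using x by (simp add: d_def)
        then show "q (2 * N) \<le> dist x y" using dlip[of y x] y by (simp add: A_def dist_commute)
      qed
      also have "\<dots> \<le> hausdorff1_outer X" by (rule outer_mono) (auto simp: A_def)
      finally show "hausdorff1_outer (X \<inter> F) + hausdorff1_outer (X - F) \<le> hausdorff1_outer X + ennreal e"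
        by (simp add: add_right_mono)
    qed
  qed
qed

lemma sets_arc [simp, measurable_cong]: "sets arc_measure = sets borel"
  and space_arc [simp]: "space arc_measure = UNIV"
  using sets.sigma_sets_eq[of "borel :: (real^2) measure"] by (simp_all add: arc_measure_def)

text \<open>\<open>arc_measure\<close> has the values of the outer measure because the latter is
  countably additive on the Borel sets: the sets satisfying Caratheodory's condition form a
  sigma-algebra that contains every closed set.\<close>

lemma emeasure_arc:
  assumes "A \<in> sets borel" shows "emeasure arc_measure A = hausdorff1_outer A"
proof -
  let ?L = "lambda_system UNIV UNIV hausdorff1_outer :: (real^2) set set"
  have "outer_measure_space UNIV hausdorff1_outer"
    unfolding outer_measure_space_def
    by (auto simp: positive_def increasing_def countably_subadditive_def outer_empty
        intro: outer_mono outer_subadditive)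
  then have ms: "measure_space UNIV ?L hausdorff1_outer"
    using sigma_algebra.caratheodory_lemma[of "UNIV :: (real^2) set" "Pow UNIV" hausdorff1_outer]
    using sigma_algebra_Pow[of "UNIV :: (real^2) set"] by simp
  have "F \<in> ?L" if "closed F" for F
    using outer_closed_caratheodory[OF that] by (auto simp: lambda_system_def Int_commute Diff_eq)
  then have "sigma_sets UNIV (Collect closed) \<subseteq> ?L"
    using ms by (intro sigma_algebra.sigma_sets_subset) (auto simp: measure_space_def)
  then have sub: "sets borel \<subseteq> ?L" by (simp add: borel_eq_closed)
  show ?thesis unfolding arc_measure_def
  proof (rule emeasure_measure_of_sigma)
    show "sigma_algebra UNIV (sets borel :: (real^2) set set)" by (metis sets.sigma_algebra_axioms space_borel)
    show "positive (sets borel) hausdorff1_outer" by (simp add: positive_def outer_empty)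
    show "countably_additive (sets borel) hausdorff1_outer"
      using ms sub unfolding measure_space_def countably_additive_def by blast
  qed fact
qed

lemma arc_finite_null: assumes "finite S" shows "S \<in> null_sets arc_measure"
proof -
  have "S \<in> sets borel" using finite_imp_closed[OF assms] by auto
  then show ?thesis using emeasure_arc[of S] outer_finite_subset[OF assms] by (auto simp: null_sets_def)
qed

lemma AE_arc_finite: "finite S \<Longrightarrow> AE x in arc_measure. x \<notin> S"
  using arc_finite_null by (rule AE_not_in)

section \<open>Arc length and integrals along nearly straight curves\<close>

lemma diameter_segment_image:
  fixes \<gamma> :: "real \<Rightarrow> real^2"
  assumes "s \<le> t" "0 \<le> L" and lip: "\<And>x y. x \<in> {s..t} \<Longrightarrow> y \<in> {s..t} \<Longrightarrow> norm (\<gamma> x - \<gamma> y) \<le> L * \<bar>x - y\<bar>"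
  shows "bounded (\<gamma> ` {s..t})" "diameter (\<gamma> ` {s..t}) \<le> L * (t - s)"
proof -
  have *: "dist x y \<le> L * (t - s)" if xy: "x \<in> \<gamma> ` {s..t}" "y \<in> \<gamma> ` {s..t}" for x y
  proof -
    obtain x' y' where "x' \<in> {s..t}" "y' \<in> {s..t}" "x = \<gamma> x'" "y = \<gamma> y'" using xy by blast
    moreover have "\<bar>x' - y'\<bar> \<le> t - s" using \<open>x' \<in> {s..t}\<close> \<open>y' \<in> {s..t}\<close> by auto
    ultimately show ?thesis using lip[of x' y'] mult_left_mono[OF _ assms(2)] by (auto simp: dist_norm intro: order.trans)
  qed
  show "bounded (\<gamma> ` {s..t})" unfolding bounded_two_points using * by blast
  show "diameter (\<gamma> ` {s..t}) \<le> L * (t - s)"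
    using assms * by (intro diameter_le) (auto simp: dist_norm)
qed

text \<open>Cutting the parameter interval into n equal pieces covers the curve by sets of diameter
  at most L (t - s) / n; n is taken so large that this does not exceed \<delta>.\<close>

lemma outer_curve_le:
  fixes \<gamma> :: "real \<Rightarrow> real^2"
  assumes st: "s \<le> t" and L: "0 \<le> L"
    and lip: "\<And>x y. x \<in> {s..t} \<Longrightarrow> y \<in> {s..t} \<Longrightarrow> norm (\<gamma> x - \<gamma> y) \<le> L * \<bar>x - y\<bar>"
  shows "hausdorff1_outer (\<gamma> ` {s..t}) \<le> ennreal (L * (t - s))"
  unfolding hausdorff1_outer_def
proof (rule SUP_least)
  fix \<delta> :: real assume "\<delta> \<in> {0<..}"
  then have d: "\<delta> > 0" by simp
  obtain n0 where n0: "L * (t - s) / \<delta> < real n0" using reals_Archimedean2 by blast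
  define n where "n = Suc n0"
  define c where "c = (t - s) / real n"
  have n: "n > 0" and c0: "c \<ge> 0" using st by (auto simp: n_def c_def)
  have nc: "real n * c = t - s" using n by (simp add: c_def)
  have Lc: "L * c \<le> \<delta>"
  proof -
    have "L * (t - s) \<le> real n * \<delta>" using n0 d by (simp add: n_def field_simps)
    then show ?thesis using n by (simp add: c_def field_simps)
  qed
  define I where "I i = (if i < n then \<gamma> ` {s + real i * c..s + real (Suc i) * c} else {})" for i
  have seg: "{s + real i * c..s + real (Suc i) * c} \<subseteq> {s..t}" if "i < n" for i
  proof -
    have "real (Suc i) * c \<le> real n * c" using that c0 by (intro mult_right_mono) auto
    moreover have "real i * c \<ge> 0" using c0 by simp
    ultimately show ?thesis using nc by auto
  qed
  have I: "bounded (I i)" "diameter (I i) \<le> (if i < n then L * c else 0)" for i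
  proof -
    have *: "s + real i * c \<le> s + real (Suc i) * c" using c0 by (simp add: algebra_simps)
    have "bounded (I i) \<and> diameter (I i) \<le> (if i < n then L * c else 0)"
    proof (cases "i < n")
      case True
      have "bounded (\<gamma> ` {s + real i * c..s + real (Suc i) * c})"
        "diameter (\<gamma> ` {s + real i * c..s + real (Suc i) * c}) \<le> L * (s + real (Suc i) * c - (s + real i * c))"
        using * L lip seg[OF True] by (intro diameter_segment_image; blast)+
      then show ?thesis using True by (simp add: I_def algebra_simps)
    qed (simp add: I_def)
    then show "bounded (I i)" "diameter (I i) \<le> (if i < n then L * c else 0)" by auto
  qed
  have "\<gamma> ` {s..t} \<subseteq> (\<Union>i. I i)"
  proof safe
    fix x assume x: "x \<in> {s..t}"
    show "\<gamma> x \<in> (\<Union>i. I i)"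
    proof (cases "c = 0 \<or> x = t")
      case True
      then have "x \<in> {s + real (n - 1) * c..s + real (Suc (n - 1)) * c}"
        using x nc n c0 by (auto simp: algebra_simps of_nat_diff)
      then show ?thesis using n by (intro UN_I[of "n - 1"]) (auto simp: I_def)
    next
      case False
      then have c: "c > 0" and xt: "x < t" using c0 x by auto
      let ?i = "nat \<lfloor>(x - s) / c\<rfloor>"
      have f: "real ?i = of_int \<lfloor>(x - s) / c\<rfloor>" using x c by simp
      have "real ?i \<le> (x - s) / c" "(x - s) / c < real ?i + 1" unfolding f by linarith+
      then have i: "real ?i * c \<le> x - s" "x - s < (real ?i + 1) * c" using c by (simp_all add: field_simps)
      have "real ?i * c < real n * c" using i(1) xt nc by linarith
      then have "?i < n" using c by simp
      then show ?thesis using i by (intro UN_I[of ?i]) (auto simp: I_def algebra_simps)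
    qed
  qed
  then have "cover \<delta> (\<gamma> ` {s..t}) I" unfolding cover_def using I Lc d by (auto intro: order.trans split: if_splits)
    (smt (verit, ccfv_threshold) I(2))
  then have "hausdorff1_pre \<delta> (\<gamma> ` {s..t}) \<le> (\<Sum>i. ennreal (diameter (I i)))" by (rule pre_le)
  also have "\<dots> = (\<Sum>i<n. ennreal (diameter (I i)))" by (rule suminf_finite) (auto simp: I_def)
  also have "\<dots> \<le> (\<Sum>i<n. ennreal (L * c))"
    using I(2) by (intro sum_mono ennreal_leI) (metis lessThan_iff)
  also have "\<dots> = ennreal (real n * (L * c))"
    using L c0 by (simp add: ennreal_of_nat_eq_real_of_nat ennreal_mult[symmetric])
  also have "real n * (L * c) = L * (t - s)" unfolding nc[symmetric] by simp
  finally show "hausdorff1_pre \<delta> (\<gamma> ` {s..t}) \<le> ennreal (L * (t - s))" .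
qed

text \<open>The projection l onto the direction of the chord is 1-Lipschitz, and by the intermediate
  value theorem it maps the curve onto the whole interval between the projected end points. Every
  cover of the curve yields a cover of that interval by intervals no longer than the
  diameters.\<close>

lemma outer_curve_ge:
  fixes \<gamma> :: "real \<Rightarrow> real^2"
  assumes st: "s \<le> t" and cont: "continuous_on {s..t} \<gamma>"
  shows "ennreal (norm (\<gamma> t - \<gamma> s)) \<le> hausdorff1_outer (\<gamma> ` {s..t})"
proof (cases "\<gamma> t = \<gamma> s")
  case False
  define e where "e = (\<gamma> t - \<gamma> s) /\<^sub>R norm (\<gamma> t - \<gamma> s)"
  have e: "norm e = 1" using False by (simp add: e_def)
  define l where "l x = e \<bullet> x" for x
  have l1: "\<bar>l x - l y\<bar> \<le> dist x y" for x y
    using Cauchy_Schwarz_ineq2[of e "x - y"] e by (simp add: l_def inner_diff_right dist_norm)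
  have len: "l (\<gamma> t) - l (\<gamma> s) = norm (\<gamma> t - \<gamma> s)"
  proof -
    have "l (\<gamma> t) - l (\<gamma> s) = e \<bullet> (\<gamma> t - \<gamma> s)" by (simp add: l_def inner_diff_right)
    also have "\<dots> = norm (\<gamma> t - \<gamma> s)" using False by (simp add: e_def dot_square_norm power2_eq_square)
    finally show ?thesis .
  qed
  have ivt: "{l (\<gamma> s)..l (\<gamma> t)} \<subseteq> (\<lambda>x. l (\<gamma> x)) ` {s..t}"
  proof
    fix y assume "y \<in> {l (\<gamma> s)..l (\<gamma> t)}"
    then have "\<exists>x. s \<le> x \<and> x \<le> t \<and> l (\<gamma> x) = y"
      using st by (intro IVT') (auto simp: l_def intro!: continuous_intros cont)
    then show "y \<in> (\<lambda>x. l (\<gamma> x)) ` {s..t}" by auto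
  qed
  have "ennreal (norm (\<gamma> t - \<gamma> s)) \<le> hausdorff1_pre 1 (\<gamma> ` {s..t})"
  proof (rule pre_greatest)
    fix A assume A: "cover 1 (\<gamma> ` {s..t}) A"
    \<comment> \<open>The interval spanned by a projected cover set; \<open>Inf\<close> and
      \<open>Sup\<close> say nothing useful about an empty one.\<close>
    define J where "J n = (if A n = {} then {} else {Inf (l ` A n)..Sup (l ` A n)})" for n
    have bA: "bounded (l ` A n)" for n
    proof -
      have "bounded_linear l" unfolding l_def by (rule bounded_linear_inner_right)
      then show ?thesis using A by (intro bounded_linear_image) (auto simp: cover_def)
    qed
    have J: "emeasure lborel (J n) \<le> ennreal (diameter (A n))" for n
    proof (cases "A n = {}")
      case ne: False
      have "Sup (l ` A n) \<le> Inf (l ` A n) + diameter (A n)"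
      proof (rule cSUP_least[OF ne])
        fix x assume x: "x \<in> A n"
        have "l x - diameter (A n) \<le> Inf (l ` A n)"
        proof (rule cINF_greatest[OF ne])
          fix y assume y: "y \<in> A n"
          have "dist x y \<le> diameter (A n)" using A x y by (intro diameter_bounded_bound) (auto simp: cover_def)
          then show "l x - diameter (A n) \<le> l y" using l1[of x y] by auto
        qed
        then show "l x \<le> Inf (l ` A n) + diameter (A n)" by simp
      qed
      moreover have "Inf (l ` A n) \<le> Sup (l ` A n)"
        using ne bA[of n] by (intro cInf_le_cSup) (auto simp: bounded_imp_bdd_above bounded_imp_bdd_below)
      ultimately show ?thesis using ne by (auto simp: J_def intro!: ennreal_leI)
    qed (simp add: J_def)
    have "ennreal (norm (\<gamma> t - \<gamma> s)) = emeasure lborel {l (\<gamma> s)..l (\<gamma> t)}"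
      using len by (subst emeasure_lborel_Icc) (auto, metis diff_ge_0_iff_ge norm_ge_zero)
    also have "\<dots> \<le> emeasure lborel (\<Union>n. J n)"
    proof (rule emeasure_mono)
      show "{l (\<gamma> s)..l (\<gamma> t)} \<subseteq> (\<Union>n. J n)"
      proof
        fix y assume "y \<in> {l (\<gamma> s)..l (\<gamma> t)}"
        then obtain x where x: "x \<in> {s..t}" "y = l (\<gamma> x)" using ivt by auto
        then obtain n where "\<gamma> x \<in> A n" using A unfolding cover_def by blast
        then have "y \<in> J n" using bA[of n] x
          by (auto simp: J_def intro!: cSUP_upper cINF_lower bounded_imp_bdd_above bounded_imp_bdd_below)
        then show "y \<in> (\<Union>n. J n)" by auto
      qed
    qed (auto simp: J_def)
    also have "\<dots> \<le> (\<Sum>n. emeasure lborel (J n))" by (rule emeasure_subadditive_countably) (auto simp: J_def)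
    also have "\<dots> \<le> (\<Sum>n. ennreal (diameter (A n)))" by (intro suminf_le J) auto
    finally show "ennreal (norm (\<gamma> t - \<gamma> s)) \<le> (\<Sum>n. ennreal (diameter (A n)))" .
  qed
  also have "\<dots> \<le> hausdorff1_outer (\<gamma> ` {s..t})" by (rule pre_le_outer) simp
  finally show ?thesis .
qed simp

text \<open>Subdividing into short intervals and adding up turns a bound per unit length that holds
  locally, up to e, into a global one. It serves to compare two kinds of integral as functions of
  the parameter interval.\<close>

lemma additive_interval_bound:
  fixes \<Phi> :: "real \<Rightarrow> real \<Rightarrow> real"
  assumes ab: "a \<le> b"
    and add: "\<And>s t. a \<le> s \<Longrightarrow> s \<le> t \<Longrightarrow> t \<le> b \<Longrightarrow> \<Phi> a t = \<Phi> a s + \<Phi> s t"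
    and zero: "\<Phi> a a = 0"
    and loc: "\<And>e. e > 0 \<Longrightarrow> \<exists>\<delta>>0. \<forall>s t. a \<le> s \<longrightarrow> s \<le> t \<longrightarrow> t \<le> b \<longrightarrow> t - s < \<delta> \<longrightarrow> \<bar>\<Phi> s t\<bar> \<le> (c + e) * (t - s)"
  shows "\<bar>\<Phi> a b\<bar> \<le> c * (b - a)"
proof (rule field_le_epsilon)
  fix e' :: real assume e': "e' > 0"
  define e where "e = e' / (b - a + 1)"
  have e: "e > 0" "e * (b - a) \<le> e'" using e' ab by (auto simp: e_def field_simps)
  obtain \<delta> where \<delta>: "\<delta> > 0" "\<And>s t. a \<le> s \<Longrightarrow> s \<le> t \<Longrightarrow> t \<le> b \<Longrightarrow> t - s < \<delta> \<Longrightarrow> \<bar>\<Phi> s t\<bar> \<le> (c + e) * (t - s)"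
    using loc[OF e(1)] by auto
  obtain n0 where n0: "(b - a) / \<delta> < real n0" using reals_Archimedean2 by blast
  define n where "n = Suc n0"
  define h where "h = (b - a) / real n"
  have h: "0 \<le> h" "h < \<delta>" "real n * h = b - a"
    using n0 \<delta>(1) ab by (auto simp: h_def n_def field_simps)
  have "i \<le> n \<Longrightarrow> \<bar>\<Phi> a (a + real i * h)\<bar> \<le> (c + e) * (real i * h)" for i
  proof (induction i)
    case 0 then show ?case by (simp add: zero)
  next
    case (Suc i)
    have le: "real (Suc i) * h \<le> real n * h" using Suc.prems h by (intro mult_right_mono) auto
    have i0: "real i * h \<ge> 0" using h by simp
    have S: "a + real (Suc i) * h = (a + real i * h) + h" by (simp add: algebra_simps)
    have le2: "a + real i * h + h \<le> b" using le h(3) S by linarith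
    have "\<Phi> a (a + real (Suc i) * h) = \<Phi> a (a + real i * h) + \<Phi> (a + real i * h) (a + real i * h + h)"
      unfolding S by (rule add) (use i0 h le2 in linarith)+
    moreover have "\<bar>\<Phi> (a + real i * h) (a + real i * h + h)\<bar> \<le> (c + e) * (a + real i * h + h - (a + real i * h))"
      by (rule \<delta>(2)) (use i0 h le2 in linarith)+
    moreover have "\<bar>\<Phi> a (a + real i * h)\<bar> \<le> (c + e) * (real i * h)" using Suc by simp
    ultimately show ?case by (simp add: algebra_simps)
  qed
  from this[of n] have "\<bar>\<Phi> a b\<bar> \<le> (c + e) * (b - a)" using h(3) by simp
  then show "\<bar>\<Phi> a b\<bar> \<le> c * (b - a) + e'" using e(2) by (simp add: algebra_simps)
qed

lemma set_integrable_bounded: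
  fixes f :: "'a :: topological_space \<Rightarrow> real"
  assumes "S \<in> sets M" "sets M = sets borel" "emeasure M S < \<infinity>" "continuous_on S f" "\<And>x. x \<in> S \<Longrightarrow> \<bar>f x\<bar> \<le> B"
  shows "set_integrable M S f"
  unfolding set_integrable_def
proof (rule Bochner_Integration.integrable_bound)
  show "integrable M (\<lambda>x. B * indicator S x)" using assms by (intro integrable_mult_right integrable_real_indicator) auto
  show "(\<lambda>x. indicator S x *\<^sub>R f x) \<in> borel_measurable M"
    using borel_measurable_continuous_on_indicator[of S f] assms by (simp add: measurable_cong_sets[OF assms(2) refl])
  show "AE x in M. norm (indicator S x *\<^sub>R f x) \<le> norm (B * indicator S x)"
    using assms(5) by (intro AE_I2) (force simp: indicator_def)
qed

text \<open>On every parameter interval the arc measure lies between (norm w - \<epsilon>) and (norm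
  w + \<epsilon>) times the length, by the two curve estimates. This alone, with uniform continuity
  of f along the curve, gives the integral estimate; no area formula enters.\<close>

lemma arc_integral_approx:
  fixes \<gamma> :: "real \<Rightarrow> real^2" and f :: "real^2 \<Rightarrow> real"
  assumes ab: "a \<le> b" and \<epsilon>: "0 \<le> \<epsilon>" "\<epsilon> < norm w"
    and near: "\<And>s t. s \<in> {a..b} \<Longrightarrow> t \<in> {a..b} \<Longrightarrow> norm (\<gamma> t - \<gamma> s - (t - s) *\<^sub>R w) \<le> \<epsilon> * \<bar>t - s\<bar>"
    and f: "continuous_on (\<gamma> ` {a..b}) f" and M: "\<And>t. t \<in> {a..b} \<Longrightarrow> \<bar>f (\<gamma> t)\<bar> \<le> M"
  shows "set_integrable arc_measure (\<gamma> ` {a..b}) f"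
    and "\<bar>(LINT x:\<gamma> ` {a..b}|arc_measure. f x) - norm w * integral {a..b} (\<lambda>t. f (\<gamma> t))\<bar> \<le> \<epsilon> * M * (b - a)"
proof -
  let ?L = "norm w + \<epsilon>"
  have L0: "?L \<ge> 0" using \<epsilon> by simp
  have up: "norm (\<gamma> t - \<gamma> s) \<le> ?L * \<bar>t - s\<bar>" if "s \<in> {a..b}" "t \<in> {a..b}" for s t
    using near[OF that] norm_triangle_ineq[of "\<gamma> t - \<gamma> s - (t - s) *\<^sub>R w" "(t - s) *\<^sub>R w"]
    unfolding diff_add_cancel norm_scaleR distrib_right real_norm_def by (simp only: mult.commute)
  have low: "norm (\<gamma> t - \<gamma> s) \<ge> (norm w - \<epsilon>) * \<bar>t - s\<bar>" if "s \<in> {a..b}" "t \<in> {a..b}" for s t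
  proof -
    have "\<bar>t - s\<bar> * norm w \<le> norm (\<gamma> t - \<gamma> s) + norm (\<gamma> t - \<gamma> s - (t - s) *\<^sub>R w)"
      using norm_triangle_ineq4[of "\<gamma> t - \<gamma> s" "\<gamma> t - \<gamma> s - (t - s) *\<^sub>R w"] by simp
    then show ?thesis using near[OF that] by (simp add: left_diff_distrib right_diff_distrib mult.commute)
  qed
  have lip: "(?L)-lipschitz_on {a..b} \<gamma>" 
  proof (rule lipschitz_onI)
    fix x y assume "x \<in> {a..b}" "y \<in> {a..b}"
    then show "dist (\<gamma> x) (\<gamma> y) \<le> ?L * dist x y" using up[of y x] by (simp add: dist_norm)
  qed (rule L0)
  have cont: "continuous_on {a..b} \<gamma>" by (rule lipschitz_on_continuous_on[OF lip])
  \<comment> \<open>\<epsilon> < norm w makes the curve injective, so that consecutive pieces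
    overlap in a single point, a null set.\<close>
  have inj: "s = t" if "s \<in> {a..b}" "t \<in> {a..b}" "\<gamma> s = \<gamma> t" for s t
  proof -
    have "(norm w - \<epsilon>) * \<bar>t - s\<bar> \<le> 0" using low[OF that(1,2)] that(3) by simp
    then show ?thesis using \<epsilon> by (simp add: mult_le_0_iff)
  qed
  have comp: "compact (\<gamma> ` {s..t})" if "a \<le> s" "t \<le> b" for s t
    using that by (intro compact_continuous_image continuous_on_subset[OF cont]) auto
  have bor: "\<gamma> ` {s..t} \<in> sets borel" if "a \<le> s" "t \<le> b" for s t
    using comp[OF that] by (simp add: borel_closed compact_imp_closed)
  have H: "emeasure arc_measure (\<gamma> ` {s..t}) \<le> ennreal (?L * (t - s))"
    "emeasure arc_measure (\<gamma> ` {s..t}) \<ge> ennreal ((norm w - \<epsilon>) * (t - s))"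
    if st: "a \<le> s" "s \<le> t" "t \<le> b" for s t
  proof -
    show "emeasure arc_measure (\<gamma> ` {s..t}) \<le> ennreal (?L * (t - s))"
      unfolding emeasure_arc[OF bor[OF st(1,3)]]
    proof (rule outer_curve_le[OF st(2) L0])
      fix x y assume "x \<in> {s..t}" "y \<in> {s..t}"
      then show "norm (\<gamma> x - \<gamma> y) \<le> ?L * \<bar>x - y\<bar>" using up[of y x] st by simp
    qed
    have "ennreal ((norm w - \<epsilon>) * (t - s)) \<le> ennreal (norm (\<gamma> t - \<gamma> s))"
      using low[of s t] st by (intro ennreal_leI) auto
    also have "\<dots> \<le> hausdorff1_outer (\<gamma> ` {s..t})"
      using st by (intro outer_curve_ge continuous_on_subset[OF cont]) auto
    finally show "emeasure arc_measure (\<gamma> ` {s..t}) \<ge> ennreal ((norm w - \<epsilon>) * (t - s))"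
      unfolding emeasure_arc[OF bor[OF st(1,3)]] .
  qed
  have fin: "emeasure arc_measure (\<gamma> ` {s..t}) < \<infinity>" if "a \<le> s" "s \<le> t" "t \<le> b" for s t
    using H(1)[OF that] by (auto simp: less_top[symmetric] top_unique)
  have m: "measure arc_measure (\<gamma> ` {s..t}) \<le> ?L * (t - s)"
      "\<bar>measure arc_measure (\<gamma> ` {s..t}) - norm w * (t - s)\<bar> \<le> \<epsilon> * (t - s)"
    if st: "a \<le> s" "s \<le> t" "t \<le> b" for s t
  proof -
    have e: "emeasure arc_measure (\<gamma> ` {s..t}) = ennreal (measure arc_measure (\<gamma> ` {s..t}))"
      using fin[OF st] by (intro emeasure_eq_ennreal_measure) auto
    show 1: "measure arc_measure (\<gamma> ` {s..t}) \<le> ?L * (t - s)"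
      using H(1)[OF st] L0 st unfolding e by (subst (asm) ennreal_le_iff) auto
    have "(norm w - \<epsilon>) * (t - s) \<le> measure arc_measure (\<gamma> ` {s..t})"
      using H(2)[OF st] unfolding e by (subst (asm) ennreal_le_iff) auto
    then show "\<bar>measure arc_measure (\<gamma> ` {s..t}) - norm w * (t - s)\<bar> \<le> \<epsilon> * (t - s)"
      using 1 by (auto simp: algebra_simps abs_le_iff)
  qed
  have int: "set_integrable arc_measure (\<gamma> ` {s..t}) f" if st: "a \<le> s" "s \<le> t" "t \<le> b" for s t
    using st bor[OF st(1,3)] fin[OF st] M
    by (intro set_integrable_bounded[where B=M] continuous_on_subset[OF f]) auto
  then show "set_integrable arc_measure (\<gamma> ` {a..b}) f" using ab by simp
  have contf: "continuous_on {a..b} (\<lambda>t. f (\<gamma> t))" using continuous_on_compose[OF cont f] by (simp add: o_def)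
  have intf: "(\<lambda>t. f (\<gamma> t)) integrable_on {s..t}" if "a \<le> s" "t \<le> b" for s t
    using that by (intro integrable_continuous_interval continuous_on_subset[OF contf]) auto
  \<comment> \<open>The error on a subinterval. It is additive in the interval, hence it suffices to
    bound it on short ones, where f is nearly constant along the curve.\<close>
  define \<Phi> where "\<Phi> s t = (LINT x:\<gamma> ` {s..t}|arc_measure. f x) - norm w * integral {s..t} (\<lambda>t. f (\<gamma> t))" for s t
  have "\<bar>\<Phi> a b\<bar> \<le> (\<epsilon> * M) * (b - a)"
  proof (rule additive_interval_bound[OF ab])
    fix s t assume st: "a \<le> s" "s \<le> t" "t \<le> b"
    have un: "\<gamma> ` {a..t} = \<gamma> ` {a..s} \<union> \<gamma> ` {s..t}" using st by (subst image_Un[symmetric]) (simp add: ivl_disj_un)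
    have "AE x in arc_measure. \<not> (x \<in> \<gamma> ` {a..s} \<and> x \<in> \<gamma> ` {s..t})"
    proof (rule AE_mp[OF AE_arc_finite[of "{\<gamma> s}"]])
      have "x = \<gamma> s" if "x \<in> \<gamma> ` {a..s}" "x \<in> \<gamma> ` {s..t}" for x
      proof -
        obtain u v where "u \<in> {a..s}" "v \<in> {s..t}" "x = \<gamma> u" "x = \<gamma> v" using \<open>x \<in> \<gamma> ` {a..s}\<close> \<open>x \<in> \<gamma> ` {s..t}\<close> by auto
        then show ?thesis using inj[of u v] st by auto
      qed
      then show "AE x in arc_measure. x \<notin> {\<gamma> s} \<longrightarrow> \<not> (x \<in> \<gamma> ` {a..s} \<and> x \<in> \<gamma> ` {s..t})"
        by (intro AE_I2) auto
    qed simp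
    then have "(LINT x:\<gamma> ` {a..t}|arc_measure. f x) = (LINT x:\<gamma> ` {a..s}|arc_measure. f x) + (LINT x:\<gamma> ` {s..t}|arc_measure. f x)"
      unfolding un using st bor int by (intro set_integral_Un_AE) auto
    moreover have "integral {a..t} (\<lambda>t. f (\<gamma> t)) = integral {a..s} (\<lambda>t. f (\<gamma> t)) + integral {s..t} (\<lambda>t. f (\<gamma> t))"
      using st intf[of a t] by (intro Henstock_Kurzweil_Integration.integral_combine[symmetric]) auto
    ultimately show "\<Phi> a t = \<Phi> a s + \<Phi> s t" by (simp add: \<Phi>_def algebra_simps)
  next
    have "(LINT x:{\<gamma> a}|arc_measure. f x) = 0"
    proof -
      have "AE x in arc_measure. indicator {\<gamma> a} x *\<^sub>R f x = 0"
        using AE_arc_finite[of "{\<gamma> a}", simplified] by eventually_elim auto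
      then show ?thesis unfolding set_lebesgue_integral_def by (rule integral_eq_zero_AE)
    qed
    then show "\<Phi> a a = 0" by (simp add: \<Phi>_def)
  next
    fix e :: real assume e: "e > 0"
    \<comment> \<open>An oscillation \<eta> of f costs \<eta> * ?L per unit of parameter in the arc
      integral and norm w * \<eta> in the parameter integral; this choice keeps the total below
      e.\<close>
    define \<eta> where "\<eta> = e / (2 * ?L + 1)"
    have \<eta>: "\<eta> > 0" "\<eta> * ?L + norm w * \<eta> \<le> e"
    proof -
      show "\<eta> > 0" using e L0 by (simp add: \<eta>_def)
      have "\<eta> * ?L + norm w * \<eta> \<le> \<eta> * (2 * ?L + 1)" using \<open>\<eta> > 0\<close> \<epsilon> by (simp add: algebra_simps)
      also have "\<dots> = e" using L0 by (simp add: \<eta>_def)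
      finally show "\<eta> * ?L + norm w * \<eta> \<le> e" .
    qed
    have "uniformly_continuous_on {a..b} (\<lambda>t. f (\<gamma> t))"
      by (rule compact_uniformly_continuous[OF contf]) simp
    then obtain \<delta> where \<delta>: "\<delta> > 0"
        "\<And>x y. x \<in> {a..b} \<Longrightarrow> y \<in> {a..b} \<Longrightarrow> dist y x < \<delta> \<Longrightarrow> dist (f (\<gamma> y)) (f (\<gamma> x)) < \<eta>"
      using \<eta>(1) unfolding uniformly_continuous_on_def by metis
    have "\<bar>\<Phi> s t\<bar> \<le> (\<epsilon> * M + e) * (t - s)" if st: "a \<le> s" "s \<le> t" "t \<le> b" "t - s < \<delta>" for s t
    proof -
      have osc: "\<bar>f (\<gamma> u) - f (\<gamma> s)\<bar> \<le> \<eta>" if "u \<in> {s..t}" for u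
        using \<delta>(2)[of s u] st that by (auto simp: dist_real_def)
      let ?m = "measure arc_measure (\<gamma> ` {s..t})"
      have c: "(LINT x:\<gamma> ` {s..t}|arc_measure. f (\<gamma> s)) = ?m * f (\<gamma> s)"
        and ic: "set_integrable arc_measure (\<gamma> ` {s..t}) (\<lambda>x. f (\<gamma> s))"
        and ie: "set_integrable arc_measure (\<gamma> ` {s..t}) (\<lambda>x. \<eta>)"
        and ce: "(LINT x:\<gamma> ` {s..t}|arc_measure. \<eta>) = ?m * \<eta>"
        using bor[of s t] fin[of s t] st
        by (auto simp: set_integrable_def set_lebesgue_integral_def)
      have d: "(LINT x:\<gamma> ` {s..t}|arc_measure. f x) - ?m * f (\<gamma> s) = (LINT x:\<gamma> ` {s..t}|arc_measure. f x - f (\<gamma> s))"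
        unfolding c[symmetric] by (rule set_integral_diff(2)[symmetric]) (use int[of s t] st ic in auto)
      have "\<bar>LINT x:\<gamma> ` {s..t}|arc_measure. f x - f (\<gamma> s)\<bar> \<le> ?m * \<eta>"
      proof -
        have i: "set_integrable arc_measure (\<gamma> ` {s..t}) (\<lambda>x. f x - f (\<gamma> s))"
          using int[of s t] st ic by (intro set_integral_diff) auto
        have "(LINT x:\<gamma> ` {s..t}|arc_measure. f x - f (\<gamma> s)) \<le> ?m * \<eta>"
          unfolding ce[symmetric] using osc by (intro set_integral_mono i ie) (auto simp: abs_le_iff)
        moreover have "(LINT x:\<gamma> ` {s..t}|arc_measure. - \<eta>) \<le> (LINT x:\<gamma> ` {s..t}|arc_measure. f x - f (\<gamma> s))"
        proof (intro set_integral_mono i)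
          show "set_integrable arc_measure (\<gamma> ` {s..t}) (\<lambda>x. - \<eta>)"
            using ie unfolding set_integrable_def by (auto dest: integrable_minus)
          show "\<And>x. x \<in> \<gamma> ` {s..t} \<Longrightarrow> - \<eta> \<le> f x - f (\<gamma> s)" using osc by (fastforce simp: abs_le_iff)
        qed
        moreover have "(LINT x:\<gamma> ` {s..t}|arc_measure. - \<eta>) = - (?m * \<eta>)"
          using ce by (simp add: set_lebesgue_integral_def)
        ultimately show ?thesis by auto
      qed
      then have 1: "\<bar>(LINT x:\<gamma> ` {s..t}|arc_measure. f x) - ?m * f (\<gamma> s)\<bar> \<le> ?m * \<eta>" unfolding d .
      have 2: "?m * \<eta> \<le> (?L * (t - s)) * \<eta>" using m(1)[of s t] st \<eta>(1) by (intro mult_right_mono) auto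
      have 3: "\<bar>?m * f (\<gamma> s) - norm w * (t - s) * f (\<gamma> s)\<bar> \<le> (\<epsilon> * (t - s)) * M"
        unfolding left_diff_distrib[symmetric] abs_mult
        using m(2)[of s t] st M[of s] \<epsilon> by (intro mult_mono) auto
      have "\<bar>integral {s..t} (\<lambda>u. f (\<gamma> u)) - (t - s) * f (\<gamma> s)\<bar> \<le> \<eta> * (t - s)"
      proof -
        have ic2: "(\<lambda>u. f (\<gamma> s)) integrable_on {s..t}" by (rule integrable_const_ivl)
        have "(t - s) * f (\<gamma> s) = integral {s..t} (\<lambda>u. f (\<gamma> s))" using st by simp
        then have "integral {s..t} (\<lambda>u. f (\<gamma> u)) - (t - s) * f (\<gamma> s) = integral {s..t} (\<lambda>u. f (\<gamma> u) - f (\<gamma> s))"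
          using integral_diff[OF intf[OF st(1,3)] ic2] by simp
        moreover have "norm (integral {s..t} (\<lambda>u. f (\<gamma> u) - f (\<gamma> s))) \<le> \<eta> * (t - s)"
          using st osc by (intro integral_bound continuous_intros continuous_on_subset[OF contf]) auto
        ultimately show ?thesis by simp
      qed
      then have a: "norm w * \<bar>integral {s..t} (\<lambda>u. f (\<gamma> u)) - (t - s) * f (\<gamma> s)\<bar> \<le> norm w * (\<eta> * (t - s))"
        by (intro mult_left_mono) auto
      have 4: "\<bar>norm w * (t - s) * f (\<gamma> s) - norm w * integral {s..t} (\<lambda>u. f (\<gamma> u))\<bar> \<le> norm w * (\<eta> * (t - s))"
      proof -
        have "norm w * (t - s) * f (\<gamma> s) - norm w * integral {s..t} (\<lambda>u. f (\<gamma> u))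
          = norm w * - (integral {s..t} (\<lambda>u. f (\<gamma> u)) - (t - s) * f (\<gamma> s))" by (simp add: algebra_simps)
        then have "\<bar>norm w * (t - s) * f (\<gamma> s) - norm w * integral {s..t} (\<lambda>u. f (\<gamma> u))\<bar>
          = norm w * \<bar>integral {s..t} (\<lambda>u. f (\<gamma> u)) - (t - s) * f (\<gamma> s)\<bar>"
          by (simp only: abs_mult abs_minus_cancel abs_norm_cancel)
        then show ?thesis using a by simp
      qed
      have "\<bar>\<Phi> s t\<bar> \<le> (?L * (t - s)) * \<eta> + (\<epsilon> * (t - s)) * M + norm w * (\<eta> * (t - s))"
        unfolding \<Phi>_def using 1 2 3 4 by linarith
      also have "\<dots> = (\<epsilon> * M + (\<eta> * ?L + norm w * \<eta>)) * (t - s)" by (simp add: algebra_simps)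
      also have "\<dots> \<le> (\<epsilon> * M + e) * (t - s)" using \<eta>(2) st by (intro mult_right_mono) auto
      finally show ?thesis .
    qed
    then show "\<exists>\<delta>>0. \<forall>s t. a \<le> s \<longrightarrow> s \<le> t \<longrightarrow> t \<le> b \<longrightarrow> t - s < \<delta> \<longrightarrow> \<bar>\<Phi> s t\<bar> \<le> (\<epsilon> * M + e) * (t - s)"
      using \<delta>(1) by blast
  qed
  then show "\<bar>(LINT x:\<gamma> ` {a..b}|arc_measure. f x) - norm w * integral {a..b} (\<lambda>t. f (\<gamma> t))\<bar> \<le> \<epsilon> * M * (b - a)"
    by (simp add: \<Phi>_def)
qed

section \<open>Smooth bump functions and local Lipschitz continuity of W^{1,\<infinity>}
  functions\<close>

definition smooth1 :: "(real \<Rightarrow> real) \<Rightarrow> bool" where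
  "smooth1 f \<longleftrightarrow> (\<exists>D. D 0 = f \<and> (\<forall>n x. (D n has_real_derivative D (Suc n) x) (at x)))"

text \<open>p(1/x) exp(-1/x), continued by 0 to x \<le> 0. The family is closed under
  differentiation, p turning into X^2 (p - p'), so all its members are smooth.\<close>

definition flat_exp :: "real poly \<Rightarrow> real \<Rightarrow> real" where
  "flat_exp p x = (if x > 0 then poly p (1 / x) * exp (- (1 / x)) else 0)"

lemma poly_times_exp_tendsto_0: "((\<lambda>x. poly p x * exp (- x)) \<longlongrightarrow> 0) (at_top :: real filter)"
proof -
  have "((\<lambda>x. coeff p i * (x ^ i / exp x)) \<longlongrightarrow> coeff p i * 0) (at_top :: real filter)" for i
    by (intro tendsto_mult tendsto_const tendsto_power_div_exp_0)
  then have "((\<lambda>x. \<Sum>i\<le>degree p. coeff p i * (x ^ i / exp x)) \<longlongrightarrow> (\<Sum>i\<le>degree p. coeff p i * 0)) (at_top :: real filter)"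
    by (rule tendsto_sum)
  then show ?thesis by (simp add: poly_altdef sum_distrib_right exp_minus divide_inverse mult.assoc)
qed

lemma flat_exp_deriv:
  "(flat_exp p has_real_derivative flat_exp (pCons 0 (pCons 0 (p - pderiv p))) x) (at x)"
proof -
  consider "x > 0" | "x < 0" | "x = 0" by linarith
  then show ?thesis
  proof cases
    case 1
    have "((\<lambda>x. poly p (1 / x) * exp (- (1 / x))) has_real_derivative
        flat_exp (pCons 0 (pCons 0 (p - pderiv p))) x) (at x)"
      using 1 by (auto intro!: derivative_eq_intros simp: flat_exp_def power2_eq_square divide_simps)
         (simp add: algebra_simps)?
    then show ?thesis
      by (rule DERIV_cong_ev[THEN iffD1, rotated 3])
        (use 1 eventually_nhds_in_open[of "{0<..}" x] in \<open>auto simp: flat_exp_def elim!: eventually_mono\<close>)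
  next
    case 2
    have "((\<lambda>x. 0) has_real_derivative 0) (at x)" by simp
    then have "(flat_exp p has_real_derivative 0) (at x)"
      by (rule DERIV_cong_ev[THEN iffD1, rotated 3])
        (use 2 eventually_nhds_in_open[of "{..<0}" x] in \<open>auto simp: flat_exp_def elim!: eventually_mono\<close>)
    then show ?thesis using 2 by (simp add: flat_exp_def)
  next
    case 3
    have lim: "((\<lambda>h. flat_exp p h / h) \<longlongrightarrow> 0) (at_right 0)"
    proof -
      have "((\<lambda>h. poly (pCons 0 p) (inverse h) * exp (- inverse h)) \<longlongrightarrow> 0) (at_right 0)"
        by (rule filterlim_compose[OF poly_times_exp_tendsto_0 filterlim_inverse_at_top_right])
      then show ?thesis
        by (rule Lim_transform_eventually)
          (auto simp: flat_exp_def eventually_at_filter field_simps)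
    qed
    have "((\<lambda>h. flat_exp p h / h) \<longlongrightarrow> 0) (at_left 0)"
      by (rule Lim_transform_eventually[OF tendsto_const])
         (auto simp: flat_exp_def eventually_at_filter)
    then have "((\<lambda>h. flat_exp p h / h) \<longlongrightarrow> 0) (at 0)" using lim by (rule filterlim_split_at)
    then show ?thesis unfolding 3 DERIV_def by (simp add: flat_exp_def)
  qed
qed

text \<open>The smallest collection that contains the products supported in [-1, 1] and is closed
  under sums; by the product rule it is then closed under differentiation.\<close>

inductive_set bumps :: "(real \<Rightarrow> real) set" where
  prod: "(\<lambda>x. flat_exp p (1 + x) * flat_exp q (1 - x)) \<in> bumps"
| add: "f \<in> bumps \<Longrightarrow> g \<in> bumps \<Longrightarrow> (\<lambda>x. f x + g x) \<in> bumps"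

lemma bumps_deriv: "f \<in> bumps \<Longrightarrow> \<exists>f'\<in>bumps. \<forall>x. (f has_real_derivative f' x) (at x)"
proof (induction rule: bumps.induct)
  case (prod p q)
  let ?D = "\<lambda>p :: real poly. pCons 0 (pCons 0 (p - pderiv p))"
  have 1: "((\<lambda>x. flat_exp p (1 + x)) has_real_derivative flat_exp (?D p) (1 + x)) (at x)" for x
  proof -
    have "((\<lambda>x. flat_exp p (1 + x)) has_real_derivative flat_exp (?D p) (1 + x) * 1) (at x)"
      by (rule DERIV_chain2[OF flat_exp_deriv]) (auto intro!: derivative_eq_intros)
    then show ?thesis by simp
  qed
  have 2: "((\<lambda>x. flat_exp q (1 - x)) has_real_derivative flat_exp (?D (-q)) (1 - x)) (at x)" for x
  proof -
    have "flat_exp (?D (-q)) (1 - x) = flat_exp (?D q) (1 - x) * (-1)"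
      by (simp add: flat_exp_def pderiv_minus algebra_simps)
    moreover have "((\<lambda>x. flat_exp q (1 - x)) has_real_derivative flat_exp (?D q) (1 - x) * (-1)) (at x)"
      by (rule DERIV_chain2[OF flat_exp_deriv]) (auto intro!: derivative_eq_intros)
    ultimately show ?thesis by simp
  qed
  have "((\<lambda>x. flat_exp p (1 + x) * flat_exp q (1 - x)) has_real_derivative
     flat_exp (?D p) (1 + x) * flat_exp q (1 - x) + flat_exp p (1 + x) * flat_exp (?D (-q)) (1 - x)) (at x)" for x
    using DERIV_mult[OF 1 2, of x] by (simp only: add.commute mult.commute)
  then show ?case by (intro bexI[OF _ bumps.add[OF bumps.prod bumps.prod]]) auto
next
  case (add f g)
  then obtain f' g' where "f' \<in> bumps" "g' \<in> bumps" "\<And>x. (f has_real_derivative f' x) (at x)"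
     "\<And>x. (g has_real_derivative g' x) (at x)" by auto
  then show ?case by (intro bexI[OF _ bumps.add[of f' g']]) (auto intro!: derivative_intros)
qed

lemma smooth1_bumps: assumes "f \<in> bumps" shows "smooth1 f"
proof -
  have "\<exists>D. D 0 = f \<and> (\<forall>n. D n \<in> bumps \<and> (\<forall>x. (D n has_real_derivative D (Suc n) x) (at x)))"
  proof -
    obtain d where d: "\<And>f. f \<in> bumps \<Longrightarrow> d f \<in> bumps \<and> (\<forall>x. (f has_real_derivative d f x) (at x))"
      using bumps_deriv by metis
    have "(d ^^ n) f \<in> bumps" for n using assms d by (induction n) auto
    then show ?thesis using d by (intro exI[of _ "\<lambda>n. (d ^^ n) f"]) auto
  qed
  then show ?thesis unfolding smooth1_def by blast
qed

lemma smooth1_affine: assumes "smooth1 f" shows "smooth1 (\<lambda>x. f (c * x + d))"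
proof -
  obtain D where D: "D 0 = f" "\<And>n x. (D n has_real_derivative D (Suc n) x) (at x)"
    using assms unfolding smooth1_def by blast
  have "((\<lambda>x. c ^ n * D n (c * x + d)) has_real_derivative c ^ Suc n * D (Suc n) (c * x + d)) (at x)" for n x
  proof -
    have "((\<lambda>x. D n (c * x + d)) has_real_derivative D (Suc n) (c * x + d) * c) (at x)"
      by (rule DERIV_chain2[OF D(2)]) (auto intro!: derivative_eq_intros)
    from DERIV_cmult[OF this, of "c ^ n"] show ?thesis by (simp add: algebra_simps)
  qed
  then show ?thesis unfolding smooth1_def using D(1)
    by (intro exI[of _ "\<lambda>n x. c ^ n * D n (c * x + d)"]) auto
qed

lemma smooth1_continuous: "smooth1 f \<Longrightarrow> continuous_on S f"
  unfolding smooth1_def by (metis DERIV_isCont continuous_at_imp_continuous_on)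

lemma smooth1_diff: assumes "smooth1 f" "smooth1 g" shows "smooth1 (\<lambda>x. f x - g x)"
proof -
  obtain D E where "D 0 = f" "\<And>n x. (D n has_real_derivative D (Suc n) x) (at x)"
    "E 0 = g" "\<And>n x. (E n has_real_derivative E (Suc n) x) (at x)"
    using assms unfolding smooth1_def by blast
  then show ?thesis unfolding smooth1_def
    by (intro exI[of _ "\<lambda>n x. D n x - E n x"]) (auto intro!: derivative_intros)
qed

lemma smooth1_antideriv:
  assumes "smooth1 f" "\<And>x. (F has_real_derivative f x) (at x)" shows "smooth1 F"
proof -
  obtain D where "D 0 = f" "\<And>n x. (D n has_real_derivative D (Suc n) x) (at x)"
    using assms unfolding smooth1_def by blast
  then show ?thesis unfolding smooth1_def using assms(2)
    by (intro exI[of _ "\<lambda>n. case n of 0 \<Rightarrow> F | Suc m \<Rightarrow> D m"]) (auto split: nat.split)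
qed

lemma standard_bump:
  obtains \<beta> where "smooth1 \<beta>" "\<And>x. \<beta> x \<ge> 0" "\<And>x. \<bar>x\<bar> \<ge> 1 \<Longrightarrow> \<beta> x = 0" "\<And>x. \<bar>x\<bar> < 1 \<Longrightarrow> \<beta> x > 0"
proof
  let ?\<beta> = "\<lambda>x. flat_exp 1 (1 + x) * flat_exp 1 (1 - x)"
  show "smooth1 ?\<beta>" by (intro smooth1_bumps bumps.prod)
qed (auto simp: flat_exp_def)

lemma pd_UNIV: "pd UNIV i f x = vector_derivative (\<lambda>t. f (x + t *\<^sub>R axis i 1)) (at 0)"
  by (simp add: pd_def)

lemma pd_UNIV_eqI:
  assumes "((\<lambda>t. f (x + t *\<^sub>R axis i 1)) has_vector_derivative d) (at 0)"
  shows "pd UNIV i f x = d"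
  unfolding pd_UNIV using assms by (rule vector_derivative_at)

lemma prod_smooth_deriv:
  fixes i i' :: 2
  assumes "i \<noteq> i'" "\<And>x. (f has_real_derivative f' x) (at x)" "\<And>x. (g has_real_derivative g' x) (at x)"
  shows "((\<lambda>t. f ((x + t *\<^sub>R axis j 1) $ i) * g ((x + t *\<^sub>R axis j 1) $ i')) has_vector_derivative
     (if j = i then f' (x $ i) * g (x $ i') else f (x $ i) * g' (x $ i'))) (at 0)"
proof (cases "j = i")
  case True
  have "((\<lambda>t. f (x $ i + t)) has_real_derivative f' (x $ i + 0) * 1) (at 0)"
    by (rule DERIV_chain2[OF assms(2)]) (auto intro!: derivative_eq_intros)
  then have "((\<lambda>t. f (x $ i + t) * g (x $ i')) has_real_derivative f' (x $ i) * g (x $ i')) (at 0)"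
    by (auto intro!: derivative_eq_intros)
  then show ?thesis using True assms(1)
    by (simp add: axis_def has_real_derivative_iff_has_vector_derivative)
next
  case False
  then have j: "j = i'" using assms(1) by (metis exhaust_2)
  have "((\<lambda>t. g (x $ i' + t)) has_real_derivative g' (x $ i' + 0) * 1) (at 0)"
    by (rule DERIV_chain2[OF assms(3)]) (auto intro!: derivative_eq_intros)
  then have "((\<lambda>t. f (x $ i) * g (x $ i' + t)) has_real_derivative f (x $ i) * g' (x $ i')) (at 0)"
    by (auto intro!: derivative_eq_intros)
  then show ?thesis using False j assms(1)
    by (simp add: axis_def has_real_derivative_iff_has_vector_derivative)
qed

lemma Ck_on_prod:
  fixes i i' :: 2
  assumes "i \<noteq> i'" "smooth1 f" "smooth1 g"
  shows "Ck_on m UNIV (\<lambda>x. f (x $ i) * g (x $ i'))"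
proof -
  obtain D E where D: "D 0 = f" "\<And>n x. (D n has_real_derivative D (Suc n) x) (at x)"
    and E: "E 0 = g" "\<And>n x. (E n has_real_derivative E (Suc n) x) (at x)"
    using assms unfolding smooth1_def by blast
  have *: "\<exists>n n'. pds UNIV is (\<lambda>x. f (x $ i) * g (x $ i')) = (\<lambda>x. D n (x $ i) * E n' (x $ i'))" for "is"
  proof (induction "is")
    case Nil then show ?case using D(1) E(1) by auto
  next
    case (Cons j js)
    then obtain n n' where n: "pds UNIV js (\<lambda>x. f (x $ i) * g (x $ i')) = (\<lambda>x. D n (x $ i) * E n' (x $ i'))" by auto
    have "pds UNIV (j # js) (\<lambda>x. f (x $ i) * g (x $ i')) = (\<lambda>x. if j = i then D (Suc n) (x $ i) * E n' (x $ i') else D n (x $ i) * E (Suc n') (x $ i'))"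
      unfolding pds.simps n by (intro ext pd_UNIV_eqI prod_smooth_deriv assms D E)
    then show ?case by (cases "j = i") auto
  qed
  have cD: "continuous_on S (D n)" "continuous_on S (E n)" for S n
    using D E by (metis DERIV_isCont continuous_at_imp_continuous_on)+
  show ?thesis unfolding Ck_on_def
  proof (intro conjI allI impI ballI)
    fix "is" :: "2 list"
    obtain n n' where n: "pds UNIV is (\<lambda>x. f (x $ i) * g (x $ i')) = (\<lambda>x. D n (x $ i) * E n' (x $ i'))" using * by blast
    show "continuous_on UNIV (pds UNIV is (\<lambda>x. f (x $ i) * g (x $ i')))"
      unfolding n by (intro continuous_intros continuous_on_compose2[OF cD(1)[of UNIV]] continuous_on_compose2[OF cD(2)[of UNIV]]) auto
    fix j x
    show "(\<lambda>t. pds UNIV is (\<lambda>x. f (x $ i) * g (x $ i')) (x + t *\<^sub>R axis j 1)) differentiable at 0 within {t. x + t *\<^sub>R axis j 1 \<in> UNIV}"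
      unfolding n using prod_smooth_deriv[OF assms(1) D(2) E(2), where x=x and j=j] by (auto intro: differentiableI_vector)
  qed
qed

text \<open>The set where the bound fails is open by continuity and null by assumption, hence
  empty.\<close>

lemma continuous_AE_bound:
  fixes f :: "real^2 \<Rightarrow> real"
  assumes "open U" "continuous_on U f" "AE x in lebesgue. x \<in> U \<longrightarrow> \<bar>f x\<bar> \<le> M" "x \<in> U"
  shows "\<bar>f x\<bar> \<le> M"
proof (rule ccontr)
  assume a: "\<not> ?thesis"
  let ?S = "U \<inter> f -` {y. M < \<bar>y\<bar>}"
  have "open {y :: real. M < \<bar>y\<bar>}" by (intro open_Collect_less continuous_intros)
  then have o: "open ?S" using assms continuous_openin_preimage_eq continuous_open_preimage by blast
  have "AE x in lebesgue. x \<notin> ?S" using assms(3) by eventually_elim auto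
  moreover have "?S \<in> sets lebesgue" using o by (simp add: lborelD borel_open)
  ultimately have "?S \<in> null_sets lebesgue" by (simp add: AE_iff_null_sets)
  then have "negligible ?S" by (simp add: negligible_iff_null_sets)
  then have "?S = {}" using open_not_negligible[OF o] by blast
  then show False using a assms(4) by auto
qed

lemma set_integral_near:
  fixes f \<rho> :: "'a \<Rightarrow> real"
  assumes "set_integrable M U (\<lambda>x. f x * \<rho> x)" "set_integrable M U \<rho>"
    and "\<And>x. x \<in> U \<Longrightarrow> \<rho> x \<ge> 0" and "\<And>x. x \<in> U \<Longrightarrow> \<rho> x \<noteq> 0 \<Longrightarrow> \<bar>f x - c\<bar> \<le> \<eta>"
  shows "\<bar>(LINT x:U|M. f x * \<rho> x) - c * (LINT x:U|M. \<rho> x)\<bar> \<le> \<eta> * (LINT x:U|M. \<rho> x)"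
proof -
  have b: "(c - \<eta>) * \<rho> x \<le> f x * \<rho> x \<and> f x * \<rho> x \<le> (c + \<eta>) * \<rho> x" if "x \<in> U" for x
    using assms(3,4)[OF that] by (cases "\<rho> x = 0") (auto simp: abs_le_iff intro!: mult_right_mono)
  have "(LINT x:U|M. (c - \<eta>) * \<rho> x) \<le> (LINT x:U|M. f x * \<rho> x)"
    using assms b by (intro set_integral_mono) auto
  moreover have "(LINT x:U|M. f x * \<rho> x) \<le> (LINT x:U|M. (c + \<eta>) * \<rho> x)"
    using assms b by (intro set_integral_mono) auto
  ultimately show ?thesis unfolding set_integral_mult_right
    by (simp add: abs_le_iff left_diff_distrib distrib_right)
qed

lemma set_integral_AE_bound:
  fixes g \<phi> :: "real^2 \<Rightarrow> real"
  assumes g: "set_borel_measurable lebesgue U g" "AE x in lebesgue. x \<in> U \<longrightarrow> \<bar>g x\<bar> \<le> M"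
    and \<phi>: "integrable lebesgue \<phi>" "\<And>x. \<phi> x \<ge> 0" "\<And>x. x \<notin> U \<Longrightarrow> \<phi> x = 0" and M: "M \<ge> 0"
  shows "\<bar>LINT x:U|lebesgue. g x * \<phi> x\<bar> \<le> M * (LINT x|lebesgue. \<phi> x)"
proof -
  have m: "(\<lambda>x. indicator U x *\<^sub>R (g x * \<phi> x)) \<in> borel_measurable lebesgue"
  proof -
    have "(\<lambda>x. (indicator U x *\<^sub>R g x) * \<phi> x) \<in> borel_measurable lebesgue"
      using g(1) \<phi>(1) unfolding set_borel_measurable_def by (intro borel_measurable_times) auto
    then show ?thesis by (simp add: mult.assoc)
  qed
  have AE: "AE x in lebesgue. norm (indicator U x *\<^sub>R (g x * \<phi> x)) \<le> norm (M * \<phi> x)"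
    using g(2)
  proof eventually_elim
    case (elim x)
    show ?case
    proof (cases "x \<in> U")
      case True
      then have "\<bar>g x\<bar> * \<phi> x \<le> M * \<phi> x" using elim \<phi>(2) by (intro mult_right_mono) auto
      then show ?thesis using True \<phi>(2)[of x] M by (simp add: abs_mult)
    qed simp
  qed
  have i: "integrable lebesgue (\<lambda>x. indicator U x *\<^sub>R (g x * \<phi> x))"
    by (rule Bochner_Integration.integrable_bound[OF _ m AE]) (use \<phi>(1) in auto)
  have "\<bar>LINT x:U|lebesgue. g x * \<phi> x\<bar> \<le> (LINT x|lebesgue. norm (indicator U x *\<^sub>R (g x * \<phi> x)))"
    unfolding set_lebesgue_integral_def real_norm_def[symmetric] by (rule integral_norm_bound)
  also have "\<dots> \<le> (LINT x|lebesgue. M * \<phi> x)"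
    using AE M \<phi>(2) by (intro integral_mono_AE integrable_norm i) (use \<phi>(1) in auto)
  finally show ?thesis by simp
qed

lemma integrable_lebesgue_continuous_compact_support:
  fixes f :: "real^2 \<Rightarrow> real"
  assumes "continuous_on UNIV f" "compact K" "\<And>x. x \<notin> K \<Longrightarrow> f x = 0"
  shows "integrable lborel f" "integrable lebesgue f" "set_integrable lebesgue U f \<or> U \<notin> sets lebesgue"
proof -
  have "integrable lborel (\<lambda>x. if x \<in> K then f x else 0)"
  proof -
    have "(\<lambda>x. if x \<in> K then f x else 0) = (\<lambda>x. indicator K x *\<^sub>R f x)" by (auto simp: indicator_def)
    then show ?thesis using borel_integrable_compact[OF assms(2) continuous_on_subset[OF assms(1)]] by simp
  qed
  moreover have "(\<lambda>x. if x \<in> K then f x else 0) = f" using assms(3) by auto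
  ultimately show 1: "integrable lborel f" by simp
  then show 2: "integrable lebesgue f" using borel_measurable_continuous_onI[OF assms(1)] by (simp add: integrable_completion)
  show "set_integrable lebesgue U f \<or> U \<notin> sets lebesgue"
    using 2 integrable_mult_indicator[of U lebesgue f] by (auto simp: set_integrable_def)
qed

lemma lborel_integral_translate:
  fixes f :: "'a :: euclidean_space \<Rightarrow> real"
  assumes "f \<in> borel_measurable borel"
  shows "(LINT x|lborel. f (x - c)) = (LINT x|lborel. f x)"
proof -
  have "(LINT x|lborel. f x) = (LINT x|distr lborel borel ((+) (- c)). f x)" by (simp add: lborel_distr_plus)
  also have "\<dots> = (LINT x|lborel. f (- c + x))" using assms by (subst integral_distr) auto
  finally show ?thesis by simp
qed

text \<open>The test function is \<phi>(x) = (F(x_i) - F(x_i - t)) \<beta>(x_i'), where F is an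
  antiderivative of a bump. Its derivative in direction i is \<rho>(x) - \<rho>(x - t e_i) with a
  bump \<rho> concentrated at c. The weak derivative identity then compares averages of f near the
  two ends of the segment, and their difference is at most M times the integral of \<phi>, which is
  t times the mass of \<rho>.\<close>

lemma weak_pd_slope:
  fixes f g :: "real^2 \<Rightarrow> real" and i :: 2
  assumes U: "open U" and f: "continuous_on U f" and fB: "\<And>x. x \<in> U \<Longrightarrow> \<bar>f x\<bar> \<le> B"
    and g: "set_borel_measurable lebesgue U g" "AE x in lebesgue. x \<in> U \<longrightarrow> \<bar>g x\<bar> \<le> M"
    and M: "M \<ge> 0" and w: "weak_pd U i f g"
    and t: "t > 0" and seg: "\<And>s. s \<in> {0..t} \<Longrightarrow> c + s *\<^sub>R axis i 1 \<in> U"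
  shows "\<bar>f (c + t *\<^sub>R axis i 1) - f c\<bar> \<le> M * t"
proof (rule field_le_epsilon)
  fix e :: real assume e: "e > 0"
  let ?e = "axis i 1 :: real^2"
  define \<eta> where "\<eta> = e / 2"
  have \<eta>: "\<eta> > 0" using e by (simp add: \<eta>_def)
  obtain i' :: 2 where i': "i \<noteq> i'" "\<And>j. j = i \<or> j = i'" 
  proof (cases "i = 1")
    case True then show ?thesis using that[of 2] exhaust_2 by auto
  next
    case False then show ?thesis using that[of 1] exhaust_2 by metis
  qed
  have c0: "c \<in> U" and ct: "c + t *\<^sub>R ?e \<in> U" using seg[of 0] seg[of t] t by auto
  define S where "S = (\<lambda>s. c + s *\<^sub>R ?e) ` {0..t}"
  have "compact S" unfolding S_def by (intro compact_continuous_image continuous_intros) auto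
  moreover have "S \<subseteq> U" using seg by (auto simp: S_def)
  ultimately obtain r0 where r0: "r0 > 0" "(\<Union>x\<in>S. cball x r0) \<subseteq> U"
    using compact_subset_open_imp_cball_epsilon_subset[OF _ U] by metis
  have "continuous (at x) f" if "x \<in> U" for x using f U that continuous_on_eq_continuous_at by blast
  then have "\<exists>d>0. \<forall>y. dist y x < d \<longrightarrow> \<bar>f y - f x\<bar> < \<eta>" if "x \<in> U" for x
    using that \<eta> unfolding continuous_at_eps_delta by (auto simp: dist_real_def)
  from this[OF c0] this[OF ct] obtain d1 d2 where d: "d1 > 0" "\<And>y. dist y c < d1 \<Longrightarrow> \<bar>f y - f c\<bar> < \<eta>"
    "d2 > 0" "\<And>y. dist y (c + t *\<^sub>R ?e) < d2 \<Longrightarrow> \<bar>f y - f (c + t *\<^sub>R ?e)\<bar> < \<eta>" by metis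
  \<comment> \<open>Small enough for two purposes: the support of \<phi> stays in U, and on the
    bumps at both end points f differs from its value there by less than \<eta>.\<close>
  define r where "r = min r0 (min d1 d2) / 4"
  have r: "r > 0" "2 * r \<le> r0" "2 * r < d1" "2 * r < d2" using r0 d by (auto simp: r_def)
  have near: "dist x y \<le> 2 * r" if "\<bar>x $ i - y $ i\<bar> \<le> r" "\<bar>x $ i' - y $ i'\<bar> \<le> r" for x y :: "real^2"
  proof -
    have "norm (x - y) \<le> (\<Sum>j\<in>UNIV. \<bar>(x - y) $ j\<bar>)" by (rule norm_le_l1_cart)
    also have "(UNIV :: 2 set) = {i, i'}" using i' by auto
    finally show ?thesis using i'(1) that by (simp add: dist_norm)
  qed
  obtain \<beta>0 where \<beta>0: "smooth1 \<beta>0" "\<And>x. \<beta>0 x \<ge> 0" "\<And>x. \<bar>x\<bar> \<ge> 1 \<Longrightarrow> \<beta>0 x = 0" "\<And>x. \<bar>x\<bar> < 1 \<Longrightarrow> \<beta>0 x > 0"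
    using standard_bump by metis
  define \<beta> where "\<beta> j x = \<beta>0 ((1/r) * x + (- c $ j / r))" for j :: 2 and x
  have \<beta>: "smooth1 (\<beta> j)" "\<beta> j x \<ge> 0" "\<bar>x - c $ j\<bar> \<ge> r \<Longrightarrow> \<beta> j x = 0" "\<beta> j (c $ j) > 0" for j x
  proof -
    show "smooth1 (\<beta> j)" unfolding \<beta>_def by (rule smooth1_affine[OF \<beta>0(1)])
    have "(1/r) * x + (- c $ j / r) = (x - c $ j) / r" by (simp add: diff_divide_distrib)
    then show "\<bar>x - c $ j\<bar> \<ge> r \<Longrightarrow> \<beta> j x = 0" unfolding \<beta>_def using r by (intro \<beta>0(3)) (simp add: field_simps)
  qed (use \<beta>0 in \<open>auto simp: \<beta>_def\<close>)
  have "\<exists>F. \<forall>x :: real. -\<infinity> < ereal x \<longrightarrow> ereal x < \<infinity> \<longrightarrow> (F has_vector_derivative \<beta> i x) (at x)"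
    by (rule einterval_antiderivative)
      (use smooth1_continuous[OF \<beta>(1)[of i], of UNIV] in \<open>auto simp: continuous_on_eq_continuous_at\<close>)
  then obtain F where F: "\<And>x. (F has_real_derivative \<beta> i x) (at x)"
    by (auto simp: has_real_derivative_iff_has_vector_derivative)
  have smF: "smooth1 F" by (rule smooth1_antideriv[OF \<beta>(1) F])
  \<comment> \<open>A plateau: nonnegative because F is increasing, and zero away from the segment
    because the bump vanishes between x - t and x there.\<close>
  define G where "G x = F x - F (x - t)" for x
  have smG: "smooth1 G" unfolding G_def
    using smooth1_affine[OF smF, of 1 "-t"] by (intro smooth1_diff smF) simp
  have Gd: "(G has_real_derivative \<beta> i x - \<beta> i (x - t)) (at x)" for x
  proof -
    have "((\<lambda>x. F (x - t)) has_real_derivative \<beta> i (x - t) * 1) (at x)"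
      by (rule DERIV_chain2[OF F]) (auto intro!: derivative_eq_intros)
    from DERIV_diff[OF F this] show ?thesis by (simp add: G_def[abs_def])
  qed
  have Fmono: "F x \<le> F y" if "x \<le> y" for x y
    by (rule DERIV_nonneg_imp_nondecreasing[OF that]) (use F \<beta>(2) in blast)
  have Gpos: "G x \<ge> 0" for x using Fmono[of "x - t" x] t by (simp add: G_def)
  have Gsupp: "G x = 0" if "\<not> (c $ i - r \<le> x \<and> x \<le> c $ i + t + r)" for x
  proof -
    have "(\<forall>y\<in>{x - t..x}. \<beta> i y = 0)" using that t by (intro ballI \<beta>(3)) auto
    then have "F x = F (x - t)" using t F
      by (intro DERIV_isconst_end[of "x - t" x F]) (auto intro: DERIV_isCont continuous_at_imp_continuous_on, metis atLeastAtMost_iff less_imp_le)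
    then show ?thesis by (simp add: G_def)
  qed
  define \<phi> where "\<phi> x = G (x $ i) * \<beta> i' (x $ i')" for x :: "real^2"
  define \<rho> where "\<rho> x = \<beta> i (x $ i) * \<beta> i' (x $ i')" for x :: "real^2"
  define box where "box = {x :: real^2. c $ i - r \<le> x $ i \<and> x $ i \<le> c $ i + t + r \<and> \<bar>x $ i' - c $ i'\<bar> \<le> r}"
  have boxU: "box \<subseteq> U"
  proof
    fix x assume x: "x \<in> box"
    define s where "s = max 0 (min t (x $ i - c $ i))"
    have "s \<in> {0..t}" using t by (auto simp: s_def)
    have "dist (c + s *\<^sub>R ?e) x \<le> 2 * r"
      using x i' t r by (intro near) (auto simp: box_def s_def axis_def max_def min_def)
    then have "x \<in> cball (c + s *\<^sub>R ?e) r0" using r by auto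
    moreover have "c + s *\<^sub>R ?e \<in> S" using \<open>s \<in> {0..t}\<close> by (auto simp: S_def)
    ultimately show "x \<in> U" using r0(2) by blast
  qed
  have compbox: "compact box"
  proof -
    have "closed box" unfolding box_def
      by (intro closed_Collect_conj closed_Collect_le continuous_intros)
    moreover have "bounded box"
    proof (rule bounded_subset[OF bounded_cball])
      show "box \<subseteq> cball c (2 * r + (t + r))"
      proof
        fix x assume x: "x \<in> box"
        have "norm (c - x) \<le> (\<Sum>j\<in>UNIV. \<bar>(c - x) $ j\<bar>)" by (rule norm_le_l1_cart)
        also have "(UNIV :: 2 set) = {i, i'}" using i' by auto
        finally have "norm (c - x) \<le> \<bar>c $ i - x $ i\<bar> + \<bar>c $ i' - x $ i'\<bar>" using i'(1) by simp
        then show "x \<in> cball c (2 * r + (t + r))" using x t r by (auto simp: box_def dist_norm)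
      qed
    qed
    ultimately show ?thesis by (simp add: compact_eq_bounded_closed)
  qed
  have \<phi>0: "\<phi> x = 0" if "x \<notin> box" for x
    using that Gsupp[of "x $ i"] \<beta>(3)[of "x $ i'" i'] by (auto simp: \<phi>_def box_def)
  have tf: "test_function U \<phi>"
    unfolding test_function_def
  proof (intro conjI allI)
    show "Ck_on m UNIV \<phi>" for m
      unfolding \<phi>_def[abs_def] by (rule Ck_on_prod[OF i'(1) smG \<beta>(1)])
    have "closure {x. \<phi> x \<noteq> 0} \<subseteq> box"
      using \<phi>0 compbox by (intro closure_minimal) (auto simp: compact_imp_closed)
    then show "compact (closure {x. \<phi> x \<noteq> 0})" "closure {x. \<phi> x \<noteq> 0} \<subseteq> U"
      using boxU compbox unfolding compact_eq_bounded_closed by (auto intro: bounded_subset)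
  qed
  have pdphi: "pd UNIV i \<phi> x = \<rho> x - \<rho> (x - t *\<^sub>R ?e)" for x
  proof -
    obtain D where "D 0 = \<beta> i'" "\<And>n x. (D n has_real_derivative D (Suc n) x) (at x)"
      using \<beta>(1)[of i'] unfolding smooth1_def by blast
    then have b': "(\<beta> i' has_real_derivative D 1 x) (at x)" for x by (metis One_nat_def)
    have "pd UNIV i \<phi> x = (\<beta> i (x $ i) - \<beta> i (x $ i - t)) * \<beta> i' (x $ i')"
      unfolding \<phi>_def[abs_def]
      using prod_smooth_deriv[OF i'(1) Gd b', where x=x and j=i] by (intro pd_UNIV_eqI) simp
    then show ?thesis using i' by (simp add: \<rho>_def axis_def algebra_simps)
  qed
  have cont\<rho>: "continuous_on UNIV (\<lambda>x. \<rho> (x - s *\<^sub>R ?e))" for s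
    unfolding \<rho>_def by (intro continuous_intros continuous_on_compose2[OF smooth1_continuous[OF \<beta>(1), of UNIV]]) auto
  have cont\<phi>: "continuous_on UNIV \<phi>"
    unfolding \<phi>_def by (intro continuous_intros continuous_on_compose2[OF smooth1_continuous[OF \<beta>(1), of UNIV]]
        continuous_on_compose2[OF smooth1_continuous[OF smG, of UNIV]]) auto
  have \<rho>0: "\<rho> (x - s *\<^sub>R ?e) = 0" if "x \<notin> box" "s \<in> {0..t}" for x s
  proof (rule ccontr)
    assume "\<rho> (x - s *\<^sub>R ?e) \<noteq> 0"
    then have "\<bar>x $ i - s - c $ i\<bar> < r" "\<bar>x $ i' - c $ i'\<bar> < r"
      using i' \<beta>(3)[of "x $ i - s" i] \<beta>(3)[of "x $ i'" i'] by (auto simp: \<rho>_def axis_def not_le[symmetric])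
    then show False using that by (auto simp: box_def)
  qed
  have \<rho>near: "dist x (c + s *\<^sub>R ?e) \<le> 2 * r" if "\<rho> (x - s *\<^sub>R ?e) \<noteq> 0" for x s
  proof -
    have "\<bar>x $ i - s - c $ i\<bar> < r" "\<bar>x $ i' - c $ i'\<bar> < r"
      using that i' \<beta>(3)[of "x $ i - s" i] \<beta>(3)[of "x $ i'" i'] by (auto simp: \<rho>_def axis_def not_le[symmetric])
    then show ?thesis using i' by (intro near) (auto simp: axis_def)
  qed
  have \<rho>pos: "\<rho> x \<ge> 0" for x using \<beta>(2) by (simp add: \<rho>_def)
  have Ume: "U \<in> sets lebesgue" using U by (simp add: lborelD borel_open)
  have int\<rho>: "integrable lborel (\<lambda>x. \<rho> (x - s *\<^sub>R ?e))" "integrable lebesgue (\<lambda>x. \<rho> (x - s *\<^sub>R ?e))"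
     "set_integrable lebesgue U (\<lambda>x. \<rho> (x - s *\<^sub>R ?e))" if "s \<in> {0..t}" for s
    using integrable_lebesgue_continuous_compact_support(1,2)[OF cont\<rho>[of s] compbox \<rho>0[OF _ that]]
      integrable_lebesgue_continuous_compact_support(3)[OF cont\<rho>[of s] compbox \<rho>0[OF _ that], where U=U] Ume by auto
  have int\<phi>: "integrable lborel \<phi>" "integrable lebesgue \<phi>"
    using integrable_lebesgue_continuous_compact_support[OF cont\<phi> compbox \<phi>0] by auto
  have intf\<rho>: "set_integrable lebesgue U (\<lambda>x. f x * \<rho> (x - s *\<^sub>R ?e))" if s: "s \<in> {0..t}" for s
    unfolding set_integrable_def
  proof (rule Bochner_Integration.integrable_bound)
    show "integrable lebesgue (\<lambda>x. B * \<rho> (x - s *\<^sub>R ?e))" using int\<rho>(2)[OF s] by simp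
    have "(\<lambda>x. indicator U x *\<^sub>R (f x * \<rho> (x - s *\<^sub>R ?e))) \<in> borel_measurable borel"
      using U f continuous_on_subset[OF cont\<rho>] by (intro borel_measurable_continuous_on_indicator continuous_intros) auto
    then show "(\<lambda>x. indicator U x *\<^sub>R (f x * \<rho> (x - s *\<^sub>R ?e))) \<in> borel_measurable lebesgue"
      by (intro measurable_completion) simp
    show "AE x in lebesgue. norm (indicator U x *\<^sub>R (f x * \<rho> (x - s *\<^sub>R ?e))) \<le> norm (B * \<rho> (x - s *\<^sub>R ?e))"
    proof (intro AE_I2)
      fix x
      show "norm (indicator U x *\<^sub>R (f x * \<rho> (x - s *\<^sub>R ?e))) \<le> norm (B * \<rho> (x - s *\<^sub>R ?e))"
      proof (cases "x \<in> U")
        case True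
        have "\<bar>f x\<bar> \<le> \<bar>B\<bar>" using fB[OF True] by linarith
        then show ?thesis using True by (simp add: abs_mult mult_right_mono)
      qed simp
    qed
  qed
  define R where "R = (LINT x|lborel. \<rho> x)"
  have Req: "(LINT x:U|lebesgue. \<rho> (x - s *\<^sub>R ?e)) = R" if s: "s \<in> {0..t}" for s
  proof -
    have "(LINT x:U|lebesgue. \<rho> (x - s *\<^sub>R ?e)) = (LINT x|lebesgue. \<rho> (x - s *\<^sub>R ?e))"
      unfolding set_lebesgue_integral_def
    proof (intro Bochner_Integration.integral_cong refl)
      fix x
      show "indicat_real U x *\<^sub>R \<rho> (x - s *\<^sub>R ?e) = \<rho> (x - s *\<^sub>R ?e)"
        using \<rho>0[OF _ s, of x] boxU by (cases "x \<in> box") auto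
    qed
    also have "\<dots> = (LINT x|lborel. \<rho> (x - s *\<^sub>R ?e))"
      using int\<rho>(1)[OF s] by (intro integral_completion) auto
    also have "\<dots> = R" unfolding R_def
      using borel_measurable_continuous_onI[OF cont\<rho>[of 0]] by (intro lborel_integral_translate) simp
    finally show ?thesis .
  qed
  have Rpos: "R > 0"
  proof -
    have "R \<ge> 0" unfolding R_def using \<rho>pos by (intro integral_nonneg_AE) auto
    moreover have "R \<noteq> 0"
    proof
      assume "R = 0"
      then have "AE x in lborel. \<rho> x = 0"
        using integral_nonneg_eq_0_iff_AE[where f=\<rho> and M=lborel] int\<rho>(1)[of 0] \<rho>pos t by (auto simp: R_def)
      then have "AE x in lebesgue. x \<in> UNIV \<longrightarrow> \<bar>\<rho> x\<bar> \<le> 0" by (auto dest!: AE_completion elim: eventually_mono)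
      then have "\<bar>\<rho> c\<bar> \<le> 0" using cont\<rho>[of 0] by (intro continuous_AE_bound[of UNIV]) auto
      then show False using mult_pos_pos[OF \<beta>(4)[of i] \<beta>(4)[of i']] by (simp add: \<rho>_def)
    qed
    ultimately show ?thesis by simp
  qed
  \<comment> \<open>\<phi> is the integral over s in [0, t] of the translates of \<rho> by s e_i; by
    Fubini and translation invariance each s contributes the mass R.\<close>
  have \<phi>int: "(LINT x|lebesgue. \<phi> x) = t * R"
  proof -
    have \<phi>pos: "\<phi> x \<ge> 0" for x using Gpos \<beta>(2) by (simp add: \<phi>_def)
    have inner: "ennreal (\<phi> x) = (\<integral>\<^sup>+ s. ennreal (\<rho> (x - s *\<^sub>R ?e)) * indicator {0..t} s \<partial>lborel)" for x
    proof -
      have "(\<integral>\<^sup>+ s. ennreal (\<rho> (x - s *\<^sub>R ?e)) * indicator {0..t} s \<partial>lborel)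
          = ennreal (- F (x $ i - t) * \<beta> i' (x $ i') - (- F (x $ i - 0) * \<beta> i' (x $ i')))"
      proof (rule nn_integral_FTC_Icc[of _ 0 t "\<lambda>s. - F (x $ i - s) * \<beta> i' (x $ i')"])
        show "(\<lambda>s. \<rho> (x - s *\<^sub>R ?e)) \<in> borel_measurable borel"
          unfolding \<rho>_def by (intro borel_measurable_continuous_onI continuous_intros continuous_on_compose2[OF smooth1_continuous[OF \<beta>(1), of UNIV]]) auto
        fix s
        have "((\<lambda>s. F (x $ i - s)) has_real_derivative \<beta> i (x $ i - s) * (-1)) (at s)"
          by (rule DERIV_chain2[OF F]) (auto intro!: derivative_eq_intros)
        from DERIV_cmult_right[OF DERIV_minus[OF this], of "\<beta> i' (x $ i')"]
        show "((\<lambda>s. - F (x $ i - s) * \<beta> i' (x $ i')) has_real_derivative \<rho> (x - s *\<^sub>R ?e)) (at s)"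
          using i' by (simp add: \<rho>_def axis_def)
      qed (use \<rho>pos t in auto)
      then show ?thesis by (simp add: \<phi>_def G_def algebra_simps)
    qed
    have meas: "(\<lambda>(x, s). ennreal (\<rho> (x - s *\<^sub>R ?e)) * indicator {0..t} s) \<in> borel_measurable ((lborel :: (real^2) measure) \<Otimes>\<^sub>M lborel)"
    proof -
      have "(\<lambda>p :: (real^2) \<times> real. \<rho> (fst p - snd p *\<^sub>R ?e)) \<in> borel_measurable borel"
        unfolding \<rho>_def by (intro borel_measurable_continuous_onI continuous_intros continuous_on_compose2[OF smooth1_continuous[OF \<beta>(1), of UNIV]]) auto
      then have [measurable]: "(\<lambda>p :: (real^2) \<times> real. \<rho> (fst p - snd p *\<^sub>R ?e)) \<in> borel_measurable (borel \<Otimes>\<^sub>M borel)"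
        by (simp add: borel_prod)
      show ?thesis unfolding split_beta' by measurable
    qed
    have "(\<integral>\<^sup>+ x. ennreal (\<phi> x) \<partial>lborel) = (\<integral>\<^sup>+ s. (\<integral>\<^sup>+ x. ennreal (\<rho> (x - s *\<^sub>R ?e)) * indicator {0..t} s \<partial>lborel) \<partial>lborel)"
      unfolding inner by (rule lborel_pair.Fubini'[OF meas, symmetric, unfolded prod.case])
    also have "\<dots> = (\<integral>\<^sup>+ s. ennreal R * indicator {0..t} s \<partial>lborel)"
    proof (intro nn_integral_cong)
      fix s :: real
      show "(\<integral>\<^sup>+ x. ennreal (\<rho> (x - s *\<^sub>R ?e)) * indicator {0..t} s \<partial>lborel) = ennreal R * indicator {0..t} s"
      proof (cases "s \<in> {0..t}")
        case True
        have "(\<integral>\<^sup>+ x. ennreal (\<rho> (x - s *\<^sub>R ?e)) \<partial>lborel) = ennreal (LINT x|lborel. \<rho> (x - s *\<^sub>R ?e))"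
          using int\<rho>(1)[OF True] \<rho>pos by (intro nn_integral_eq_integral) auto
        also have "(LINT x|lborel. \<rho> (x - s *\<^sub>R ?e)) = R" unfolding R_def
          using borel_measurable_continuous_onI[OF cont\<rho>[of 0]] by (intro lborel_integral_translate) simp
        finally show ?thesis using True by simp
      qed simp
    qed
    also have "\<dots> = ennreal (t * R)" using t Rpos by (simp add: nn_integral_cmult ennreal_mult' mult.commute ennreal_mult)
    finally have "(LINT x|lborel. \<phi> x) = t * R"
      using int\<phi>(1) \<phi>pos t Rpos by (subst integral_eq_nn_integral) auto
    then show ?thesis using int\<phi>(1) by (subst integral_completion) auto
  qed
  \<comment> \<open>The averages of f over the bump at c, and in \<open>At\<close> over its
    translate to c + t e_i, recover the point values up to \<eta>.\<close>
  have A0: "\<bar>(LINT x:U|lebesgue. f x * \<rho> (x - 0 *\<^sub>R ?e)) - f c * R\<bar> \<le> \<eta> * R"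
    unfolding Req[of 0, symmetric, OF atLeastAtMost_iff[THEN iffD2, OF conjI[OF order.refl less_imp_le[OF t]]]]
    using t r d(2) \<rho>near[of _ 0] \<rho>pos
    by (intro set_integral_near intf\<rho> int\<rho>(3)) (auto, meson le_less_trans less_imp_le)
  have At: "\<bar>(LINT x:U|lebesgue. f x * \<rho> (x - t *\<^sub>R ?e)) - f (c + t *\<^sub>R ?e) * R\<bar> \<le> \<eta> * R"
    unfolding Req[of t, symmetric, OF atLeastAtMost_iff[THEN iffD2, OF conjI[OF less_imp_le[OF t] order.refl]]]
    using t r d(4) \<rho>near[of _ t] \<rho>pos
    by (intro set_integral_near intf\<rho> int\<rho>(3)) (auto, meson le_less_trans less_imp_le)
  have "(LINT x:U|lebesgue. f x * pd UNIV i \<phi> x) = (LINT x:U|lebesgue. f x * \<rho> (x - 0 *\<^sub>R ?e) - f x * \<rho> (x - t *\<^sub>R ?e))"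
    unfolding pdphi by (simp add: algebra_simps)
  also have "\<dots> = (LINT x:U|lebesgue. f x * \<rho> (x - 0 *\<^sub>R ?e)) - (LINT x:U|lebesgue. f x * \<rho> (x - t *\<^sub>R ?e))"
    using t by (intro set_integral_diff intf\<rho>) auto
  finally have "(LINT x:U|lebesgue. f x * \<rho> (x - t *\<^sub>R ?e)) - (LINT x:U|lebesgue. f x * \<rho> (x - 0 *\<^sub>R ?e)) = (LINT x:U|lebesgue. g x * \<phi> x)"
    using w tf unfolding weak_pd_def by force
  moreover have "\<bar>LINT x:U|lebesgue. g x * \<phi> x\<bar> \<le> M * (t * R)"
    unfolding \<phi>int[symmetric]
  proof (rule set_integral_AE_bound[OF g int\<phi>(2) _ _ M])
    show "\<phi> x \<ge> 0" for x using Gpos \<beta>(2) by (simp add: \<phi>_def)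
    show "x \<notin> U \<Longrightarrow> \<phi> x = 0" for x using boxU \<phi>0 by blast
  qed
  ultimately have "\<bar>f (c + t *\<^sub>R ?e) * R - f c * R\<bar> \<le> M * (t * R) + \<eta> * R + \<eta> * R" using A0 At by linarith
  then have "\<bar>f (c + t *\<^sub>R ?e) - f c\<bar> * R \<le> (M * t + 2 * \<eta>) * R"
  proof -
    have "f (c + t *\<^sub>R ?e) * R - f c * R = (f (c + t *\<^sub>R ?e) - f c) * R" by (simp add: left_diff_distrib)
    moreover have "M * (t * R) + \<eta> * R + \<eta> * R = (M * t + 2 * \<eta>) * R" by (simp add: algebra_simps)
    ultimately show ?thesis using \<open>\<bar>f (c + t *\<^sub>R ?e) * R - f c * R\<bar> \<le> M * (t * R) + \<eta> * R + \<eta> * R\<close> Rpos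
      by (simp only: abs_mult abs_of_pos)
  qed
  then show "\<bar>f (c + t *\<^sub>R ?e) - f c\<bar> \<le> M * t + e" using Rpos by (simp add: \<eta>_def)
qed

text \<open>Two points of a ball, one of them the centre, are joined by two axis-parallel segments
  inside the ball, and each obeys the slope bound. Working in balls keeps the path in U, which need
  not be convex. The same L also bounds f.\<close>

lemma W1inf_local_lipschitz:
  assumes U: "open U" and W: "W1inf U f"
  obtains L where "L \<ge> 0" "\<And>x. x \<in> U \<Longrightarrow> \<bar>f x\<bar> \<le> L"
    "\<And>x y r. ball x r \<subseteq> U \<Longrightarrow> y \<in> ball x r \<Longrightarrow> \<bar>f y - f x\<bar> \<le> L * norm (y - x)"
proof -
  have f: "continuous_on U f" using W by (simp add: W1inf_def)
  obtain B where B: "AE x in lebesgue. x \<in> U \<longrightarrow> \<bar>f x\<bar> \<le> B" using W by (auto simp: W1inf_def Linf_def)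
  have fB: "\<bar>f x\<bar> \<le> B" if "x \<in> U" for x using continuous_AE_bound[OF U f B that] .
  have "\<exists>g M. set_borel_measurable lebesgue U g \<and> (AE x in lebesgue. x \<in> U \<longrightarrow> \<bar>g x\<bar> \<le> M) \<and> weak_pd U i f g" for i
  proof -
    obtain g where "Linf U g" "weak_pd U i f g" using W unfolding W1inf_def by blast
    then show ?thesis unfolding Linf_def by blast
  qed
  then have "\<exists>g. \<forall>i. \<exists>M. set_borel_measurable lebesgue U (g i) \<and> (AE x in lebesgue. x \<in> U \<longrightarrow> \<bar>g i x\<bar> \<le> M) \<and> weak_pd U i f (g i)"
    by (intro choice allI)
  then obtain g where g': "\<forall>i. \<exists>M. set_borel_measurable lebesgue U (g i) \<and> (AE x in lebesgue. x \<in> U \<longrightarrow> \<bar>g i x\<bar> \<le> M) \<and> weak_pd U i f (g i)" ..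
  from choice[OF g'] obtain M0 where g0: "\<And>i. set_borel_measurable lebesgue U (g i)"
    "\<And>i. AE x in lebesgue. x \<in> U \<longrightarrow> \<bar>g i x\<bar> \<le> M0 i" "\<And>i. weak_pd U i f (g i)" by blast
  define M where "M = max \<bar>M0 1\<bar> \<bar>M0 2\<bar>"
  have MM: "M0 i \<le> M" for i using exhaust_2[of i] by (auto simp: M_def)
  have M0: "M \<ge> 0" by (auto simp: M_def)
  have g: "AE x in lebesgue. x \<in> U \<longrightarrow> \<bar>g i x\<bar> \<le> M" for i
    using g0(2)[of i] by eventually_elim (use MM[of i] in auto)
  have slope: "\<bar>f (c + t *\<^sub>R axis i 1) - f c\<bar> \<le> M * \<bar>t\<bar>"
    if "\<And>s. s \<in> closed_segment 0 t \<Longrightarrow> c + s *\<^sub>R axis i 1 \<in> U" for c t i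
  proof -
    consider "t = 0" | "t > 0" | "t < 0" by linarith
    then show ?thesis
    proof cases
      case 2
      then show ?thesis using weak_pd_slope[OF U f fB g0(1) g M0 g0(3) 2, of c i] that
        by (auto simp: closed_segment_eq_real_ivl)
    next
      case 3
      have "\<bar>f (c + t *\<^sub>R axis i 1 + (-t) *\<^sub>R axis i 1) - f (c + t *\<^sub>R axis i 1)\<bar> \<le> M * (-t)"
      proof (rule weak_pd_slope[OF U f fB g0(1) g M0 g0(3)])
        fix s assume "s \<in> {0..-t}"
        then have "c + (t + s) *\<^sub>R axis i 1 \<in> U" using 3 by (intro that) (auto simp: closed_segment_eq_real_ivl)
        then show "c + t *\<^sub>R axis i 1 + s *\<^sub>R axis i 1 \<in> U" by (simp add: algebra_simps)
      qed (use 3 in auto)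
      then show ?thesis using 3 by (simp add: abs_minus_commute)
    qed simp
  qed
  have lip: "\<bar>f y - f x\<bar> \<le> (2 * M) * norm (y - x)" if b: "ball x r \<subseteq> U" "y \<in> ball x r" for x y r
  proof -
    define z where "z = x + ((y - x) $ 1) *\<^sub>R axis 1 (1::real)"
    have y: "y = z + ((y - x) $ 2) *\<^sub>R axis 2 1"
      by (simp add: z_def vec_eq_iff forall_2 axis_def)
    have in1: "x + s *\<^sub>R axis 1 1 \<in> U" if s: "s \<in> closed_segment 0 ((y - x) $ 1)" for s
    proof -
      have "\<bar>s\<bar> \<le> \<bar>(y - x) $ 1\<bar>" using s by (auto simp: closed_segment_eq_real_ivl split: if_splits)
      also have "\<dots> \<le> norm (y - x)" by (rule component_le_norm_cart)
      finally have "dist x (x + s *\<^sub>R axis 1 1) < r" using b(2) by (simp add: dist_norm norm_minus_commute)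
      then show ?thesis using b(1) by auto
    qed
    have in2: "z + s *\<^sub>R axis 2 1 \<in> U" if s: "s \<in> closed_segment 0 ((y - x) $ 2)" for s
    proof -
      have s': "\<bar>s\<bar> \<le> \<bar>(y - x) $ 2\<bar>" using s by (auto simp: closed_segment_eq_real_ivl split: if_splits)
      have "norm (z + s *\<^sub>R axis 2 1 - x) \<le> norm (y - x)"
        by (rule norm_le_componentwise_cart) (use s' in \<open>auto simp: z_def axis_def, (metis exhaust_2)?\<close>)
      then have "dist x (z + s *\<^sub>R axis 2 1) < r" using b(2) by (simp add: dist_norm norm_minus_commute)
      then show ?thesis using b(1) by auto
    qed
    have "\<bar>f z - f x\<bar> \<le> M * \<bar>(y - x) $ 1\<bar>" unfolding z_def by (rule slope[OF in1])
    moreover have "\<bar>f y - f z\<bar> \<le> M * \<bar>(y - x) $ 2\<bar>" by (subst y) (rule slope[OF in2])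
    moreover have m: "M * \<bar>(y - x) $ i\<bar> \<le> M * norm (y - x)" for i
      using M0 component_le_norm_cart[of "y - x" i] by (intro mult_left_mono) auto
    ultimately show ?thesis using m[of 1] m[of 2] by linarith
  qed
  show ?thesis
  proof (rule that[of "max \<bar>B\<bar> (2 * M)"])
    show "max \<bar>B\<bar> (2 * M) \<ge> 0" by auto
    show "\<bar>f x\<bar> \<le> max \<bar>B\<bar> (2 * M)" if "x \<in> U" for x using fB[OF that] by auto
    show "\<bar>f y - f x\<bar> \<le> max \<bar>B\<bar> (2 * M) * norm (y - x)" if "ball x r \<subseteq> U" "y \<in> ball x r" for x y r
      by (rule order.trans[OF lip[OF that] mult_right_mono]) auto
  qed
qed

section \<open>Slices of tensor-product polynomials and coercivity on the reference square\<close>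

text \<open>For p(x, y) with coefficient matrix c, \<open>sl k c s\<close> is the slice y -> p(s, y)
  and \<open>dsl k c s\<close> below is y -> \<partial>_x p(s, y); transposing c by
  \<open>tr\<close> exchanges the variables. Slices are of type \<open>poly\<close>, so that the
  univariate pairing applies to them.\<close>

definition sl :: "nat \<Rightarrow> (nat \<Rightarrow> nat \<Rightarrow> real) \<Rightarrow> real \<Rightarrow> real poly" where
  "sl k c s = (\<Sum>b\<le>k. monom (\<Sum>a\<le>k. c a b * s ^ a) b)"

definition dsl :: "nat \<Rightarrow> (nat \<Rightarrow> nat \<Rightarrow> real) \<Rightarrow> real \<Rightarrow> real poly" where
  "dsl k c s = (\<Sum>b\<le>k. monom (\<Sum>a\<le>k. c a b * (real a * s ^ (a - 1))) b)"

abbreviation (input) tr :: "(nat \<Rightarrow> nat \<Rightarrow> real) \<Rightarrow> nat \<Rightarrow> nat \<Rightarrow> real" where "tr c \<equiv> \<lambda>a b. c b a"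

lemma degree_sl: "degree (sl k c s) \<le> k"
  unfolding sl_def by (rule degree_sum_le) (auto intro: order.trans[OF degree_monom_le])

lemma degree_dsl: "degree (dsl k c s) \<le> k"
  unfolding dsl_def by (rule degree_sum_le) (auto intro: order.trans[OF degree_monom_le])

lemma poly_sl: "poly (sl k c s) t = (\<Sum>a\<le>k. \<Sum>b\<le>k. c a b * s ^ a * t ^ b)"
proof -
  have "poly (sl k c s) t = (\<Sum>b\<le>k. \<Sum>a\<le>k. c a b * s ^ a * t ^ b)"
    by (simp add: sl_def poly_sum poly_monom sum_distrib_right)
  also have "\<dots> = (\<Sum>a\<le>k. \<Sum>b\<le>k. c a b * s ^ a * t ^ b)" by (rule sum.swap)
  finally show ?thesis .
qed

lemma poly_sl_tr: "poly (sl k (tr c) t) s = poly (sl k c s) t"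
proof -
  have "poly (sl k (tr c) t) s = (\<Sum>a\<le>k. \<Sum>b\<le>k. c b a * t ^ a * s ^ b)" by (rule poly_sl)
  also have "\<dots> = (\<Sum>b\<le>k. \<Sum>a\<le>k. c b a * t ^ a * s ^ b)" by (rule sum.swap)
  also have "\<dots> = poly (sl k c s) t" unfolding poly_sl by (intro sum.cong refl) simp
  finally show ?thesis .
qed

lemma poly_pderiv_sl: "poly (pderiv (sl k c s)) t = (\<Sum>a\<le>k. \<Sum>b\<le>k. c a b * s ^ a * (real b * t ^ (b - 1)))"
proof -
  have "pderiv (sl k c s) = (\<Sum>b\<le>k. monom (real b * (\<Sum>a\<le>k. c a b * s ^ a)) (b - 1))"
    unfolding sl_def higher_pderiv_sum[where n=1, simplified] pderiv_monom by simp
  then have "poly (pderiv (sl k c s)) t = (\<Sum>b\<le>k. \<Sum>a\<le>k. c a b * s ^ a * (real b * t ^ (b - 1)))"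
    by (simp add: poly_sum poly_monom sum_distrib_left sum_distrib_right mult.assoc mult.left_commute mult.commute)
  also have "\<dots> = (\<Sum>a\<le>k. \<Sum>b\<le>k. c a b * s ^ a * (real b * t ^ (b - 1)))" by (rule sum.swap)
  finally show ?thesis .
qed

lemma poly_dsl: "poly (dsl k c s) t = poly (pderiv (sl k (tr c) t)) s"
proof -
  have "poly (dsl k c s) t = (\<Sum>b\<le>k. \<Sum>a\<le>k. c a b * t ^ b * (real a * s ^ (a - 1)))"
    unfolding dsl_def poly_sum poly_monom sum_distrib_right
    by (simp add: mult.assoc mult.left_commute mult.commute)
  then show ?thesis unfolding poly_pderiv_sl .
qed

lemma poly_dsl_tr: "poly (dsl k (tr c) t) s = poly (pderiv (sl k c s)) t"
  by (rule poly_dsl)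

lemma poly_pderiv_dsl: "poly (pderiv (dsl k c s)) t = (\<Sum>a\<le>k. \<Sum>b\<le>k. c a b * (real a * s ^ (a - 1)) * (real b * t ^ (b - 1)))"
proof -
  have "dsl k c s = sl k (\<lambda>a b. c a b * (real a * s ^ (a - 1))) 1" by (simp add: dsl_def sl_def)
  then show ?thesis by (simp add: poly_pderiv_sl)
qed

text \<open>Discrete energies: the Gauss rule in x and exact integration in y, applied to
  (\<partial>_x p)^2 here, to (\<partial>_y p)^2 in \<open>Yq\<close> and to \<partial>_x p
  \<partial>_y p in \<open>Zq\<close>. This semi-discrete form is what a sum over Gauss lines
  produces.\<close>

definition Xq :: "nat \<Rightarrow> (nat \<Rightarrow> nat \<Rightarrow> real) \<Rightarrow> real" where
  "Xq k c = (\<Sum>i\<in>{1..k}. gauss_wt k i * Iq (dsl k c (gauss_pt k i) * dsl k c (gauss_pt k i)))"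
definition Yq :: "nat \<Rightarrow> (nat \<Rightarrow> nat \<Rightarrow> real) \<Rightarrow> real" where
  "Yq k c = (\<Sum>i\<in>{1..k}. gauss_wt k i * Iq (pderiv (sl k c (gauss_pt k i)) * pderiv (sl k c (gauss_pt k i))))"
definition Zq :: "nat \<Rightarrow> (nat \<Rightarrow> nat \<Rightarrow> real) \<Rightarrow> real" where
  "Zq k c = (\<Sum>i\<in>{1..k}. gauss_wt k i * Iq (dsl k c (gauss_pt k i) * pderiv (sl k c (gauss_pt k i))))"

lemma Xq_nonneg: "Xq k c \<ge> 0" unfolding Xq_def
  by (intro sum_nonneg mult_nonneg_nonneg Iq_sq_nonneg less_imp_le[OF gauss_wt_pos]) auto

lemma Iq_Gq_sl: "k \<ge> 1 \<Longrightarrow> Iq (pderiv (sl k c s) * pderiv (sl k c s)) = Gq k (pderiv (sl k c s) * pderiv (sl k c s))"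
  using degree_mult_le[of "pderiv (sl k c s)" "pderiv (sl k c s)"] degree_sl[of k c s]
  by (intro gauss_exact) (auto simp: degree_pderiv)

lemma Iq_Gq_dsl_sl: "k \<ge> 1 \<Longrightarrow> Iq (dsl k c s * pderiv (sl k c s)) = Gq k (dsl k c s * pderiv (sl k c s))"
  using degree_mult_le[of "dsl k c s" "pderiv (sl k c s)"] degree_sl[of k c s] degree_dsl[of k c s]
  by (intro gauss_exact) (auto simp: degree_pderiv)

text \<open>Both sides are compared with the full tensor Gauss sum of (\<partial>_y p)^2.
  \<open>Yq\<close> equals it, since \<partial>_y p has degree at most k - 1 in y. In
  \<open>Xq k (tr c)\<close> the exact integral runs along x, where the degree may be k and the
  Gauss rule underestimates squares.\<close>

lemma Yq_le_Xq_tr: assumes "k \<ge> 1" shows "Yq k c \<le> Xq k (tr c)"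
proof -
  have "Yq k c = (\<Sum>i\<in>{1..k}. \<Sum>j\<in>{1..k}. gauss_wt k i * (gauss_wt k j * (poly (pderiv (sl k c (gauss_pt k i))) (gauss_pt k j))\<^sup>2))"
    unfolding Yq_def Iq_Gq_sl[OF assms] Gq_def by (simp add: sum_distrib_left power2_eq_square)
  also have "\<dots> = (\<Sum>j\<in>{1..k}. gauss_wt k j * Gq k (dsl k (tr c) (gauss_pt k j) * dsl k (tr c) (gauss_pt k j)))"
    by (subst sum.swap) (simp add: Gq_def poly_dsl_tr sum_distrib_left power2_eq_square mult.left_commute)
  also have "\<dots> \<le> Xq k (tr c)" unfolding Xq_def
    using gauss_sq_le[OF assms degree_dsl] gauss_wt_pos[of _ k]
    by (intro sum_mono mult_left_mono) (auto intro: less_imp_le)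
  finally show ?thesis .
qed

text \<open>The product of the two derivatives has degree at most 2k - 1 in either variable, so both
  sides equal the same tensor Gauss sum.\<close>

lemma Zq_tr: assumes "k \<ge> 1" shows "Zq k (tr c) = Zq k c"
proof -
  have *: "Zq k c = (\<Sum>i\<in>{1..k}. \<Sum>j\<in>{1..k}. gauss_wt k i * gauss_wt k j *
      (poly (dsl k c (gauss_pt k i)) (gauss_pt k j) * poly (pderiv (sl k c (gauss_pt k i))) (gauss_pt k j)))" for c
    unfolding Zq_def Iq_Gq_dsl_sl[OF assms] Gq_def by (simp add: sum_distrib_left mult.assoc)
  show ?thesis unfolding *[of c] *[of "tr c"]
    by (subst sum.swap) (simp add: poly_dsl poly_dsl_tr mult.assoc mult.left_commute mult.commute)
qed

lemma quad_form_integral: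
  assumes "\<And>x y :: real. \<beta>1 * x\<^sup>2 + 2 * \<gamma> * x * y + \<beta>2 * y\<^sup>2 \<ge> \<mu> * (x\<^sup>2 + y\<^sup>2)"
  shows "\<beta>1 * Xq k c + 2 * \<gamma> * Zq k c + \<beta>2 * Yq k c \<ge> \<mu> * (Xq k c + Yq k c)"
proof -
  have *: "\<beta>1 * Iq (p * p) + 2 * \<gamma> * Iq (p * q) + \<beta>2 * Iq (q * q) \<ge> \<mu> * (Iq (p * p) + Iq (q * q))" for p q
  proof -
    have "Iq (smult \<mu> (p * p + q * q)) \<le> Iq (smult \<beta>1 (p * p) + smult (2 * \<gamma>) (p * q) + smult \<beta>2 (q * q))"
    proof (intro integral_le)
      fix x :: real
      show "poly (smult \<mu> (p * p + q * q)) x \<le> poly (smult \<beta>1 (p * p) + smult (2 * \<gamma>) (p * q) + smult \<beta>2 (q * q)) x"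
        using assms[of "poly p x" "poly q x"] by (simp add: power2_eq_square mult.assoc)
    qed (rule poly_integrable)+
    then show ?thesis unfolding Iq_add Iq_smult .
  qed
  have "\<mu> * (Xq k c + Yq k c) = (\<Sum>i\<in>{1..k}. gauss_wt k i * (\<mu> * (Iq (dsl k c (gauss_pt k i) * dsl k c (gauss_pt k i))
       + Iq (pderiv (sl k c (gauss_pt k i)) * pderiv (sl k c (gauss_pt k i))))))"
    unfolding Xq_def Yq_def by (simp add: sum_distrib_left sum.distrib[symmetric] algebra_simps)
  also have "\<dots> \<le> (\<Sum>i\<in>{1..k}. gauss_wt k i * (\<beta>1 * Iq (dsl k c (gauss_pt k i) * dsl k c (gauss_pt k i))
       + 2 * \<gamma> * Iq (dsl k c (gauss_pt k i) * pderiv (sl k c (gauss_pt k i)))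
       + \<beta>2 * Iq (pderiv (sl k c (gauss_pt k i)) * pderiv (sl k c (gauss_pt k i)))))"
    by (intro sum_mono mult_left_mono * less_imp_le[OF gauss_wt_pos])
  also have "\<dots> = \<beta>1 * Xq k c + 2 * \<gamma> * Zq k c + \<beta>2 * Yq k c"
    unfolding Xq_def Yq_def Zq_def by (simp add: sum_distrib_left sum.distrib algebra_simps)
  finally show ?thesis .
qed

lemma dual_form_lin: "dual_form k p (smult a q + smult b r) = a * dual_form k p q + b * dual_form k p r"
proof -
  have "integral {gauss_pt k j..gauss_pt k (Suc j)} (poly (smult a q + smult b r))
    = a * integral {gauss_pt k j..gauss_pt k (Suc j)} (poly q) + b * integral {gauss_pt k j..gauss_pt k (Suc j)} (poly r)" for j
  proof -
    have m: "integral S (poly (smult a q)) = a * integral S (poly q)" for S a and q :: "real poly"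
      unfolding poly_smult[abs_def] by (rule integral_mult_right)
    have "integral {gauss_pt k j..gauss_pt k (Suc j)} (\<lambda>x. poly (smult a q) x + poly (smult b r) x)
      = integral {gauss_pt k j..gauss_pt k (Suc j)} (poly (smult a q)) + integral {gauss_pt k j..gauss_pt k (Suc j)} (poly (smult b r))"
      by (rule integral_add) (rule poly_integrable)+
    then show ?thesis unfolding m poly_add[abs_def] .
  qed
  then show ?thesis unfolding dual_form_def by (simp add: sum_distrib_left sum.distrib algebra_simps)
qed

text \<open>On an affine element the flux through the lines \<open>\<xi> = g\<^sub>i\<close> is a combination of the normal and the
  tangential derivative.  The tangential term is integrated exactly; the normal one is overestimated.\<close>

definition flux_form :: "nat \<Rightarrow> (nat \<Rightarrow> nat \<Rightarrow> real) \<Rightarrow> real \<Rightarrow> real \<Rightarrow> real" where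
  "flux_form k c \<beta> \<gamma> = (\<Sum>i\<in>{1..k}. gauss_wt k i * dual_form k (dsl k c (gauss_pt k i))
      (smult \<beta> (dsl k c (gauss_pt k i)) + smult \<gamma> (pderiv (sl k c (gauss_pt k i)))))"

lemma flux_form_ge:
  assumes "k \<ge> 1" "\<beta> \<ge> 0"
  shows "flux_form k c \<beta> \<gamma> \<ge> \<beta> * Xq k c + \<gamma> * Zq k c"
proof -
  have "\<beta> * Xq k c + \<gamma> * Zq k c = (\<Sum>i\<in>{1..k}. gauss_wt k i * (\<beta> * Iq (dsl k c (gauss_pt k i) * dsl k c (gauss_pt k i))
     + \<gamma> * Iq (dsl k c (gauss_pt k i) * pderiv (sl k c (gauss_pt k i)))))"
    unfolding Xq_def Zq_def by (simp add: sum_distrib_left sum.distrib algebra_simps)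
  also have "\<dots> \<le> flux_form k c \<beta> \<gamma>"
    unfolding flux_form_def dual_form_lin
  proof (rule sum_mono, rule mult_left_mono, rule add_mono, rule mult_left_mono)
    fix i assume "i \<in> {1..k}"
    then show "0 \<le> gauss_wt k i" using gauss_wt_pos less_imp_le by blast
    show "Iq (dsl k c (gauss_pt k i) * dsl k c (gauss_pt k i)) \<le> dual_form k (dsl k c (gauss_pt k i)) (dsl k c (gauss_pt k i))"
      by (rule dual_form_self[OF assms(1) degree_dsl])
    show "\<gamma> * Iq (dsl k c (gauss_pt k i) * pderiv (sl k c (gauss_pt k i))) \<le> \<gamma> * dual_form k (dsl k c (gauss_pt k i)) (pderiv (sl k c (gauss_pt k i)))"
      using degree_sl[of k c "gauss_pt k i"]
      by (subst dual_form_exact[OF assms(1) degree_dsl]) (auto simp: degree_pderiv)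
  qed (use assms in auto)
  finally show ?thesis .
qed

text \<open>The flux forms are bounded below by \<beta>1 X + 2 \<gamma> Z + \<beta>2 X', where X' is
  \<open>Xq\<close> of the transpose. The quadratic form inequality, integrated along the lines of
  either family, has Y in place of X' or Y' in place of X. Adding both versions and using Y \<le> X'
  and Y' \<le> X gives twice the lower bound, whence the factor 1/2.\<close>

lemma flux_form_coercive:
  assumes k: "k \<ge> 1" and \<mu>: "\<mu> > 0"
    and q: "\<And>x y :: real. \<beta>1 * x\<^sup>2 + 2 * \<gamma> * x * y + \<beta>2 * y\<^sup>2 \<ge> \<mu> * (x\<^sup>2 + y\<^sup>2)"
  shows "flux_form k c \<beta>1 \<gamma> + flux_form k (tr c) \<beta>2 \<gamma> \<ge> \<mu> / 2 * (Xq k c + Xq k (tr c))"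
proof -
  have b: "\<beta>1 \<ge> 0" "\<beta>2 \<ge> 0" using q[of 1 0] q[of 0 1] \<mu> by auto
  have q': "\<beta>2 * x\<^sup>2 + 2 * \<gamma> * x * y + \<beta>1 * y\<^sup>2 \<ge> \<mu> * (x\<^sup>2 + y\<^sup>2)" for x y
    using q[of y x] by (simp add: algebra_simps)
  have L: "flux_form k c \<beta>1 \<gamma> + flux_form k (tr c) \<beta>2 \<gamma> \<ge> \<beta>1 * Xq k c + 2 * \<gamma> * Zq k c + \<beta>2 * Xq k (tr c)"
    using flux_form_ge[OF k b(1), of c \<gamma>] flux_form_ge[OF k b(2), of "tr c" \<gamma>] Zq_tr[OF k, of c] by simp
  have 1: "\<beta>1 * Xq k c + 2 * \<gamma> * Zq k c + \<beta>2 * Yq k c \<ge> \<mu> * (Xq k c + Yq k c)"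
    by (rule quad_form_integral[OF q])
  have 2: "\<beta>2 * Xq k (tr c) + 2 * \<gamma> * Zq k c + \<beta>1 * Yq k (tr c) \<ge> \<mu> * (Xq k (tr c) + Yq k (tr c))"
    using quad_form_integral[OF q', of k "tr c"] Zq_tr[OF k, of c] by simp
  have 3: "\<beta>2 * Yq k c \<le> \<beta>2 * Xq k (tr c)" using Yq_le_Xq_tr[OF k, of c] b by (intro mult_left_mono)
  have 4: "\<beta>1 * Yq k (tr c) \<le> \<beta>1 * Xq k c" using Yq_le_Xq_tr[OF k, of "tr c"] b by (intro mult_left_mono) auto
  have 5: "\<mu> * Yq k c \<ge> 0" "\<mu> * Yq k (tr c) \<ge> 0"
    using \<mu> unfolding Yq_def
    by (intro mult_nonneg_nonneg sum_nonneg Iq_sq_nonneg less_imp_le[OF gauss_wt_pos]; auto)+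
  have e: "\<mu> / 2 * (Xq k c + Xq k (tr c)) = (\<mu> * Xq k c + \<mu> * Xq k (tr c)) / 2" by (simp add: algebra_simps)
  show ?thesis using L 1 2 3 4 5 unfolding e distrib_left by linarith
qed

text \<open>In x the derivative \<partial>_x p has degree less than k, so it is interpolated from
  its values on the k Gauss lines; on each line the sup norm and the dual interpolant are controlled
  by the L^2 norm. Hence \<open>Xq\<close> controls both the derivative and the jumps of the test
  function.\<close>

lemma dsl_sup_bound:
  assumes k: "k \<ge> 1"
  shows "\<exists>C\<ge>0. \<forall>c. (\<forall>s\<in>{-1..1}. \<forall>t\<in>{-1..1}. \<bar>poly (dsl k c s) t\<bar> \<le> C * sqrt (Xq k c)) \<and>
     (\<forall>i\<in>{1..k}. \<forall>j\<le>k. \<bar>gauss_wt k i * dI k (dsl k c (gauss_pt k i)) j\<bar> \<le> C * sqrt (Xq k c))"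
proof -
  obtain C1 where C1: "C1 \<ge> 0" "\<And>p x. degree p \<le> k \<Longrightarrow> x \<in> {-1..1} \<Longrightarrow> \<bar>poly p x\<bar> \<le> C1 * sqrt (Iq (p * p))"
    using poly_sup_bound[of k] by metis
  obtain C2 where C2: "C2 \<ge> 0" "\<And>p j. degree p \<le> k \<Longrightarrow> j \<le> k \<Longrightarrow> \<bar>dI k p j\<bar> \<le> C2 * sqrt (Iq (p * p))"
    using dI_bound[of k] by metis
  obtain B where B: "\<And>i. B i \<ge> 0" "\<And>i x. x \<in> {-1..1} \<Longrightarrow> \<bar>poly (lag k i) x\<bar> \<le> B i"
    using choice[of "\<lambda>i B. B \<ge> 0 \<and> (\<forall>x\<in>{-1..1}. \<bar>poly (lag k i) x\<bar> \<le> B)"] poly_bdd by blast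
  define W where "W = (\<Sum>i\<in>{1..k}. 1 / sqrt (gauss_wt k i))"
  define V where "V = (\<Sum>i\<in>{1..k}. gauss_wt k i)"
  define S where "S = (\<Sum>i\<in>{1..k}. B i)"
  have Wi: "1 / sqrt (gauss_wt k i) \<le> W" if "i \<in> {1..k}" for i
    unfolding W_def using that gauss_wt_pos[of _ k] by (intro member_le_sum) (auto intro: less_imp_le)
  have Vi: "gauss_wt k i \<le> V" if "i \<in> {1..k}" for i
    unfolding V_def using that gauss_wt_pos[of _ k] by (intro member_le_sum) (auto intro: less_imp_le)
  have W0: "W \<ge> 0" "V \<ge> 0" unfolding W_def V_def
    using gauss_wt_pos[of _ k] by (auto intro!: sum_nonneg intro: less_imp_le)
  have S0: "S \<ge> 0" unfolding S_def using B by (auto intro!: sum_nonneg)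
  have base: "sqrt (Iq (dsl k c (gauss_pt k i) * dsl k c (gauss_pt k i))) \<le> W * sqrt (Xq k c)" if i: "i \<in> {1..k}" for c i
  proof -
    have "gauss_wt k i * Iq (dsl k c (gauss_pt k i) * dsl k c (gauss_pt k i)) \<le> Xq k c"
      unfolding Xq_def using i gauss_wt_pos[of _ k] Iq_sq_nonneg
      by (intro member_le_sum[where f="\<lambda>i. gauss_wt k i * Iq (dsl k c (gauss_pt k i) * dsl k c (gauss_pt k i))"] mult_nonneg_nonneg)
         (auto intro: less_imp_le)
    then have "Iq (dsl k c (gauss_pt k i) * dsl k c (gauss_pt k i)) \<le> Xq k c / gauss_wt k i"
      using gauss_wt_pos[OF i] by (simp add: field_simps)
    then have "sqrt (Iq (dsl k c (gauss_pt k i) * dsl k c (gauss_pt k i))) \<le> 1 / sqrt (gauss_wt k i) * sqrt (Xq k c)"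
      by (metis real_sqrt_le_mono real_sqrt_divide mult.commute times_divide_eq_right mult.right_neutral)
    also have "\<dots> \<le> W * sqrt (Xq k c)" using Wi[OF i] Xq_nonneg by (intro mult_right_mono) auto
    finally show ?thesis .
  qed
  have sup: "\<bar>poly (dsl k c s) t\<bar> \<le> S * (C1 * W) * sqrt (Xq k c)" if st: "s \<in> {-1..1}" "t \<in> {-1..1}" for c s t
  proof -
    let ?p = "pderiv (sl k (tr c) t)"
    have d: "degree ?p < k" using degree_sl[of k "tr c" t] k by (auto simp: degree_pderiv)
    have "poly (dsl k c s) t = poly ?p s" by (rule poly_dsl)
    also have "\<dots> = (\<Sum>i\<in>{1..k}. poly ?p (gauss_pt k i) * poly (lag k i) s)"
      by (subst lagrange_interpolation[OF d]) (simp add: poly_sum)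
    also have "\<dots> = (\<Sum>i\<in>{1..k}. poly (dsl k c (gauss_pt k i)) t * poly (lag k i) s)" by (simp add: poly_dsl)
    also have "\<bar>\<dots>\<bar> \<le> (\<Sum>i\<in>{1..k}. (C1 * (W * sqrt (Xq k c))) * B i)"
    proof (rule order.trans[OF sum_abs], intro sum_mono)
      fix i assume i: "i \<in> {1..k}"
      have "\<bar>poly (dsl k c (gauss_pt k i)) t\<bar> \<le> C1 * (W * sqrt (Xq k c))"
        by (rule order.trans[OF C1(2)[OF degree_dsl st(2)] mult_left_mono[OF base[OF i] C1(1)]])
      then show "\<bar>poly (dsl k c (gauss_pt k i)) t * poly (lag k i) s\<bar> \<le> (C1 * (W * sqrt (Xq k c))) * B i"
        unfolding abs_mult using B(2)[OF st(1), of i] by (intro mult_mono) (auto intro: order.trans[OF abs_ge_zero])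
    qed
    also have "\<dots> = S * (C1 * W) * sqrt (Xq k c)" unfolding S_def by (simp add: sum_distrib_left sum_distrib_right algebra_simps)
    finally show ?thesis .
  qed
  have jump: "\<bar>gauss_wt k i * dI k (dsl k c (gauss_pt k i)) j\<bar> \<le> V * (C2 * W) * sqrt (Xq k c)" if ij: "i \<in> {1..k}" "j \<le> k" for c i j
  proof -
    have "\<bar>dI k (dsl k c (gauss_pt k i)) j\<bar> \<le> C2 * (W * sqrt (Xq k c))"
      by (rule order.trans[OF C2(2)[OF degree_dsl ij(2)] mult_left_mono[OF base[OF ij(1)] C2(1)]])
    then have "\<bar>gauss_wt k i\<bar> * \<bar>dI k (dsl k c (gauss_pt k i)) j\<bar> \<le> V * (C2 * (W * sqrt (Xq k c)))"
      using Vi[OF ij(1)] gauss_wt_pos[OF ij(1)] W0 by (intro mult_mono) auto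
    then show ?thesis by (simp add: abs_mult mult.assoc)
  qed
  let ?C = "S * (C1 * W) + V * (C2 * W)"
  have le: "S * (C1 * W) \<le> ?C" "V * (C2 * W) \<le> ?C" "?C \<ge> 0" using S0 W0 C1(1) C2(1) by auto
  show ?thesis
  proof (intro exI[of _ ?C] conjI allI ballI impI le)
    show "\<bar>poly (dsl k c s) t\<bar> \<le> ?C * sqrt (Xq k c)" if "s \<in> {-1..1}" "t \<in> {-1..1}" for c s t
      by (rule order.trans[OF sup[OF that] mult_right_mono[OF le(1)]]) (simp add: Xq_nonneg)
    show "\<bar>gauss_wt k i * dI k (dsl k c (gauss_pt k i)) j\<bar> \<le> ?C * sqrt (Xq k c)" if "i \<in> {1..k}" "j \<le> k" for c i j
      by (rule order.trans[OF jump[OF that] mult_right_mono[OF le(2)]]) (simp add: Xq_nonneg)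
  qed
qed

section \<open>Reference square and planar vectors\<close>

text \<open>Coordinates adapted to direction d: component d is s, the other one t. As a function of
  t it is a grid line or an edge, so one argument covers both directions.\<close>

definition rp :: "2 \<Rightarrow> real \<Rightarrow> real \<Rightarrow> real^2" where
  "rp d s t = (\<chi> i. if i = d then s else t)"

definition oth :: "2 \<Rightarrow> 2" where "oth d = (if d = 1 then 2 else 1)"

lemma oth_simps [simp]: "oth 1 = 2" "oth 2 = 1" "oth (oth d) = d" "oth d \<noteq> d" "d \<noteq> oth d"
  using exhaust_2[of d] by (auto simp: oth_def)

lemma oth_cases: "i = d \<or> i = oth d" using exhaust_2[of i] exhaust_2[of d] by (auto simp: oth_def)

lemma oth_eq: "i \<noteq> d \<longleftrightarrow> i = oth d" using oth_cases[of i d] by auto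

lemma rp_nth [simp]: "rp d s t $ d = s" "rp d s t $ oth d = t" by (auto simp: rp_def)

lemma all_oth: "(\<forall>i. P i) \<longleftrightarrow> P d \<and> P (oth d)"
proof (intro iffI allI)
  fix i assume "P d \<and> P (oth d)"
  then show "P i" using oth_cases[of i d] by auto
qed auto

lemma vec_eq_oth: "x = y \<longleftrightarrow> x $ d = y $ d \<and> x $ oth d = y $ oth d" for x y :: "'a^2"
  unfolding vec_eq_iff by (rule all_oth)

lemma rp_eq_iff [simp]: "rp d s t = rp d s' t' \<longleftrightarrow> s = s' \<and> t = t'"
  by (subst vec_eq_oth[of _ _ d]) simp

lemma rp_collapse [simp]: "rp d (z $ d) (z $ oth d) = z" by (subst vec_eq_oth[of _ _ d]) simp

lemma rp_oth: "rp (oth d) t s = rp d s t" by (subst vec_eq_oth[of _ _ d]) (use rp_nth[of "oth d" t s] in simp)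

lemma rp_pt: "rp 1 s t = pt s t" "rp 2 s t = pt t s"
  by (auto simp: rp_def vec_eq_iff forall_2)

lemma pt_nth [simp]: "pt x y $ 1 = x" "pt x y $ 2 = y" by auto

lemma ref_square_iff: "x \<in> ref_square \<longleftrightarrow> (\<forall>i. -1 \<le> x $ i \<and> x $ i \<le> 1)"
proof
  assume "\<forall>i. -1 \<le> x $ i \<and> x $ i \<le> 1"
  then have "x = pt (x $ 1) (x $ 2) \<and> x $ 1 \<in> {-1..1} \<and> x $ 2 \<in> {-1..1}" by (simp add: vec_eq_iff forall_2)
  then show "x \<in> ref_square" unfolding ref_square_def by blast
qed (auto simp: ref_square_def forall_2)

lemma rp_in_ref [simp]: "rp d s t \<in> ref_square \<longleftrightarrow> -1 \<le> s \<and> s \<le> 1 \<and> -1 \<le> t \<and> t \<le> 1"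
  unfolding ref_square_iff all_oth[of _ d] by simp

lemma ref_square_cbox: "ref_square = cbox (\<chi> i. -1) (\<chi> i. 1)"
  by (auto simp: ref_square_iff mem_box_cart)

lemma compact_ref: "compact ref_square" and convex_ref: "convex ref_square"
  by (auto simp: ref_square_cbox compact_cbox convex_box)

lemma interior_ref: "interior ref_square = {z. \<forall>i. -1 < z $ i \<and> z $ i < 1}"
  by (auto simp: ref_square_cbox interior_cbox mem_box_cart)

lemma zero_in_ref: "0 \<in> ref_square" by (simp add: ref_square_iff)

lemma norm_rp_diff: "norm (rp d s t - rp d s t') = \<bar>t - t'\<bar>"
proof -
  have "rp d s t - rp d s t' = axis (oth d) (t - t')"
    by (subst vec_eq_oth[of _ _ d]) (auto simp: axis_def)
  then show ?thesis by (simp add: norm_eq_sqrt_inner inner_axis_axis)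
qed

lemma rp_add_axis: "rp d s t + r *\<^sub>R axis (oth d) 1 = rp d s (t + r)"
  by (subst vec_eq_oth[of _ _ d]) (auto simp: axis_def)

lemma line_set_ref:
  assumes "z \<in> ref_square"
  shows "{t. z + t *\<^sub>R axis i 1 \<in> ref_square} = {- 1 - z $ i .. 1 - z $ i}"
proof -
  have "(z + t *\<^sub>R axis i 1) $ j = (if j = i then z $ i + t else z $ j)" for j t
    by (simp add: axis_def)
  then show ?thesis using assms unfolding ref_square_iff by (auto split: if_splits)
qed

text \<open>Even through a boundary point, each axis-parallel line meets the square in a segment of
  length 2, so one-sided derivatives are unique.\<close>

lemma line_within_nontrivial:
  assumes "z \<in> ref_square"
  shows "at 0 within {t. z + t *\<^sub>R axis i 1 \<in> ref_square} \<noteq> (bot :: real filter)"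
proof -
  have z: "-1 \<le> z $ i" "z $ i \<le> 1" using assms by (auto simp: ref_square_iff)
  have "(0::real) islimpt {-1 - z $ i .. 1 - z $ i}"
  proof (rule connected_imp_perfect)
    show "{-1 - z $ i .. 1 - z $ i} \<noteq> {a}" for a by (auto simp: atLeastAtMost_singleton_iff)
  qed (use z in auto)
  then show ?thesis unfolding line_set_ref[OF assms] by (simp add: trivial_limit_within)
qed

lemma pd_ref_eqI:
  assumes "z \<in> ref_square"
    and "((\<lambda>t. f (z + t *\<^sub>R axis i 1)) has_vector_derivative d) (at 0 within {t. z + t *\<^sub>R axis i 1 \<in> ref_square})"
  shows "pd ref_square i f z = d"
  unfolding pd_def using assms line_within_nontrivial by (intro vector_derivative_within) auto

lemma has_derivative_line:
  assumes "(f has_derivative D) (at z within S)"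
  shows "((\<lambda>t. f (z + t *\<^sub>R v)) has_vector_derivative D v) (at 0 within {t. z + t *\<^sub>R v \<in> S})"
proof -
  have "((\<lambda>t. z + t *\<^sub>R v) has_vector_derivative v) (at 0 within {t. z + t *\<^sub>R v \<in> S})"
    by (auto intro!: derivative_eq_intros)
  then have "((f \<circ> (\<lambda>t. z + t *\<^sub>R v)) has_vector_derivative D v) (at 0 within {t. z + t *\<^sub>R v \<in> S})"
    by (rule vector_derivative_diff_chain_within) (use assms in \<open>auto intro: has_derivative_subset\<close>)
  then show ?thesis by (simp add: o_def)
qed

lemma pd_ref_has_derivative:
  assumes "z \<in> ref_square" "(f has_derivative D) (at z within ref_square)"
  shows "pd ref_square i f z = D (axis i 1)"
  using has_derivative_line[OF assms(2)] by (intro pd_ref_eqI assms)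

lemma has_vector_derivative_shift:
  fixes f :: "real^2 \<Rightarrow> 'b :: real_normed_vector"
  assumes "((\<lambda>t. f (y + t0 *\<^sub>R v + t *\<^sub>R v)) has_vector_derivative d) (at 0 within {t. y + t0 *\<^sub>R v + t *\<^sub>R v \<in> S})"
  shows "((\<lambda>t. f (y + t *\<^sub>R v)) has_vector_derivative d) (at t0 within {t. y + t *\<^sub>R v \<in> S})"
proof -
  let ?F = "\<lambda>t. f (y + t0 *\<^sub>R v + t *\<^sub>R v)"
  have e: "y + t0 *\<^sub>R v + (t - t0) *\<^sub>R v = y + t *\<^sub>R v" for t by (simp add: algebra_simps)
  have im: "(\<lambda>t. t - t0) ` {t. y + t *\<^sub>R v \<in> S} \<subseteq> {t. y + t0 *\<^sub>R v + t *\<^sub>R v \<in> S}"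
    by (intro image_subsetI CollectI) (unfold e, simp)
  have "((\<lambda>t. t - t0) has_vector_derivative 1) (at t0 within {t. y + t *\<^sub>R v \<in> S})"
    by (auto intro!: derivative_eq_intros)
  moreover have "(?F has_vector_derivative d) (at (t0 - t0) within (\<lambda>t. t - t0) ` {t. y + t *\<^sub>R v \<in> S})"
    using has_vector_derivative_within_subset[OF assms im] by simp
  ultimately have "((?F \<circ> (\<lambda>t. t - t0)) has_vector_derivative 1 *\<^sub>R d) (at t0 within {t. y + t *\<^sub>R v \<in> S})"
    by (rule vector_diff_chain_within)
  then show ?thesis by (simp only: o_def e scaleR_one)
qed

lemma vector_derivative_bound_interval:
  fixes f :: "real \<Rightarrow> 'b :: real_normed_vector"
  assumes "\<And>t. t \<in> {a..b} \<Longrightarrow> (f has_vector_derivative f' t) (at t within {a..b})"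
    and "\<And>t. t \<in> {a..b} \<Longrightarrow> norm (f' t) \<le> B" "s \<in> {a..b}" "t \<in> {a..b}"
  shows "norm (f t - f s) \<le> B * \<bar>t - s\<bar>"
proof -
  have "norm (f t - f s) \<le> B * norm (t - s)"
  proof (rule differentiable_bound[of "{a..b}" f "\<lambda>t x. x *\<^sub>R f' t"])
    show "(f has_derivative (\<lambda>x. x *\<^sub>R f' t)) (at t within {a..b})" if "t \<in> {a..b}" for t
      using assms(1)[OF that] by (simp add: has_vector_derivative_def)
    show "onorm (\<lambda>x. x *\<^sub>R f' t) \<le> B" if "t \<in> {a..b}" for t
      using assms(2)[OF that] by (simp add: onorm_scaleR_left_lemma onorm_scaleR_left onorm_id)
  qed (use assms in auto)
  then show ?thesis by simp
qed

definition cross :: "real^2 \<Rightarrow> real^2 \<Rightarrow> real" where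
  "cross a b = a $ 1 * b $ 2 - a $ 2 * b $ 1"

lemma cross_bound: "\<bar>cross a b\<bar> \<le> norm a * norm b"
proof -
  have "(cross a b)\<^sup>2 + (a \<bullet> b)\<^sup>2 = (norm a)\<^sup>2 * (norm b)\<^sup>2"
    unfolding power2_norm_eq_inner by (simp add: cross_def inner_vec_def sum_2 power2_eq_square algebra_simps)
  then have "(cross a b)\<^sup>2 \<le> (norm a * norm b)\<^sup>2" by (simp add: power_mult_distrib) (metis le_add_same_cancel1 zero_le_power2)
  then show ?thesis by (simp add: abs_le_square_iff[symmetric] abs_mult)
qed

lemma cross_lagrange: "(cross a b)\<^sup>2 + (a \<bullet> b)\<^sup>2 = (norm a)\<^sup>2 * (norm b)\<^sup>2"
  unfolding power2_norm_eq_inner by (simp add: cross_def inner_vec_def sum_2 power2_eq_square algebra_simps)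

lemma cross_swap: "cross b a = - cross a b" by (simp add: cross_def)

lemma inner_2: "(a :: real^2) \<bullet> b = a $ 1 * b $ 1 + a $ 2 * b $ 2" by (simp add: inner_vec_def sum_2)

section \<open>A single curved element with scaled derivative bounds\<close>

text \<open>What is extracted from shape regularity for one element: tangent vectors of size at most
  h, second derivatives of size h^2 and a Jacobian of size at least h^2. \<open>G\<close> is the
  inverse map. The constants \<open>Cb\<close> and \<open>cJ\<close> will be the same for all
  elements of all meshes.\<close>

locale element =
  fixes \<Psi> G :: "real^2 \<Rightarrow> real^2" and E :: "(real^2) set" and h Cb cJ :: real
  assumes hom: "homeomorphism ref_square E \<Psi> G"
    and d\<Psi>: "\<Psi> differentiable_on ref_square" and dG: "G differentiable_on E"
    and Ck: "Ck_on 2 ref_square \<Psi>"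
    and b1: "\<And>i z. z \<in> ref_square \<Longrightarrow> norm (pd ref_square i \<Psi> z) \<le> Cb * h"
    and b2: "\<And>i j z. z \<in> ref_square \<Longrightarrow> norm (pd ref_square j (pd ref_square i \<Psi>) z) \<le> Cb * h\<^sup>2"
    and J: "\<And>z. z \<in> ref_square \<Longrightarrow> cJ * h\<^sup>2 \<le> \<bar>cross (pd ref_square 1 \<Psi> z) (pd ref_square 2 \<Psi> z)\<bar>"
    and h: "h > 0" and Cb: "Cb > 0" and cJ: "cJ > 0"
begin

abbreviation A :: "2 \<Rightarrow> real^2 \<Rightarrow> real^2" where "A i \<equiv> pd ref_square i \<Psi>"

lemma G\<Psi> [simp]: "z \<in> ref_square \<Longrightarrow> G (\<Psi> z) = z" and \<Psi>_in [simp]: "z \<in> ref_square \<Longrightarrow> \<Psi> z \<in> E"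
  and \<Psi>G [simp]: "x \<in> E \<Longrightarrow> \<Psi> (G x) = x" and G_in [simp]: "x \<in> E \<Longrightarrow> G x \<in> ref_square"
  and cont\<Psi>: "continuous_on ref_square \<Psi>" and contG: "continuous_on E G" and E_eq: "E = \<Psi> ` ref_square"
  using hom unfolding homeomorphism_def by auto

lemma inj\<Psi>: "z \<in> ref_square \<Longrightarrow> z' \<in> ref_square \<Longrightarrow> \<Psi> z = \<Psi> z' \<longleftrightarrow> z = z'"
  by (metis G\<Psi>)

lemma compact_E: "compact E" unfolding E_eq by (rule compact_continuous_image[OF cont\<Psi> compact_ref])

lemma contA: "continuous_on ref_square (A i)"
proof -
  have "length [i] \<le> 2 \<longrightarrow> continuous_on ref_square (pds ref_square [i] \<Psi>)"
    using Ck unfolding Ck_on_def by blast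
  then show ?thesis by simp
qed

lemma derivA:
  assumes z: "z \<in> ref_square"
  shows "((\<lambda>t. A i (z + t *\<^sub>R axis j 1)) has_vector_derivative pd ref_square j (A i) z)
     (at 0 within {t. z + t *\<^sub>R axis j 1 \<in> ref_square})"
proof -
  have "length [i] < 2 \<longrightarrow> (\<forall>j. \<forall>x\<in>ref_square. (\<lambda>t. pds ref_square [i] \<Psi> (x + t *\<^sub>R axis j 1))
      differentiable (at 0 within {t. x + t *\<^sub>R axis j 1 \<in> ref_square}))"
    using Ck unfolding Ck_on_def by blast
  then have "(\<lambda>t. pds ref_square [i] \<Psi> (z + t *\<^sub>R axis j 1)) differentiable (at 0 within {t. z + t *\<^sub>R axis j 1 \<in> ref_square})"
    using z by simp
  then show ?thesis by (simp add: vector_derivative_works pd_def)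
qed

lemma A_axis_lipschitz:
  assumes "z \<in> ref_square" "z + t *\<^sub>R axis j 1 \<in> ref_square"
  shows "norm (A i (z + t *\<^sub>R axis j 1) - A i z) \<le> Cb * h\<^sup>2 * \<bar>t\<bar>"
proof -
  let ?T = "{t. z + t *\<^sub>R axis j 1 \<in> ref_square}"
  have T: "?T = {-1 - z $ j..1 - z $ j}" by (rule line_set_ref[OF assms(1)])
  have "norm (A i (z + t *\<^sub>R axis j 1) - A i (z + 0 *\<^sub>R axis j 1)) \<le> Cb * h\<^sup>2 * \<bar>t - 0\<bar>"
  proof (rule vector_derivative_bound_interval[where f="\<lambda>t. A i (z + t *\<^sub>R axis j 1)"])
    fix s assume "s \<in> {-1 - z $ j..1 - z $ j}"
    then have s: "z + s *\<^sub>R axis j 1 \<in> ref_square" using T by blast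
    show "((\<lambda>t. A i (z + t *\<^sub>R axis j 1)) has_vector_derivative pd ref_square j (A i) (z + s *\<^sub>R axis j 1)) (at s within {-1 - z $ j..1 - z $ j})"
      using has_vector_derivative_shift[OF derivA[OF s]] unfolding T .
    show "norm (pd ref_square j (A i) (z + s *\<^sub>R axis j 1)) \<le> Cb * h\<^sup>2" by (rule b2[OF s])
  qed (use assms in \<open>simp_all add: T[symmetric] ref_square_iff\<close>)
  then show ?thesis by simp
qed

text \<open>The tangent fields are known to be differentiable along the axes, so z and z' are joined
  by two axis-parallel segments; this accounts for the factor 2.\<close>

lemma A_lipschitz:
  assumes "z \<in> ref_square" "z' \<in> ref_square"
  shows "norm (A i z' - A i z) \<le> 2 * Cb * h\<^sup>2 * norm (z' - z)"
proof -
  define y where "y = z + (z' $ 1 - z $ 1) *\<^sub>R axis 1 (1::real)"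
  have y: "y \<in> ref_square" "z' = y + (z' $ 2 - z $ 2) *\<^sub>R axis 2 1"
    using assms by (simp_all add: y_def ref_square_iff forall_2 axis_def vec_eq_iff)
  have c0: "0 \<le> Cb * h\<^sup>2" using Cb by simp
  have "norm (A i y - A i z) \<le> Cb * h\<^sup>2 * \<bar>z' $ 1 - z $ 1\<bar>"
    using A_axis_lipschitz[of z "z' $ 1 - z $ 1" 1 i] assms y(1) unfolding y_def by simp
  moreover have "norm (A i z' - A i y) \<le> Cb * h\<^sup>2 * \<bar>z' $ 2 - z $ 2\<bar>"
    using A_axis_lipschitz[of y "z' $ 2 - z $ 2" 2 i] assms(2) y(1) unfolding y(2)[symmetric] by simp
  moreover have m: "Cb * h\<^sup>2 * \<bar>z' $ j - z $ j\<bar> \<le> Cb * h\<^sup>2 * norm (z' - z)" for j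
    using component_le_norm_cart[of "z' - z" j] c0 by (intro mult_left_mono) auto
  moreover have "norm (A i z' - A i z) \<le> norm (A i z' - A i y) + norm (A i y - A i z)"
    using norm_triangle_ineq[of "A i z' - A i y" "A i y - A i z"] by simp
  ultimately have "norm (A i z' - A i z) \<le> Cb * h\<^sup>2 * norm (z' - z) + Cb * h\<^sup>2 * norm (z' - z)"
    using m[of 1] m[of 2] by linarith
  then show ?thesis by (simp add: mult_ac)
qed

text \<open>Points of the reference square have norm at most 2. As the tangent vectors are of size
  h, the element is affine up to a relative error of order h.\<close>

lemma A_near_0:
  assumes "z \<in> ref_square"
  shows "norm (A i z - A i 0) \<le> 4 * Cb * h\<^sup>2"
proof -
  have "norm z \<le> (\<Sum>j\<in>UNIV. \<bar>z $ j\<bar>)" by (rule norm_le_l1_cart)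
  also have "\<dots> \<le> 2" using assms by (auto simp: sum_2 ref_square_iff forall_2)
  finally have n2: "norm z \<le> 2" .
  then have "2 * Cb * h\<^sup>2 * norm (z - 0) \<le> 2 * Cb * h\<^sup>2 * 2" using Cb by (intro mult_left_mono) auto
  then show ?thesis using A_lipschitz[OF zero_in_ref assms, of i] unfolding diff_0_right by linarith
qed

lemma deriv_ref:
  assumes z: "z \<in> ref_square"
  shows "(\<Psi> has_derivative (\<lambda>v. v $ 1 *\<^sub>R A 1 z + v $ 2 *\<^sub>R A 2 z)) (at z within ref_square)"
proof -
  obtain D where D: "(\<Psi> has_derivative D) (at z within ref_square)"
    using d\<Psi> z unfolding differentiable_on_def differentiable_def by blast
  have ax: "D (axis i 1) = A i z" for i using pd_ref_has_derivative[OF z D] by simp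
  have lin: "linear D" using D has_derivative_linear by blast
  have "D = (\<lambda>v. v $ 1 *\<^sub>R A 1 z + v $ 2 *\<^sub>R A 2 z)"
  proof
    fix v :: "real^2"
    have "v = v $ 1 *\<^sub>R axis 1 1 + v $ 2 *\<^sub>R axis 2 1" by (simp add: vec_eq_iff forall_2 axis_def)
    then have "D v = D (v $ 1 *\<^sub>R axis 1 1 + v $ 2 *\<^sub>R axis 2 1)" by (rule arg_cong)
    then show "D v = v $ 1 *\<^sub>R A 1 z + v $ 2 *\<^sub>R A 2 z"
      by (simp add: linear_add[OF lin] linear_scale[OF lin] ax)
  qed
  with D show ?thesis by simp
qed

lemma line_deriv:
  assumes "-1 \<le> s" "s \<le> 1" "t \<in> {-1..1}"
  shows "((\<lambda>t. \<Psi> (rp d s t)) has_vector_derivative A (oth d) (rp d s t)) (at t within {-1..1})"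
proof -
  have z: "rp d s t \<in> ref_square" using assms by simp
  have ax: "axis (oth d) 1 $ 1 *\<^sub>R A 1 (rp d s t) + axis (oth d) 1 $ 2 *\<^sub>R A 2 (rp d s t) = A (oth d) (rp d s t)"
    using exhaust_2[of d] by (auto simp: axis_def)
  let ?e = "axis (oth d) 1 :: real^2"
  have e: "rp d s 0 + t *\<^sub>R ?e = rp d s t" by (simp add: rp_add_axis)
  have "((\<lambda>r. \<Psi> (rp d s t + r *\<^sub>R ?e)) has_vector_derivative A (oth d) (rp d s t)) (at 0 within {r. rp d s t + r *\<^sub>R ?e \<in> ref_square})"
    using has_derivative_line[OF deriv_ref[OF z], of ?e] unfolding ax .
  then have "((\<lambda>r. \<Psi> (rp d s 0 + r *\<^sub>R ?e)) has_vector_derivative A (oth d) (rp d s t)) (at t within {r. rp d s 0 + r *\<^sub>R ?e \<in> ref_square})"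
    by (intro has_vector_derivative_shift[where f=\<Psi> and y="rp d s 0" and v="?e"]) (simp only: e)
  moreover have "{r. rp d s 0 + r *\<^sub>R axis (oth d) 1 \<in> ref_square} = {-1..1}" using assms by (auto simp: rp_add_axis)
  ultimately show ?thesis by (simp add: rp_add_axis)
qed

lemma line_near:
  assumes "-1 \<le> s" "s \<le> 1" "t \<in> {-1..1}" "t' \<in> {-1..1}"
  shows "norm (\<Psi> (rp d s t') - \<Psi> (rp d s t) - (t' - t) *\<^sub>R A (oth d) 0) \<le> 4 * Cb * h\<^sup>2 * \<bar>t' - t\<bar>"
proof -
  have "norm ((\<Psi> (rp d s t') - t' *\<^sub>R A (oth d) 0) - (\<Psi> (rp d s t) - t *\<^sub>R A (oth d) 0)) \<le> 4 * Cb * h\<^sup>2 * \<bar>t' - t\<bar>"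
  proof (rule vector_derivative_bound_interval[where f="\<lambda>t. \<Psi> (rp d s t) - t *\<^sub>R A (oth d) 0"])
    fix t :: real assume t: "t \<in> {-1..1}"
    show "((\<lambda>t. \<Psi> (rp d s t) - t *\<^sub>R A (oth d) 0) has_vector_derivative (A (oth d) (rp d s t) - A (oth d) 0)) (at t within {-1..1})"
      by (rule derivative_eq_intros line_deriv assms t refl | simp)+
    show "norm (A (oth d) (rp d s t) - A (oth d) 0) \<le> 4 * Cb * h\<^sup>2"
      using assms t by (intro A_near_0) simp
  qed (use assms in auto)
  then show ?thesis by (simp add: algebra_simps)
qed

text \<open>The Jacobian, at least cJ h^2 in size, is at most the product of the lengths of both
  tangent vectors, and the other one is at most Cb h.\<close>

lemma A_lower: assumes "z \<in> ref_square" shows "norm (A i z) \<ge> cJ / Cb * h"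
proof -
  have "cJ * h\<^sup>2 \<le> norm (A 1 z) * norm (A 2 z)" using J[OF assms] cross_bound[of "A 1 z" "A 2 z"] by linarith
  also have "\<dots> = norm (A i z) * norm (A (oth i) z)" using exhaust_2[of i] by auto
  also have "\<dots> \<le> norm (A i z) * (Cb * h)" using b1[OF assms] by (intro mult_left_mono) auto
  finally have "cJ * h \<le> norm (A i z) * Cb" using h by (simp add: power2_eq_square)
  then show ?thesis using Cb by (simp add: field_simps)
qed

lemma \<Psi>_lipschitz:
  assumes "z \<in> ref_square" "z' \<in> ref_square"
  shows "norm (\<Psi> z' - \<Psi> z) \<le> 2 * Cb * h * norm (z' - z)"
proof -
  let ?D = "\<lambda>z v. v $ 1 *\<^sub>R A 1 z + v $ 2 *\<^sub>R A 2 z"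
  have on: "onorm (?D z) \<le> 2 * Cb * h" if z: "z \<in> ref_square" for z
  proof (rule onorm_le)
    fix v
    have "norm (?D z v) \<le> norm (v $ 1 *\<^sub>R A 1 z) + norm (v $ 2 *\<^sub>R A 2 z)" by (rule norm_triangle_ineq)
    also have "\<dots> = \<bar>v $ 1\<bar> * norm (A 1 z) + \<bar>v $ 2\<bar> * norm (A 2 z)" by simp
    also have "\<dots> \<le> norm v * (Cb * h) + norm v * (Cb * h)"
      by (intro add_mono mult_mono b1[OF z] component_le_norm_cart) auto
    finally show "norm (?D z v) \<le> 2 * Cb * h * norm v" by (simp add: algebra_simps)
  qed
  show ?thesis
    by (rule differentiable_bound[where f=\<Psi> and S=ref_square and f'="?D" and B="2 * Cb * h"])
      (use convex_ref deriv_ref on assms in auto)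
qed

end

section \<open>Outward normals and the flux through coordinate lines\<close>

text \<open>Move from x a short way along d = m - n, where m . d = c > 0 and n . d = -c. If the new
  point is in S it contradicts normality of m, otherwise that of n.\<close>

lemma outward_normal_unique:
  assumes "is_outward_normal S x n" "is_outward_normal S x m"
  shows "n = m"
proof (rule ccontr)
  assume ne: "n \<noteq> m"
  have nm: "norm n = 1" "norm m = 1" using assms by (auto simp: is_outward_normal_def)
  define d where "d = m - n"
  define c where "c = (norm d)\<^sup>2 / 2"
  have d0: "norm d > 0" using ne by (simp add: d_def)
  have c0: "c > 0" using d0 by (simp add: c_def)
  have nn: "n \<bullet> n = 1" "m \<bullet> m = 1" using nm by (simp_all add: dot_square_norm)
  have dd: "(norm d)\<^sup>2 = 2 - 2 * (n \<bullet> m)"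
    unfolding d_def power2_norm_eq_inner using nn by (simp add: inner_diff inner_commute algebra_simps)
  have "c = 1 - n \<bullet> m" unfolding c_def dd by simp
  then have nd: "n \<bullet> d = - c" "m \<bullet> d = c"
    unfolding d_def using nn by (simp_all add: inner_diff_right inner_commute)
  define \<epsilon> where "\<epsilon> = c / (2 * norm d)"
  have \<epsilon>: "\<epsilon> > 0" "\<epsilon> * norm d = c / 2" using c0 d0 by (auto simp: \<epsilon>_def)
  obtain \<delta>1 where \<delta>1: "\<delta>1 > 0" "\<And>y. y \<in> ball x \<delta>1 \<Longrightarrow> y \<notin> S \<Longrightarrow> n \<bullet> (y - x) \<ge> - \<epsilon> * norm (y - x)"
    using assms(1) \<epsilon>(1) unfolding is_outward_normal_def by blast
  obtain \<delta>2 where \<delta>2: "\<delta>2 > 0" "\<And>y. y \<in> ball x \<delta>2 \<Longrightarrow> y \<in> S \<Longrightarrow> m \<bullet> (y - x) \<le> \<epsilon> * norm (y - x)"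
    using assms(2) \<epsilon>(1) unfolding is_outward_normal_def by blast
  define s where "s = min \<delta>1 \<delta>2 / (2 * norm d)"
  have s: "s > 0" "s * norm d < \<delta>1" "s * norm d < \<delta>2" using \<delta>1(1) \<delta>2(1) d0 by (auto simp: s_def min_def)
  define y where "y = x + s *\<^sub>R d"
  have y: "y - x = s *\<^sub>R d" "y \<in> ball x \<delta>1" "y \<in> ball x \<delta>2" using s by (auto simp: y_def dist_norm)
  have nrm: "norm (y - x) = s * norm d" using s by (simp add: y)
  show False
  proof (cases "y \<in> S")
    case True
    then have "s * c \<le> \<epsilon> * (s * norm d)" using \<delta>2(2)[OF y(3)] nd(2) unfolding nrm unfolding y(1) by simp
    also have "\<dots> = s * (c / 2)" using \<epsilon>(2) by (metis mult.left_commute)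
    finally show False using s(1) c0 by simp
  next
    case False
    then have "s * (- c) \<ge> - (\<epsilon> * (s * norm d))" using \<delta>1(2)[OF y(2)] nd(1) unfolding nrm unfolding y(1) by simp
    moreover have "\<epsilon> * (s * norm d) = s * (c / 2)" using \<epsilon>(2) by (metis mult.left_commute)
    ultimately show False using s(1) c0 by simp
  qed
qed

lemma outward_normal_eqI: "is_outward_normal S x n \<Longrightarrow> outward_normal S x = n"
  unfolding outward_normal_def using outward_normal_unique by blast

text \<open>Near x the set is a sublevel set of g, and the first-order expansion of g turns it into
  the half plane defined by the gradient N.\<close>

lemma is_outward_normal_level:
  fixes g :: "real^2 \<Rightarrow> real"
  assumes D: "(g has_derivative (\<lambda>v. N \<bullet> v)) (at x)" and N: "N \<noteq> 0"
    and r: "r > 0" "\<And>y. y \<in> ball x r \<Longrightarrow> y \<in> S \<longleftrightarrow> g y \<le> g x"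
  shows "is_outward_normal S x (N /\<^sub>R norm N)"
  unfolding is_outward_normal_def
proof (intro conjI allI impI)
  show "norm (N /\<^sub>R norm N) = 1" using N by simp
  fix \<epsilon> :: real assume \<epsilon>: "\<epsilon> > 0"
  then have "\<epsilon> * norm N > 0" using N by simp
  then obtain d where d: "d > 0" "\<And>y. norm (y - x) < d \<Longrightarrow> norm (g y - g x - N \<bullet> (y - x)) \<le> \<epsilon> * norm N * norm (y - x)"
    using D unfolding has_derivative_at_alt by blast
  show "\<exists>\<delta>>0. \<forall>y\<in>ball x \<delta>. (y \<in> S \<longrightarrow> (N /\<^sub>R norm N) \<bullet> (y - x) \<le> \<epsilon> * norm (y - x)) \<and>
      (y \<notin> S \<longrightarrow> (N /\<^sub>R norm N) \<bullet> (y - x) \<ge> - \<epsilon> * norm (y - x))"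
  proof (intro exI[of _ "min d r"] conjI ballI)
    fix y assume y: "y \<in> ball x (min d r)"
    then have b: "\<bar>g y - g x - N \<bullet> (y - x)\<bar> \<le> \<epsilon> * norm N * norm (y - x)"
      using d(2)[of y] by (simp add: dist_norm norm_minus_commute)
    have e: "(N /\<^sub>R norm N) \<bullet> (y - x) = (N \<bullet> (y - x)) / norm N" by (simp add: divide_inverse mult.commute)
    have le: "(N /\<^sub>R norm N) \<bullet> (y - x) \<le> \<epsilon> * norm (y - x)" if "N \<bullet> (y - x) \<le> \<epsilon> * norm N * norm (y - x)"
      unfolding e using that N by (simp add: divide_le_eq mult.commute mult.left_commute)
    have ge: "(N /\<^sub>R norm N) \<bullet> (y - x) \<ge> - \<epsilon> * norm (y - x)" if "N \<bullet> (y - x) \<ge> - (\<epsilon> * norm N * norm (y - x))"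
      unfolding e using that N by (simp add: le_divide_eq mult.commute mult.left_commute)
    show "(y \<in> S \<longrightarrow> (N /\<^sub>R norm N) \<bullet> (y - x) \<le> \<epsilon> * norm (y - x))"
    proof
      assume "y \<in> S"
      then have "g y \<le> g x" using r(2)[of y] y by auto
      then show "(N /\<^sub>R norm N) \<bullet> (y - x) \<le> \<epsilon> * norm (y - x)" by (intro le) (use b in linarith)
    qed
    show "(y \<notin> S \<longrightarrow> (N /\<^sub>R norm N) \<bullet> (y - x) \<ge> - \<epsilon> * norm (y - x))"
    proof
      assume "y \<notin> S"
      then have "g y > g x" using r(2)[of y] y by auto
      then show "(N /\<^sub>R norm N) \<bullet> (y - x) \<ge> - \<epsilon> * norm (y - x)" by (intro ge) (use b in linarith)
    qed
  qed (use d r in auto)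
qed

lemma grad_has_derivative:
  assumes "(u has_derivative D) (at x)"
  shows "grad u x \<bullet> n = D n"
proof -
  have lin: "linear D" using assms has_derivative_linear by blast
  have "pd UNIV i u x = D (axis i 1)" for i
    using has_derivative_line[of u D x UNIV "axis i 1"] assms by (intro pd_UNIV_eqI) simp
  then have "grad u x \<bullet> n = n $ 1 * D (axis 1 1) + n $ 2 * D (axis 2 1)" by (simp add: grad_def inner_2)
  also have "\<dots> = D (n $ 1 *\<^sub>R axis 1 1 + n $ 2 *\<^sub>R axis 2 1)"
    by (simp add: linear_add[OF lin] linear_scale[OF lin])
  also have "n $ 1 *\<^sub>R axis 1 1 + n $ 2 *\<^sub>R axis 2 1 = n" by (simp add: vec_eq_iff forall_2 axis_def)
  finally show ?thesis .
qed

lemma open_image_injective: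
  fixes f :: "real^2 \<Rightarrow> real^2"
  assumes "continuous_on S f" "inj_on f S" "open U" "U \<subseteq> S"
  shows "open (f ` U)"
  using assms by (intro invariance_of_domain) (auto intro: continuous_on_subset inj_on_subset)

context element
begin

abbreviation jac :: "real^2 \<Rightarrow> real" where "jac z \<equiv> cross (A 1 z) (A 2 z)"

text \<open>The rows of the inverse Jacobian matrix: \<open>N d z\<close> is the gradient at \<Psi>
  z of component d of the inverse map, hence normal to the coordinate line on which this component
  is constant.\<close>

definition N :: "2 \<Rightarrow> real^2 \<Rightarrow> real^2" where
  "N d z = (let b = A (oth d) z in (if d = 1 then 1 else -1) *\<^sub>R pt (b $ 2) (- b $ 1) /\<^sub>R jac z)"

lemma jac_nz: "z \<in> ref_square \<Longrightarrow> jac z \<noteq> 0"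
proof -
  assume "z \<in> ref_square"
  moreover have "cJ * h\<^sup>2 > 0" using h cJ by simp
  ultimately show ?thesis using J[of z] by linarith
qed

lemma A_pos: assumes "z \<in> ref_square" shows "norm (A i z) > 0"
proof -
  have "cJ / Cb * h > 0" using h cJ Cb by simp
  then show ?thesis using A_lower[OF assms, of i] by linarith
qed

lemma inj_on_\<Psi>: "inj_on \<Psi> ref_square" by (auto simp: inj_on_def inj\<Psi>)

lemma open_image: "open U \<Longrightarrow> U \<subseteq> ref_square \<Longrightarrow> open (\<Psi> ` U)"
  by (rule open_image_injective[OF cont\<Psi> inj_on_\<Psi>])

text \<open>Invariance of domain, applied to \<Psi> and to its inverse.\<close>

lemma interior_E: "interior E = \<Psi> ` interior ref_square"
proof (intro equalityI subsetI)
  fix x assume "x \<in> \<Psi> ` interior ref_square"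
  moreover have "open (\<Psi> ` interior ref_square)" by (intro open_image) (auto simp: interior_subset)
  moreover have "\<Psi> ` interior ref_square \<subseteq> E" unfolding E_eq using interior_subset by blast
  ultimately show "x \<in> interior E" by (meson interiorI)
next
  fix x assume x: "x \<in> interior E"
  have "open (G ` interior E)"
  proof (rule open_image_injective)
    show "inj_on G E" by (metis inj_onI \<Psi>G)
  qed (use contG interior_subset in auto)
  moreover have "G ` interior E \<subseteq> ref_square" using interior_subset by fastforce
  ultimately have "G x \<in> interior ref_square" using x by (meson imageI interiorI)
  then show "x \<in> \<Psi> ` interior ref_square" using x interior_subset by (metis \<Psi>G image_eqI subsetD)
qed

text \<open>The chain rule for the identity G \<circ> \<Psi> fixes the derivative of
  \<open>G\<close> on the two tangent vectors, which span the plane.\<close>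

lemma G_derivative:
  assumes z: "z \<in> interior ref_square"
  shows "(G has_derivative (\<lambda>v. \<chi> i. N i z \<bullet> v)) (at (\<Psi> z))"
proof -
  have zr: "z \<in> ref_square" using z interior_subset by blast
  have xE: "\<Psi> z \<in> interior E" unfolding interior_E using z by blast
  then obtain G' where "(G has_derivative G') (at (\<Psi> z) within E)"
    using dG interior_subset unfolding differentiable_on_def differentiable_def by blast
  then have G': "(G has_derivative G') (at (\<Psi> z))"
    unfolding at_within_interior[OF xE] .
  let ?D = "\<lambda>v. v $ 1 *\<^sub>R A 1 z + v $ 2 *\<^sub>R A 2 z"
  have D': "(\<Psi> has_derivative ?D) (at z)" using deriv_ref[OF zr] unfolding at_within_interior[OF z] .
  have "(G \<circ> \<Psi> has_derivative G' \<circ> ?D) (at z)" using diff_chain_at[OF D' G'] .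
  moreover have "(G \<circ> \<Psi> has_derivative (\<lambda>v. v)) (at z)"
  proof (rule has_derivative_transform_eventually[OF has_derivative_ident])
    show "\<forall>\<^sub>F y in at z within UNIV. y = (G \<circ> \<Psi>) y"
      unfolding eventually_at_filter
    proof (rule eventually_mono[OF eventually_nhds_in_open[OF open_interior z]])
      fix y assume "y \<in> interior ref_square"
      then have "y \<in> ref_square" using interior_subset by blast
      then show "y \<noteq> z \<longrightarrow> y \<in> UNIV \<longrightarrow> y = (G \<circ> \<Psi>) y" by simp
    qed
  qed (use zr in auto)
  ultimately have "G' \<circ> ?D = (\<lambda>v. v)" by (rule has_derivative_unique)
  then have GD: "G' (?D v) = v" for v by (simp add: fun_eq_iff)
  have lin: "linear G'" using G' has_derivative_linear by blast
  have j: "jac z \<noteq> 0" by (rule jac_nz[OF zr])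
  have GA: "G' (A i z) = axis i 1" for i
    using GD[of "axis i 1"] exhaust_2[of i] by (auto simp: axis_def)
  have "G' v = (\<chi> i. N i z \<bullet> v)" for v
  proof -
    define a where "a = cross v (A 2 z) / jac z"
    define b where "b = cross (A 1 z) v / jac z"
    \<comment> \<open>Cramer's rule: the expansion of v in the tangent vectors.\<close>
    have "jac z * v $ i = cross v (A 2 z) * A 1 z $ i + cross (A 1 z) v * A 2 z $ i" for i
      using exhaust_2[of i] by (auto simp: cross_def algebra_simps)
    then have "v = a *\<^sub>R A 1 z + b *\<^sub>R A 2 z"
      using j unfolding vec_eq_iff a_def b_def by (simp add: field_simps)
    then have "G' v = G' (a *\<^sub>R A 1 z + b *\<^sub>R A 2 z)" by simp
    also have "\<dots> = a *\<^sub>R axis 1 1 + b *\<^sub>R axis 2 1" by (simp add: linear_add[OF lin] linear_scale[OF lin] GA)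
    finally have *: "G' v = a *\<^sub>R axis 1 1 + b *\<^sub>R axis 2 1" .
    have "G' v $ 1 = a" "G' v $ 2 = b" unfolding * by (auto simp: axis_def)
    moreover have "N 1 z \<bullet> v = a" "N 2 z \<bullet> v = b"
      by (simp_all add: N_def a_def b_def Let_def inner_2 cross_def divide_inverse algebra_simps)
    ultimately show ?thesis by (simp add: vec_eq_iff forall_2)
  qed
  then have "G' = (\<lambda>v. \<chi> i. N i z \<bullet> v)" by auto
  then show ?thesis using G' by simp
qed

lemma N_facts:
  assumes "z \<in> ref_square"
  shows "norm (N d z) = norm (A (oth d) z) / \<bar>jac z\<bar>" "N d z \<noteq> 0"
    "N 1 z \<bullet> N 2 z = - (A 1 z \<bullet> A 2 z) / (jac z)\<^sup>2"
proof -
  have j: "jac z \<noteq> 0" by (rule jac_nz[OF assms])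
  have pn: "norm (pt (b $ 2) (- b $ 1)) = norm b" for b :: "real^2"
    by (simp add: norm_eq_sqrt_inner inner_2 add.commute)
  show n: "norm (N d z) = norm (A (oth d) z) / \<bar>jac z\<bar>"
    using pn[of "A (oth d) z"] by (simp add: N_def Let_def divide_inverse abs_inverse)
  have "norm (A (oth d) z) > 0" by (rule A_pos[OF assms])
  then show "N d z \<noteq> 0" using n j by (metis divide_eq_0_iff abs_eq_0 norm_eq_zero order_less_irrefl)
  show "N 1 z \<bullet> N 2 z = - (A 1 z \<bullet> A 2 z) / (jac z)\<^sup>2"
    by (simp add: N_def Let_def inner_2 divide_inverse power2_eq_square algebra_simps)
qed

lemma N_inner: "z \<in> ref_square \<Longrightarrow> N d z \<bullet> N (oth d) z = - (A 1 z \<bullet> A 2 z) / (jac z)\<^sup>2"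
  using N_facts(3)[of z] exhaust_2[of d] by (auto simp: inner_commute)

lemma normal_at:
  assumes z: "z \<in> interior ref_square" and r: "r > 0" and sgn: "\<sigma> = 1 \<or> \<sigma> = -1"
    and S: "\<And>y. y \<in> ball (\<Psi> z) r \<Longrightarrow> y \<in> S \<longleftrightarrow> \<sigma> * G y $ d \<le> \<sigma> * z $ d"
  shows "outward_normal S (\<Psi> z) = \<sigma> *\<^sub>R (N d z /\<^sub>R norm (N d z))"
proof -
  have zr: "z \<in> ref_square" using z interior_subset by blast
  have "((\<lambda>y. \<sigma> * G y $ d) has_derivative (\<lambda>v. \<sigma> * ((\<chi> i. N i z \<bullet> v) $ d))) (at (\<Psi> z))"
    by (intro has_derivative_mult_right bounded_linear.has_derivative[OF bounded_linear_vec_nth] G_derivative[OF z])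
  then have "((\<lambda>y. \<sigma> * G y $ d) has_derivative (\<lambda>v. (\<sigma> *\<^sub>R N d z) \<bullet> v)) (at (\<Psi> z))" by simp
  then have "is_outward_normal S (\<Psi> z) ((\<sigma> *\<^sub>R N d z) /\<^sub>R norm (\<sigma> *\<^sub>R N d z))"
    using N_facts(2)[OF zr, of d] sgn S zr r by (intro is_outward_normal_level) auto
  then have "outward_normal S (\<Psi> z) = (\<sigma> *\<^sub>R N d z) /\<^sub>R norm (\<sigma> *\<^sub>R N d z)" by (rule outward_normal_eqI)
  then show ?thesis using sgn by auto
qed

lemma composite_derivative:
  assumes z: "z \<in> interior ref_square" and u: "\<And>z. z \<in> ref_square \<Longrightarrow> u (\<Psi> z) = p z"
    and p: "(p has_derivative (\<lambda>v. v $ 1 * p1 + v $ 2 * p2)) (at z)"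
  shows "(u has_derivative (\<lambda>v. (N 1 z \<bullet> v) * p1 + (N 2 z \<bullet> v) * p2)) (at (\<Psi> z))"
proof -
  have zr: "z \<in> ref_square" using z interior_subset by blast
  have xE: "\<Psi> z \<in> interior E" unfolding interior_E using z by blast
  have "(p \<circ> G has_derivative (\<lambda>v. v $ 1 * p1 + v $ 2 * p2) \<circ> (\<lambda>v. \<chi> i. N i z \<bullet> v)) (at (\<Psi> z))"
    using p zr by (intro diff_chain_at G_derivative z) simp
  then have *: "(p \<circ> G has_derivative (\<lambda>v. (N 1 z \<bullet> v) * p1 + (N 2 z \<bullet> v) * p2)) (at (\<Psi> z))" by (simp add: o_def)
  show ?thesis
  proof (rule has_derivative_transform_eventually[OF *])
    show "\<forall>\<^sub>F y in at (\<Psi> z) within UNIV. (p \<circ> G) y = u y"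
      unfolding eventually_at_filter
    proof (rule eventually_mono[OF eventually_nhds_in_open[OF open_interior xE]])
      fix y assume "y \<in> interior E"
      then have "y \<in> E" using interior_subset by blast
      then have "u (\<Psi> (G y)) = p (G y)" by (intro u G_in)
      then show "y \<noteq> \<Psi> z \<longrightarrow> y \<in> UNIV \<longrightarrow> (p \<circ> G) y = u y"
        unfolding \<Psi>G[OF \<open>y \<in> E\<close>] by simp
    qed
    show "(p \<circ> G) (\<Psi> z) = u (\<Psi> z)" using u zr by simp
  qed simp
qed

text \<open>The gradient of u is the combination of the rows \<open>N i z\<close> with the reference
  derivatives as coefficients, and the inner products of these rows are known. The factor
  \<open>norm (A (oth d) z)\<close> in the denominator is the speed of the coordinate line and will
  cancel against arc length.\<close>

lemma flux_density:
  assumes z: "z \<in> interior ref_square" and u: "\<And>z. z \<in> ref_square \<Longrightarrow> u (\<Psi> z) = p z"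
    and p: "(p has_derivative (\<lambda>v. v $ 1 * p' 1 + v $ 2 * p' 2)) (at z)"
  shows "grad u (\<Psi> z) \<bullet> (N d z /\<^sub>R norm (N d z)) =
     ((norm (A (oth d) z))\<^sup>2 * p' d - (A 1 z \<bullet> A 2 z) * p' (oth d)) / (\<bar>jac z\<bar> * norm (A (oth d) z))"
proof -
  have zr: "z \<in> ref_square" using z interior_subset by blast
  let ?n = "N d z /\<^sub>R norm (N d z)"
  let ?a = "norm (A (oth d) z)" and ?j = "jac z"
  have j: "?j \<noteq> 0" by (rule jac_nz[OF zr])
  have a: "?a > 0" by (rule A_pos[OF zr])
  have F1: "N d z \<bullet> ?n = ?a / \<bar>?j\<bar>"
    unfolding N_facts(1)[OF zr, symmetric] using N_facts(2)[OF zr, of d] by (simp add: dot_square_norm power2_eq_square)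
  have F2: "N (oth d) z \<bullet> ?n = (- (A 1 z \<bullet> A 2 z) / ?j\<^sup>2) / (?a / \<bar>?j\<bar>)"
    unfolding N_facts(1)[OF zr, symmetric] N_inner[OF zr, of d, symmetric] by (simp add: inner_commute divide_inverse mult.commute)
  have "grad u (\<Psi> z) \<bullet> ?n = (N 1 z \<bullet> ?n) * p' 1 + (N 2 z \<bullet> ?n) * p' 2"
    by (rule grad_has_derivative[OF composite_derivative[OF z u p]])
  also have "\<dots> = (N d z \<bullet> ?n) * p' d + (N (oth d) z \<bullet> ?n) * p' (oth d)"
    using exhaust_2[of d] by auto
  also have "\<dots> = ?a / \<bar>?j\<bar> * p' d + (- (A 1 z \<bullet> A 2 z) / ?j\<^sup>2) / (?a / \<bar>?j\<bar>) * p' (oth d)"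
    unfolding F1 F2 ..
  also have "?a / \<bar>?j\<bar> * p' d + (- (A 1 z \<bullet> A 2 z) / ?j\<^sup>2) / (?a / \<bar>?j\<bar>) * p' (oth d)
     = (?a\<^sup>2 * p' d - (A 1 z \<bullet> A 2 z) * p' (oth d)) / (\<bar>?j\<bar> * ?a)"
  proof -
    have "?j\<^sup>2 = \<bar>?j\<bar> * \<bar>?j\<bar>" by (simp add: power2_eq_square)
    then show ?thesis using j a by (simp add: field_simps power2_eq_square)
  qed
  finally show ?thesis .
qed

text \<open>Taking the gradient itself as direction turns the derivative formula into its squared
  norm; the rows \<open>N\<close> have norm at most (Cb h) / (cJ h^2).\<close>

lemma grad_bound:
  assumes z: "z \<in> interior ref_square" and u: "\<And>z. z \<in> ref_square \<Longrightarrow> u (\<Psi> z) = p z"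
    and p: "(p has_derivative (\<lambda>v. v $ 1 * p' 1 + v $ 2 * p' 2)) (at z)"
    and S: "\<And>i :: 2. \<bar>p' i\<bar> \<le> S"
  shows "norm (grad u (\<Psi> z)) \<le> 2 * Cb / cJ / h * S"
proof -
  have zr: "z \<in> ref_square" using z interior_subset by blast
  have nN: "norm (N d z) \<le> Cb / cJ / h" for d
  proof -
    have "norm (N d z) \<le> (Cb * h) / (cJ * h\<^sup>2)"
      unfolding N_facts(1)[OF zr] using b1[OF zr, of "oth d"] J[OF zr] h cJ Cb by (intro frac_le) auto
    then show ?thesis using h cJ by (simp add: power2_eq_square field_simps)
  qed
  have S0: "S \<ge> 0" using S[of 1] by linarith
  let ?g = "grad u (\<Psi> z)"
  have "(norm ?g)\<^sup>2 = ?g \<bullet> ?g" by (simp add: dot_square_norm)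
  also have "\<dots> = (N 1 z \<bullet> ?g) * p' 1 + (N 2 z \<bullet> ?g) * p' 2"
    by (rule grad_has_derivative[OF composite_derivative[OF z u p]])
  also have "\<dots> \<le> (Cb / cJ / h * norm ?g) * S + (Cb / cJ / h * norm ?g) * S"
  proof -
    have "(N d z \<bullet> ?g) * p' d \<le> (Cb / cJ / h * norm ?g) * S" for d
    proof -
      have "\<bar>N d z \<bullet> ?g\<bar> \<le> norm (N d z) * norm ?g" by (rule Cauchy_Schwarz_ineq2)
      also have "\<dots> \<le> Cb / cJ / h * norm ?g" by (intro mult_right_mono nN) simp
      finally have "\<bar>N d z \<bullet> ?g\<bar> * \<bar>p' d\<bar> \<le> (Cb / cJ / h * norm ?g) * S"
        using S[of d] Cb cJ h by (intro mult_mono) auto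
      then show ?thesis unfolding abs_mult[symmetric] by linarith
    qed
    then show ?thesis by (intro add_mono)
  qed
  finally have "norm ?g * norm ?g \<le> norm ?g * (2 * Cb / cJ / h * S)" by (simp add: power2_eq_square algebra_simps)
  show ?thesis
  proof (cases "norm ?g > 0")
    case True
    then show ?thesis using mult_left_le_imp_le[OF \<open>norm ?g * norm ?g \<le> norm ?g * (2 * Cb / cJ / h * S)\<close>] by simp
  next
    case False
    moreover have "0 \<le> 2 * Cb / cJ / h * S" using S0 Cb cJ h by simp
    ultimately show ?thesis by linarith
  qed
qed

end

section \<open>Freezing the flux coefficients at the element centre\<close>

text \<open>Possible values of the diffusion coefficient and of the two tangent vectors divided by
  h. The set is compact and independent of the mesh, and the flux coefficients \<open>coef1\<close>
  (normal) and \<open>coef2\<close> (tangential) are continuous on it, so boundedness and uniform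
  continuity come for free.\<close>

definition coef_set :: "real \<Rightarrow> real \<Rightarrow> real \<Rightarrow> (real \<times> (real^2) \<times> (real^2)) set" where
  "coef_set M C c = {(\<kappa>, a, b). \<bar>\<kappa>\<bar> \<le> M \<and> norm a \<le> C \<and> norm b \<le> C \<and> c \<le> \<bar>cross a b\<bar>}"

definition coef1 :: "real \<times> (real^2) \<times> (real^2) \<Rightarrow> real" where
  "coef1 = (\<lambda>(\<kappa>, a, b). \<kappa> * norm b / \<bar>cross a b\<bar>)"

definition coef2 :: "real \<times> (real^2) \<times> (real^2) \<Rightarrow> real" where
  "coef2 = (\<lambda>(\<kappa>, a, b). - \<kappa> * (a \<bullet> b) / (\<bar>cross a b\<bar> * norm b))"

lemma coef_set_nz:
  assumes "c > 0" "p \<in> coef_set M C c"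
  shows "\<bar>cross (fst (snd p)) (snd (snd p))\<bar> \<noteq> 0" "norm (snd (snd p)) \<noteq> 0"
proof -
  show 1: "\<bar>cross (fst (snd p)) (snd (snd p))\<bar> \<noteq> 0" using assms by (auto simp: coef_set_def)
  then show "norm (snd (snd p)) \<noteq> 0" by (auto simp: cross_def)
qed

lemma compact_coef_set: "compact (coef_set M C c)"
proof -
  have "coef_set M C c = {p. \<bar>fst p\<bar> \<le> M} \<inter> ({p. norm (fst (snd p)) \<le> C} \<inter> ({p. norm (snd (snd p)) \<le> C}
      \<inter> {p. c \<le> \<bar>cross (fst (snd p)) (snd (snd p))\<bar>}))"
    by (auto simp: coef_set_def)
  moreover have "closed \<dots>"
    unfolding cross_def by (intro closed_Int closed_Collect_le continuous_intros)
  ultimately have "closed (coef_set M C c)" by simp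
  moreover have "coef_set M C c \<subseteq> cball 0 M \<times> (cball 0 C \<times> cball 0 C)" by (auto simp: coef_set_def)
  then have "bounded (coef_set M C c)"
    by (rule bounded_subset[rotated]) (intro bounded_Times bounded_cball)
  ultimately show ?thesis by (simp add: compact_eq_bounded_closed)
qed

lemma coef_continuous:
  assumes "c > 0"
  shows "continuous_on (coef_set M C c) coef1" "continuous_on (coef_set M C c) coef2"
proof -
  have cr: "continuous_on S (\<lambda>p. cross (fst (snd p)) (snd (snd p)))" for S :: "(real \<times> (real^2) \<times> (real^2)) set"
    unfolding cross_def by (intro continuous_intros)
  show "continuous_on (coef_set M C c) coef1" unfolding coef1_def split_beta
    using coef_set_nz[OF assms] by (intro continuous_intros cr ballI) auto
  show "continuous_on (coef_set M C c) coef2" unfolding coef2_def split_beta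
    using coef_set_nz[OF assms] by (intro continuous_intros cr ballI) auto
qed

lemma coef_bound:
  assumes "c > 0"
  shows "\<exists>B\<ge>0. \<forall>p\<in>coef_set M C c. \<bar>coef1 p\<bar> \<le> B \<and> \<bar>coef2 p\<bar> \<le> B"
proof -
  have "bounded (coef1 ` coef_set M C c)" "bounded (coef2 ` coef_set M C c)"
    by (intro compact_imp_bounded compact_continuous_image coef_continuous[OF assms] compact_coef_set)+
  then obtain B1 B2 where B: "\<forall>p\<in>coef_set M C c. \<bar>coef1 p\<bar> \<le> B1" "\<forall>p\<in>coef_set M C c. \<bar>coef2 p\<bar> \<le> B2"
    unfolding bounded_iff by auto
  show ?thesis
  proof (intro exI[of _ "\<bar>B1\<bar> + \<bar>B2\<bar>"] conjI ballI)
    fix p assume "p \<in> coef_set M C c"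
    then have "\<bar>coef1 p\<bar> \<le> B1" "\<bar>coef2 p\<bar> \<le> B2" using B by auto
    then show "\<bar>coef1 p\<bar> \<le> \<bar>B1\<bar> + \<bar>B2\<bar>" "\<bar>coef2 p\<bar> \<le> \<bar>B1\<bar> + \<bar>B2\<bar>" by linarith+
  qed simp
qed

definition coef_modulus :: "real \<Rightarrow> real \<Rightarrow> real \<Rightarrow> real \<Rightarrow> real \<Rightarrow> bool" where
  "coef_modulus M C c \<delta> \<epsilon> \<longleftrightarrow> (\<forall>p\<in>coef_set M C c. \<forall>q\<in>coef_set M C c. dist p q < \<delta> \<longrightarrow>
     \<bar>coef1 p - coef1 q\<bar> \<le> \<epsilon> \<and> \<bar>coef2 p - coef2 q\<bar> \<le> \<epsilon>)"

lemma coef_modulus_exists: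
  assumes "c > 0" "\<epsilon> > 0"
  shows "\<exists>\<delta>>0. coef_modulus M C c \<delta> \<epsilon>"
proof -
  have u: "uniformly_continuous_on (coef_set M C c) coef1" "uniformly_continuous_on (coef_set M C c) coef2"
    by (intro compact_uniformly_continuous coef_continuous[OF assms(1)] compact_coef_set)+
  obtain d1 where d1: "d1 > 0" "\<forall>p\<in>coef_set M C c. \<forall>q\<in>coef_set M C c. dist q p < d1 \<longrightarrow> dist (coef1 q) (coef1 p) < \<epsilon>"
    using u(1) assms(2) unfolding uniformly_continuous_on_def by blast
  obtain d2 where d2: "d2 > 0" "\<forall>p\<in>coef_set M C c. \<forall>q\<in>coef_set M C c. dist q p < d2 \<longrightarrow> dist (coef2 q) (coef2 p) < \<epsilon>"
    using u(2) assms(2) unfolding uniformly_continuous_on_def by blast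
  have "coef_modulus M C c (min d1 d2) \<epsilon>"
    unfolding coef_modulus_def
  proof (intro ballI impI conjI)
    fix p q assume pq: "p \<in> coef_set M C c" "q \<in> coef_set M C c" "dist p q < min d1 d2"
    have "dist (coef1 p) (coef1 q) < \<epsilon>" using d1(2)[rule_format, OF pq(2,1)] pq(3) by simp
    then show "\<bar>coef1 p - coef1 q\<bar> \<le> \<epsilon>" by (simp add: dist_real_def)
    have "dist (coef2 p) (coef2 q) < \<epsilon>" using d2(2)[rule_format, OF pq(2,1)] pq(3) by simp
    then show "\<bar>coef2 p - coef2 q\<bar> \<le> \<epsilon>" by (simp add: dist_real_def)
  qed
  then show ?thesis using d1(1) d2(1) by (intro exI[of _ "min d1 d2"]) auto
qed

lemma dist_triple_le:
  fixes a a' :: "'a :: real_normed_vector" and b b' :: "'b :: real_normed_vector" and k k' :: real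
  shows "dist (k, a, b) (k', a', b') \<le> \<bar>k - k'\<bar> + (norm (a - a') + norm (b - b'))"
proof -
  have "dist (k, a, b) (k', a', b') \<le> dist k k' + dist (a, b) (a', b')"
    unfolding dist_Pair_Pair[of k] by (rule sqrt_sum_squares_le_sum) auto
  moreover have "dist (a, b) (a', b') \<le> dist a a' + dist b b'"
    unfolding dist_Pair_Pair by (rule sqrt_sum_squares_le_sum) auto
  ultimately show ?thesis by (simp add: dist_real_def dist_norm)
qed

lemma cont_rp: "continuous_on T (rp d s)"
proof -
  have "continuous_on T (\<lambda>t. if i = d then s else t)" for i by (cases "i = d") auto
  then show ?thesis unfolding rp_def[abs_def] by (intro continuous_on_vec_lambda)
qed

context element
begin

definition fl :: "(real^2 \<Rightarrow> real) \<Rightarrow> (2 \<Rightarrow> real^2 \<Rightarrow> real) \<Rightarrow> 2 \<Rightarrow> real^2 \<Rightarrow> real" where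
  "fl \<kappa> p' d x = \<kappa> x * (((norm (A (oth d) (G x)))\<^sup>2 * p' d (G x) - (A 1 (G x) \<bullet> A 2 (G x)) * p' (oth d) (G x))
      / (\<bar>jac (G x)\<bar> * norm (A (oth d) (G x))))"

text \<open>With J the Jacobian matrix at the centre, \<open>\<beta>c\<close> is a diagonal and
  \<open>\<gamma>c\<close> the off-diagonal entry of \<kappa> |det J| J^{-1} J^{-T}, the coefficient
  matrix of the operator pulled back to the square.\<close>

definition \<beta>c :: "(real^2 \<Rightarrow> real) \<Rightarrow> 2 \<Rightarrow> real" where
  "\<beta>c \<kappa> d = \<kappa> (\<Psi> 0) * (norm (A (oth d) 0))\<^sup>2 / \<bar>jac 0\<bar>"
definition \<gamma>c :: "(real^2 \<Rightarrow> real) \<Rightarrow> real" where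
  "\<gamma>c \<kappa> = - \<kappa> (\<Psi> 0) * (A 1 0 \<bullet> A 2 0) / \<bar>jac 0\<bar>"

text \<open>Dividing the tangent vectors by h brings them into the fixed compact set; the flux
  coefficients are homogeneous of degree -1 in the tangent vectors, so this costs a factor h
  only.\<close>

definition Pc :: "(real^2 \<Rightarrow> real) \<Rightarrow> 2 \<Rightarrow> real^2 \<Rightarrow> real \<times> (real^2) \<times> (real^2)" where
  "Pc \<kappa> d z = (\<kappa> (\<Psi> z), (1/h) *\<^sub>R A d z, (1/h) *\<^sub>R A (oth d) z)"

lemma cross_scaled: "cross ((1/h) *\<^sub>R a) ((1/h) *\<^sub>R b) = cross a b / h\<^sup>2"
  by (simp add: cross_def power2_eq_square diff_divide_distrib)

lemma cross_d: "\<bar>cross (A d z) (A (oth d) z)\<bar> = \<bar>jac z\<bar>" "A d z \<bullet> A (oth d) z = A 1 z \<bullet> A 2 z"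
  using exhaust_2[of d] cross_swap[of "A 1 z" "A 2 z"] by (auto simp: inner_commute)

lemma Pc_in: assumes "z \<in> ref_square" "\<bar>\<kappa> (\<Psi> z)\<bar> \<le> M" shows "Pc \<kappa> d z \<in> coef_set M Cb cJ"
proof -
  have "norm ((1/h) *\<^sub>R A i z) \<le> Cb" for i
    using b1[OF assms(1), of i] h by (simp add: field_simps)
  moreover have "cJ \<le> \<bar>cross (A d z) (A (oth d) z) / h\<^sup>2\<bar>"
    using J[OF assms(1)] h cross_d(1)[of d z] by (simp add: field_simps)
  ultimately show ?thesis using assms(2) by (simp add: Pc_def coef_set_def cross_scaled)
qed

lemma coef_Pc:
  "coef1 (Pc \<kappa> d z) = h * (\<kappa> (\<Psi> z) * norm (A (oth d) z) / \<bar>jac z\<bar>)"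
  "coef2 (Pc \<kappa> d z) = h * (- \<kappa> (\<Psi> z) * (A 1 z \<bullet> A 2 z) / (\<bar>jac z\<bar> * norm (A (oth d) z)))"
proof -
  have c: "\<bar>cross ((1/h) *\<^sub>R A d z) ((1/h) *\<^sub>R A (oth d) z)\<bar> = \<bar>jac z\<bar> / h\<^sup>2"
    unfolding cross_scaled using cross_d(1)[of d z] by (simp add: abs_divide)
  have i: "((1/h) *\<^sub>R A d z) \<bullet> ((1/h) *\<^sub>R A (oth d) z) = (A 1 z \<bullet> A 2 z) / h\<^sup>2"
    using cross_d(2)[of d z] by (simp add: power2_eq_square)
  have n: "norm ((1/h) *\<^sub>R A (oth d) z) = norm (A (oth d) z) / h" using h by simp
  show "coef1 (Pc \<kappa> d z) = h * (\<kappa> (\<Psi> z) * norm (A (oth d) z) / \<bar>jac z\<bar>)"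
    unfolding coef1_def Pc_def prod.case c n using h by (simp add: field_simps power2_eq_square)
  show "coef2 (Pc \<kappa> d z) = h * (- \<kappa> (\<Psi> z) * (A 1 z \<bullet> A 2 z) / (\<bar>jac z\<bar> * norm (A (oth d) z)))"
    unfolding coef2_def Pc_def prod.case c n i using h by (simp add: field_simps power2_eq_square)
qed

lemma fl_coef:
  assumes "z \<in> ref_square"
  shows "fl \<kappa> p' d (\<Psi> z) = (coef1 (Pc \<kappa> d z) * p' d z + coef2 (Pc \<kappa> d z) * p' (oth d) z) / h"
proof -
  have "norm (A (oth d) z) \<noteq> 0" "\<bar>jac z\<bar> \<noteq> 0" using A_pos[OF assms, of "oth d"] jac_nz[OF assms] by auto
  then show ?thesis unfolding fl_def G\<Psi>[OF assms] coef_Pc using h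
    by (simp add: field_simps power2_eq_square)
qed

lemma coef_at_0:
  "norm (A (oth d) 0) / h * coef1 (Pc \<kappa> d 0) = \<beta>c \<kappa> d"
  "norm (A (oth d) 0) / h * coef2 (Pc \<kappa> d 0) = \<gamma>c \<kappa>"
proof -
  have "norm (A (oth d) 0) \<noteq> 0" using A_pos[OF zero_in_ref, of "oth d"] by auto
  then show "norm (A (oth d) 0) / h * coef1 (Pc \<kappa> d 0) = \<beta>c \<kappa> d"
    "norm (A (oth d) 0) / h * coef2 (Pc \<kappa> d 0) = \<gamma>c \<kappa>"
    unfolding coef_Pc \<beta>c_def \<gamma>c_def using h by (simp_all add: power2_eq_square)
qed

lemma Pc_dist:
  assumes z: "z \<in> ref_square" and "\<bar>\<kappa> (\<Psi> z) - \<kappa> (\<Psi> 0)\<bar> \<le> \<omega>"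
  shows "dist (Pc \<kappa> d z) (Pc \<kappa> d 0) \<le> \<omega> + 8 * Cb * h"
proof -
  have "norm ((1/h) *\<^sub>R A i z - (1/h) *\<^sub>R A i 0) \<le> 4 * Cb * h" for i
  proof -
    have "norm ((1/h) *\<^sub>R A i z - (1/h) *\<^sub>R A i 0) = norm (A i z - A i 0) / h"
      using h by (simp add: scaleR_diff_right[symmetric])
    also have "\<dots> \<le> (4 * Cb * h\<^sup>2) / h" using A_near_0[OF z, of i] h by (intro divide_right_mono) auto
    finally show ?thesis using h by (simp add: power2_eq_square)
  qed
  from this[of d] this[of "oth d"] show ?thesis unfolding Pc_def
    using assms(2) by (intro order.trans[OF dist_triple_le]) linarith
qed

lemma contG_comp: "continuous_on ref_square f \<Longrightarrow> continuous_on E (\<lambda>x. f (G x))"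
  using continuous_on_compose2[OF _ contG] by fastforce

lemma cont_fl:
  assumes "continuous_on E \<kappa>" "\<And>i. continuous_on ref_square (p' i)"
  shows "continuous_on E (fl \<kappa> p' d)"
proof -
  have nz: "\<forall>x\<in>E. \<bar>jac (G x)\<bar> * norm (A (oth d) (G x)) \<noteq> 0"
    using jac_nz[OF G_in] A_pos[OF G_in, of _ "oth d"] by (auto simp: less_le)
  have A: "continuous_on E (\<lambda>x. A i (G x))" for i by (intro contG_comp contA)
  show ?thesis unfolding fl_def[abs_def] cross_def
    using nz unfolding cross_def by (intro continuous_intros assms A contG_comp)
qed

lemma line_image: "\<Psi> ` rp d s ` T = (\<lambda>t. \<Psi> (rp d s t)) ` T" by (simp add: image_image)

lemma small_h: "4 * Cb\<^sup>2 * h < cJ \<Longrightarrow> 4 * Cb * h\<^sup>2 < norm (A i 0)"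
proof -
  assume "4 * Cb\<^sup>2 * h < cJ"
  then have "4 * Cb\<^sup>2 * h * (h / Cb) < cJ * (h / Cb)" using h Cb by (intro mult_strict_right_mono) auto
  moreover have "4 * Cb\<^sup>2 * h * (h / Cb) = 4 * Cb * h\<^sup>2" using Cb by (simp add: power2_eq_square)
  ultimately show ?thesis using A_lower[OF zero_in_ref, of i] by simp
qed

text \<open>\<open>F\<close> bounds the integrand and \<open>D\<close> its distance to a model g.
  The first error term comes from replacing the speed of the curve by its value at the centre, the
  second from replacing f by g; parameter intervals have length at most 2.\<close>

lemma line_integral_approx:
  assumes st: "-1 \<le> s" "s \<le> 1" "-1 \<le> t1" "t1 \<le> t2" "t2 \<le> 1" and hs: "4 * Cb\<^sup>2 * h < cJ"
    and f: "continuous_on E f" and F: "\<And>t. t \<in> {-1..1} \<Longrightarrow> \<bar>f (\<Psi> (rp d s t))\<bar> \<le> F"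
    and g: "continuous_on {t1..t2} g" and fg: "\<And>t. t \<in> {t1..t2} \<Longrightarrow> \<bar>f (\<Psi> (rp d s t)) - g t\<bar> \<le> D"
  shows "set_integrable arc_measure (\<Psi> ` rp d s ` {t1..t2}) f"
    and "\<bar>(LINT x:\<Psi> ` rp d s ` {t1..t2}|arc_measure. f x) - norm (A (oth d) 0) * integral {t1..t2} g\<bar>
       \<le> 8 * Cb * h\<^sup>2 * F + 2 * Cb * h * D"
proof -
  let ?\<gamma> = "\<lambda>t. \<Psi> (rp d s t)"
  let ?w = "A (oth d) 0"
  have sub: "?\<gamma> ` {t1..t2} \<subseteq> E" using st by auto
  have near: "norm (?\<gamma> t - ?\<gamma> t' - (t - t') *\<^sub>R ?w) \<le> 4 * Cb * h\<^sup>2 * \<bar>t - t'\<bar>" if "t' \<in> {t1..t2}" "t \<in> {t1..t2}" for t t'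
    using that st by (intro line_near) auto
  have fc: "continuous_on (?\<gamma> ` {t1..t2}) f" by (rule continuous_on_subset[OF f sub])
  have F0: "F \<ge> 0" using F[of 0] by simp
  have D0: "D \<ge> 0" using fg[of t1] st by (meson abs_ge_zero atLeastAtMost_iff order.refl order.trans)
  have e0: "0 \<le> 4 * Cb * h\<^sup>2" using Cb by simp
  note arc = arc_integral_approx[OF st(4) e0 small_h[OF hs] near fc, of F, simplified]
  show "set_integrable arc_measure (\<Psi> ` rp d s ` {t1..t2}) f"
    unfolding line_image by (rule arc(1)) (use F st in auto)
  have 1: "\<bar>(LINT x:?\<gamma> ` {t1..t2}|arc_measure. f x) - norm ?w * integral {t1..t2} (\<lambda>t. f (?\<gamma> t))\<bar> \<le> 4 * Cb * h\<^sup>2 * F * (t2 - t1)"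
    by (rule arc(2)) (use F st in auto)
  have "4 * Cb * h\<^sup>2 * F * (t2 - t1) \<le> 4 * Cb * h\<^sup>2 * F * 2" using st F0 Cb by (intro mult_left_mono) auto
  then have 1: "\<bar>(LINT x:?\<gamma> ` {t1..t2}|arc_measure. f x) - norm ?w * integral {t1..t2} (\<lambda>t. f (?\<gamma> t))\<bar> \<le> 8 * Cb * h\<^sup>2 * F"
    using 1 by linarith
  have c\<gamma>: "continuous_on {t1..t2} ?\<gamma>"
    using st by (intro continuous_on_compose2[OF cont\<Psi> cont_rp]) auto
  have cf\<gamma>: "continuous_on {t1..t2} (\<lambda>t. f (?\<gamma> t))" using continuous_on_compose[OF c\<gamma> fc] by (simp add: o_def)
  have "norm (integral {t1..t2} (\<lambda>t. f (?\<gamma> t) - g t)) \<le> D * (t2 - t1)"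
    using fg st by (intro integral_bound continuous_intros cf\<gamma> g) auto
  also have "\<dots> \<le> D * 2" using D0 st by (intro mult_left_mono) auto
  also have "integral {t1..t2} (\<lambda>t. f (?\<gamma> t) - g t) = integral {t1..t2} (\<lambda>t. f (?\<gamma> t)) - integral {t1..t2} g"
    by (intro integral_diff integrable_continuous_interval cf\<gamma> g)
  finally have "norm ?w * \<bar>integral {t1..t2} (\<lambda>t. f (?\<gamma> t)) - integral {t1..t2} g\<bar> \<le> (Cb * h) * (D * 2)"
    using b1[OF zero_in_ref, of "oth d"] Cb h by (intro mult_mono) auto
  then have 2: "\<bar>norm ?w * integral {t1..t2} (\<lambda>t. f (?\<gamma> t)) - norm ?w * integral {t1..t2} g\<bar> \<le> 2 * Cb * h * D"
    unfolding right_diff_distrib[symmetric] abs_mult by (simp add: algebra_simps)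
  show "\<bar>(LINT x:\<Psi> ` rp d s ` {t1..t2}|arc_measure. f x) - norm ?w * integral {t1..t2} g\<bar>
       \<le> 8 * Cb * h\<^sup>2 * F + 2 * Cb * h * D"
    unfolding line_image using 1 2 by linarith
qed

text \<open>The flux density is at most 2 B S / h, and freezing changes it by at most 2 \<epsilon> S
  / h. The powers of h in the line integral estimate compensate the denominators, and S is left with
  a factor that is small with h and \<epsilon>.\<close>

lemma flux_integral_approx:
  assumes st: "-1 \<le> s" "s \<le> 1" "-1 \<le> t1" "t1 \<le> t2" "t2 \<le> 1" and hs: "4 * Cb\<^sup>2 * h < cJ"
    and \<kappa>: "continuous_on E \<kappa>" "\<And>x. x \<in> E \<Longrightarrow> \<bar>\<kappa> x\<bar> \<le> M" "\<And>x. x \<in> E \<Longrightarrow> \<bar>\<kappa> x - \<kappa> (\<Psi> 0)\<bar> \<le> \<omega>"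
    and p': "\<And>i. continuous_on ref_square (p' i)" "\<And>i z. z \<in> ref_square \<Longrightarrow> \<bar>p' i z\<bar> \<le> S"
    and B: "B \<ge> 0" "\<And>p. p \<in> coef_set M Cb cJ \<Longrightarrow> \<bar>coef1 p\<bar> \<le> B \<and> \<bar>coef2 p\<bar> \<le> B"
    and md: "coef_modulus M Cb cJ \<delta> \<epsilon>" "\<omega> + 8 * Cb * h < \<delta>"
  shows "set_integrable arc_measure (\<Psi> ` rp d s ` {t1..t2}) (fl \<kappa> p' d)" (is ?I)
    and "\<bar>(LINT x:\<Psi> ` rp d s ` {t1..t2}|arc_measure. fl \<kappa> p' d x)
       - integral {t1..t2} (\<lambda>t. \<beta>c \<kappa> d * p' d (rp d s t) + \<gamma>c \<kappa> * p' (oth d) (rp d s t))\<bar>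
       \<le> (16 * Cb * B * h + 4 * Cb * \<epsilon>) * S" (is ?A)
proof -
  have S0: "S \<ge> 0" using p'(2)[OF zero_in_ref, of 1] by linarith
  let ?g = "\<lambda>t. (coef1 (Pc \<kappa> d 0) * p' d (rp d s t) + coef2 (Pc \<kappa> d 0) * p' (oth d) (rp d s t)) / h"
  have Pin: "Pc \<kappa> d z \<in> coef_set M Cb cJ" if "z \<in> ref_square" for z
    by (rule Pc_in[of z \<kappa> M, OF that \<kappa>(2)[OF \<Psi>_in[OF that]]])
  have F: "\<bar>fl \<kappa> p' d (\<Psi> z)\<bar> \<le> 2 * B * S / h" if z: "z \<in> ref_square" for z
  proof -
    have "\<bar>coef1 (Pc \<kappa> d z) * p' d z + coef2 (Pc \<kappa> d z) * p' (oth d) z\<bar> \<le> B * S + B * S"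
      using B(2)[OF Pin[OF z]] p'(2)[OF z] B(1)
      by (intro order.trans[OF abs_triangle_ineq] add_mono) (auto simp: abs_mult intro!: mult_mono)
    then show ?thesis unfolding fl_coef[OF z] using h by (simp add: abs_divide divide_right_mono)
  qed
  have Dg: "\<bar>fl \<kappa> p' d (\<Psi> z) - (coef1 (Pc \<kappa> d 0) * p' d z + coef2 (Pc \<kappa> d 0) * p' (oth d) z) / h\<bar> \<le> 2 * \<epsilon> * S / h"
    if z: "z \<in> ref_square" for z
  proof -
    have "dist (Pc \<kappa> d z) (Pc \<kappa> d 0) < \<delta>"
      using Pc_dist[OF z \<kappa>(3)[OF \<Psi>_in[OF z]]] md(2) by (rule le_less_trans)
    then have c: "\<bar>coef1 (Pc \<kappa> d z) - coef1 (Pc \<kappa> d 0)\<bar> \<le> \<epsilon>" "\<bar>coef2 (Pc \<kappa> d z) - coef2 (Pc \<kappa> d 0)\<bar> \<le> \<epsilon>"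
      using md(1) Pin[OF z] Pin[OF zero_in_ref] unfolding coef_modulus_def by blast+
    have "\<bar>(coef1 (Pc \<kappa> d z) - coef1 (Pc \<kappa> d 0)) * p' d z + (coef2 (Pc \<kappa> d z) - coef2 (Pc \<kappa> d 0)) * p' (oth d) z\<bar> \<le> \<epsilon> * S + \<epsilon> * S"
      using c p'(2)[OF z] order.trans[OF abs_ge_zero c(1)]
      by (intro order.trans[OF abs_triangle_ineq] add_mono) (auto simp: abs_mult intro!: mult_mono)
    then have "\<bar>((coef1 (Pc \<kappa> d z) - coef1 (Pc \<kappa> d 0)) * p' d z + (coef2 (Pc \<kappa> d z) - coef2 (Pc \<kappa> d 0)) * p' (oth d) z) / h\<bar> \<le> 2 * \<epsilon> * S / h"
      using divide_right_mono[of _ "2 * \<epsilon> * S" h] h by (simp add: abs_divide mult_ac)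
    moreover have "fl \<kappa> p' d (\<Psi> z) - (coef1 (Pc \<kappa> d 0) * p' d z + coef2 (Pc \<kappa> d 0) * p' (oth d) z) / h
      = ((coef1 (Pc \<kappa> d z) - coef1 (Pc \<kappa> d 0)) * p' d z + (coef2 (Pc \<kappa> d z) - coef2 (Pc \<kappa> d 0)) * p' (oth d) z) / h"
      unfolding fl_coef[OF z] by (simp add: diff_divide_distrib[symmetric] algebra_simps)
    ultimately show ?thesis by simp
  qed
  have rpc: "continuous_on {t1..t2} (\<lambda>t. p' i (rp d s t))" for i
    using st by (intro continuous_on_compose2[OF p'(1) cont_rp]) auto
  have gc: "continuous_on {t1..t2} ?g" using h by (intro continuous_intros rpc) auto
  have F1: "\<bar>fl \<kappa> p' d (\<Psi> (rp d s t))\<bar> \<le> 2 * B * S / h" if "t \<in> {-1..1}" for t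
    using that st by (intro F) simp
  have D1: "\<bar>fl \<kappa> p' d (\<Psi> (rp d s t)) - ?g t\<bar> \<le> 2 * \<epsilon> * S / h" if "t \<in> {t1..t2}" for t
    using that st by (intro Dg) simp
  note la = line_integral_approx[OF st hs cont_fl[OF \<kappa>(1) p'(1)] F1 gc D1]
  have L: "set_integrable arc_measure (\<Psi> ` rp d s ` {t1..t2}) (fl \<kappa> p' d)"
    "\<bar>(LINT x:\<Psi> ` rp d s ` {t1..t2}|arc_measure. fl \<kappa> p' d x) - norm (A (oth d) 0) * integral {t1..t2} ?g\<bar>
       \<le> 8 * Cb * h\<^sup>2 * (2 * B * S / h) + 2 * Cb * h * (2 * \<epsilon> * S / h)"
    by (rule la(1); assumption) (rule la(2); assumption)
  show ?I by (rule L(1))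
  have "norm (A (oth d) 0) * integral {t1..t2} ?g = integral {t1..t2} (\<lambda>t. norm (A (oth d) 0) * ?g t)"
    by (rule integral_mult_right[symmetric])
  also have "(\<lambda>t. norm (A (oth d) 0) * ?g t) = (\<lambda>t. \<beta>c \<kappa> d * p' d (rp d s t) + \<gamma>c \<kappa> * p' (oth d) (rp d s t))"
    unfolding coef_at_0[symmetric, of \<kappa> d] coef_at_0(2)[symmetric, of \<kappa> d] using h by (intro ext) (simp add: field_simps)
  finally have e: "norm (A (oth d) 0) * integral {t1..t2} ?g = integral {t1..t2} (\<lambda>t. \<beta>c \<kappa> d * p' d (rp d s t) + \<gamma>c \<kappa> * p' (oth d) (rp d s t))" .
  have "8 * Cb * h\<^sup>2 * (2 * B * S / h) + 2 * Cb * h * (2 * \<epsilon> * S / h) = (16 * Cb * B * h + 4 * Cb * \<epsilon>) * S"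
    using h by (simp add: power2_eq_square field_simps)
  then show ?A using L(2) unfolding e by simp
qed

text \<open>With tangent vectors a, b and v = x b - y a, the form is \<kappa> |v|^2 divided by the
  absolute Jacobian.\<close>

lemma form_positive:
  assumes "\<kappa> (\<Psi> 0) \<ge> \<kappa>0" "\<kappa>0 > 0"
  shows "\<beta>c \<kappa> 1 * x\<^sup>2 + 2 * \<gamma>c \<kappa> * x * y + \<beta>c \<kappa> 2 * y\<^sup>2 \<ge> \<kappa>0 * cJ / (2 * Cb\<^sup>2) * (x\<^sup>2 + y\<^sup>2)"
proof -
  define a where "a = A 1 0"
  define b where "b = A 2 0"
  define j where "j = \<bar>cross a b\<bar>"
  define k where "k = \<kappa> (\<Psi> 0)"
  have j: "j > 0" "j \<ge> cJ * h\<^sup>2" using jac_nz[OF zero_in_ref] J[OF zero_in_ref] by (auto simp: j_def a_def b_def)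
  have n: "norm a \<le> Cb * h" "norm b \<le> Cb * h" using b1[OF zero_in_ref] by (auto simp: a_def b_def)
  define v where "v = x *\<^sub>R b - y *\<^sub>R a"
  have e: "\<beta>c \<kappa> 1 * x\<^sup>2 + 2 * \<gamma>c \<kappa> * x * y + \<beta>c \<kappa> 2 * y\<^sup>2 = k / j * (norm v)\<^sup>2"
  proof -
    have "(norm v)\<^sup>2 = (norm b)\<^sup>2 * x\<^sup>2 - 2 * (a \<bullet> b) * x * y + (norm a)\<^sup>2 * y\<^sup>2"
      unfolding v_def power2_norm_eq_inner by (simp add: inner_diff inner_commute power2_eq_square algebra_simps)
    moreover have "\<beta>c \<kappa> 1 * x\<^sup>2 + 2 * \<gamma>c \<kappa> * x * y + \<beta>c \<kappa> 2 * y\<^sup>2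
        = k / j * ((norm b)\<^sup>2 * x\<^sup>2 - 2 * (a \<bullet> b) * x * y + (norm a)\<^sup>2 * y\<^sup>2)"
      unfolding \<beta>c_def \<gamma>c_def using j
      by (simp add: a_def[symmetric] b_def[symmetric] j_def[symmetric] k_def[symmetric] field_simps)
    ultimately show ?thesis by simp
  qed
  \<comment> \<open>The cross product of v with a or b isolates one of the two variables; since a
    and b are at most Cb h long, |v| bounds x and y from above.\<close>
  have cv: "cross a v = x * cross a b" "cross b v = y * cross a b" by (simp_all add: v_def cross_def algebra_simps)
  have "x\<^sup>2 * j\<^sup>2 \<le> (Cb * h)\<^sup>2 * (norm v)\<^sup>2" "y\<^sup>2 * j\<^sup>2 \<le> (Cb * h)\<^sup>2 * (norm v)\<^sup>2"
  proof -
    have "(cross c v)\<^sup>2 \<le> (Cb * h)\<^sup>2 * (norm v)\<^sup>2" if "norm c \<le> Cb * h" for c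
    proof -
      have "(cross c v)\<^sup>2 \<le> (norm c)\<^sup>2 * (norm v)\<^sup>2" using cross_lagrange[of c v] by (metis le_add_same_cancel1 zero_le_power2)
      also have "\<dots> \<le> (Cb * h)\<^sup>2 * (norm v)\<^sup>2" using that by (intro mult_right_mono power_mono) auto
      finally show ?thesis .
    qed
    from this[OF n(1)] this[OF n(2)] show "x\<^sup>2 * j\<^sup>2 \<le> (Cb * h)\<^sup>2 * (norm v)\<^sup>2" "y\<^sup>2 * j\<^sup>2 \<le> (Cb * h)\<^sup>2 * (norm v)\<^sup>2"
      unfolding cv j_def by (simp_all add: power_mult_distrib)
  qed
  then have s: "(x\<^sup>2 + y\<^sup>2) * j\<^sup>2 \<le> 2 * (Cb * h)\<^sup>2 * (norm v)\<^sup>2" by (simp add: algebra_simps)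
  have "(x\<^sup>2 + y\<^sup>2) * (cJ * h\<^sup>2) * j \<le> (x\<^sup>2 + y\<^sup>2) * j * j" using j by (intro mult_right_mono mult_left_mono) auto
  also have "\<dots> \<le> 2 * (Cb * h)\<^sup>2 * (norm v)\<^sup>2" using s by (simp add: power2_eq_square mult.assoc)
  finally have "cJ / (2 * Cb\<^sup>2) * (x\<^sup>2 + y\<^sup>2) \<le> (norm v)\<^sup>2 / j"
  proof -
    assume "(x\<^sup>2 + y\<^sup>2) * (cJ * h\<^sup>2) * j \<le> 2 * (Cb * h)\<^sup>2 * (norm v)\<^sup>2"
    then have "h\<^sup>2 * ((x\<^sup>2 + y\<^sup>2) * cJ * j) \<le> h\<^sup>2 * (2 * Cb\<^sup>2 * (norm v)\<^sup>2)"
      by (simp add: power_mult_distrib mult_ac)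
    then have "(x\<^sup>2 + y\<^sup>2) * cJ * j \<le> 2 * Cb\<^sup>2 * (norm v)\<^sup>2"
      by (rule mult_left_le_imp_le) (use h in simp)
    then show ?thesis using j Cb by (simp add: field_simps)
  qed
  then have "\<kappa>0 * (cJ / (2 * Cb\<^sup>2) * (x\<^sup>2 + y\<^sup>2)) \<le> k * ((norm v)\<^sup>2 / j)"
    using assms j cJ unfolding k_def by (intro mult_mono) auto
  then show ?thesis unfolding e by simp
qed

end

section \<open>Integrals over faces, reference edges and Gauss segments\<close>

text \<open>Finite sets have arc measure zero, so the description of A by faces, their disjointness
  and the formula for the integrand are required only outside N.\<close>

lemma LINT_faces:
  fixes f :: "'i \<Rightarrow> real^2 \<Rightarrow> real"
  assumes I: "finite I" and N: "finite N" and A: "\<And>x. x \<notin> N \<Longrightarrow> x \<in> A \<longleftrightarrow> (\<exists>i\<in>I. x \<in> F i)"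
    and disj: "\<And>i j x. i \<in> I \<Longrightarrow> j \<in> I \<Longrightarrow> x \<in> F i \<Longrightarrow> x \<in> F j \<Longrightarrow> x \<notin> N \<Longrightarrow> i = j"
    and h: "\<And>i x. i \<in> I \<Longrightarrow> x \<in> F i \<Longrightarrow> x \<notin> N \<Longrightarrow> h x = f i x"
    and int: "\<And>i. i \<in> I \<Longrightarrow> set_integrable arc_measure (F i) (f i)"
  shows "(LINT x:A|arc_measure. h x) = (\<Sum>i\<in>I. LINT x:F i|arc_measure. f i x)"
proof -
  have e: "indicator A x *\<^sub>R h x = (\<Sum>i\<in>I. indicator (F i) x *\<^sub>R f i x)" if x: "x \<notin> N" for x
  proof (cases "x \<in> A")
    case True
    then obtain i where i: "i \<in> I" "x \<in> F i" using A[OF x] by blast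
    have "(\<Sum>j\<in>I. indicator (F j) x *\<^sub>R f j x) = (\<Sum>j\<in>I. if j = i then f i x else 0)"
    proof (intro sum.cong refl)
      fix j assume j: "j \<in> I"
      show "indicator (F j) x *\<^sub>R f j x = (if j = i then f i x else 0)"
      proof (cases "j = i")
        case True then show ?thesis using i(2) by simp
      next
        case False
        then have "x \<notin> F j" using disj[OF i(1) j i(2) _ x] by blast
        then show ?thesis using False by simp
      qed
    qed
    then show ?thesis using True i I h[OF i x] by simp
  next
    case False
    then have "\<And>i. i \<in> I \<Longrightarrow> x \<notin> F i" using A[OF x] by blast
    then show ?thesis using False by simp
  qed
  have "(LINT x:A|arc_measure. h x) = (LINT x|arc_measure. (\<Sum>i\<in>I. indicator (F i) x *\<^sub>R f i x))"
    unfolding set_lebesgue_integral_def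
  proof (rule integral_discrete_difference[of N])
    show "countable N" using N by (rule countable_finite)
    fix x assume "x \<in> N"
    show "emeasure arc_measure {x} = 0" "{x} \<in> sets arc_measure" using arc_finite_null[of "{x}"] by auto
  qed (rule e)
  also have "\<dots> = (\<Sum>i\<in>I. LINT x:F i|arc_measure. f i x)"
    unfolding set_lebesgue_integral_def
    using int by (intro Bochner_Integration.integral_sum) (simp add: set_integrable_def)
  finally show ?thesis .
qed

lemma ref_edges_rp: "e \<in> ref_edges \<longleftrightarrow> (\<exists>d s. (s = -1 \<or> s = 1) \<and> e = rp d s)"
proof -
  have eq: "ref_edges = {rp 2 (-1), rp 1 1, rp 2 1, rp 1 (-1)}"
  proof -
    have "(\<lambda>t. pt t (-1)) = rp 2 (-1)" "(\<lambda>t. pt 1 t) = rp 1 1" "(\<lambda>t. pt t 1) = rp 2 1" "(\<lambda>t. pt (-1) t) = rp 1 (-1)"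
      by (intro ext; simp only: rp_pt)+
    then show ?thesis unfolding ref_edges_def by simp
  qed
  have R: "e \<in> ref_edges \<longleftrightarrow> e = rp 2 (-1) \<or> e = rp 1 1 \<or> e = rp 2 1 \<or> e = rp 1 (-1)"
    unfolding eq by blast
  show ?thesis
  proof
    assume "e \<in> ref_edges" then show "\<exists>d s. (s = -1 \<or> s = 1) \<and> e = rp d s" using R by blast
  next
    assume "\<exists>d s. (s = -1 \<or> s = 1) \<and> e = rp d s"
    then obtain d s where ds: "s = -1 \<or> s = 1" "e = rp d s" by blast
    have "d = 1 \<or> d = 2" by (rule exhaust_2)
    then show "e \<in> ref_edges" using ds R by blast
  qed
qed

lemma ref_vertices_iff: "z \<in> ref_vertices \<longleftrightarrow> (\<forall>i. z $ i = -1 \<or> z $ i = 1)"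
proof -
  have "z \<in> ref_vertices \<longleftrightarrow> (z $ 1 = -1 \<and> z $ 2 = -1) \<or> (z $ 1 = 1 \<and> z $ 2 = -1) \<or> (z $ 1 = 1 \<and> z $ 2 = 1) \<or> (z $ 1 = -1 \<and> z $ 2 = 1)"
    unfolding ref_vertices_def by (simp add: vec_eq_iff forall_2)
  then show ?thesis unfolding forall_2 by blast
qed

lemma ref_vertices_sub: assumes "a \<in> ref_vertices" shows "a \<in> ref_square"
  unfolding ref_square_iff
proof
  fix i
  have "a $ i = -1 \<or> a $ i = 1" using assms unfolding ref_vertices_iff by blast
  then show "-1 \<le> a $ i \<and> a $ i \<le> 1" by auto
qed

lemma lagrange_node_less: "lagrange_nodes k l \<Longrightarrow> i < j \<Longrightarrow> j \<le> k \<Longrightarrow> l i < l j"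
proof (induction j)
  case (Suc j)
  have "l j < l (Suc j)" using Suc.prems by (auto simp: lagrange_nodes_def)
  then show ?case using Suc by (cases "i = j") auto
qed simp

lemma lagrange_node_eq: "lagrange_nodes k l \<Longrightarrow> i \<le> k \<Longrightarrow> j \<le> k \<Longrightarrow> l i = l j \<longleftrightarrow> i = j"
  using lagrange_node_less[of k l i j] lagrange_node_less[of k l j i] by (cases i j rule: linorder_cases) auto

lemma lagrange_node_bounds: "lagrange_nodes k l \<Longrightarrow> i \<le> k \<Longrightarrow> -1 \<le> l i \<and> l i \<le> 1"
  using lagrange_node_less[of k l 0 i] lagrange_node_less[of k l i k]
  by (cases "i = 0"; cases "i = k") (auto simp: lagrange_nodes_def)

lemma lagrange_node_symm: "lagrange_nodes k l \<Longrightarrow> i \<le> k \<Longrightarrow> l (k - i) = - l i"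
  by (auto simp: lagrange_nodes_def)

definition gI :: "nat \<Rightarrow> nat \<Rightarrow> real set" where
  "gI k j = {gauss_pt k j..gauss_pt k (Suc j)}"

lemma gI_sub: "j \<le> k \<Longrightarrow> t \<in> gI k j \<Longrightarrow> -1 \<le> t \<and> t \<le> 1"
  using gauss_pt_bounds[of j k] gauss_pt_bounds[of "Suc j" k] by (auto simp: gI_def)

lemma gI_unique: "t \<in> gI k j \<Longrightarrow> t \<in> gI k m \<Longrightarrow> j \<le> k \<Longrightarrow> m \<le> k \<Longrightarrow> t \<notin> gauss_pt k ` {..Suc k} \<Longrightarrow> j = m"
  unfolding gI_def by (rule gauss_interval_unique)

lemma gI_exists: "-1 \<le> t \<Longrightarrow> t \<le> 1 \<Longrightarrow> \<exists>j\<le>k. t \<in> gI k j"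
  using gauss_interval_exists by (simp add: gI_def)

lemma gI_reflect: assumes "j \<le> k" "t \<in> gI k j" shows "- t \<in> gI k (k - j)"
proof -
  have "gauss_pt k (Suc k - j) = - gauss_pt k j" "gauss_pt k (Suc k - Suc j) = - gauss_pt k (Suc j)"
    using assms by (intro gauss_pt_symm; simp)+
  moreover have "Suc k - j = Suc (k - j)" using assms by simp
  ultimately show ?thesis using assms by (simp add: gI_def)
qed

lemma gI_open: "t \<in> gI k j \<Longrightarrow> t \<notin> gauss_pt k ` {..Suc k} \<Longrightarrow> j \<le> k \<Longrightarrow> gauss_pt k j < t \<and> t < gauss_pt k (Suc j)"
proof -
  assume a: "t \<in> gI k j" "t \<notin> gauss_pt k ` {..Suc k}" "j \<le> k"
  then have "t \<noteq> gauss_pt k j" "t \<noteq> gauss_pt k (Suc j)" by auto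
  then show ?thesis using a(1) by (auto simp: gI_def)
qed

lemma gI_endpoint:
  assumes "s = -1 \<or> s = 1" "m \<le> k"
  shows "s \<in> gI k m \<longleftrightarrow> m = (if s = 1 then k else 0)"
proof -
  have 1: "gauss_pt k m = -1 \<longleftrightarrow> m = 0" "gauss_pt k (Suc m) = 1 \<longleftrightarrow> m = k"
    using gauss_pt_inj[of m k 0] gauss_pt_inj[of "Suc m" k "Suc k"] assms by auto
  have "-1 \<le> gauss_pt k m" "gauss_pt k (Suc m) \<le> 1" "gauss_pt k m < gauss_pt k (Suc m)"
    using gauss_pt_bounds[of m k] gauss_pt_bounds[of "Suc m" k] gauss_pt_less[of m "Suc m" k] assms by auto
  then show ?thesis using 1 assms(1) by (auto simp: gI_def)
qed

lemma gI_interior_point: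
  assumes "i \<in> {1..k}" "m \<le> k" "gauss_pt k (i - 1) < s" "s < gauss_pt k (Suc i)"
  shows "s \<in> gI k m \<longleftrightarrow> (m = i - 1 \<and> s \<le> gauss_pt k i) \<or> (m = i \<and> gauss_pt k i \<le> s)"
proof
  assume s: "s \<in> gI k m"
  have "gauss_pt k (i - 1) < gauss_pt k (Suc m)" "gauss_pt k m < gauss_pt k (Suc i)" using s assms by (auto simp: gI_def)
  have "i - 1 < Suc m"
  proof (rule ccontr)
    assume "\<not> ?thesis"
    then have "gauss_pt k (Suc m) \<le> gauss_pt k (i - 1)" using assms by (intro gauss_pt_le) auto
    then show False using \<open>gauss_pt k (i - 1) < gauss_pt k (Suc m)\<close> by simp
  qed
  moreover have "m < Suc i"
  proof (rule ccontr)
    assume "\<not> ?thesis"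
    then have "gauss_pt k (Suc i) \<le> gauss_pt k m" using assms by (intro gauss_pt_le) auto
    then show False using \<open>gauss_pt k m < gauss_pt k (Suc i)\<close> by simp
  qed
  ultimately  have "m = i - 1 \<or> m = i" by auto
  then show "(m = i - 1 \<and> s \<le> gauss_pt k i) \<or> (m = i \<and> gauss_pt k i \<le> s)" using s assms by (auto simp: gI_def)
next
  assume "(m = i - 1 \<and> s \<le> gauss_pt k i) \<or> (m = i \<and> gauss_pt k i \<le> s)"
  then show "s \<in> gI k m" using assms by (auto simp: gI_def)
qed

section \<open>Meshes: common edges, nodes and control volumes\<close>

definition shared :: "mesh \<Rightarrow> (real^2) set \<Rightarrow> 2 \<Rightarrow> real \<Rightarrow> bool" where
  "shared M K d s \<longleftrightarrow> (\<exists>K'\<in>cells M. \<exists>d' s'. K' \<noteq> K \<and> (s' = -1 \<or> s' = 1) \<and>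
     elem M K \<inter> elem M K' = emap M K ` rp d s ` {-1..1} \<and> elem M K \<inter> elem M K' = emap M K' ` rp d' s' ` {-1..1})"

locale fv_mesh =
  fixes k :: nat and l :: "nat \<Rightarrow> real" and M :: mesh and Cb cJ :: real
    and Gi :: "(real^2) set \<Rightarrow> real^2 \<Rightarrow> real^2"
  assumes k: "k \<ge> 1" and l: "lagrange_nodes k l" and fin: "finite (cells M)"
    and el: "\<And>K. K \<in> cells M \<Longrightarrow> element (emap M K) (Gi K) (elem M K) (diameter K) Cb cJ"
    and conf: "conforming M" and edg: "edge_params_agree M"
begin

abbreviation g where "g \<equiv> gauss_pt k"

definition nodeP :: "(real^2) set \<Rightarrow> 2 \<Rightarrow> nat \<Rightarrow> nat \<Rightarrow> real^2" where
  "nodeP K d i j = emap M K (rp d (l i) (l j))"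

lemma node_eq: "node l M K i j = nodeP K 1 i j" by (simp add: node_def nodeP_def rp_pt)

lemma nodeP_oth: "nodeP K (oth d) j i = nodeP K d i j" by (simp add: nodeP_def rp_oth)

lemma nodeP_2: "nodeP K 2 i j = nodeP K 1 j i" using nodeP_oth[of K 1 i j] by simp

lemma G\<Psi>: "K \<in> cells M \<Longrightarrow> z \<in> ref_square \<Longrightarrow> Gi K (emap M K z) = z"
  and G_in: "K \<in> cells M \<Longrightarrow> x \<in> elem M K \<Longrightarrow> Gi K x \<in> ref_square"
  and \<Psi>G: "K \<in> cells M \<Longrightarrow> x \<in> elem M K \<Longrightarrow> emap M K (Gi K x) = x"
  and contG: "K \<in> cells M \<Longrightarrow> continuous_on (elem M K) (Gi K)"
  and cont\<Psi>: "K \<in> cells M \<Longrightarrow> continuous_on ref_square (emap M K)"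
  and closed_elem: "K \<in> cells M \<Longrightarrow> closed (elem M K)"
  and open_im: "K \<in> cells M \<Longrightarrow> open U \<Longrightarrow> U \<subseteq> ref_square \<Longrightarrow> open (emap M K ` U)"
  and interior_elem: "K \<in> cells M \<Longrightarrow> interior (elem M K) = emap M K ` interior ref_square"
proof -
  assume K: "K \<in> cells M"
  interpret element "emap M K" "Gi K" "elem M K" "diameter K" Cb cJ using el[OF K] .
  show "z \<in> ref_square \<Longrightarrow> Gi K (emap M K z) = z" by (rule G\<Psi>)
  show "x \<in> elem M K \<Longrightarrow> Gi K x \<in> ref_square" by (rule G_in)
  show "x \<in> elem M K \<Longrightarrow> emap M K (Gi K x) = x" by (rule \<Psi>G)
  show "continuous_on (elem M K) (Gi K)" by (rule contG)
  show "continuous_on ref_square (emap M K)" by (rule cont\<Psi>)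
  show "closed (elem M K)" using compact_E by (rule compact_imp_closed)
  show "open U \<Longrightarrow> U \<subseteq> ref_square \<Longrightarrow> open (emap M K ` U)" by (rule open_image)
  show "interior (elem M K) = emap M K ` interior ref_square" by (rule interior_E)
qed

lemma \<Psi>_in: "z \<in> ref_square \<Longrightarrow> emap M K z \<in> elem M K" by (simp add: elem_def)

lemma inj\<Psi>: "K \<in> cells M \<Longrightarrow> z \<in> ref_square \<Longrightarrow> z' \<in> ref_square \<Longrightarrow> emap M K z = emap M K z' \<Longrightarrow> z = z'"
proof -
  assume a: "K \<in> cells M" "z \<in> ref_square" "z' \<in> ref_square" "emap M K z = emap M K z'"
  have "z = Gi K (emap M K z)" using G\<Psi>[OF a(1,2)] by simp
  also have "\<dots> = z'" unfolding a(4) by (rule G\<Psi>[OF a(1,3)])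
  finally show "z = z'" .
qed

text \<open>A point lying in two elements is a common vertex or lies on a common edge, whose two
  parametrisations differ by the factor \<open>\<tau>\<close> only.\<close>

lemma meet_cases:
  assumes K: "K \<in> cells M" "K' \<in> cells M" "K \<noteq> K'" and x: "x \<in> elem M K" "x \<in> elem M K'"
  obtains (vertex) a a' where "a \<in> ref_vertices" "a' \<in> ref_vertices" "x = emap M K a" "x = emap M K' a'"
  | (edge) d s d' s' t \<tau> where "s = -1 \<or> s = 1" "s' = -1 \<or> s' = 1" "\<tau> = -1 \<or> \<tau> = 1"
      "elem M K \<inter> elem M K' = emap M K ` rp d s ` {-1..1}" "elem M K \<inter> elem M K' = emap M K' ` rp d' s' ` {-1..1}"
      "t \<in> {-1..1}" "x = emap M K (rp d s t)" "x = emap M K' (rp d' s' (\<tau> * t))"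
      "\<And>t. t \<in> {-1..1} \<Longrightarrow> emap M K (rp d s t) = emap M K' (rp d' s' (\<tau> * t))"
proof -
  have "elem M K \<inter> elem M K' = {} \<or>
     (\<exists>a\<in>ref_vertices. \<exists>a'\<in>ref_vertices. emap M K a = emap M K' a' \<and> elem M K \<inter> elem M K' = {emap M K a}) \<or>
     (\<exists>e\<in>ref_edges. \<exists>e'\<in>ref_edges. elem M K \<inter> elem M K' = emap M K ` e ` {-1..1} \<and> elem M K \<inter> elem M K' = emap M K' ` e' ` {-1..1})"
    by (rule conf[unfolded conforming_def, rule_format, OF K])
  then show ?thesis
  proof (elim disjE)
    assume "elem M K \<inter> elem M K' = {}" then show ?thesis using x by blast
  next
    assume "\<exists>a\<in>ref_vertices. \<exists>a'\<in>ref_vertices. emap M K a = emap M K' a' \<and> elem M K \<inter> elem M K' = {emap M K a}"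
    then obtain a a' where a: "a \<in> ref_vertices" "a' \<in> ref_vertices" "emap M K a = emap M K' a'" "elem M K \<inter> elem M K' = {emap M K a}"
      by blast
    then have xa: "x = emap M K a" using x by blast
    show ?thesis by (rule vertex[OF a(1,2) xa xa[unfolded a(3)]])
  next
    assume "\<exists>e\<in>ref_edges. \<exists>e'\<in>ref_edges. elem M K \<inter> elem M K' = emap M K ` e ` {-1..1} \<and> elem M K \<inter> elem M K' = emap M K' ` e' ` {-1..1}"
    then obtain e e' where e: "e \<in> ref_edges" "e' \<in> ref_edges"
      "elem M K \<inter> elem M K' = emap M K ` e ` {-1..1}" "elem M K \<inter> elem M K' = emap M K' ` e' ` {-1..1}"
      by (elim bexE conjE) (rule that)
    obtain d s where ds: "s = -1 \<or> s = 1" "e = rp d s" using e(1) ref_edges_rp by blast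
    obtain d' s' where ds': "s' = -1 \<or> s' = 1" "e' = rp d' s'" using e(2) ref_edges_rp by blast
    have "emap M K ` e ` {-1..1} = emap M K' ` e' ` {-1..1}" using e by blast
    then have "(\<forall>t\<in>{-1..1}. emap M K (e t) = emap M K' (e' t)) \<or> (\<forall>t\<in>{-1..1}. emap M K (e t) = emap M K' (e' (- t)))"
      by (rule edg[unfolded edge_params_agree_def, rule_format, OF K e(1,2)])
    then obtain \<tau> :: real where \<tau>: "\<tau> = -1 \<or> \<tau> = 1" "\<And>t. t \<in> {-1..1} \<Longrightarrow> emap M K (e t) = emap M K' (e' (\<tau> * t))"
    proof (elim disjE)
      assume "\<forall>t\<in>{-1..1}. emap M K (e t) = emap M K' (e' t)"
      then show thesis by (intro that[of 1]) auto
    next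
      assume "\<forall>t\<in>{-1..1}. emap M K (e t) = emap M K' (e' (- t))"
      then show thesis by (intro that[of "-1"]) auto
    qed
    have "x \<in> emap M K ` e ` {-1..1}" using x e(3) by blast
    then obtain t where t: "t \<in> {-1..1}" "x = emap M K (e t)" by blast
    then have x': "x = emap M K' (e' (\<tau> * t))" unfolding \<tau>(2)[OF t(1), symmetric] by simp
    show ?thesis
      by (rule edge[OF ds(1) ds'(1) \<tau>(1) e(3)[unfolded ds(2)] e(4)[unfolded ds'(2)] t(1) t(2)[unfolded ds(2)]
            x'[unfolded ds'(2)] \<tau>(2)[unfolded ds(2) ds'(2)]])
  qed
qed

lemma interior_unique:
  assumes K: "K \<in> cells M" "K' \<in> cells M" and z: "z \<in> interior ref_square" and x: "emap M K z \<in> elem M K'"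
  shows "K' = K"
proof (rule ccontr)
  assume ne: "K' \<noteq> K"
  have zr: "z \<in> ref_square" using z interior_subset by blast
  have zi: "-1 < z $ i" "z $ i < 1" for i using z by (auto simp: interior_ref)
  show False
  proof (rule meet_cases[OF K ne[symmetric] \<Psi>_in[OF zr] x])
    fix a a' assume a: "a \<in> ref_vertices" "emap M K z = emap M K a"
    then have "a \<in> ref_square" by (intro ref_vertices_sub)
    then have "z = a" using inj\<Psi>[OF K(1) zr _ a(2)] by blast
    moreover have "a $ 1 = -1 \<or> a $ 1 = 1" using a(1) unfolding ref_vertices_iff by blast
    ultimately show False using zi[of 1] by auto
  next
    fix d s d' s' t \<tau> assume a: "s = -1 \<or> s = (1::real)" "t \<in> {-1..1}" "emap M K z = emap M K (rp d s t)"
    then have "z = rp d s t" using inj\<Psi>[OF K(1) zr _ a(3)] by auto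
    then have "z $ d = s" by simp
    then show False using zi[of d] a(1) by auto
  qed
qed

text \<open>The relative interior of an edge contains no vertex and, the element map being
  injective, meets no other edge of K. If such a point lies in K', this very edge must be the common
  one.\<close>

lemma edge_meet:
  assumes K: "K \<in> cells M" "K' \<in> cells M" "K' \<noteq> K" and s: "s = -1 \<or> s = 1" and t: "-1 < t" "t < 1"
    and x: "emap M K (rp d s t) \<in> elem M K'"
  obtains d' s' \<tau> where "s' = -1 \<or> s' = 1" "\<tau> = -1 \<or> \<tau> = 1"
      "elem M K \<inter> elem M K' = emap M K ` rp d s ` {-1..1}" "elem M K \<inter> elem M K' = emap M K' ` rp d' s' ` {-1..1}"
      "\<forall>t\<in>{-1..1}. emap M K (rp d s t) = emap M K' (rp d' s' (\<tau> * t))"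
proof -
  have zr: "rp d s t \<in> ref_square" using s t by auto
  show ?thesis
  proof (rule meet_cases[OF K(1,2) K(3)[symmetric] \<Psi>_in[OF zr] x])
    fix a a' assume a: "a \<in> ref_vertices" "emap M K (rp d s t) = emap M K a"
    then have "a \<in> ref_square" by (intro ref_vertices_sub)
    then have "rp d s t = a" using inj\<Psi>[OF K(1) zr _ a(2)] by blast
    then have "a $ oth d = t" by auto
    moreover have "a $ oth d = -1 \<or> a $ oth d = 1" using a(1) unfolding ref_vertices_iff by blast
    ultimately have False using t by auto
    then show ?thesis ..
  next
    fix e r d' s' q \<tau> assume a: "r = -1 \<or> r = (1::real)" "s' = -1 \<or> s' = (1::real)" "\<tau> = -1 \<or> \<tau> = (1::real)"
      "elem M K \<inter> elem M K' = emap M K ` rp e r ` {-1..1}" "elem M K \<inter> elem M K' = emap M K' ` rp d' s' ` {-1..1}"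
      "q \<in> {-1..1}" "emap M K (rp d s t) = emap M K (rp e r q)"
      "\<And>t. t \<in> {-1..1} \<Longrightarrow> emap M K (rp e r t) = emap M K' (rp d' s' (\<tau> * t))"
    have eq: "rp d s t = rp e r q" using inj\<Psi>[OF K(1) zr _ a(7)] a(1,6) by auto
    have "e = d"
    proof (rule ccontr)
      assume "e \<noteq> d"
      then have "e = oth d" by (simp add: oth_eq)
      then have "r = t" using arg_cong[OF eq, of "\<lambda>v. v $ e"] by simp
      then show False using a(1) t by auto
    qed
    have "r = s" using eq unfolding \<open>e = d\<close> by simp
    show ?thesis
      by (rule that[OF a(2,3) a(4)[unfolded \<open>e = d\<close> \<open>r = s\<close>] a(5) ballI[OF a(8)[unfolded \<open>e = d\<close> \<open>r = s\<close>]]])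
  qed
qed

text \<open>Images of the tensor grid of Gauss points and end points, element corners included. Off
  this finite set every point of a face has a neighbourhood of simple shape.\<close>

definition Bad :: "(real^2) set" where
  "Bad = (\<Union>K\<in>cells M. \<Union>i\<le>Suc k. \<Union>j\<le>Suc k. {emap M K (rp 1 (g i) (g j))})"

lemma finite_Bad: "finite Bad" unfolding Bad_def using fin by auto

lemma Bad_rp: assumes "K \<in> cells M" "i \<le> Suc k" "j \<le> Suc k" shows "emap M K (rp d (g i) (g j)) \<in> Bad"
proof -
  have "emap M K (rp 1 (g i) (g j)) \<in> Bad" "emap M K (rp 1 (g j) (g i)) \<in> Bad" using assms unfolding Bad_def by blast+
  moreover have "rp 2 (g i) (g j) = rp 1 (g j) (g i)" using rp_oth[of 1 "g i" "g j"] by simp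
  moreover have "d = 1 \<or> d = 2" by (rule exhaust_2)
  ultimately show ?thesis by auto
qed

lemma not_Bad:
  assumes "K \<in> cells M" "i \<le> Suc k" "emap M K (rp d (g i) t) \<notin> Bad"
  shows "t \<notin> g ` {..Suc k}"
  using Bad_rp[OF assms(1,2), of _ d] assms(3) by auto

text \<open>Membership in the control volume of P, read in the reference coordinates of K; by
  \<open>cellc_d\<close> either direction may come first.\<close>

definition cellc :: "(real^2) set \<Rightarrow> real^2 \<Rightarrow> real^2 \<Rightarrow> bool" where
  "cellc K P z \<longleftrightarrow> (\<exists>i\<le>k. \<exists>j\<le>k. z $ 1 \<in> gI k i \<and> z $ 2 \<in> gI k j \<and> nodeP K 1 i j = P)"

lemma cellc_d: "cellc K P z \<longleftrightarrow> (\<exists>i\<le>k. \<exists>j\<le>k. z $ d \<in> gI k i \<and> z $ oth d \<in> gI k j \<and> nodeP K d i j = P)"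
proof -
  consider "d = 1" | "d = 2" using exhaust_2[of d] by blast
  then show ?thesis
  proof cases
    case 1 then show ?thesis by (simp add: cellc_def)
  next
    case 2 then show ?thesis unfolding cellc_def 2 nodeP_2 by auto
  qed
qed

lemma cellc_ref: assumes "cellc K P z" shows "z \<in> ref_square"
proof -
  obtain i j where "i \<le> k" "j \<le> k" "z $ 1 \<in> gI k i" "z $ 2 \<in> gI k j" using assms unfolding cellc_def by blast
  then show ?thesis using gI_sub[of i k "z $ 1"] gI_sub[of j k "z $ 2"] by (auto simp: ref_square_iff forall_2)
qed

lemma subcell_eq: "subcell k M K i j = emap M K ` {z. z $ 1 \<in> gI k i \<and> z $ 2 \<in> gI k j}"
proof -
  have "{pt x y |x y. x \<in> {g i..g (i + 1)} \<and> y \<in> {g j..g (j + 1)}} = {z. z $ 1 \<in> gI k i \<and> z $ 2 \<in> gI k j}"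
  proof (intro equalityI subsetI)
    fix z :: "real^2" assume "z \<in> {z. z $ 1 \<in> gI k i \<and> z $ 2 \<in> gI k j}"
    moreover have "z = pt (z $ 1) (z $ 2)" by (simp add: vec_eq_iff forall_2)
    ultimately show "z \<in> {pt x y |x y. x \<in> {g i..g (i + 1)} \<and> y \<in> {g j..g (j + 1)}}"
      unfolding gI_def mem_Collect_eq Suc_eq_plus1 by blast
  qed (auto simp: gI_def)
  then show ?thesis unfolding subcell_def by simp
qed

lemma control_volume_iff: "x \<in> control_volume k l M P \<longleftrightarrow> (\<exists>K\<in>cells M. \<exists>z. cellc K P z \<and> x = emap M K z)"
  unfolding control_volume_def node_eq subcell_eq cellc_def by blast

lemma control_volume_sub: "control_volume k l M P \<subseteq> Omega_h M"
proof
  fix x assume "x \<in> control_volume k l M P"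
  then obtain K z where "K \<in> cells M" "cellc K P z" "x = emap M K z" unfolding control_volume_iff by blast
  then show "x \<in> Omega_h M" unfolding Omega_h_def elem_def using cellc_ref by blast
qed

lemma closed_control_volume: "closed (control_volume k l M P)"
proof -
  have "control_volume k l M P = (\<Union>K\<in>cells M. \<Union>i\<in>{..k}. \<Union>j\<in>{..k}. if nodeP K 1 i j = P then subcell k M K i j else {})"
    unfolding control_volume_def node_eq by (auto split: if_splits)
  moreover have "closed (subcell k M K i j)" if K: "K \<in> cells M" "i \<le> k" "j \<le> k" for K i j
  proof -
    let ?B = "{z :: real^2. z $ 1 \<in> gI k i \<and> z $ 2 \<in> gI k j}"
    have sub: "?B \<subseteq> ref_square" using gI_sub[OF K(2)] gI_sub[OF K(3)] by (auto simp: ref_square_iff forall_2)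
    have "closed ?B" unfolding gI_def atLeastAtMost_iff by (intro closed_Collect_conj closed_Collect_le continuous_intros)
    then have "compact (?B \<inter> ref_square)" using compact_ref by (rule closed_Int_compact)
    then have "compact ?B" using sub by (simp only: Int_absorb2)
    then have "compact (emap M K ` ?B)" by (intro compact_continuous_image continuous_on_subset[OF cont\<Psi>[OF K(1)] sub])
    then show ?thesis unfolding subcell_eq by (rule compact_imp_closed)
  qed
  ultimately show ?thesis using fin by (auto intro!: closed_UN)
qed

lemma closed_Omega_h: "closed (Omega_h M)"
  unfolding Omega_h_def using fin closed_elem by (intro closed_UN) auto

lemma cv_interior:
  assumes K: "K \<in> cells M" and z: "z \<in> interior ref_square"
  shows "emap M K z \<in> control_volume k l M P \<longleftrightarrow> cellc K P z"
proof
  assume "emap M K z \<in> control_volume k l M P"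
  then obtain K' z' where K': "K' \<in> cells M" "cellc K' P z'" "emap M K z = emap M K' z'" unfolding control_volume_iff by blast
  have "K' = K" using interior_unique[OF K K'(1) z] \<Psi>_in[OF cellc_ref[OF K'(2)], of K'] K'(3) by simp
  moreover have "z' = z" using inj\<Psi>[OF K cellc_ref[OF K'(2)] subsetD[OF interior_subset z]] K'(3) \<open>K' = K\<close> by simp
  ultimately show "cellc K P z" using K'(2) by simp
next
  assume "cellc K P z"
  then show "emap M K z \<in> control_volume k l M P" unfolding control_volume_iff using K by blast
qed

text \<open>By invariance of domain the image of W is open, so the inverse map is a chart on a ball
  around the point.\<close>

lemma local_coords:
  assumes K: "K \<in> cells M" and W: "open W" "W \<subseteq> interior ref_square" "z \<in> W"
  obtains r where "r > 0" "\<And>y. y \<in> ball (emap M K z) r \<Longrightarrow> Gi K y \<in> W \<and> emap M K (Gi K y) = y"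
proof -
  have sub: "W \<subseteq> ref_square" using W(2) interior_subset by blast
  have "open (emap M K ` W)" by (rule open_im[OF K W(1) sub])
  then obtain r where r: "r > 0" "ball (emap M K z) r \<subseteq> emap M K ` W" using W(3) unfolding open_contains_ball by blast
  have *: "Gi K y \<in> W \<and> emap M K (Gi K y) = y" if y: "y \<in> ball (emap M K z) r" for y
  proof -
    obtain w where w: "w \<in> W" "y = emap M K w" using r(2) y by blast
    then have "Gi K y = w" using G\<Psi>[OF K] sub by blast
    then show ?thesis using w by simp
  qed
  show ?thesis by (rule that[OF r(1) *])
qed

lemma nodeP_inj:
  assumes "K \<in> cells M" "i \<le> k" "j \<le> k" "i' \<le> k" "j' \<le> k"
  shows "nodeP K d i j = nodeP K d i' j' \<longleftrightarrow> i = i' \<and> j = j'"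
proof
  assume "nodeP K d i j = nodeP K d i' j'"
  then have e: "emap M K (rp d (l i) (l j)) = emap M K (rp d (l i') (l j'))" unfolding nodeP_def .
  have r: "rp d (l m) (l n) \<in> ref_square" if "m \<le> k" "n \<le> k" for m n
    unfolding rp_in_ref using lagrange_node_bounds[OF l that(1)] lagrange_node_bounds[OF l that(2)] by blast
  have "rp d (l i) (l j) = rp d (l i') (l j')" by (rule inj\<Psi>[OF assms(1) r[OF assms(2,3)] r[OF assms(4,5)] e])
  then have "l i = l i'" "l j = l j'" by auto
  then show "i = i' \<and> j = j'" using lagrange_node_eq[OF l assms(2,4)] lagrange_node_eq[OF l assms(3,5)] by blast
qed auto

lemma nodeP_in_nodes: assumes "K \<in> cells M" "i \<le> k" "j \<le> k" shows "nodeP K d i j \<in> nodes k l M"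
proof -
  have "nodeP K 1 i j \<in> nodes k l M" "nodeP K 1 j i \<in> nodes k l M"
    using assms unfolding nodes_def node_eq by blast+
  then show ?thesis using exhaust_2[of d] nodeP_2[of K i j] by auto
qed

end

section \<open>Inner faces and gluing along edges\<close>

context fv_mesh
begin

definition face :: "(real^2) set \<Rightarrow> 2 \<Rightarrow> real \<Rightarrow> nat \<Rightarrow> (real^2) set" where
  "face K d s j = emap M K ` rp d s ` gI k j"

lemma face_point:
  assumes "x \<in> face K d s j" "j \<le> k"
  obtains t where "t \<in> gI k j" "-1 \<le> t" "t \<le> 1" "x = emap M K (rp d s t)"
  using assms gI_sub unfolding face_def by blast

text \<open>In the chart over the open rectangle W, two segments wide across g_i and one segment
  along it, only the volumes of the nodes i - 1 and i occur, and component d decides between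
  them.\<close>

lemma inner_face_local:
  assumes K: "K \<in> cells M" and i: "i \<in> {1..k}" and j: "j \<le> k" and x: "x \<in> face K d (g i) j" "x \<notin> Bad"
  obtains t r where "x = emap M K (rp d (g i) t)" "rp d (g i) t \<in> interior ref_square" "r > 0"
    "t \<notin> g ` {..Suc k}" "t \<in> gI k j"
    "\<forall>y\<in>ball x r. Gi K y \<in> interior ref_square \<and> emap M K (Gi K y) = y"
    "\<forall>y\<in>ball x r. \<forall>P. y \<in> control_volume k l M P \<longleftrightarrow>
        (P = nodeP K d (i - 1) j \<and> Gi K y $ d \<le> g i) \<or> (P = nodeP K d i j \<and> g i \<le> Gi K y $ d)"
proof -
  obtain t where t: "t \<in> gI k j" "x = emap M K (rp d (g i) t)" using x(1) unfolding face_def by blast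
  have ik: "i \<le> Suc k" using i by simp
  have tn: "t \<notin> g ` {..Suc k}" using not_Bad[OF K ik] x(2) t(2) by blast
  have to: "g j < t" "t < g (Suc j)" using gI_open[OF t(1) tn j] by auto
  have gi: "-1 < g i" "g i < 1" using gauss_pt_inner[OF i] by auto
  have gij: "-1 \<le> g j" "g (Suc j) \<le> 1" using gauss_pt_bounds[of j k] gauss_pt_bounds[of "Suc j" k] j by auto
  have gii: "-1 \<le> g (i - 1)" "g (Suc i) \<le> 1" "g (i - 1) < g i" "g i < g (Suc i)"
    using gauss_pt_bounds[of "i - 1" k] gauss_pt_bounds[of "Suc i" k] gauss_pt_less[of "i - 1" i k] gauss_pt_less[of i "Suc i" k] i by auto
  define W where "W = {z :: real^2. g (i - 1) < z $ d \<and> z $ d < g (Suc i) \<and> g j < z $ oth d \<and> z $ oth d < g (Suc j)}"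
  have oW: "open W" unfolding W_def by (intro open_Collect_conj open_Collect_less continuous_intros)
  have sW: "W \<subseteq> interior ref_square"
  proof
    fix z assume z: "z \<in> W"
    then have "-1 < z $ d \<and> z $ d < 1" "-1 < z $ oth d \<and> z $ oth d < 1" using gij gii unfolding W_def by auto
    then show "z \<in> interior ref_square" unfolding interior_ref mem_Collect_eq all_oth[of _ d] by blast
  qed
  have zW: "rp d (g i) t \<in> W" unfolding W_def using to gii by simp
  obtain r where r: "r > 0" "\<forall>y\<in>ball (emap M K (rp d (g i) t)) r. Gi K y \<in> W \<and> emap M K (Gi K y) = y"
    by (rule local_coords[OF K oW sW zW]) (use that in blast)
  show ?thesis
  proof (rule that[OF t(2) subsetD[OF sW zW] r(1) tn t(1)]; intro ballI allI)
    fix y assume y: "y \<in> ball x r"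
    have yW: "Gi K y \<in> W" "emap M K (Gi K y) = y" using r(2) y unfolding t(2) by blast+
    show "Gi K y \<in> interior ref_square \<and> emap M K (Gi K y) = y" using yW sW by blast
    fix P
    let ?z = "Gi K y"
    have "?z $ oth d \<in> gI k m \<longleftrightarrow> m = j" if "m \<le> k" for m
    proof
      assume a: "?z $ oth d \<in> gI k m"
      have "?z $ oth d \<notin> g ` {..Suc k}"
      proof
        assume "?z $ oth d \<in> g ` {..Suc k}"
        then obtain n where n: "n \<le> Suc k" "?z $ oth d = g n" by auto
        then have "g j < g n" "g n < g (Suc j)" using yW(1) unfolding W_def by auto
        moreover have "n \<le> j \<or> Suc j \<le> n" by linarith
        ultimately show False using gauss_pt_le[of n j k] gauss_pt_le[of "Suc j" n k] n(1) j by auto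
      qed
      moreover have "?z $ oth d \<in> gI k j" using yW(1) unfolding W_def gI_def by auto
      ultimately show "m = j" using gI_unique[OF a _ that j] by blast
    next
      assume "m = j" then show "?z $ oth d \<in> gI k m" using yW(1) unfolding W_def gI_def by auto
    qed
    then have c1: "cellc K P ?z \<longleftrightarrow> (\<exists>m\<le>k. ?z $ d \<in> gI k m \<and> nodeP K d m j = P)"
      unfolding cellc_d[of K P ?z d] using j by blast
    have c2: "?z $ d \<in> gI k m \<longleftrightarrow> (m = i - 1 \<and> ?z $ d \<le> g i) \<or> (m = i \<and> g i \<le> ?z $ d)" if "m \<le> k" for m
      using yW(1) unfolding W_def by (intro gI_interior_point[OF i that]) auto
    have "y \<in> control_volume k l M P \<longleftrightarrow> cellc K P ?z"
      using cv_interior[OF K subsetD[OF sW yW(1)], of P] yW(2) by simp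
    also have "\<dots> \<longleftrightarrow> (P = nodeP K d (i - 1) j \<and> ?z $ d \<le> g i) \<or> (P = nodeP K d i j \<and> g i \<le> ?z $ d)"
    proof -
      have "i - 1 \<le> k" "i \<le> k" using i by auto
      then show ?thesis unfolding c1 using c2 by blast
    qed
    finally show "y \<in> control_volume k l M P \<longleftrightarrow> (P = nodeP K d (i - 1) j \<and> ?z $ d \<le> g i) \<or> (P = nodeP K d i j \<and> g i \<le> ?z $ d)" .
  qed
qed

lemma inner_face_not_Gamma:
  assumes K: "K \<in> cells M" and z: "z \<in> interior ref_square"
  shows "emap M K z \<notin> Gamma_h M"
proof -
  have "emap M K z \<in> interior (elem M K)" unfolding interior_elem[OF K] using z by blast
  moreover have "interior (elem M K) \<subseteq> interior (Omega_h M)"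
    by (rule interior_mono) (use K in \<open>auto simp: Omega_h_def\<close>)
  ultimately show ?thesis unfolding Gamma_h_def frontier_def by blast
qed

text \<open>The point lies in both closed volumes, and a small shift across the Gauss line leaves
  either of them.\<close>

lemma inner_face_frontier:
  assumes K: "K \<in> cells M" and i: "i \<in> {1..k}" and j: "j \<le> k" and x: "x \<in> face K d (g i) j" "x \<notin> Bad"
  shows "x \<in> frontier (control_volume k l M P) \<longleftrightarrow> P = nodeP K d (i - 1) j \<or> P = nodeP K d i j"
proof -
  obtain t r where tr: "x = emap M K (rp d (g i) t)" "rp d (g i) t \<in> interior ref_square" "r > 0"
    "\<forall>y\<in>ball x r. \<forall>P. y \<in> control_volume k l M P \<longleftrightarrow>
        (P = nodeP K d (i - 1) j \<and> Gi K y $ d \<le> g i) \<or> (P = nodeP K d i j \<and> g i \<le> Gi K y $ d)"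
    by (rule inner_face_local[OF K i j x]) (rule that)
  let ?C = "control_volume k l M P"
  have Gx: "Gi K x $ d = g i" unfolding tr(1) G\<Psi>[OF K subsetD[OF interior_subset tr(2)]] by simp
  have xb: "x \<in> ball x r" using tr(3) by simp
  have fr: "x \<in> frontier ?C \<longleftrightarrow> x \<in> ?C \<and> x \<notin> interior ?C"
    unfolding frontier_def using closed_control_volume by auto
  have xC: "x \<in> ?C \<longleftrightarrow> P = nodeP K d (i - 1) j \<or> P = nodeP K d i j" using tr(4)[rule_format, OF xb, of P] Gx by auto
  have ne: "nodeP K d (i - 1) j \<noteq> nodeP K d i j"
  proof -
    have "i - 1 \<le> k" "i \<le> k" "i - 1 \<noteq> i" using i by auto
    then show ?thesis using nodeP_inj[OF K \<open>i - 1 \<le> k\<close> j \<open>i \<le> k\<close> j] by blast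
  qed
  have "x \<notin> interior ?C" if P: "P = nodeP K d (i - 1) j \<or> P = nodeP K d i j"
  proof
    assume "x \<in> interior ?C"
    then obtain e where e: "e > 0" "ball x e \<subseteq> ?C" unfolding mem_interior by blast
    \<comment> \<open>The sign of the shift that leaves the volume of P: increasing component d for
      node i - 1, decreasing for node i.\<close>
    define \<sigma> :: real where "\<sigma> = (if P = nodeP K d (i - 1) j then 1 else -1)"
    have zi: "-1 < rp d (g i) t $ m \<and> rp d (g i) t $ m < 1" for m using tr(2) unfolding interior_ref by blast
    have gi: "-1 < g i" "g i < 1" and ti: "-1 < t" "t < 1" using zi[of d] zi[of "oth d"] by auto
    have oU: "open (ball x (min e r))" by simp
    have cz: "continuous_on interior_ref_line (\<lambda>s. emap M K (rp d s t))" if "interior_ref_line = {-1<..<1::real}" for interior_ref_line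
    proof -
      have "continuous_on {-1<..<1} (\<lambda>s. rp (oth d) t s)" by (rule cont_rp)
      then have "continuous_on {-1<..<1} (\<lambda>s. rp d s t)" unfolding rp_oth .
      then show ?thesis unfolding that using ti by (intro continuous_on_compose2[OF cont\<Psi>[OF K]]) auto
    qed
    have "open ({-1<..<1} \<inter> (\<lambda>s. emap M K (rp d s t)) -` ball x (min e r))"
      by (rule continuous_open_preimage[OF cz[OF refl]]) auto
    moreover have "g i \<in> {-1<..<1} \<inter> (\<lambda>s. emap M K (rp d s t)) -` ball x (min e r)"
      using gi e tr(1,3) by simp
    ultimately obtain q where q: "q > 0" "ball (g i) q \<subseteq> {-1<..<1} \<inter> (\<lambda>s. emap M K (rp d s t)) -` ball x (min e r)"
      unfolding open_contains_ball by blast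
    define s where "s = g i + \<sigma> * (q / 2)"
    have "s \<in> ball (g i) q" using q(1) by (auto simp: s_def \<sigma>_def dist_real_def)
    then have s: "-1 < s" "s < 1" "emap M K (rp d s t) \<in> ball x (min e r)" using q(2) by auto
    have Gy: "Gi K (emap M K (rp d s t)) $ d = s" using G\<Psi>[OF K, of "rp d s t"] s ti by simp
    have "emap M K (rp d s t) \<in> ?C" using e(2) s(3) by auto
    then have "(P = nodeP K d (i - 1) j \<and> s \<le> g i) \<or> (P = nodeP K d i j \<and> g i \<le> s)"
      using tr(4)[rule_format, of "emap M K (rp d s t)" P] s(3) Gy by auto
    then show False using P ne q(1) by (auto simp: s_def \<sigma>_def split: if_splits)
  qed
  then show ?thesis using fr xC by blast
qed

text \<open>Gluing the two elements along a common edge gives an injective continuous map on an open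
  set, so by invariance of domain the edge is interior to their union.\<close>

lemma glued_edge_interior:
  assumes K: "K \<in> cells M" "K' \<in> cells M" "K' \<noteq> K" and s: "s = -1 \<or> s = 1" "s' = -1 \<or> s' = 1" "\<tau> = -1 \<or> \<tau> = 1"
    and meet: "elem M K \<inter> elem M K' = emap M K ` rp d s ` {-1..1}"
    and agree: "\<And>t. t \<in> {-1..1} \<Longrightarrow> emap M K (rp d s t) = emap M K' (rp d' s' (\<tau> * t))"
    and t: "-1 \<le> a" "a < t" "t < b" "b \<le> 1" and \<delta>: "0 < \<delta>" "\<delta> \<le> 1"
  shows "emap M K (rp d s t) \<in> interior (emap M K ` {z. \<bar>s - z $ d\<bar> < \<delta> \<and> z $ d \<in> {-1..1} \<and> z $ oth d \<in> {a<..<b}}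
     \<union> emap M K' ` {z. \<bar>s' - z $ d'\<bar> < \<delta> \<and> z $ d' \<in> {-1..1} \<and> \<tau> * z $ oth d' \<in> {a<..<b}})"
proof -
  let ?A = "emap M K ` {z. \<bar>s - z $ d\<bar> < \<delta> \<and> z $ d \<in> {-1..1} \<and> z $ oth d \<in> {a<..<b}}"
  let ?B = "emap M K' ` {z. \<bar>s' - z $ d'\<bar> < \<delta> \<and> z $ d' \<in> {-1..1} \<and> \<tau> * z $ oth d' \<in> {a<..<b}}"
  \<comment> \<open>Coordinates across the edge: a nonpositive first component means depth inside K,
    a positive one depth inside K'. The factor \<tau> matches the two parametrisations of the
    edge.\<close>
  define z1 where "z1 \<zeta> = rp d (s * (1 + \<zeta> $ 1)) (\<zeta> $ 2)" for \<zeta> :: "real^2"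
  define z2 where "z2 \<zeta> = rp d' (s' * (1 - \<zeta> $ 1)) (\<tau> * \<zeta> $ 2)" for \<zeta> :: "real^2"
  define F where "F \<zeta> = (if \<zeta> $ 1 \<le> 0 then emap M K (z1 \<zeta>) else emap M K' (z2 \<zeta>))" for \<zeta> :: "real^2"
  define U where "U = {\<zeta> :: real^2. -\<delta> < \<zeta> $ 1 \<and> \<zeta> $ 1 < \<delta> \<and> a < \<zeta> $ 2 \<and> \<zeta> $ 2 < b}"
  have oU: "open U" unfolding U_def by (intro open_Collect_conj open_Collect_less continuous_intros)
  have r1: "z1 \<zeta> \<in> ref_square" if "\<zeta> \<in> U" "\<zeta> $ 1 \<le> 0" for \<zeta>
    using that s t \<delta> unfolding z1_def U_def by auto
  have r2: "z2 \<zeta> \<in> ref_square" if "\<zeta> \<in> U" "0 \<le> \<zeta> $ 1" for \<zeta>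
    using that s t \<delta> unfolding z2_def U_def by auto
  have eq0: "emap M K (z1 \<zeta>) = emap M K' (z2 \<zeta>)" if "\<zeta> \<in> U" "\<zeta> $ 1 = 0" for \<zeta>
    using that agree[of "\<zeta> $ 2"] t unfolding z1_def z2_def U_def by auto
  have crp: "continuous_on S (\<lambda>\<zeta>. rp e (p \<zeta>) (q \<zeta>))" if "continuous_on S p" "continuous_on S q" for S :: "(real^2) set" and p q e
  proof -
    have "continuous_on S (\<lambda>\<zeta>. if i = e then p \<zeta> else q \<zeta>)" for i using that by (cases "i = e") auto
    then show ?thesis unfolding rp_def by (intro continuous_on_vec_lambda)
  qed
  have contF: "continuous_on U F"
  proof -
    have U12: "U = {\<zeta> \<in> U. \<zeta> $ 1 \<le> 0} \<union> {\<zeta> \<in> U. 0 \<le> \<zeta> $ 1}" by auto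
    have "continuous_on ({\<zeta> \<in> U. \<zeta> $ 1 \<le> 0} \<union> {\<zeta> \<in> U. 0 \<le> \<zeta> $ 1}) F"
      unfolding F_def
    proof (rule continuous_on_cases_local)
      show "closedin (top_of_set ({\<zeta> \<in> U. \<zeta> $ 1 \<le> 0} \<union> {\<zeta> \<in> U. 0 \<le> \<zeta> $ 1})) {\<zeta> \<in> U. \<zeta> $ 1 \<le> 0}"
        unfolding U12[symmetric] by (intro closedin_closed_Int[of "{\<zeta> :: real^2. \<zeta> $ 1 \<le> 0}" U, unfolded Int_def, simplified] closed_Collect_le continuous_intros)
      show "closedin (top_of_set ({\<zeta> \<in> U. \<zeta> $ 1 \<le> 0} \<union> {\<zeta> \<in> U. 0 \<le> \<zeta> $ 1})) {\<zeta> \<in> U. 0 \<le> \<zeta> $ 1}"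
        unfolding U12[symmetric] by (intro closedin_closed_Int[of "{\<zeta> :: real^2. 0 \<le> \<zeta> $ 1}" U, unfolded Int_def, simplified] closed_Collect_le continuous_intros)
      have "continuous_on {\<zeta> \<in> U. \<zeta> $ 1 \<le> 0} z1" unfolding z1_def by (intro crp continuous_intros)
      then show "continuous_on {\<zeta> \<in> U. \<zeta> $ 1 \<le> 0} (\<lambda>\<zeta>. emap M K (z1 \<zeta>))"
        by (rule continuous_on_compose2[OF cont\<Psi>[OF K(1)]]) (use r1 in blast)
      have "continuous_on {\<zeta> \<in> U. 0 \<le> \<zeta> $ 1} z2" unfolding z2_def by (intro crp continuous_intros)
      then show "continuous_on {\<zeta> \<in> U. 0 \<le> \<zeta> $ 1} (\<lambda>\<zeta>. emap M K' (z2 \<zeta>))"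
        by (rule continuous_on_compose2[OF cont\<Psi>[OF K(2)]]) (use r2 in blast)
      fix \<zeta> assume "\<zeta> \<in> {\<zeta> \<in> U. \<zeta> $ 1 \<le> 0} \<and> \<not> \<zeta> $ 1 \<le> 0 \<or> \<zeta> \<in> {\<zeta> \<in> U. 0 \<le> \<zeta> $ 1} \<and> \<zeta> $ 1 \<le> 0"
      then have "\<zeta> \<in> U" "\<zeta> $ 1 = 0" by auto
      then show "emap M K (z1 \<zeta>) = emap M K' (z2 \<zeta>)" by (rule eq0)
    qed
    then show ?thesis unfolding U12[symmetric] .
  qed
  have mix: False if \<zeta>: "\<zeta> \<in> U" "\<zeta>' \<in> U" "\<zeta> $ 1 \<le> 0" "0 < \<zeta>' $ 1" "emap M K (z1 \<zeta>) = emap M K' (z2 \<zeta>')" for \<zeta> \<zeta>'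
  proof -
    have "emap M K (z1 \<zeta>) \<in> elem M K \<inter> elem M K'"
      using \<Psi>_in[OF r1[OF \<zeta>(1,3)], of K] \<Psi>_in[OF r2[OF \<zeta>(2)], of K'] \<zeta>(4,5) by auto
    then obtain q where q: "q \<in> {-1..1}" "emap M K (z1 \<zeta>) = emap M K (rp d s q)" unfolding meet by blast
    then have "emap M K' (z2 \<zeta>') = emap M K' (rp d' s' (\<tau> * q))" using agree[OF q(1)] \<zeta>(5) by simp
    then have "z2 \<zeta>' = rp d' s' (\<tau> * q)"
      by (rule inj\<Psi>[OF K(2) r2[OF \<zeta>(2)], rotated 2]) (use \<zeta>(4) q(1) s in auto)
    then have "s' * (1 - \<zeta>' $ 1) = s'" unfolding z2_def by simp
    then show False using s \<zeta>(4) by auto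
  qed
  have injF: "inj_on F U"
  proof (rule inj_onI)
    fix \<zeta> \<zeta>' assume \<zeta>: "\<zeta> \<in> U" "\<zeta>' \<in> U" "F \<zeta> = F \<zeta>'"
    consider "\<zeta> $ 1 \<le> 0" "\<zeta>' $ 1 \<le> 0" | "\<zeta> $ 1 \<le> 0" "0 < \<zeta>' $ 1" | "0 < \<zeta> $ 1" "\<zeta>' $ 1 \<le> 0" | "0 < \<zeta> $ 1" "0 < \<zeta>' $ 1" by linarith
    then show "\<zeta> = \<zeta>'"
    proof cases
      case 1
      have "emap M K (z1 \<zeta>) = emap M K (z1 \<zeta>')" using \<zeta>(3) 1 unfolding F_def by simp
      then have "z1 \<zeta> = z1 \<zeta>'" by (rule inj\<Psi>[OF K(1) r1[OF \<zeta>(1) 1(1)] r1[OF \<zeta>(2) 1(2)]])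
      then have "s * (1 + \<zeta> $ 1) = s * (1 + \<zeta>' $ 1)" "\<zeta> $ 2 = \<zeta>' $ 2" unfolding z1_def rp_eq_iff using s by auto
      then have "\<zeta> $ 1 = \<zeta>' $ 1" using s by auto
      then show ?thesis using \<open>\<zeta> $ 2 = \<zeta>' $ 2\<close> by (simp add: vec_eq_iff forall_2)
    next
      case 2 then show ?thesis using mix[OF \<zeta>(1,2)] \<zeta>(3) by (auto simp: F_def)
    next
      case 3 then show ?thesis using mix[OF \<zeta>(2,1)] \<zeta>(3) by (auto simp: F_def)
    next
      case 4
      have "emap M K' (z2 \<zeta>) = emap M K' (z2 \<zeta>')" using \<zeta>(3) 4 unfolding F_def by simp
      then have "z2 \<zeta> = z2 \<zeta>'" by (rule inj\<Psi>[OF K(2) r2[OF \<zeta>(1) less_imp_le[OF 4(1)]] r2[OF \<zeta>(2) less_imp_le[OF 4(2)]]])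
      then have "s' * (1 - \<zeta> $ 1) = s' * (1 - \<zeta>' $ 1)" "\<zeta> $ 2 = \<zeta>' $ 2" unfolding z2_def rp_eq_iff using s by auto
      then have "\<zeta> $ 1 = \<zeta>' $ 1" using s by auto
      then show ?thesis using \<open>\<zeta> $ 2 = \<zeta>' $ 2\<close> by (simp add: vec_eq_iff forall_2)
    qed
  qed
  have oF: "open (F ` U)" by (rule invariance_of_domain[OF contF oU injF])
  have sub: "F ` U \<subseteq> ?A \<union> ?B"
  proof (rule image_subsetI)
    fix \<zeta> assume \<zeta>: "\<zeta> \<in> U"
    show "F \<zeta> \<in> ?A \<union> ?B"
    proof (cases "\<zeta> $ 1 \<le> 0")
      case True
      have "\<bar>s - z1 \<zeta> $ d\<bar> < \<delta> \<and> z1 \<zeta> $ d \<in> {-1..1} \<and> z1 \<zeta> $ oth d \<in> {a<..<b}"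
        using \<zeta> True s \<delta> unfolding z1_def U_def by (auto simp: algebra_simps abs_if)
      then show ?thesis using True unfolding F_def by auto
    next
      case False
      have "\<bar>s' - z2 \<zeta> $ d'\<bar> < \<delta> \<and> z2 \<zeta> $ d' \<in> {-1..1} \<and> \<tau> * z2 \<zeta> $ oth d' \<in> {a<..<b}"
        using \<zeta> False s \<delta> unfolding z2_def U_def by (auto simp: algebra_simps abs_if)
      then show ?thesis using False unfolding F_def by auto
    qed
  qed
  have "pt 0 t \<in> U" using t \<delta> unfolding U_def by simp
  then have "F (pt 0 t) \<in> F ` U" by blast
  moreover have "F (pt 0 t) = emap M K (rp d s t)" unfolding F_def z1_def by simp
  ultimately show ?thesis using interiorI[OF oF _ sub] by simp
qed

end

section \<open>Tensor-product polynomials in both directions and nodal values\<close>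

text \<open>The coefficient matrix with direction d as first variable, to be used together with
  \<open>rp d\<close>.\<close>

definition cd :: "2 \<Rightarrow> (nat \<Rightarrow> nat \<Rightarrow> real) \<Rightarrow> nat \<Rightarrow> nat \<Rightarrow> real" where
  "cd d c = (if d = 1 then c else tr c)"

lemma cd_simps [simp]: "cd 1 c = c" "cd 2 c = tr c" by (auto simp: cd_def)

lemma cd_oth: "cd (oth d) c = tr (cd d c)" using exhaust_2[of d] by auto

definition qv :: "nat \<Rightarrow> (nat \<Rightarrow> nat \<Rightarrow> real) \<Rightarrow> real^2 \<Rightarrow> real" where
  "qv k c z = poly (sl k c (z $ 1)) (z $ 2)"

definition qd :: "nat \<Rightarrow> (nat \<Rightarrow> nat \<Rightarrow> real) \<Rightarrow> 2 \<Rightarrow> real^2 \<Rightarrow> real" where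
  "qd k c d z = poly (dsl k (cd d c) (z $ d)) (z $ oth d)"

lemma qv_rp: "qv k c (rp d s t) = poly (sl k (cd d c) s) t"
proof (cases "d = 1")
  case True then show ?thesis using rp_nth[of 1 s t] by (simp add: qv_def)
next
  case False
  then have d: "d = 2" using exhaust_2[of d] by blast
  show ?thesis unfolding d using rp_nth[of 2 s t] poly_sl_tr[of k c s t] by (simp add: qv_def)
qed

lemma qd_rp: "qd k c d (rp d s t) = poly (dsl k (cd d c) s) t"
  by (simp add: qd_def)

lemma qd_oth_rp: "qd k c (oth d) (rp d s t) = poly (pderiv (sl k (cd d c) s)) t"
proof -
  have "qd k c (oth d) (rp d s t) = poly (dsl k (tr (cd d c)) t) s" unfolding qd_def by (simp add: cd_oth)
  then show ?thesis by (simp add: poly_dsl_tr)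
qed

lemma Qk_coeffs: assumes "p \<in> Qk k" obtains c where "\<And>z. p z = qv k c z"
  using assms unfolding Qk_def qv_def poly_sl by blast

lemma qv_has_derivative: "(qv k c has_derivative (\<lambda>v. v $ 1 * qd k c 1 z + v $ 2 * qd k c 2 z)) (at z)"
proof -
  have n: "((\<lambda>z :: real^2. z $ i) has_derivative (\<lambda>v. v $ i)) (at z)" for i
    by (rule bounded_linear_imp_has_derivative[OF bounded_linear_vec_nth])
  have "((\<lambda>z. \<Sum>a\<le>k. \<Sum>b\<le>k. c a b * z $ 1 ^ a * z $ 2 ^ b) has_derivative
      (\<lambda>v. \<Sum>a\<le>k. \<Sum>b\<le>k. v $ 1 * (c a b * (real a * z $ 1 ^ (a - 1)) * z $ 2 ^ b) + v $ 2 * (c a b * z $ 1 ^ a * (real b * z $ 2 ^ (b - 1))))) (at z)"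
  proof (intro has_derivative_sum)
    fix a b
    show "((\<lambda>z. c a b * z $ 1 ^ a * z $ 2 ^ b) has_derivative
      (\<lambda>v. v $ 1 * (c a b * (real a * z $ 1 ^ (a - 1)) * z $ 2 ^ b) + v $ 2 * (c a b * z $ 1 ^ a * (real b * z $ 2 ^ (b - 1))))) (at z)"
    proof -
      have 1: "((\<lambda>z. c a b * z $ 1 ^ a) has_derivative (\<lambda>v. c a b * (real a * v $ 1 * z $ 1 ^ (a - 1)))) (at z)"
        by (rule has_derivative_mult_right[OF has_derivative_power[OF n]])
      show ?thesis
        by (rule has_derivative_eq_rhs[OF has_derivative_mult[OF 1 has_derivative_power[OF n]]])
          (simp add: fun_eq_iff algebra_simps)
    qed
  qed
  moreover have "(\<lambda>z. \<Sum>a\<le>k. \<Sum>b\<le>k. c a b * z $ 1 ^ a * z $ 2 ^ b) = qv k c" by (simp add: fun_eq_iff qv_def poly_sl)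
  moreover have "(\<Sum>a\<le>k. \<Sum>b\<le>k. v $ 1 * (c a b * (real a * z $ 1 ^ (a - 1)) * z $ 2 ^ b) + v $ 2 * (c a b * z $ 1 ^ a * (real b * z $ 2 ^ (b - 1))))
     = v $ 1 * qd k c 1 z + v $ 2 * qd k c 2 z" for v :: "real^2"
  proof -
    have "qd k c 1 z = (\<Sum>a\<le>k. \<Sum>b\<le>k. c a b * (real a * z $ 1 ^ (a - 1)) * z $ 2 ^ b)"
      unfolding qd_def by (simp add: poly_dsl poly_pderiv_sl) (subst sum.swap, simp add: mult_ac)
    moreover have "qd k c 2 z = (\<Sum>a\<le>k. \<Sum>b\<le>k. c a b * z $ 1 ^ a * (real b * z $ 2 ^ (b - 1)))"
      unfolding qd_def by (simp add: poly_dsl_tr poly_pderiv_sl)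
    ultimately show ?thesis by (simp add: sum.distrib sum_distrib_left)
  qed
  ultimately show ?thesis by simp
qed

lemma qd_continuous: "continuous_on S (qd k c d)"
proof -
  have "continuous_on S (\<lambda>z. \<Sum>a\<le>k. \<Sum>b\<le>k. cd d c b a * z $ oth d ^ a * (real b * z $ d ^ (b - 1)))"
    by (intro continuous_intros)
  then show ?thesis unfolding qd_def[abs_def] poly_dsl poly_pderiv_sl .
qed

lemma pd_ref_cong_derivative:
  assumes z: "z \<in> ref_square" and f: "\<And>z. z \<in> ref_square \<Longrightarrow> f z = F z" and D: "(F has_derivative D) (at z)"
  shows "pd ref_square i f z = D (axis i 1)"
proof (rule pd_ref_has_derivative[OF z])
  show "(f has_derivative D) (at z within ref_square)"
    by (rule has_derivative_transform[OF z f has_derivative_at_withinI[OF D]])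
qed

lemma pd_ref_qv:
  assumes z: "z \<in> ref_square" and f: "\<And>z. z \<in> ref_square \<Longrightarrow> f z = qv k c z"
  shows "pd ref_square i f z = qd k c i z"
proof -
  have "pd ref_square i f z = axis i 1 $ 1 * qd k c 1 z + axis i 1 $ 2 * qd k c 2 z"
    by (rule pd_ref_cong_derivative[where F="qv k c", OF z f qv_has_derivative])
  moreover have "i = 1 \<or> i = 2" by (rule exhaust_2)
  ultimately show ?thesis by (auto simp: axis_def)
qed

lemma pd_ref_mixed:
  assumes z: "z \<in> ref_square" and f: "\<And>z. z \<in> ref_square \<Longrightarrow> f z = qv k c z"
  shows "pd ref_square 1 (pd ref_square 2 f) z = poly (pderiv (dsl k c (z $ 1))) (z $ 2)"
proof -
  \<comment> \<open>Coefficients of \<partial>_y p, shifted down by one and padded with zero at k,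
    so that the first-derivative formula can be reused for the mixed derivative.\<close>
  define c' where "c' a b = (if b < k then c a (Suc b) * real (Suc b) else 0)" for a b
  have "qd k c 2 z = qv k c' z" for z
  proof -
    have *: "(\<Sum>b\<le>k. c a b * z $ 1 ^ a * (real b * z $ 2 ^ (b - 1))) = (\<Sum>b\<le>k. c' a b * z $ 1 ^ a * z $ 2 ^ b)" for a
    proof -
      have "(\<Sum>b\<le>k. c a b * z $ 1 ^ a * (real b * z $ 2 ^ (b - 1))) = (\<Sum>b<k. c a (Suc b) * z $ 1 ^ a * (real (Suc b) * z $ 2 ^ b))"
        by (subst sum.atMost_shift) simp
      also have "\<dots> = (\<Sum>b<k. c' a b * z $ 1 ^ a * z $ 2 ^ b)" by (intro sum.cong) (auto simp: c'_def)
      also have "\<dots> = (\<Sum>b\<le>k. c' a b * z $ 1 ^ a * z $ 2 ^ b)" by (rule sum.mono_neutral_left) (auto simp: c'_def)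
      finally show ?thesis .
    qed
    show ?thesis unfolding qd_def qv_def cd_simps oth_simps poly_dsl_tr poly_pderiv_sl poly_sl using * by simp
  qed
  then have "pd ref_square 2 f z = qv k c' z" if "z \<in> ref_square" for z using pd_ref_qv[OF that f] by simp
  then have "pd ref_square 1 (pd ref_square 2 f) z = qd k c' 1 z" by (rule pd_ref_qv[OF z])
  also have "\<dots> = poly (pderiv (dsl k c (z $ 1))) (z $ 2)"
  proof -
    have "(\<Sum>b\<le>k. c' a b * z $ 2 ^ b * (real a * z $ 1 ^ (a - 1))) = (\<Sum>b\<le>k. c a b * (real a * z $ 1 ^ (a - 1)) * (real b * z $ 2 ^ (b - 1)))" for a
    proof -
      have "(\<Sum>b\<le>k. c a b * (real a * z $ 1 ^ (a - 1)) * (real b * z $ 2 ^ (b - 1))) = (\<Sum>b<k. c a (Suc b) * (real a * z $ 1 ^ (a - 1)) * (real (Suc b) * z $ 2 ^ b))"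
        by (subst sum.atMost_shift) simp
      also have "\<dots> = (\<Sum>b<k. c' a b * z $ 2 ^ b * (real a * z $ 1 ^ (a - 1)))" by (intro sum.cong) (auto simp: c'_def)
      also have "\<dots> = (\<Sum>b\<le>k. c' a b * z $ 2 ^ b * (real a * z $ 1 ^ (a - 1)))" by (rule sum.mono_neutral_left) (auto simp: c'_def)
      finally show ?thesis ..
    qed
    then show ?thesis unfolding qd_def cd_simps oth_simps poly_dsl poly_pderiv_sl poly_pderiv_dsl
      by (subst sum.swap) simp
  qed
  finally show ?thesis .
qed

lemma dI_linear_sum: "finite A \<Longrightarrow> dI k (p + (\<Sum>m\<in>A. smult (w m) (q m))) j = dI k p j + (\<Sum>m\<in>A. w m * dI k (q m) j)"
proof (induction A rule: finite_induct)
  case (insert a A)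
  have *: "dI k (p + smult w q) j = dI k p j + w * dI k q j" for p q and w :: real
    by (simp add: dI_def pderiv_add pderiv_smult sum.distrib sum_distrib_left algebra_simps)
  have "p + (\<Sum>m\<in>insert a A. smult (w m) (q m)) = (p + (\<Sum>m\<in>A. smult (w m) (q m))) + smult (w a) (q a)"
    using insert by (simp add: add_ac)
  then have "dI k (p + (\<Sum>m\<in>insert a A. smult (w m) (q m))) j
      = dI k (p + (\<Sum>m\<in>A. smult (w m) (q m))) j + w a * dI k (q a) j" by (simp only: *)
  then show ?case using insert by simp
qed simp

text \<open>The solution of the defining equations of the dual interpolation on one element:
  \<open>dI\<close> in the second variable plus the jumps over the first i Gauss lines. It is the
  tensor product of the one-dimensional interpolation with itself.\<close>

definition Vn :: "nat \<Rightarrow> (nat \<Rightarrow> nat \<Rightarrow> real) \<Rightarrow> nat \<Rightarrow> nat \<Rightarrow> real" where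
  "Vn k c i j = dI k (sl k c (-1)) j + (\<Sum>m\<in>{1..i}. gauss_wt k m * dI k (dsl k c (gauss_pt k m)) j)"

text \<open>Expanded, the value consists of a corner value, two edge sums and a double sum of mixed
  derivatives; transposition exchanges the edge sums and keeps the rest.\<close>

lemma Vn_tr: "Vn k (tr c) j i = Vn k c i j"
proof -
  have e: "Vn k c i j = poly (sl k c (-1)) (-1)
      + (\<Sum>n\<in>{1..j}. gauss_wt k n * poly (pderiv (sl k c (-1))) (gauss_pt k n))
      + ((\<Sum>m\<in>{1..i}. gauss_wt k m * poly (dsl k c (gauss_pt k m)) (-1))
      + (\<Sum>m\<in>{1..i}. \<Sum>n\<in>{1..j}. gauss_wt k m * (gauss_wt k n * poly (pderiv (dsl k c (gauss_pt k m))) (gauss_pt k n))))" for c i j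
    unfolding Vn_def dI_def by (simp add: distrib_left sum.distrib sum_distrib_left)
  have p: "poly (pderiv (dsl k (tr c) t)) s = poly (pderiv (dsl k c s)) t" for s t
    unfolding poly_pderiv_dsl by (subst sum.swap) (simp add: mult_ac)
  have "(\<Sum>m\<in>{1..j}. \<Sum>n\<in>{1..i}. gauss_wt k m * (gauss_wt k n * poly (pderiv (dsl k (tr c) (gauss_pt k m))) (gauss_pt k n)))
      = (\<Sum>m\<in>{1..i}. \<Sum>n\<in>{1..j}. gauss_wt k m * (gauss_wt k n * poly (pderiv (dsl k c (gauss_pt k m))) (gauss_pt k n)))"
    unfolding p by (subst sum.swap) (simp only: mult.left_commute)
  then show ?thesis unfolding e[of c i j] e[of "tr c" j i] poly_sl_tr[of k c] poly_dsl[of k c, symmetric] poly_dsl_tr[of k c]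
    by linarith
qed

lemma Vn_0 [simp]: "Vn k c 0 j = dI k (sl k c (-1)) j" by (simp add: Vn_def)

lemma Vn_jump: "i \<in> {1..k} \<Longrightarrow> Vn k c i j - Vn k c (i - 1) j = gauss_wt k i * dI k (dsl k c (gauss_pt k i)) j"
  by (cases i) (auto simp: Vn_def)

text \<open>\<partial>_x p has degree at most k - 1 in x, so the Gauss rule gives the trace at 1
  exactly as the trace at -1 plus weighted slices, and \<open>dI\<close> is linear. Values on this
  edge thus depend on the trace of u alone, which a neighbour shares.\<close>

lemma Vn_end: assumes "k \<ge> 1" shows "Vn k c k j = dI k (sl k c 1) j"
proof -
  have "sl k c 1 = sl k c (-1) + (\<Sum>m\<in>{1..k}. smult (gauss_wt k m) (dsl k c (gauss_pt k m)))"
  proof (rule poly_eq_poly_eq_iff[THEN iffD1], rule ext)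
    fix t
    have "poly (sl k c 1) t = poly (sl k (tr c) t) 1" by (rule poly_sl_tr[symmetric])
    also have "\<dots> = dI k (sl k (tr c) t) k" by (rule dI_end[OF assms degree_sl, symmetric])
    also have "\<dots> = poly (sl k c (-1)) t + (\<Sum>m\<in>{1..k}. gauss_wt k m * poly (dsl k c (gauss_pt k m)) t)"
      unfolding dI_def poly_sl_tr[of k c] poly_dsl[of k c] ..
    finally show "poly (sl k c 1) t = poly (sl k c (-1) + (\<Sum>m\<in>{1..k}. smult (gauss_wt k m) (dsl k c (gauss_pt k m)))) t"
      by (simp add: poly_sum)
  qed
  then show ?thesis unfolding Vn_def by (simp add: dI_linear_sum)
qed

lemma Vn_edge:
  assumes "k \<ge> 1" "s = -1 \<or> s = 1"
  shows "Vn k c (if s = 1 then k else 0) j = dI k (sl k c s) j"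
  using assms Vn_end by auto

section \<open>Element edges: shared edges and boundary edges\<close>

context fv_mesh
begin

definition ie :: "real \<Rightarrow> nat" where "ie s = (if s = 1 then k else 0)"

lemma ie_le [simp]: "ie s \<le> k" by (simp add: ie_def)

lemma l_ie: "s = -1 \<or> s = 1 \<Longrightarrow> l (ie s) = s"
  using l by (auto simp: ie_def lagrange_nodes_def)

lemma l_tau:
  assumes "\<tau> = -1 \<or> \<tau> = (1::real)" "j \<le> k"
  shows "l (if \<tau> = 1 then j else k - j) = \<tau> * l j"
  using assms lagrange_node_symm[OF l assms(2)] by auto

lemma gI_tau:
  assumes "\<tau> = -1 \<or> \<tau> = (1::real)" "j \<le> k"
  shows "\<tau> * t \<in> gI k j \<longleftrightarrow> t \<in> gI k (if \<tau> = 1 then j else k - j)"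
proof (cases "\<tau> = 1")
  case False
  then have "\<tau> = -1" using assms by simp
  moreover have "- t \<in> gI k j \<longleftrightarrow> t \<in> gI k (k - j)"
    using gI_reflect[of j k "- t"] gI_reflect[of "k - j" k t] assms(2) by auto
  ultimately show ?thesis by simp
qed simp

lemma edge_point:
  assumes K: "K \<in> cells M" and s: "s = -1 \<or> s = 1" and j: "j \<le> k" and x: "x \<in> face K d s j" "x \<notin> Bad"
  obtains t where "x = emap M K (rp d s t)" "t \<in> gI k j" "t \<notin> g ` {..Suc k}" "g j < t" "t < g (Suc j)" "-1 < t" "t < 1"
proof -
  obtain t where t: "t \<in> gI k j" "x = emap M K (rp d s t)" using x(1) unfolding face_def by blast
  \<comment> \<open>Edges are grid lines too, with the Gauss indices 0 and k + 1; hence points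
    outside \<open>Bad\<close> avoid the Gauss parameters along an edge as well.\<close>
  define i where "i = (if s = 1 then Suc k else 0)"
  have i: "i \<le> Suc k" "g i = s" using s by (auto simp: i_def)
  have tn: "t \<notin> g ` {..Suc k}" using not_Bad[OF K i(1), of d t] x(2) t(2) i(2) by simp
  have to: "g j < t" "t < g (Suc j)" using gI_open[OF t(1) tn j] by auto
  have "-1 \<le> g j" "g (Suc j) \<le> 1" using gauss_pt_bounds[of j k] gauss_pt_bounds[of "Suc j" k] j by auto
  then show ?thesis using that[OF t(2,1) tn to] to by linarith
qed

text \<open>Seen from a neighbour the point has parameter \<tau> t. Reversal sends segment j to k -
  j and, the Lagrange nodes being symmetric, node j to node k - j, so the neighbour names the same
  node.\<close>

lemma edge_cv:
  assumes K: "K \<in> cells M" and s: "s = -1 \<or> s = 1" and j: "j \<le> k"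
    and t: "t \<in> gI k j" "t \<notin> g ` {..Suc k}" "-1 < t" "t < 1"
    and Q: "emap M K (rp d s t) \<in> control_volume k l M Q"
  shows "Q = nodeP K d (ie s) j"
proof -
  obtain K' z where K': "K' \<in> cells M" "cellc K' Q z" "emap M K (rp d s t) = emap M K' z" using Q unfolding control_volume_iff by blast
  have zr: "z \<in> ref_square" by (rule cellc_ref[OF K'(2)])
  have sr: "rp d s t \<in> ref_square" using s t by auto
  show ?thesis
  proof (cases "K' = K")
    case True
    have z: "z = rp d s t" using inj\<Psi>[OF K zr sr] K'(3) True by simp
    have "cellc K Q (rp d s t)" using K'(2) unfolding True z .
    then have "\<exists>i'\<le>k. \<exists>j'\<le>k. s \<in> gI k i' \<and> t \<in> gI k j' \<and> nodeP K d i' j' = Q"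
      unfolding cellc_d[of K Q "rp d s t" d] rp_nth .
    then obtain i' j' where ij: "i' \<le> k" "j' \<le> k" "s \<in> gI k i'" "t \<in> gI k j'" "nodeP K d i' j' = Q" by blast
    have "i' = ie s" using gI_endpoint[OF s ij(1)] ij(3) by (simp add: ie_def)
    moreover have "j' = j" by (rule gI_unique[OF ij(4) t(1) ij(2) j t(2)])
    ultimately show ?thesis using ij(5) by simp
  next
    case False
    have xK: "emap M K (rp d s t) \<in> elem M K'" unfolding K'(3) by (rule \<Psi>_in[OF zr])
    obtain d' s' \<tau> where e: "s' = -1 \<or> s' = 1" "\<tau> = -1 \<or> \<tau> = 1"
      "elem M K \<inter> elem M K' = emap M K ` rp d s ` {-1..1}" "elem M K \<inter> elem M K' = emap M K' ` rp d' s' ` {-1..1}"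
      "\<forall>t\<in>{-1..1}. emap M K (rp d s t) = emap M K' (rp d' s' (\<tau> * t))"
      by (rule edge_meet[OF K K'(1) False s t(3,4) xK]) (rule that)
    have t11: "t \<in> {-1..1}" using t(3,4) by simp
    have eq: "emap M K' z = emap M K' (rp d' s' (\<tau> * t))" by (rule trans[OF K'(3)[symmetric] bspec[OF e(5) t11]])
    have r': "rp d' s' (\<tau> * t) \<in> ref_square" unfolding rp_in_ref using e(1,2) t(3,4) by auto
    have z: "z = rp d' s' (\<tau> * t)" by (rule inj\<Psi>[OF K'(1) zr r' eq])
    have "cellc K' Q (rp d' s' (\<tau> * t))" using K'(2) unfolding z .
    then have "\<exists>i'\<le>k. \<exists>j'\<le>k. s' \<in> gI k i' \<and> \<tau> * t \<in> gI k j' \<and> nodeP K' d' i' j' = Q"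
      unfolding cellc_d[of K' Q "rp d' s' (\<tau> * t)" d'] rp_nth .
    then obtain i' j' where ij: "i' \<le> k" "j' \<le> k" "s' \<in> gI k i'" "\<tau> * t \<in> gI k j'" "nodeP K' d' i' j' = Q" by blast
    have i': "i' = ie s'" using gI_endpoint[OF e(1) ij(1)] ij(3) by (simp add: ie_def)
    have "t \<in> gI k (if \<tau> = 1 then j' else k - j')" using gI_tau[OF e(2) ij(2)] ij(4) by blast
    then have "(if \<tau> = 1 then j' else k - j') = j" by (rule gI_unique[OF _ t(1) _ j t(2)]) (use ij(2) in auto)
    then have lj: "l j = \<tau> * l j'" using l_tau[OF e(2) ij(2)] by simp
    have "\<tau> * l j = l j'" using e(2) unfolding lj by auto
    then have "nodeP K' d' i' j' = emap M K' (rp d' s' (\<tau> * l j))" unfolding nodeP_def i' l_ie[OF e(1)] by simp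
    also have "\<dots> = emap M K (rp d s (l j))" using e(5) lagrange_node_bounds[OF l j] by simp
    also have "\<dots> = nodeP K d (ie s) j" unfolding nodeP_def l_ie[OF s] ..
    finally show ?thesis using ij(5) by simp
  qed
qed

lemma edge_in_cv:
  assumes K: "K \<in> cells M" and s: "s = -1 \<or> s = 1" and j: "j \<le> k" and t: "t \<in> gI k j"
  shows "emap M K (rp d s t) \<in> control_volume k l M (nodeP K d (ie s) j)"
proof -
  have "s \<in> gI k (ie s)" using gI_endpoint[OF s ie_le[of s]] by (simp add: ie_def)
  then have "cellc K (nodeP K d (ie s) j) (rp d s t)"
    unfolding cellc_d[of K _ _ d] rp_nth using t j ie_le[of s] by blast
  then show ?thesis unfolding control_volume_iff using K by blast
qed

text \<open>\<open>1 + g 1\<close> is the width of the first Gauss segment and by symmetry of the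
  last one.\<close>

lemma near_edge_cellc:
  assumes K: "K \<in> cells M" and s: "s = -1 \<or> s = 1" and j: "j \<le> k"
    and z: "\<bar>s - z $ d\<bar> < 1 + g 1" "z $ d \<in> {-1..1}" "z $ oth d \<in> gI k j"
  shows "cellc K (nodeP K d (ie s) j) z"
proof -
  have gk: "g k = - g 1" using gauss_pt_symm[of 1 k] by simp
  have "z $ d \<in> gI k (ie s)"
    using s z(1,2) gk by (auto simp: ie_def gI_def)
  then show ?thesis unfolding cellc_d[of K _ z d] using z(3) j ie_le[of s] by blast
qed

text \<open>The one-sided neighbourhoods in both elements belong to the control volume of one node,
  and glued together they form a full neighbourhood. A shared edge therefore contributes to no
  boundary.\<close>

lemma shared_edge:
  assumes K: "K \<in> cells M" and s: "s = -1 \<or> s = 1" and j: "j \<le> k" and x: "x \<in> face K d s j" "x \<notin> Bad"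
    and sh: "shared M K d s"
  shows "x \<notin> Gamma_h M" "x \<notin> frontier (control_volume k l M P)"
proof -
  obtain t where t: "x = emap M K (rp d s t)" "t \<in> gI k j" "t \<notin> g ` {..Suc k}" "g j < t" "t < g (Suc j)" "-1 < t" "t < 1"
    by (rule edge_point[OF K s j x]) (rule that)
  obtain K' where K': "K' \<in> cells M" "K' \<noteq> K" "elem M K \<inter> elem M K' = emap M K ` rp d s ` {-1..1}"
    using sh unfolding shared_def by blast
  have "emap M K (rp d s t) \<in> emap M K ` rp d s ` {-1..1}" by (intro imageI) (use t(6,7) in auto)
  then have xK: "emap M K (rp d s t) \<in> elem M K'" unfolding K'(3)[symmetric] by (rule IntD2)
  obtain d' s' \<tau> where e: "s' = -1 \<or> s' = 1" "\<tau> = -1 \<or> \<tau> = 1"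
      "elem M K \<inter> elem M K' = emap M K ` rp d s ` {-1..1}" "elem M K \<inter> elem M K' = emap M K' ` rp d' s' ` {-1..1}"
      "\<forall>t\<in>{-1..1}. emap M K (rp d s t) = emap M K' (rp d' s' (\<tau> * t))"
    by (rule edge_meet[OF K K'(1,2) s t(6,7) xK]) (rule that)
  let ?P = "nodeP K d (ie s) j"
  define j' where "j' = (if \<tau> = 1 then j else k - j)"
  have j': "j' \<le> k" using j by (simp add: j'_def)
  have P': "nodeP K' d' (ie s') j' = ?P"
  proof -
    have "nodeP K' d' (ie s') j' = emap M K' (rp d' s' (\<tau> * l j))"
      unfolding nodeP_def l_ie[OF e(1)] j'_def l_tau[OF e(2) j] ..
    also have "\<dots> = emap M K (rp d s (l j))" using e(5) lagrange_node_bounds[OF l j] by simp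
    finally show ?thesis unfolding nodeP_def l_ie[OF s] .
  qed
  have gk: "g k = - g 1" using gauss_pt_symm[of 1 k] by simp
  \<comment> \<open>Since g k = - g 1 and g 1 \<le> g k, the first Gauss point is at most 0, as the
    depth bound in \<open>glued_edge_interior\<close> demands.\<close>
  have \<delta>: "0 < 1 + g 1" "1 + g 1 \<le> 1"
    using gauss_pt_inner[of 1 k] gauss_pt_le[of 1 k k] k gk by auto
  have ab: "-1 \<le> g j" "g (Suc j) \<le> 1" using gauss_pt_bounds[of j k] gauss_pt_bounds[of "Suc j" k] j by auto
  let ?A = "emap M K ` {z. \<bar>s - z $ d\<bar> < 1 + g 1 \<and> z $ d \<in> {-1..1} \<and> z $ oth d \<in> {g j<..<g (Suc j)}}"
  let ?B = "emap M K' ` {z. \<bar>s' - z $ d'\<bar> < 1 + g 1 \<and> z $ d' \<in> {-1..1} \<and> \<tau> * z $ oth d' \<in> {g j<..<g (Suc j)}}"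
  have int: "x \<in> interior (?A \<union> ?B)"
    unfolding t(1)
    by (rule glued_edge_interior[OF K K'(1,2) s e(1,2) K'(3) _ ab(1) t(4,5) ab(2) \<delta>]) (rule bspec[OF e(5)])
  have "?A \<union> ?B \<subseteq> control_volume k l M ?P"
  proof (intro Un_least image_subsetI)
    fix z assume "z \<in> {z. \<bar>s - z $ d\<bar> < 1 + g 1 \<and> z $ d \<in> {-1..1} \<and> z $ oth d \<in> {g j<..<g (Suc j)}}"
    then have "cellc K ?P z" by (intro near_edge_cellc[OF K s j]) (auto simp: gI_def)
    then show "emap M K z \<in> control_volume k l M ?P" unfolding control_volume_iff using K by blast
  next
    fix z assume z: "z \<in> {z. \<bar>s' - z $ d'\<bar> < 1 + g 1 \<and> z $ d' \<in> {-1..1} \<and> \<tau> * z $ oth d' \<in> {g j<..<g (Suc j)}}"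
    then have "\<tau> * z $ oth d' \<in> gI k j" by (auto simp: gI_def)
    then have "z $ oth d' \<in> gI k j'" unfolding j'_def gI_tau[OF e(2) j] .
    then have "cellc K' (nodeP K' d' (ie s') j') z" using z by (intro near_edge_cellc[OF K'(1) e(1) j']) auto
    then show "emap M K' z \<in> control_volume k l M ?P" unfolding P' control_volume_iff using K'(1) by blast
  qed
  then have xi: "x \<in> interior (control_volume k l M ?P)" using int interior_mono by blast
  then have "x \<in> interior (Omega_h M)" using interior_mono[OF control_volume_sub] by blast
  then show "x \<notin> Gamma_h M" unfolding Gamma_h_def frontier_def by blast
  show "x \<notin> frontier (control_volume k l M P)"
  proof
    assume f: "x \<in> frontier (control_volume k l M P)"
    then have "x \<in> control_volume k l M P" using frontier_subset_closed[OF closed_control_volume] by blast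
    then have "P = ?P" unfolding t(1) by (rule edge_cv[OF K s j t(2,3,6,7)])
    then show False using f xi unfolding frontier_def by blast
  qed
qed

lemma unshared_alone:
  assumes K: "K \<in> cells M" and s: "s = -1 \<or> s = 1" and t: "-1 < t" "t < 1" and sh: "\<not> shared M K d s"
    and K': "K' \<in> cells M" "emap M K (rp d s t) \<in> elem M K'"
  shows "K' = K"
proof (rule ccontr)
  assume ne: "K' \<noteq> K"
  obtain d' s' \<tau> where s': "s' = -1 \<or> s' = 1" and "\<tau> = -1 \<or> \<tau> = (1::real)"
      and m: "elem M K \<inter> elem M K' = emap M K ` rp d s ` {-1..1}" "elem M K \<inter> elem M K' = emap M K' ` rp d' s' ` {-1..1}"
      and "\<forall>t\<in>{-1..1}. emap M K (rp d s t) = emap M K' (rp d' s' (\<tau> * t))"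
    by (rule edge_meet[OF K K'(1) ne s t K'(2)]) (rule that)
  have "shared M K d s" unfolding shared_def
    by (rule bexI[OF _ K'(1)], rule exI[of _ d'], rule exI[of _ s'], intro conjI) (fact ne s' m)+
  then show False using sh by simp
qed

text \<open>No other element contains the point. Were it interior to \<Omega>_h, removing the
  finitely many other closed elements would make it interior to K, but interior points of K come
  from the open square.\<close>

lemma unshared_open_edge:
  assumes K: "K \<in> cells M" and s: "s = -1 \<or> s = 1" and t: "-1 < t" "t < 1" and sh: "\<not> shared M K d s"
  shows "emap M K (rp d s t) \<in> Gamma_h M"
proof -
  let ?x = "emap M K (rp d s t)"
  have sr: "rp d s t \<in> ref_square" using s t by auto
  have xO: "?x \<in> Omega_h M" unfolding Omega_h_def using \<Psi>_in[OF sr] K by blast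
  have "?x \<notin> interior (Omega_h M)"
  proof
    assume a: "?x \<in> interior (Omega_h M)"
    let ?O = "interior (Omega_h M) - (\<Union>K'\<in>cells M - {K}. elem M K')"
    have "closed (\<Union>K'\<in>cells M - {K}. elem M K')" using fin closed_elem by (intro closed_UN) auto
    then have "open ?O" by (rule open_Diff[OF open_interior])
    moreover have "?x \<notin> (\<Union>K'\<in>cells M - {K}. elem M K')"
    proof
      assume "?x \<in> (\<Union>K'\<in>cells M - {K}. elem M K')"
      then obtain K' where K': "K' \<in> cells M" "K' \<noteq> K" "?x \<in> elem M K'" by blast
      then show False using unshared_alone[OF K s t sh K'(1,3)] by simp
    qed
    with a have "?x \<in> ?O" by simp
    moreover have "?O \<subseteq> elem M K" using interior_subset[of "Omega_h M"] unfolding Omega_h_def by blast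
    ultimately have "?x \<in> interior (elem M K)" by (rule interiorI)
    then obtain z where z: "?x = emap M K z" "z \<in> interior ref_square" unfolding interior_elem[OF K] by (rule imageE)
    have "rp d s t = z" by (rule inj\<Psi>[OF K sr subsetD[OF interior_subset z(2)] z(1)])
    then have "-1 < s \<and> s < 1" using z(2) unfolding interior_ref mem_Collect_eq all_oth[of _ d] by auto
    then show False using s by auto
  qed
  then show ?thesis unfolding Gamma_h_def frontier_def using xO closure_subset by blast
qed

text \<open>\<Gamma>_h is closed and contains the open edge, hence its end points. All nodes of a
  boundary edge, corners included, are thus among those summed over in \<open>r_h\<close>.\<close>

lemma unshared_node:
  assumes K: "K \<in> cells M" and s: "s = -1 \<or> s = 1" and sh: "\<not> shared M K d s" and j: "j \<le> k"
  shows "nodeP K d (ie s) j \<in> Gamma_h M"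
proof -
  have c: "continuous_on {-1..1} (\<lambda>t. emap M K (rp d s t))"
    using s by (intro continuous_on_compose2[OF cont\<Psi>[OF K] cont_rp]) auto
  have cl: "closure {-1<..<1::real} = {-1..1}" by simp
  have "(\<lambda>t. emap M K (rp d s t)) ` closure {-1<..<1} \<subseteq> Gamma_h M"
  proof (rule image_closure_subset)
    show "continuous_on (closure {-1<..<1}) (\<lambda>t. emap M K (rp d s t))" unfolding cl by (rule c)
    show "closed (Gamma_h M)" unfolding Gamma_h_def by simp
    show "(\<lambda>t. emap M K (rp d s t)) ` {-1<..<1} \<subseteq> Gamma_h M"
      by (rule image_subsetI, rule unshared_open_edge[OF K s _ _ sh]) auto
  qed
  then show ?thesis unfolding cl nodeP_def l_ie[OF s]
    by (rule subsetD[OF _ imageI]) (use lagrange_node_bounds[OF l j] in simp)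
qed

lemma unshared_edge:
  assumes K: "K \<in> cells M" and s: "s = -1 \<or> s = 1" and j: "j \<le> k" and x: "x \<in> face K d s j" "x \<notin> Bad"
    and sh: "\<not> shared M K d s"
  shows "x \<in> Gamma_h M" "x \<in> frontier (control_volume k l M P) \<longleftrightarrow> P = nodeP K d (ie s) j"
proof -
  obtain t where t: "x = emap M K (rp d s t)" "t \<in> gI k j" "t \<notin> g ` {..Suc k}" "g j < t" "t < g (Suc j)" "-1 < t" "t < 1"
    by (rule edge_point[OF K s j x]) (rule that)
  show G: "x \<in> Gamma_h M" unfolding t(1) by (rule unshared_open_edge[OF K s t(6,7) sh])
  show "x \<in> frontier (control_volume k l M P) \<longleftrightarrow> P = nodeP K d (ie s) j"
  proof
    assume "x \<in> frontier (control_volume k l M P)"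
    then have "x \<in> control_volume k l M P" using frontier_subset_closed[OF closed_control_volume] by blast
    then show "P = nodeP K d (ie s) j" unfolding t(1) by (rule edge_cv[OF K s j t(2,3,6,7)])
  next
    assume P: "P = nodeP K d (ie s) j"
    have "x \<in> control_volume k l M P" unfolding P t(1) by (rule edge_in_cv[OF K s j t(2)])
    moreover have "x \<notin> interior (control_volume k l M P)"
      using G interior_mono[OF control_volume_sub] unfolding Gamma_h_def frontier_def by blast
    ultimately show "x \<in> frontier (control_volume k l M P)" unfolding frontier_def using closure_subset by blast
  qed
qed

lemma open_cell_not_frontier:
  assumes K: "K \<in> cells M" and z: "z \<in> ref_square" and ng: "\<And>d. z $ d \<notin> g ` {..Suc k}"
  shows "emap M K z \<notin> frontier (control_volume k l M P)" "z \<in> interior ref_square"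
proof -
  have b: "-1 \<le> z $ d" "z $ d \<le> 1" for d using z by (auto simp: ref_square_iff)
  obtain i where i: "i \<le> k" "z $ 1 \<in> gI k i" using gI_exists[OF b] by blast
  obtain j where j: "j \<le> k" "z $ 2 \<in> gI k j" using gI_exists[OF b] by blast
  have io: "g i < z $ 1" "z $ 1 < g (Suc i)" using gI_open[OF i(2) ng i(1)] by auto
  have jo: "g j < z $ 2" "z $ 2 < g (Suc j)" using gI_open[OF j(2) ng j(1)] by auto
  have gb: "-1 \<le> g m \<and> g (Suc m) \<le> 1" if "m \<le> k" for m using gauss_pt_bounds[of m k] gauss_pt_bounds[of "Suc m" k] that by auto
  define W where "W = {w :: real^2. g i < w $ 1 \<and> w $ 1 < g (Suc i) \<and> g j < w $ 2 \<and> w $ 2 < g (Suc j)}"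
  have oW: "open W" unfolding W_def by (intro open_Collect_conj open_Collect_less continuous_intros)
  have zW: "z \<in> W" using io jo unfolding W_def by simp
  have Wi: "W \<subseteq> interior ref_square"
  proof
    fix w assume "w \<in> W"
    then show "w \<in> interior ref_square"
      unfolding interior_ref W_def mem_Collect_eq forall_2 using gb[OF i(1)] gb[OF j(1)] by linarith
  qed
  then show zi: "z \<in> interior ref_square" using zW by blast
  have oi: "open (emap M K ` W)" by (rule open_im[OF K oW]) (use Wi interior_subset in blast)
  let ?P = "nodeP K 1 i j"
  have "emap M K ` W \<subseteq> control_volume k l M ?P"
  proof (rule image_subsetI)
    fix w assume "w \<in> W"
    then have "w $ 1 \<in> gI k i" "w $ 2 \<in> gI k j" unfolding W_def gI_def by auto
    then have "cellc K ?P w" unfolding cellc_def using i(1) j(1) by blast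
    then show "emap M K w \<in> control_volume k l M ?P" unfolding control_volume_iff using K by blast
  qed
  then have xi: "emap M K z \<in> interior (control_volume k l M ?P)" using zW by (intro interiorI[OF oi imageI])
  show "emap M K z \<notin> frontier (control_volume k l M P)"
  proof
    assume f: "emap M K z \<in> frontier (control_volume k l M P)"
    then have "emap M K z \<in> control_volume k l M P" using frontier_subset_closed[OF closed_control_volume] by blast
    then have "cellc K P z" using cv_interior[OF K zi] by blast
    then obtain i' j' where ij: "i' \<le> k" "j' \<le> k" "z $ 1 \<in> gI k i'" "z $ 2 \<in> gI k j'" "nodeP K 1 i' j' = P" unfolding cellc_def by blast
    have "i' = i" by (rule gI_unique[OF ij(3) i(2) ij(1) i(1) ng])
    moreover have "j' = j" by (rule gI_unique[OF ij(4) j(2) ij(2) j(1) ng])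
    ultimately have "P = ?P" using ij(5) by simp
    then show False using f xi unfolding frontier_def by blast
  qed
qed

text \<open>The midpoint of a Gauss subcell avoids all Gauss lines. Evaluation there recovers the
  coefficient of a dual function at the node.\<close>

lemma cv_unique_point:
  assumes K: "K \<in> cells M" and ij: "i \<le> k" "j \<le> k"
  shows "\<exists>x. \<forall>P. x \<in> control_volume k l M P \<longleftrightarrow> P = nodeP K 1 i j"
proof -
  define z where "z = pt ((g i + g (Suc i)) / 2) ((g j + g (Suc j)) / 2)"
  have mid: "(g m + g (Suc m)) / 2 \<notin> g ` {..Suc k}" "(g m + g (Suc m)) / 2 \<in> gI k m" if m: "m \<le> k" for m
  proof -
    have lt: "g m < g (Suc m)" using gauss_pt_less[of m "Suc m" k] m by simp
    show "(g m + g (Suc m)) / 2 \<in> gI k m" using lt by (simp add: gI_def)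
    show "(g m + g (Suc m)) / 2 \<notin> g ` {..Suc k}"
    proof
      assume "(g m + g (Suc m)) / 2 \<in> g ` {..Suc k}"
      then obtain n where n: "n \<le> Suc k" "(g m + g (Suc m)) / 2 = g n" by auto
      then have "g m < g n" "g n < g (Suc m)" using lt by auto
      moreover have "n \<le> m \<or> Suc m \<le> n" by linarith
      ultimately show False using gauss_pt_le[of n m k] gauss_pt_le[of "Suc m" n k] n(1) m by auto
    qed
  qed
  have z1: "z $ 1 \<in> gI k i" "z $ 2 \<in> gI k j" unfolding z_def pt_nth using mid(2) ij by auto
  have ng: "z $ d \<notin> g ` {..Suc k}" for d
  proof -
    have "d = 1 \<or> d = 2" by (rule exhaust_2)
    then show ?thesis using mid(1)[OF ij(1)] mid(1)[OF ij(2)] unfolding z_def by auto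
  qed
  have zr: "z \<in> ref_square" unfolding ref_square_iff forall_2 using gI_sub[OF ij(1) z1(1)] gI_sub[OF ij(2) z1(2)] by blast
  have zi: "z \<in> interior ref_square" by (rule open_cell_not_frontier(2)[OF K zr ng])
  have "emap M K z \<in> control_volume k l M P \<longleftrightarrow> P = nodeP K 1 i j" for P
  proof -
    have "cellc K P z \<longleftrightarrow> P = nodeP K 1 i j"
    proof
      assume "cellc K P z"
      then obtain i' j' where e: "i' \<le> k" "j' \<le> k" "z $ 1 \<in> gI k i'" "z $ 2 \<in> gI k j'" "nodeP K 1 i' j' = P" unfolding cellc_def by blast
      have "i' = i" by (rule gI_unique[OF e(3) z1(1) e(1) ij(1) ng])
      moreover have "j' = j" by (rule gI_unique[OF e(4) z1(2) e(2) ij(2) ng])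
      ultimately show "P = nodeP K 1 i j" using e(5) by simp
    next
      assume "P = nodeP K 1 i j"
      then show "cellc K P z" unfolding cellc_def using z1 ij by blast
    qed
    then show ?thesis using cv_interior[OF K zi] by blast
  qed
  then show ?thesis by blast
qed

text \<open>Inner faces are indexed by element, direction, Gauss line and segment, boundary segments by
  element, direction, side and segment.\<close>

definition IFs :: "((real^2) set \<times> 2 \<times> nat \<times> nat) set" where
  "IFs = cells M \<times> UNIV \<times> {1..k} \<times> {..k}"

definition BEs :: "((real^2) set \<times> 2 \<times> real \<times> nat) set" where
  "BEs = {(K, d, s, j). K \<in> cells M \<and> (s = -1 \<or> s = 1) \<and> j \<le> k \<and> \<not> shared M K d s}"

lemma finite_IFs: "finite IFs" unfolding IFs_def using fin by auto

lemma finite_BEs: "finite BEs"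
proof (rule finite_subset)
  show "BEs \<subseteq> cells M \<times> UNIV \<times> {-1, 1} \<times> {..k}" unfolding BEs_def by auto
  show "finite (cells M \<times> (UNIV :: 2 set) \<times> {-1, 1 :: real} \<times> {..k})" using fin by auto
qed

lemma point_cases:
  assumes x: "x \<in> Omega_h M" "x \<notin> Bad"
  obtains (cell) K z where "K \<in> cells M" "z \<in> interior ref_square" "x = emap M K z" "\<forall>P. x \<notin> frontier (control_volume k l M P)"
  | (inner) K d i j where "K \<in> cells M" "i \<in> {1..k}" "j \<le> k" "x \<in> face K d (g i) j"
  | (edge) K d s j where "K \<in> cells M" "s = -1 \<or> s = 1" "j \<le> k" "x \<in> face K d s j"
proof -
  obtain K z where K: "K \<in> cells M" and z: "z \<in> ref_square" "x = emap M K z" using x(1) unfolding Omega_h_def elem_def by blast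
  show ?thesis
  proof (cases "\<exists>d. z $ d \<in> g ` {..Suc k}")
    case False
    then have ng: "\<And>d. z $ d \<notin> g ` {..Suc k}" by blast
    show ?thesis
      by (rule cell[OF K open_cell_not_frontier(2)[OF K z(1) ng] z(2)]) (use open_cell_not_frontier(1)[OF K z(1) ng] z(2) in blast)
  next
    case True
    then obtain d i where i: "i \<le> Suc k" "z $ d = g i" by auto
    have zz: "z = rp d (g i) (z $ oth d)" using rp_collapse[of d z] i(2) by simp
    have b: "-1 \<le> z $ oth d" "z $ oth d \<le> 1" using z(1) by (auto simp: ref_square_iff)
    obtain j where j: "j \<le> k" "z $ oth d \<in> gI k j" using gI_exists[OF b] by blast
    have f: "x \<in> face K d (g i) j" unfolding face_def z(2) by (subst zz) (use j(2) in blast)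
    show ?thesis
    proof (cases "i \<in> {1..k}")
      case True then show ?thesis using inner[OF K _ j(1) f] by blast
    next
      case False
      then have "i = 0 \<or> i = Suc k" using i(1) by auto
      then have "g i = -1 \<or> g i = 1" by auto
      then show ?thesis using edge[OF K _ j(1) f] by blast
    qed
  qed
qed

lemma Gamma_h_sub: "Gamma_h M \<subseteq> Omega_h M"
  unfolding Gamma_h_def using closed_Omega_h by (rule frontier_subset_closed)

lemma inner_not_Gamma:
  assumes "K \<in> cells M" "i \<in> {1..k}" "j \<le> k" "x \<in> face K d (g i) j" "x \<notin> Bad"
  shows "x \<notin> Gamma_h M"
proof -
  obtain t where "x = emap M K (rp d (g i) t)" "rp d (g i) t \<in> interior ref_square"
    by (rule inner_face_local[OF assms]) (rule that)
  then show ?thesis using inner_face_not_Gamma[OF assms(1)] by blast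
qed

text \<open>A frontier point off the grid lies on a Gauss line or on an edge. Shared edges are not
  in the frontier, and the others belong to \<Gamma>_h, which \<open>bd0_P\<close> removes; only
  inner faces remain.\<close>

lemma bd0_iff:
  assumes x: "x \<notin> Bad"
  shows "x \<in> bd0_P k l M P \<longleftrightarrow> (\<exists>f\<in>{(K, d, i, j) \<in> IFs. P = nodeP K d (i - 1) j \<or> P = nodeP K d i j}. case f of (K, d, i, j) \<Rightarrow> x \<in> face K d (g i) j)"
    (is "_ \<longleftrightarrow> ?R")
proof
  assume b: "x \<in> bd0_P k l M P"
  then have f: "x \<in> frontier (control_volume k l M P)" "x \<notin> Gamma_h M" unfolding bd0_P_def Gamma_P_def by auto
  have xO: "x \<in> Omega_h M" using f(1) frontier_subset_closed[OF closed_control_volume] control_volume_sub by blast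
  show ?R
  proof (rule point_cases[OF xO x])
    fix K z assume "\<forall>P. x \<notin> frontier (control_volume k l M P)" then show ?R using f by blast
  next
    fix K d i j assume a: "K \<in> cells M" "i \<in> {1..k}" "j \<le> k" "x \<in> face K d (g i) j"
    then have "P = nodeP K d (i - 1) j \<or> P = nodeP K d i j" using inner_face_frontier[OF a x] f(1) by blast
    then show ?R using a unfolding IFs_def by (intro bexI[of _ "(K, d, i, j)"]) auto
  next
    fix K d s j assume a: "K \<in> cells M" "s = -1 \<or> s = 1" "j \<le> k" "x \<in> face K d s j"
    show ?R using shared_edge(2)[OF a x] unshared_edge(1)[OF a x] f by blast
  qed
next
  assume ?R
  then obtain K d i j where a: "K \<in> cells M" "i \<in> {1..k}" "j \<le> k" "x \<in> face K d (g i) j" "P = nodeP K d (i - 1) j \<or> P = nodeP K d i j"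
    unfolding IFs_def by auto
  have "x \<in> frontier (control_volume k l M P)" using inner_face_frontier[OF a(1-4) x] a(5) by blast
  moreover have "x \<notin> Gamma_h M" by (rule inner_not_Gamma[OF a(1-4) x])
  ultimately show "x \<in> bd0_P k l M P" unfolding bd0_P_def Gamma_P_def by blast
qed

lemma Gamma_h_iff:
  assumes x: "x \<notin> Bad"
  shows "x \<in> Gamma_h M \<longleftrightarrow> (\<exists>f\<in>BEs. case f of (K, d, s, j) \<Rightarrow> x \<in> face K d s j)" (is "_ \<longleftrightarrow> ?R")
proof
  assume G: "x \<in> Gamma_h M"
  then have xO: "x \<in> Omega_h M" using Gamma_h_sub by blast
  show ?R
  proof (rule point_cases[OF xO x])
    fix K z assume a: "K \<in> cells M" "z \<in> interior ref_square" "x = emap M K z"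
    then show ?R using inner_face_not_Gamma[OF a(1,2)] G by blast
  next
    fix K d i j assume a: "K \<in> cells M" "i \<in> {1..k}" "j \<le> k" "x \<in> face K d (g i) j"
    show ?R using inner_not_Gamma[OF a x] G by blast
  next
    fix K d s j assume a: "K \<in> cells M" "s = -1 \<or> s = 1" "j \<le> k" "x \<in> face K d s j"
    then have "\<not> shared M K d s" using shared_edge(1)[OF a x] G by blast
    then show ?R using a unfolding BEs_def by (intro bexI[of _ "(K, d, s, j)"]) auto
  qed
next
  assume ?R
  then obtain K d s j where a: "K \<in> cells M" "s = -1 \<or> s = 1" "j \<le> k" "x \<in> face K d s j" "\<not> shared M K d s"
    unfolding BEs_def by auto
  show "x \<in> Gamma_h M" by (rule unshared_edge(1)[OF a(1-4) x a(5)])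
qed

lemma Gamma_P_iff:
  assumes x: "x \<notin> Bad"
  shows "x \<in> Gamma_P k l M P \<longleftrightarrow> (\<exists>f\<in>{(K, d, s, j) \<in> BEs. P = nodeP K d (ie s) j}. case f of (K, d, s, j) \<Rightarrow> x \<in> face K d s j)"
    (is "_ \<longleftrightarrow> ?R")
proof
  assume "x \<in> Gamma_P k l M P"
  then have f: "x \<in> frontier (control_volume k l M P)" "x \<in> Gamma_h M" unfolding Gamma_P_def by auto
  then obtain K d s j where a: "K \<in> cells M" "s = -1 \<or> s = 1" "j \<le> k" "x \<in> face K d s j" "\<not> shared M K d s"
    using Gamma_h_iff[OF x] unfolding BEs_def by auto
  have "P = nodeP K d (ie s) j" using unshared_edge(2)[OF a(1-4) x a(5)] f(1) by blast
  then show ?R using a unfolding BEs_def by (intro bexI[of _ "(K, d, s, j)"]) auto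
next
  assume ?R
  then obtain K d s j where a: "K \<in> cells M" "s = -1 \<or> s = 1" "j \<le> k" "x \<in> face K d s j" "\<not> shared M K d s" "P = nodeP K d (ie s) j"
    unfolding BEs_def by auto
  show "x \<in> Gamma_P k l M P" unfolding Gamma_P_def using unshared_edge[OF a(1-4) x a(5)] a(6) by blast
qed

lemma same_element_face:
  assumes K: "K \<in> cells M" and ij: "j \<le> k" "j' \<le> k" "i \<le> Suc k" "i' \<le> Suc k"
    and x: "x \<in> face K d (g i) j" "x \<in> face K d' (g i') j'" "x \<notin> Bad"
  shows "d = d' \<and> i = i' \<and> j = j'"
proof -
  obtain t where t: "t \<in> gI k j" "x = emap M K (rp d (g i) t)" using x(1) unfolding face_def by blast
  obtain t' where t': "t' \<in> gI k j'" "x = emap M K (rp d' (g i') t')" using x(2) unfolding face_def by blast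
  have tn: "t \<notin> g ` {..Suc k}" using not_Bad[OF K ij(3), of d t] x(3) t(2) by blast
  have r: "rp d (g i) t \<in> ref_square" "rp d' (g i') t' \<in> ref_square"
    using gI_sub[OF ij(1) t(1)] gI_sub[OF ij(2) t'(1)] gauss_pt_bounds[OF ij(3)] gauss_pt_bounds[OF ij(4)] by auto
  have eq: "rp d (g i) t = rp d' (g i') t'" by (rule inj\<Psi>[OF K r]) (use t(2) t'(2) in simp)
  have "d = d'"
  proof (rule ccontr)
    assume "d \<noteq> d'"
    then have d': "d' = oth d" using oth_eq[of d' d] by auto
    have "t = g i'" using arg_cong[OF eq, of "\<lambda>v. v $ d'"] unfolding d' by simp
    then show False using tn ij(4) by auto
  qed
  then have "g i = g i'" "t = t'" using eq by auto
  moreover have "j = j'" by (rule gI_unique[OF t(1) _ ij(1,2) tn]) (use t'(1) \<open>t = t'\<close> in simp)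
  ultimately show ?thesis using \<open>d = d'\<close> gauss_pt_inj[OF ij(3,4)] by blast
qed

lemma inner_faces_disjoint:
  assumes "(K, d, i, j) \<in> IFs" "(K', d', i', j') \<in> IFs" "x \<in> face K d (g i) j" "x \<in> face K' d' (g i') j'" "x \<notin> Bad"
  shows "(K, d, i, j) = (K', d', i', j')"
proof -
  have a: "K \<in> cells M" "i \<in> {1..k}" "j \<le> k" "K' \<in> cells M" "i' \<in> {1..k}" "j' \<le> k" using assms(1,2) unfolding IFs_def by auto
  obtain t where t: "x = emap M K (rp d (g i) t)" "rp d (g i) t \<in> interior ref_square"
    by (rule inner_face_local[OF a(1-3) assms(3,5)]) (rule that)
  obtain t' where t': "t' \<in> gI k j'" "x = emap M K' (rp d' (g i') t')" using assms(4) unfolding face_def by blast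
  have "rp d' (g i') t' \<in> ref_square" using gI_sub[OF a(6) t'(1)] gauss_pt_bounds[of i' k] a(5) by auto
  then have "x \<in> elem M K'" unfolding t'(2) by (rule \<Psi>_in)
  then have "K' = K" using interior_unique[OF a(1,4) t(2)] t(1) by blast
  moreover have "i \<le> Suc k" "i' \<le> Suc k" using a by auto
  ultimately show ?thesis using same_element_face[OF a(1,3,6) _ _ assms(3) _ assms(5), of i' d'] assms(4) by auto
qed

lemma boundary_faces_disjoint:
  assumes "(K, d, s, j) \<in> BEs" "(K', d', s', j') \<in> BEs" "x \<in> face K d s j" "x \<in> face K' d' s' j'" "x \<notin> Bad"
  shows "(K, d, s, j) = (K', d', s', j')"
proof -
  have a: "K \<in> cells M" "s = -1 \<or> s = 1" "j \<le> k" "\<not> shared M K d s" "K' \<in> cells M" "s' = -1 \<or> s' = 1" "j' \<le> k"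
    using assms(1,2) unfolding BEs_def by auto
  obtain t where t: "x = emap M K (rp d s t)" "-1 < t" "t < 1"
    by (rule edge_point[OF a(1-3) assms(3,5)]) (rule that)
  obtain t' where t': "t' \<in> gI k j'" "x = emap M K' (rp d' s' t')" using assms(4) unfolding face_def by blast
  have "rp d' s' t' \<in> ref_square" using gI_sub[OF a(7) t'(1)] a(6) by auto
  then have "x \<in> elem M K'" unfolding t'(2) by (rule \<Psi>_in)
  then have KK: "K' = K" using unshared_alone[OF a(1,2) t(2,3) a(4,5)] t(1) by blast
  define i where "i = (if s = 1 then Suc k else 0)"
  define i' where "i' = (if s' = 1 then Suc k else 0)"
  have i: "i \<le> Suc k" "g i = s" "i' \<le> Suc k" "g i' = s'" using a by (auto simp: i_def i'_def)
  have "d = d' \<and> i = i' \<and> j = j'"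
    using same_element_face[OF a(1,3,7) i(1,3), of x d d'] assms(3-5) i(2,4) KK by simp
  then show ?thesis using KK i(2,4) by auto
qed

end

section \<open>Existence, uniqueness and values of the dual interpolant\<close>

lemma poly_eq_on_interval:
  fixes p q :: "real poly"
  assumes "\<And>t. t \<in> {-1..1} \<Longrightarrow> poly p t = poly q t"
  shows "p = q"
proof (rule ccontr)
  assume "p \<noteq> q"
  then have "finite {t. poly (p - q) t = 0}" by (intro poly_roots_finite) simp
  moreover have "{-1..1} \<subseteq> {t. poly (p - q) t = 0}" using assms by auto
  ultimately have "finite {-1..1::real}" by (rule finite_subset[rotated])
  then show False using infinite_Icc[of "-1::real" 1] by simp
qed

definition dual_eqs :: "nat \<Rightarrow> (nat \<Rightarrow> nat \<Rightarrow> real) \<Rightarrow> (nat \<Rightarrow> nat \<Rightarrow> real) \<Rightarrow> bool" where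
  "dual_eqs k c V \<longleftrightarrow> V 0 0 = poly (sl k c (-1)) (-1) \<and>
     (\<forall>i\<in>{1..k}. V i 0 - V (i - 1) 0 = gauss_wt k i * poly (dsl k c (gauss_pt k i)) (-1)) \<and>
     (\<forall>j\<in>{1..k}. V 0 j - V 0 (j - 1) = gauss_wt k j * poly (pderiv (sl k c (-1))) (gauss_pt k j)) \<and>
     (\<forall>i\<in>{1..k}. \<forall>j\<in>{1..k}. V i j + V (i - 1) (j - 1) - V i (j - 1) - V (i - 1) j
        = gauss_wt k i * gauss_wt k j * poly (pderiv (dsl k c (gauss_pt k i))) (gauss_pt k j))"

lemma dual_eqs_Vn: "dual_eqs k c (Vn k c)"
proof -
  have "Vn k c i j + Vn k c (i - 1) (j - 1) - Vn k c i (j - 1) - Vn k c (i - 1) j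
        = gauss_wt k i * gauss_wt k j * poly (pderiv (dsl k c (gauss_pt k i))) (gauss_pt k j)"
    if i: "i \<in> {1..k}" and j: "j \<in> {1..k}" for i j
  proof -
    have "Vn k c i j + Vn k c (i - 1) (j - 1) - Vn k c i (j - 1) - Vn k c (i - 1) j
      = gauss_wt k i * (dI k (dsl k c (gauss_pt k i)) j - dI k (dsl k c (gauss_pt k i)) (j - 1))"
      unfolding right_diff_distrib Vn_jump[OF i, symmetric] by simp
    also have "\<dots> = gauss_wt k i * (gauss_wt k j * poly (pderiv (dsl k c (gauss_pt k i))) (gauss_pt k j))"
      using j by (subst dI_diff) auto
    finally show ?thesis by (simp add: mult.assoc)
  qed
  moreover have "Vn k c 0 j - Vn k c 0 (j - 1) = gauss_wt k j * poly (pderiv (sl k c (-1))) (gauss_pt k j)"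
    if "j \<in> {1..k}" for j unfolding Vn_0 by (rule dI_diff) (use that in simp)
  moreover have "Vn k c i 0 - Vn k c (i - 1) 0 = gauss_wt k i * poly (dsl k c (gauss_pt k i)) (-1)"
    if "i \<in> {1..k}" for i using Vn_jump[OF that, of c 0] by simp
  ultimately show ?thesis unfolding dual_eqs_def by simp
qed

text \<open>The equations form a recursion: differences fix the first row and column, and the mixed
  difference fixes each further entry from three earlier ones.\<close>

lemma dual_eqs_unique:
  assumes V: "dual_eqs k c V" and W: "dual_eqs k c W"
  shows "i \<le> k \<Longrightarrow> j \<le> k \<Longrightarrow> V i j = W i j"
proof (induction i arbitrary: j)
  case 0
  then show ?case
  proof (induction j)
    case 0 show ?case using V W unfolding dual_eqs_def by simp
  next
    case (Suc j)
    have m: "Suc j \<in> {1..k}" using Suc.prems by simp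
    have "V 0 (Suc j) - V 0 j = W 0 (Suc j) - W 0 j"
      using V[unfolded dual_eqs_def, THEN conjunct2, THEN conjunct2, THEN conjunct1, rule_format, OF m]
        W[unfolded dual_eqs_def, THEN conjunct2, THEN conjunct2, THEN conjunct1, rule_format, OF m] by simp
    then show ?case using Suc by simp
  qed
next
  case (Suc i)
  have mi: "Suc i \<in> {1..k}" using Suc.prems(1) by simp
  show ?case using Suc.prems(2)
  proof (induction j)
    case 0
    have "V (Suc i) 0 - V i 0 = W (Suc i) 0 - W i 0"
      using V[unfolded dual_eqs_def, THEN conjunct2, THEN conjunct1, rule_format, OF mi]
        W[unfolded dual_eqs_def, THEN conjunct2, THEN conjunct1, rule_format, OF mi] by simp
    then show ?case using Suc.IH[of 0] Suc.prems by simp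
  next
    case (Suc j)
    have m: "Suc j \<in> {1..k}" using Suc.prems by simp
    have "V (Suc i) (Suc j) + V i j - V (Suc i) j - V i (Suc j) = W (Suc i) (Suc j) + W i j - W (Suc i) j - W i (Suc j)"
      using V[unfolded dual_eqs_def, THEN conjunct2, THEN conjunct2, THEN conjunct2, rule_format, OF mi m]
        W[unfolded dual_eqs_def, THEN conjunct2, THEN conjunct2, THEN conjunct2, rule_format, OF mi m] by simp
    moreover have "i \<le> k" "j \<le> k" using mi m by auto
    ultimately show ?case using Suc.IH Suc.prems \<open>\<And>j. i \<le> k \<Longrightarrow> j \<le> k \<Longrightarrow> V i j = W i j\<close>[of j]
        \<open>\<And>j. i \<le> k \<Longrightarrow> j \<le> k \<Longrightarrow> V i j = W i j\<close>[of "Suc j"] by simp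
  qed
qed

context fv_mesh
begin

lemma finite_nodes: "finite (nodes k l M)"
proof -
  have "nodes k l M = (\<Union>K\<in>cells M. \<Union>i\<le>k. \<Union>j\<le>k. {node l M K i j})" unfolding nodes_def by blast
  then show ?thesis using fin by simp
qed

lemma dual_fun_point:
  assumes "K \<in> cells M" "i \<le> k" "j \<le> k"
  shows "\<exists>x. \<forall>v. dual_fun k l M v x = v (nodeP K 1 i j)"
proof -
  obtain x where x: "\<forall>P. x \<in> control_volume k l M P \<longleftrightarrow> P = nodeP K 1 i j" using cv_unique_point[OF assms] by blast
  have "dual_fun k l M v x = v (nodeP K 1 i j)" for v
  proof -
    have "dual_fun k l M v x = (\<Sum>P\<in>nodes k l M. if nodeP K 1 i j = P then v P else 0)"
      unfolding dual_fun_def by (intro sum.cong refl) (use x in \<open>auto simp: indicator_def\<close>)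
    then show ?thesis using finite_nodes nodeP_in_nodes[OF assms, of 1] by simp
  qed
  then show ?thesis by blast
qed

text \<open>All representations of a dual function agree at the point supplied by
  \<open>dual_fun_point\<close>, where each takes its coefficient at P as value. So the description
  in \<open>cv_value\<close> is unique.\<close>

lemma cv_value_dual_fun:
  assumes "P \<in> nodes k l M"
  shows "cv_value k l M (dual_fun k l M v) P = v P"
proof -
  obtain K i j where K: "K \<in> cells M" "i \<le> k" "j \<le> k" "P = nodeP K 1 i j" using assms unfolding nodes_def node_eq by blast
  obtain x where x: "\<And>v. dual_fun k l M v x = v P" using dual_fun_point[OF K(1-3)] unfolding K(4) by blast
  show ?thesis unfolding cv_value_def
  proof (rule the_equality)
    show "\<exists>v'. dual_fun k l M v = dual_fun k l M v' \<and> v P = v' P" by blast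
    fix r assume "\<exists>v'. dual_fun k l M v = dual_fun k l M v' \<and> r = v' P"
    then obtain v' where v': "dual_fun k l M v = dual_fun k l M v'" "r = v' P" by blast
    have "dual_fun k l M v x = dual_fun k l M v' x" unfolding v'(1) ..
    then show "r = v P" unfolding x v'(2) by simp
  qed
qed

lemma l_eq_end: assumes "s = -1 \<or> s = (1::real)" "i \<le> k" "l i = s" shows "i = ie s"
  using lagrange_node_eq[OF l assms(2) ie_le[of s]] l_ie[OF assms(1)] assms(3) by simp

end

locale fv_trial = fv_mesh +
  fixes u :: "real^2 \<Rightarrow> real" and c :: "(real^2) set \<Rightarrow> nat \<Rightarrow> nat \<Rightarrow> real"
  assumes u: "\<And>K z. K \<in> cells M \<Longrightarrow> z \<in> ref_square \<Longrightarrow> u (emap M K z) = qv k (c K) z"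
begin

lemma Vn_ie: "s = -1 \<or> s = 1 \<Longrightarrow> Vn k c' (ie s) j = dI k (sl k c' s) j"
  unfolding ie_def by (rule Vn_edge[OF k])

text \<open>On any of the four edges the nodal values are the one-dimensional dual interpolation of
  the trace; edges of the second direction are reduced to the first by transposition.\<close>

lemma node_edge_value:
  assumes K: "K \<in> cells M" and ij: "i \<le> k" "j \<le> k" and s: "s = -1 \<or> s = 1" and t: "t \<in> {-1..1}"
    and x: "nodeP K 1 i j = emap M K (rp d s t)"
  shows "\<exists>m\<le>k. l m = t \<and> Vn k (c K) i j = dI k (sl k (cd d (c K)) s) m"
proof -
  have r: "rp 1 (l i) (l j) \<in> ref_square" "rp d s t \<in> ref_square"
    unfolding rp_in_ref using lagrange_node_bounds[OF l ij(1)] lagrange_node_bounds[OF l ij(2)] s t by auto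
  have eq: "rp 1 (l i) (l j) = rp d s t" by (rule inj\<Psi>[OF K r x[unfolded nodeP_def]])
  consider "d = 1" | "d = 2" using exhaust_2[of d] by blast
  then show ?thesis
  proof cases
    case 1
    then have e: "l i = s" "l j = t" using eq by auto
    have "Vn k (c K) i j = dI k (sl k (cd d (c K)) s) j"
      unfolding l_eq_end[OF s ij(1) e(1)] 1 cd_simps by (rule Vn_ie[OF s])
    then show ?thesis using ij(2) e(2) by blast
  next
    case 2
    have e: "l i = t" "l j = s"
      using arg_cong[OF eq, of "\<lambda>v. v $ 1"] arg_cong[OF eq, of "\<lambda>v. v $ 2"] unfolding 2 rp_pt pt_nth .
    have "Vn k (c K) i j = Vn k (tr (c K)) j i" by (rule Vn_tr[symmetric])
    also have "\<dots> = dI k (sl k (tr (c K)) s) i" unfolding l_eq_end[OF s ij(2) e(2)] by (rule Vn_ie[OF s])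
    finally show ?thesis unfolding 2 cd_simps using ij(1) e(1) by blast
  qed
qed

lemma vertex_value:
  assumes K: "K \<in> cells M" and ij: "i \<le> k" "j \<le> k" and a: "a \<in> ref_vertices" and x: "nodeP K 1 i j = emap M K a"
  shows "Vn k (c K) i j = u (emap M K a)"
proof -
  have b: "a $ 1 = -1 \<or> a $ 1 = 1" "a $ 2 = -1 \<or> a $ 2 = 1" using a unfolding ref_vertices_iff by auto
  have ar: "a = rp 1 (a $ 1) (a $ 2)" using rp_collapse[of 1 a] by simp
  have t: "a $ 2 \<in> {-1..1}" using b by auto
  have "nodeP K 1 i j = emap M K (rp 1 (a $ 1) (a $ 2))" using x ar by simp
  then obtain m where m: "m \<le> k" "l m = a $ 2" "Vn k (c K) i j = dI k (sl k (cd 1 (c K)) (a $ 1)) m"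
    using node_edge_value[OF K ij b(1) t] by blast
  have m': "m = ie (a $ 2)" by (rule l_eq_end[OF b(2) m(1,2)])
  have "dI k (sl k (c K) (a $ 1)) m = poly (sl k (c K) (a $ 1)) (a $ 2)"
    unfolding m' using b(2) dI_end[OF k degree_sl] by (auto simp: ie_def)
  then show ?thesis using m(3) u[OF K ref_vertices_sub[OF a]] by (simp add: qv_def)
qed

text \<open>On a common edge continuity of u makes the two traces the same polynomial, reflected if
  \<tau> = -1, and \<open>dI_reflect\<close> shows that the direction is irrelevant. At a common
  vertex both values equal that of u.\<close>

lemma Vn_node_unique:
  assumes K: "K \<in> cells M" "K' \<in> cells M" and ij: "i \<le> k" "j \<le> k" "i' \<le> k" "j' \<le> k"
    and x: "nodeP K 1 i j = nodeP K' 1 i' j'"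
  shows "Vn k (c K) i j = Vn k (c K') i' j'"
proof (cases "K = K'")
  case True
  then show ?thesis using x nodeP_inj[OF K(2) ij] by simp
next
  case False
  have r: "rp 1 (l m) (l n) \<in> ref_square" if "m \<le> k" "n \<le> k" for m n
    unfolding rp_in_ref using lagrange_node_bounds[OF l that(1)] lagrange_node_bounds[OF l that(2)] by blast
  have xK: "nodeP K 1 i j \<in> elem M K" unfolding nodeP_def by (rule \<Psi>_in[OF r[OF ij(1,2)]])
  have xK': "nodeP K 1 i j \<in> elem M K'" unfolding x unfolding nodeP_def by (rule \<Psi>_in[OF r[OF ij(3,4)]])
  show ?thesis
  proof (rule meet_cases[OF K False xK xK'])
    fix a a' assume a: "a \<in> ref_vertices" "a' \<in> ref_vertices" "nodeP K 1 i j = emap M K a" "nodeP K 1 i j = emap M K' a'"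
    have "Vn k (c K) i j = u (nodeP K 1 i j)" unfolding a(3) by (rule vertex_value[OF K(1) ij(1,2) a(1,3)])
    also have "\<dots> = u (emap M K' a')" unfolding a(4) ..
    also have "\<dots> = Vn k (c K') i' j'" by (rule vertex_value[OF K(2) ij(3,4) a(2) a(4)[unfolded x], symmetric])
    finally show ?thesis .
  next
    fix d s d' s' t \<tau>
    assume a: "s = -1 \<or> s = (1::real)" "s' = -1 \<or> s' = (1::real)" "\<tau> = -1 \<or> \<tau> = (1::real)" "t \<in> {-1..1}"
      "nodeP K 1 i j = emap M K (rp d s t)" "nodeP K 1 i j = emap M K' (rp d' s' (\<tau> * t))"
      and ag: "\<And>t. t \<in> {-1..1} \<Longrightarrow> emap M K (rp d s t) = emap M K' (rp d' s' (\<tau> * t))"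
    let ?p = "sl k (cd d (c K)) s" and ?q = "sl k (cd d' (c K')) s'"
    obtain m where m: "m \<le> k" "l m = t" "Vn k (c K) i j = dI k ?p m"
      using node_edge_value[OF K(1) ij(1,2) a(1,4,5)] by blast
    have \<tau>t: "\<tau> * t \<in> {-1..1}" if "t \<in> {-1..1}" for t using that a(3) by auto
    obtain m' where m': "m' \<le> k" "l m' = \<tau> * t" "Vn k (c K') i' j' = dI k ?q m'"
      using node_edge_value[OF K(2) ij(3,4) a(2) \<tau>t[OF a(4)] a(6)[unfolded x]] by blast
    have pq: "poly ?p t = poly ?q (\<tau> * t)" if t: "t \<in> {-1..1}" for t
    proof -
      have "rp d s t \<in> ref_square" "rp d' s' (\<tau> * t) \<in> ref_square" unfolding rp_in_ref using t a(1,2) \<tau>t[OF t] by auto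
      then have "qv k (c K) (rp d s t) = qv k (c K') (rp d' s' (\<tau> * t))"
        using u[OF K(1)] u[OF K(2)] ag[OF t] by metis
      then show ?thesis unfolding qv_rp .
    qed
    have lm: "l m' = l (if \<tau> = 1 then m else k - m)" unfolding l_tau[OF a(3) m(1)] m(2) m'(2) ..
    have mm: "m' = (if \<tau> = 1 then m else k - m)"
      using lagrange_node_eq[OF l m'(1), of "if \<tau> = 1 then m else k - m"] lm m(1) by auto
    show ?thesis
    proof (cases "\<tau> = 1")
      case True
      have "?p = ?q" by (rule poly_eq_on_interval) (use pq True in simp)
      then show ?thesis using m(3) m'(3) mm True by simp
    next
      case False
      then have \<tau>: "\<tau> = -1" using a(3) by simp
      have "?p = pcompose ?q [:0, -1:]" by (rule poly_eq_on_interval) (use pq \<tau> in \<open>simp add: poly_pcompose\<close>)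
      moreover have "m = k - m'" using mm m(1) \<tau> by simp
      ultimately have "dI k ?p m = dI k ?q m'" using dI_reflect[OF k degree_sl m'(1)] by simp
      then show ?thesis using m(3) m'(3) by simp
    qed
  qed
qed

text \<open>The common nodal value. A node may be represented in several elements; by
  \<open>Vn_node_unique\<close> the choice does not matter.\<close>

definition nv :: "real^2 \<Rightarrow> real" where
  "nv P = (SOME r. \<exists>K\<in>cells M. \<exists>i\<le>k. \<exists>j\<le>k. P = nodeP K 1 i j \<and> r = Vn k (c K) i j)"

lemma nv_1:
  assumes "K \<in> cells M" "i \<le> k" "j \<le> k"
  shows "nv (nodeP K 1 i j) = Vn k (c K) i j"
  unfolding nv_def
proof (rule someI2)
  show "\<exists>K'\<in>cells M. \<exists>i'\<le>k. \<exists>j'\<le>k. nodeP K 1 i j = nodeP K' 1 i' j' \<and> Vn k (c K) i j = Vn k (c K') i' j'"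
    using assms by blast
  fix r assume "\<exists>K'\<in>cells M. \<exists>i'\<le>k. \<exists>j'\<le>k. nodeP K 1 i j = nodeP K' 1 i' j' \<and> r = Vn k (c K') i' j'"
  then obtain K' i' j' where K': "K' \<in> cells M" "i' \<le> k" "j' \<le> k" "nodeP K 1 i j = nodeP K' 1 i' j'" "r = Vn k (c K') i' j'"
    by blast
  show "r = Vn k (c K) i j" unfolding K'(5) by (rule Vn_node_unique[OF assms(1) K'(1) assms(2,3) K'(2,3,4), symmetric])
qed

lemma nv_eq:
  assumes "K \<in> cells M" "i \<le> k" "j \<le> k"
  shows "nv (nodeP K d i j) = Vn k (cd d (c K)) i j"
proof -
  consider "d = 1" | "d = 2" using exhaust_2[of d] by blast
  then show ?thesis
  proof cases
    case 1 then show ?thesis using nv_1[OF assms] by simp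
  next
    case 2 show ?thesis unfolding 2 nodeP_2 cd_simps Vn_tr[of k "c K"] by (rule nv_1[OF assms(1,3,2)])
  qed
qed

lemma is_dual_interp_iff:
  "is_dual_interp k l M u w \<longleftrightarrow> w \<in> test_space k l M \<and>
     (\<forall>K\<in>cells M. dual_eqs k (c K) (\<lambda>i j. cv_value k l M w (nodeP K 1 i j)))"
proof -
  have "(let V = (\<lambda>i j. cv_value k l M w (node l M K i j));
            U = u \<circ> emap M K; g = gauss_pt k; A = gauss_wt k;
            D\<^sub>\<xi> = pd ref_square 1; D\<^sub>\<eta> = pd ref_square 2
        in V 0 0 = U (pt (-1) (-1)) \<and>
           (\<forall>i\<in>{1..k}. V i 0 - V (i - 1) 0 = A i * D\<^sub>\<xi> U (pt (g i) (-1))) \<and>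
           (\<forall>j\<in>{1..k}. V 0 j - V 0 (j - 1) = A j * D\<^sub>\<eta> U (pt (-1) (g j))) \<and>
           (\<forall>i\<in>{1..k}. \<forall>j\<in>{1..k}.
              V i j + V (i - 1) (j - 1) - V i (j - 1) - V (i - 1) j
                = A i * A j * D\<^sub>\<xi> (D\<^sub>\<eta> U) (pt (g i) (g j))))
     \<longleftrightarrow> dual_eqs k (c K) (\<lambda>i j. cv_value k l M w (nodeP K 1 i j))" if K: "K \<in> cells M" for K
  proof -
    let ?U = "u \<circ> emap M K"
    have U: "?U z = qv k (c K) z" if "z \<in> ref_square" for z using u[OF K that] by simp
    have r: "pt x y \<in> ref_square" if "-1 \<le> x" "x \<le> 1" "-1 \<le> y" "y \<le> 1" for x y using that by (simp add: ref_square_iff forall_2)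
    have g: "-1 \<le> g i \<and> g i \<le> 1" if "i \<in> {1..k}" for i using gauss_pt_bounds[of i k] that by auto
    have 0: "?U (pt (-1) (-1)) = poly (sl k (c K) (-1)) (-1)" using U[OF r[of "-1" "-1"]] by (simp add: qv_def)
    have 1: "pd ref_square 1 ?U (pt (g i) (-1)) = poly (dsl k (c K) (g i)) (-1)" if "i \<in> {1..k}" for i
    proof -
      have "pt (g i) (-1) \<in> ref_square" using g[OF that] by (intro r) auto
      then have "pd ref_square 1 ?U (pt (g i) (-1)) = qd k (c K) 1 (pt (g i) (-1))" by (rule pd_ref_qv[OF _ U])
      then show ?thesis by (simp add: qd_def)
    qed
    have 2: "pd ref_square 2 ?U (pt (-1) (g i)) = poly (pderiv (sl k (c K) (-1))) (g i)" if "i \<in> {1..k}" for i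
    proof -
      have "pt (-1) (g i) \<in> ref_square" using g[OF that] by (intro r) auto
      then have "pd ref_square 2 ?U (pt (-1) (g i)) = qd k (c K) 2 (pt (-1) (g i))" by (rule pd_ref_qv[OF _ U])
      also have "\<dots> = poly (dsl k (tr (c K)) (g i)) (-1)" by (simp add: qd_def)
      also have "\<dots> = poly (pderiv (sl k (c K) (-1))) (g i)" by (rule poly_dsl_tr)
      finally show ?thesis .
    qed
    have 3: "pd ref_square 1 (pd ref_square 2 ?U) (pt (g i) (g j)) = poly (pderiv (dsl k (c K) (g i))) (g j)"
      if "i \<in> {1..k}" "j \<in> {1..k}" for i j
    proof -
      have "pt (g i) (g j) \<in> ref_square" using g[OF that(1)] g[OF that(2)] by (intro r) auto
      from pd_ref_mixed[OF this U] show ?thesis unfolding pt_nth .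
    qed
    show ?thesis unfolding Let_def dual_eqs_def node_eq 0
      by (intro conj_cong refl ball_cong) (simp_all only: 1 2 3)
  qed
  then show ?thesis unfolding is_dual_interp_def by (intro conj_cong refl ball_cong)
qed

lemma dual_fun_cong: "(\<And>P. P \<in> nodes k l M \<Longrightarrow> v P = v' P) \<Longrightarrow> dual_fun k l M v = dual_fun k l M v'"
  unfolding dual_fun_def fun_eq_iff by (intro allI sum.cong refl) simp

text \<open>The values \<open>nv\<close> satisfy the local equations; conversely these fix the value
  at every node, as each node belongs to some element.\<close>

lemma dual_interp_eq: "dual_interp k l M u = dual_fun k l M nv"
  unfolding dual_interp_def
proof (rule the_equality)
  have "dual_eqs k (c K) (\<lambda>i j. cv_value k l M (dual_fun k l M nv) (nodeP K 1 i j))" if K: "K \<in> cells M" for K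
  proof -
    have e: "cv_value k l M (dual_fun k l M nv) (nodeP K 1 i j) = Vn k (c K) i j" if "i \<le> k" "j \<le> k" for i j
      unfolding cv_value_dual_fun[OF nodeP_in_nodes[OF K that]] by (rule nv_1[OF K that])
    show ?thesis using dual_eqs_Vn[of k "c K"] unfolding dual_eqs_def by (auto simp: e)
  qed
  then show "is_dual_interp k l M u (dual_fun k l M nv)" unfolding is_dual_interp_iff test_space_def by blast
next
  fix w assume "is_dual_interp k l M u w"
  then have w: "w \<in> test_space k l M" "\<And>K. K \<in> cells M \<Longrightarrow> dual_eqs k (c K) (\<lambda>i j. cv_value k l M w (nodeP K 1 i j))"
    unfolding is_dual_interp_iff by auto
  obtain v where v: "w = dual_fun k l M v" using w(1) unfolding test_space_def by blast
  show "w = dual_fun k l M nv" unfolding v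
  proof (rule dual_fun_cong)
    fix P assume P: "P \<in> nodes k l M"
    then obtain K i j where K: "K \<in> cells M" "i \<le> k" "j \<le> k" "P = nodeP K 1 i j" unfolding nodes_def node_eq by blast
    have "v P = cv_value k l M w P" unfolding v by (rule cv_value_dual_fun[OF P, symmetric])
    also have "\<dots> = Vn k (c K) i j" unfolding K(4) by (rule dual_eqs_unique[OF w(2)[OF K(1)] dual_eqs_Vn K(2,3)])
    also have "\<dots> = nv P" unfolding K(4) by (rule nv_1[OF K(1-3), symmetric])
    finally show "v P = nv P" .
  qed
qed

lemma cv_value_dual_interp: "P \<in> nodes k l M \<Longrightarrow> cv_value k l M (dual_interp k l M u) P = nv P"
  unfolding dual_interp_eq by (rule cv_value_dual_fun)

end

section \<open>The bilinear form as a sum over faces\<close>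

locale fv_robin = fv_trial +
  fixes \<kappa> \<sigma> :: "real^2 \<Rightarrow> real"
  assumes cont_coef: "\<And>K. K \<in> cells M \<Longrightarrow> continuous_on (elem M K) \<kappa>" "\<And>K. K \<in> cells M \<Longrightarrow> continuous_on (elem M K) \<sigma>"
    and small: "\<And>K. K \<in> cells M \<Longrightarrow> 4 * Cb\<^sup>2 * diameter K < cJ"
begin

abbreviation FL :: "(real^2) set \<Rightarrow> 2 \<Rightarrow> real^2 \<Rightarrow> real" where
  "FL K \<equiv> element.fl (emap M K) (Gi K) \<kappa> (qd k (c K))"

lemma face_integrable:
  assumes K: "K \<in> cells M" and s: "-1 \<le> s" "s \<le> 1" and j: "j \<le> k" and f: "continuous_on (elem M K) (f :: real^2 \<Rightarrow> real)"
  shows "set_integrable arc_measure (face K d s j) f"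
proof -
  interpret element "emap M K" "Gi K" "elem M K" "diameter K" Cb cJ using el[OF K] .
  have b: "-1 \<le> g j" "g j \<le> g (Suc j)" "g (Suc j) \<le> 1"
    using gauss_pt_bounds[of j k] gauss_pt_bounds[of "Suc j" k] gauss_pt_le[of j "Suc j" k] j by auto
  have ct: "continuous_on {-1..1} (\<lambda>t. f (emap M K (rp d s t)))"
  proof (rule continuous_on_compose2[OF f])
    show "continuous_on {-1..1} (\<lambda>t. emap M K (rp d s t))"
      by (rule continuous_on_compose2[OF cont\<Psi> cont_rp]) (use s in auto)
    show "(\<lambda>t. emap M K (rp d s t)) ` {-1..1} \<subseteq> elem M K" by (rule image_subsetI) (use s in auto)
  qed
  have "compact ((\<lambda>t. f (emap M K (rp d s t))) ` {-1..1})" by (rule compact_continuous_image[OF ct]) simp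
  then obtain F where F: "\<forall>y\<in>(\<lambda>t. f (emap M K (rp d s t))) ` {-1..1}. \<bar>y\<bar> \<le> F"
    using compact_imp_bounded bounded_real by blast
  have cg: "continuous_on {g j..g (Suc j)} (\<lambda>t. f (emap M K (rp d s t)))"
    by (rule continuous_on_subset[OF ct]) (use b in auto)
  show ?thesis unfolding face_def gI_def
    by (rule line_integral_approx(1)[where F = F and D = 0, OF s b small[OF K] f _ cg]) (use F in auto)
qed

lemma FL_continuous: assumes "K \<in> cells M" shows "continuous_on (elem M K) (FL K d)"
  by (rule element.cont_fl[OF el[OF assms] cont_coef(1)[OF assms] qd_continuous])

lemma FL_at:
  assumes K: "K \<in> cells M" and z: "z \<in> interior ref_square"
    and r: "r > 0" and sgn: "\<tau> = 1 \<or> \<tau> = -1"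
    and S: "\<And>y. y \<in> ball (emap M K z) r \<Longrightarrow> y \<in> S \<longleftrightarrow> \<tau> * Gi K y $ d \<le> \<tau> * z $ d"
  shows "\<kappa> (emap M K z) * (grad u (emap M K z) \<bullet> outward_normal S (emap M K z)) = \<tau> * FL K d (emap M K z)"
proof -
  interpret element "emap M K" "Gi K" "elem M K" "diameter K" Cb cJ using el[OF K] .
  have zr: "z \<in> ref_square" using z interior_subset by blast
  have n: "outward_normal S (emap M K z) = \<tau> *\<^sub>R (N d z /\<^sub>R norm (N d z))" by (rule normal_at[OF z r sgn S])
  have f: "grad u (emap M K z) \<bullet> (N d z /\<^sub>R norm (N d z)) =
     ((norm (A (oth d) z))\<^sup>2 * qd k (c K) d z - (A 1 z \<bullet> A 2 z) * qd k (c K) (oth d) z) / (\<bar>jac z\<bar> * norm (A (oth d) z))"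
    by (rule flux_density[where p' = "\<lambda>d. qd k (c K) d z", OF z u[OF K] qv_has_derivative])
  show ?thesis unfolding n inner_scaleR_right[of _ \<tau>] f fl_def G\<Psi>[OF zr] by (simp add: algebra_simps)
qed

text \<open>The volume of node i - 1 lies where component d is smaller, so its outward normal points
  along increasing d; for node i it is opposite.\<close>

lemma flux_on_face:
  assumes K: "K \<in> cells M" and i: "i \<in> {1..k}" and j: "j \<le> k" and x: "x \<in> face K d (g i) j" "x \<notin> Bad"
    and P: "P = nodeP K d (i - 1) j \<or> P = nodeP K d i j"
  shows "\<kappa> x * (grad u x \<bullet> outward_normal (control_volume k l M P) x)
     = (if P = nodeP K d (i - 1) j then 1 else -1) * FL K d x"
proof -
  have i': "i - 1 \<le> k" "i \<le> k" "i - 1 \<noteq> i" using i by auto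
  have ne: "nodeP K d (i - 1) j \<noteq> nodeP K d i j" using nodeP_inj[OF K i'(1) j i'(2) j] i'(3) by simp
  obtain t r where t: "x = emap M K (rp d (g i) t)" "rp d (g i) t \<in> interior ref_square" "r > 0"
    "\<forall>y\<in>ball x r. \<forall>P. y \<in> control_volume k l M P \<longleftrightarrow>
        (P = nodeP K d (i - 1) j \<and> Gi K y $ d \<le> g i) \<or> (P = nodeP K d i j \<and> g i \<le> Gi K y $ d)"
    by (rule inner_face_local[OF K i j x]) (rule that)
  define \<tau> :: real where "\<tau> = (if P = nodeP K d (i - 1) j then 1 else -1)"
  have "y \<in> control_volume k l M P \<longleftrightarrow> \<tau> * Gi K y $ d \<le> \<tau> * rp d (g i) t $ d" if y: "y \<in> ball (emap M K (rp d (g i) t)) r" for y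
  proof -
    have "y \<in> ball x r" using y unfolding t(1) .
    then have "y \<in> control_volume k l M P \<longleftrightarrow>
        (P = nodeP K d (i - 1) j \<and> Gi K y $ d \<le> g i) \<or> (P = nodeP K d i j \<and> g i \<le> Gi K y $ d)"
      using t(4) by blast
    then show ?thesis using P ne unfolding \<tau>_def rp_nth by (cases "P = nodeP K d (i - 1) j") auto
  qed
  then have "\<kappa> (emap M K (rp d (g i) t)) * (grad u (emap M K (rp d (g i) t)) \<bullet>
      outward_normal (control_volume k l M P) (emap M K (rp d (g i) t))) = \<tau> * FL K d (emap M K (rp d (g i) t))"
    by (intro FL_at[OF K t(2,3)]) (auto simp: \<tau>_def)
  then show ?thesis unfolding t(1) \<tau>_def .
qed

definition lnode :: "(real^2) set \<times> 2 \<times> nat \<times> nat \<Rightarrow> real^2" where "lnode = (\<lambda>(K, d, i, j). nodeP K d (i - 1) j)"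
definition rnode :: "(real^2) set \<times> 2 \<times> nat \<times> nat \<Rightarrow> real^2" where "rnode = (\<lambda>(K, d, i, j). nodeP K d i j)"
definition LF :: "(real^2) set \<times> 2 \<times> nat \<times> nat \<Rightarrow> real" where
  "LF = (\<lambda>(K, d, i, j). LINT x:face K d (g i) j|arc_measure. FL K d x)"

lemma IFs_nodes:
  assumes "f \<in> IFs"
  shows "lnode f \<in> nodes k l M" "rnode f \<in> nodes k l M" "lnode f \<noteq> rnode f"
proof -
  obtain K d i j where f: "f = (K, d, i, j)" by (cases f)
  have a: "K \<in> cells M" "i \<in> {1..k}" "j \<le> k" using assms unfolding f IFs_def by auto
  have i': "i - 1 \<le> k" "i \<le> k" "i - 1 \<noteq> i" using a(2) by auto
  show "lnode f \<in> nodes k l M" "rnode f \<in> nodes k l M"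
    unfolding f lnode_def rnode_def prod.case by (rule nodeP_in_nodes[OF a(1) i'(1) a(3)], rule nodeP_in_nodes[OF a(1) i'(2) a(3)])
  show "lnode f \<noteq> rnode f"
    unfolding f lnode_def rnode_def prod.case using nodeP_inj[OF a(1) i'(1) a(3) i'(2) a(3)] i'(3) by simp
qed

lemma flux_bd0:
  "(LINT x:bd0_P k l M P|arc_measure. \<kappa> x * (grad u x \<bullet> outward_normal (control_volume k l M P) x))
    = (\<Sum>f\<in>{f\<in>IFs. P = lnode f \<or> P = rnode f}. (if P = lnode f then 1 else -1) * LF f)"
proof -
  let ?I = "{f\<in>IFs. P = lnode f \<or> P = rnode f}"
  let ?F = "\<lambda>(K, d, i, j). face K d (g i) j"
  let ?f = "\<lambda>f x. (if P = lnode f then 1 else -1) * (case f of (K, d, i, j) \<Rightarrow> FL K d x)"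
  have I': "?I = {(K, d, i, j) \<in> IFs. P = nodeP K d (i - 1) j \<or> P = nodeP K d i j}"
    by (auto simp: lnode_def rnode_def)
  have "(LINT x:bd0_P k l M P|arc_measure. \<kappa> x * (grad u x \<bullet> outward_normal (control_volume k l M P) x))
    = (\<Sum>f\<in>?I. LINT x:?F f|arc_measure. ?f f x)"
  proof (rule LINT_faces[where N = Bad])
    show "finite ?I" using finite_IFs by simp
    show "finite Bad" by (rule finite_Bad)
  next
    fix x assume x: "x \<notin> Bad"
    show "x \<in> bd0_P k l M P \<longleftrightarrow> (\<exists>f\<in>?I. x \<in> ?F f)"
      unfolding bd0_iff[OF x] I' by (intro bex_cong refl) (auto split: prod.split)
  next
    fix f f' x assume f: "f \<in> ?I" "f' \<in> ?I" "x \<in> ?F f" "x \<in> ?F f'" "x \<notin> Bad"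
    obtain K d i j where ff: "f = (K, d, i, j)" by (cases f)
    obtain K' d' i' j' where ff': "f' = (K', d', i', j')" by (cases f')
    have a: "(K, d, i, j) \<in> IFs" "(K', d', i', j') \<in> IFs" "x \<in> face K d (g i) j" "x \<in> face K' d' (g i') j'"
      using f(1-4) unfolding ff ff' by auto
    show "f = f'" unfolding ff ff' by (rule inner_faces_disjoint[OF a f(5)])
  next
    fix f x assume f: "f \<in> ?I" "x \<in> ?F f" "x \<notin> Bad"
    obtain K d i j where ff: "f = (K, d, i, j)" by (cases f)
    have a: "K \<in> cells M" "i \<in> {1..k}" "j \<le> k" "x \<in> face K d (g i) j" "P = nodeP K d (i - 1) j \<or> P = nodeP K d i j"
      using f(1,2) unfolding ff IFs_def lnode_def rnode_def by auto
    show "\<kappa> x * (grad u x \<bullet> outward_normal (control_volume k l M P) x) = ?f f x"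
      unfolding ff lnode_def prod.case by (rule flux_on_face[OF a(1-4) f(3) a(5)])
  next
    fix f assume f: "f \<in> ?I"
    obtain K d i j where ff: "f = (K, d, i, j)" by (cases f)
    have a: "K \<in> cells M" "i \<in> {1..k}" "j \<le> k" using f unfolding ff IFs_def by auto
    have "-1 \<le> g i" "g i \<le> 1" using gauss_pt_bounds[of i k] a(2) by auto
    then show "set_integrable arc_measure (?F f) (?f f)"
      unfolding ff prod.case by (intro face_integrable[OF a(1) _ _ a(3)] continuous_intros FL_continuous[OF a(1)])
  qed
  also have "\<dots> = (\<Sum>f\<in>?I. (if P = lnode f then 1 else -1) * LF f)"
    by (intro sum.cong refl) (auto simp: LF_def split: prod.split)
  finally show ?thesis .
qed

text \<open>Each inner face bounds exactly two control volumes with opposite normals. Exchanging the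
  sums over nodes and faces leaves jump times flux, and the minus sign in \<open>a_h0\<close> makes
  the jump right value minus left value.\<close>

lemma a_h0_eq:
  "a_h0 k l \<kappa> M u (dual_interp k l M u) = (\<Sum>f\<in>IFs. (nv (rnode f) - nv (lnode f)) * LF f)"
proof -
  have "(\<Sum>P\<in>nodes k l M. cv_value k l M (dual_interp k l M u) P *
     (LINT x:bd0_P k l M P|arc_measure. \<kappa> x * (grad u x \<bullet> outward_normal (control_volume k l M P) x)))
    = (\<Sum>P\<in>nodes k l M. \<Sum>f\<in>IFs. (if lnode f = P then nv P * LF f else 0) - (if rnode f = P then nv P * LF f else 0))"
  proof (intro sum.cong refl)
    fix P assume P: "P \<in> nodes k l M"
    have "cv_value k l M (dual_interp k l M u) P *
     (LINT x:bd0_P k l M P|arc_measure. \<kappa> x * (grad u x \<bullet> outward_normal (control_volume k l M P) x))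
      = (\<Sum>f\<in>{f\<in>IFs. P = lnode f \<or> P = rnode f}. nv P * ((if P = lnode f then 1 else -1) * LF f))"
      unfolding cv_value_dual_interp[OF P] flux_bd0 by (rule sum_distrib_left)
    also have "\<dots> = (\<Sum>f\<in>IFs. if P = lnode f \<or> P = rnode f then nv P * ((if P = lnode f then 1 else -1) * LF f) else 0)"
      using finite_IFs by (rule sum.inter_filter)
    also have "\<dots> = (\<Sum>f\<in>IFs. (if lnode f = P then nv P * LF f else 0) - (if rnode f = P then nv P * LF f else 0))"
    proof (intro sum.cong refl)
      fix f assume "f \<in> IFs"
      then have "lnode f \<noteq> rnode f" by (rule IFs_nodes(3))
      then show "(if P = lnode f \<or> P = rnode f then nv P * ((if P = lnode f then 1 else -1) * LF f) else 0)
        = (if lnode f = P then nv P * LF f else 0) - (if rnode f = P then nv P * LF f else 0)" by auto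
    qed
    finally show "cv_value k l M (dual_interp k l M u) P *
     (LINT x:bd0_P k l M P|arc_measure. \<kappa> x * (grad u x \<bullet> outward_normal (control_volume k l M P) x))
      = (\<Sum>f\<in>IFs. (if lnode f = P then nv P * LF f else 0) - (if rnode f = P then nv P * LF f else 0))" .
  qed
  also have "\<dots> = (\<Sum>f\<in>IFs. \<Sum>P\<in>nodes k l M. (if lnode f = P then nv P * LF f else 0) - (if rnode f = P then nv P * LF f else 0))"
    by (rule sum.swap)
  also have "\<dots> = (\<Sum>f\<in>IFs. nv (lnode f) * LF f - nv (rnode f) * LF f)"
    by (intro sum.cong refl) (simp add: sum_subtractf finite_nodes IFs_nodes(1,2))
  finally show ?thesis unfolding a_h0_def
    by (simp add: sum_negf[symmetric] left_diff_distrib)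
qed

lemma u_continuous: assumes K: "K \<in> cells M" shows "continuous_on (elem M K) u"
proof -
  have q: "continuous_on ref_square (qv k (c K))"
    by (intro continuous_at_imp_continuous_on ballI has_derivative_continuous[OF qv_has_derivative])
  have "continuous_on (elem M K) (\<lambda>x. qv k (c K) (Gi K x))"
    by (rule continuous_on_compose2[OF q contG[OF K]]) (use G_in[OF K] in blast)
  moreover have "u x = qv k (c K) (Gi K x)" if "x \<in> elem M K" for x
    using u[OF K G_in[OF K that]] \<Psi>G[OF K that] by simp
  ultimately show ?thesis by (simp cong: continuous_on_cong)
qed

definition bnode :: "(real^2) set \<times> 2 \<times> real \<times> nat \<Rightarrow> real^2" where "bnode = (\<lambda>(K, d, s, j). nodeP K d (ie s) j)"
definition BF :: "(real^2) set \<times> 2 \<times> real \<times> nat \<Rightarrow> (real^2) set" where "BF = (\<lambda>(K, d, s, j). face K d s j)"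

lemma bnode_boundary: assumes "f \<in> BEs" shows "bnode f \<in> boundary_nodes k l M"
proof -
  obtain K d s j where f: "f = (K, d, s, j)" by (cases f)
  have a: "K \<in> cells M" "s = -1 \<or> s = 1" "j \<le> k" "\<not> shared M K d s" using assms unfolding f BEs_def by auto
  show ?thesis unfolding f bnode_def prod.case boundary_nodes_def
    using unshared_node[OF a(1,2,4,3)] nodeP_in_nodes[OF a(1) ie_le a(3)] by blast
qed

lemma boundary_LINT:
  assumes "\<And>K. K \<in> cells M \<Longrightarrow> continuous_on (elem M K) (f :: real^2 \<Rightarrow> real)" and I: "I \<subseteq> BEs"
    and A: "\<And>x. x \<notin> Bad \<Longrightarrow> x \<in> A \<longleftrightarrow> (\<exists>e\<in>I. x \<in> BF e)"
  shows "(LINT x:A|arc_measure. f x) = (\<Sum>e\<in>I. LINT x:BF e|arc_measure. f x)"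
proof (rule LINT_faces[where N = Bad])
  show "finite I" using finite_BEs I by (rule finite_subset[rotated])
  show "finite Bad" by (rule finite_Bad)
  show "\<And>x. x \<notin> Bad \<Longrightarrow> x \<in> A \<longleftrightarrow> (\<exists>e\<in>I. x \<in> BF e)" by (rule A)
next
  fix e e' x assume f: "e \<in> I" "e' \<in> I" "x \<in> BF e" "x \<in> BF e'" "x \<notin> Bad"
  obtain K d s j where ff: "e = (K, d, s, j)" by (cases e)
  obtain K' d' s' j' where ff': "e' = (K', d', s', j')" by (cases e')
  have a: "(K, d, s, j) \<in> BEs" "(K', d', s', j') \<in> BEs" "x \<in> face K d s j" "x \<in> face K' d' s' j'"
    using f(1-4) I unfolding ff ff' BF_def by auto
  show "e = e'" unfolding ff ff' by (rule boundary_faces_disjoint[OF a f(5)])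
next
  fix e assume f: "e \<in> I"
  obtain K d s j where ff: "e = (K, d, s, j)" by (cases e)
  have a: "K \<in> cells M" "s = -1 \<or> s = 1" "j \<le> k" using f I unfolding ff BEs_def by auto
  then show "set_integrable arc_measure (BF e) f"
    unfolding ff BF_def prod.case by (intro face_integrable assms(1)) auto
qed simp

text \<open>Each boundary segment belongs to the control volume of a single node, and this node is a
  boundary node by \<open>bnode_boundary\<close>.\<close>

lemma r_h_eq:
  "r_h k l \<sigma> M u (dual_interp k l M u) = (\<Sum>e\<in>BEs. nv (bnode e) * (LINT x:BF e|arc_measure. \<sigma> x * u x))"
proof -
  let ?L = "\<lambda>e. LINT x:BF e|arc_measure. \<sigma> x * u x"
  have fb: "finite (boundary_nodes k l M)" unfolding boundary_nodes_def using finite_nodes by simp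
  have "(LINT x:Gamma_P k l M P|arc_measure. \<sigma> x * u x) = (\<Sum>e\<in>{e\<in>BEs. P = bnode e}. ?L e)" for P
  proof (rule boundary_LINT)
    fix K assume K: "K \<in> cells M"
    show "continuous_on (elem M K) (\<lambda>x. \<sigma> x * u x)" by (intro continuous_intros cont_coef(2)[OF K] u_continuous[OF K])
  next
    fix x assume x: "x \<notin> Bad"
    have I': "{e\<in>BEs. P = bnode e} = {(K, d, s, j) \<in> BEs. P = nodeP K d (ie s) j}" by (auto simp: bnode_def)
    show "x \<in> Gamma_P k l M P \<longleftrightarrow> (\<exists>e\<in>{e\<in>BEs. P = bnode e}. x \<in> BF e)"
      unfolding Gamma_P_iff[OF x] I' by (intro bex_cong refl) (auto simp: BF_def split: prod.split)
  qed auto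
  then have "r_h k l \<sigma> M u (dual_interp k l M u) = (\<Sum>P\<in>boundary_nodes k l M. nv P * (\<Sum>e\<in>{e\<in>BEs. P = bnode e}. ?L e))"
    unfolding r_h_def by (intro sum.cong refl) (simp add: boundary_nodes_def cv_value_dual_interp)
  also have "\<dots> = (\<Sum>P\<in>boundary_nodes k l M. \<Sum>e\<in>BEs. if bnode e = P then nv P * ?L e else 0)"
    by (intro sum.cong refl) (simp add: sum.inter_filter[OF finite_BEs] sum_distrib_left if_distrib eq_commute cong: if_cong)
  also have "\<dots> = (\<Sum>e\<in>BEs. \<Sum>P\<in>boundary_nodes k l M. if bnode e = P then nv P * ?L e else 0)" by (rule sum.swap)
  also have "\<dots> = (\<Sum>e\<in>BEs. nv (bnode e) * ?L e)"
    by (intro sum.cong refl) (simp add: fb bnode_boundary)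
  finally show ?thesis .
qed

end

section \<open>Element and edge estimates, and coercivity on one mesh\<close>

text \<open>The quantitative data: \<open>Mb\<close> bounds the coefficients,
  \<open>\<omega>\<close> their oscillation about the element centre, \<open>\<kappa>0\<close> and
  \<open>\<sigma>0\<close> are lower bounds, \<open>C0\<close> collects the constants of the
  reference square, and \<open>B\<close>, \<open>\<delta>\<close>, \<open>\<epsilon>\<close> are
  bound and modulus of the scaled flux coefficients.\<close>

locale fv_estimate = fv_robin +
  fixes Mb \<omega> \<kappa>0 \<sigma>0 C0 B \<delta> \<epsilon> :: real
  assumes coef_le: "\<And>K x. K \<in> cells M \<Longrightarrow> x \<in> elem M K \<Longrightarrow> \<bar>\<kappa> x\<bar> \<le> Mb"
      "\<And>K x. K \<in> cells M \<Longrightarrow> x \<in> elem M K \<Longrightarrow> \<bar>\<sigma> x\<bar> \<le> Mb"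
    and osc: "\<And>K x. K \<in> cells M \<Longrightarrow> x \<in> elem M K \<Longrightarrow> \<bar>\<kappa> x - \<kappa> (emap M K 0)\<bar> \<le> \<omega>"
      "\<And>K x. K \<in> cells M \<Longrightarrow> x \<in> elem M K \<Longrightarrow> \<bar>\<sigma> x - \<sigma> (emap M K 0)\<bar> \<le> \<omega>"
    and pos: "\<kappa>0 > 0" "\<sigma>0 > 0" "\<And>K. K \<in> cells M \<Longrightarrow> \<kappa>0 \<le> \<kappa> (emap M K 0)" "\<And>x. x \<in> Gamma_h M \<Longrightarrow> \<sigma>0 \<le> \<sigma> x"
    and C0: "C0 \<ge> 0"
      "\<And>c' s t. s \<in> {-1..1} \<Longrightarrow> t \<in> {-1..1} \<Longrightarrow> \<bar>poly (dsl k c' s) t\<bar> \<le> C0 * sqrt (Xq k c')"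
      "\<And>c' i j. i \<in> {1..k} \<Longrightarrow> j \<le> k \<Longrightarrow> \<bar>gauss_wt k i * dI k (dsl k c' (gauss_pt k i)) j\<bar> \<le> C0 * sqrt (Xq k c')"
      "\<And>p t. degree p \<le> k \<Longrightarrow> t \<in> {-1..1} \<Longrightarrow> \<bar>poly p t\<bar> \<le> C0 * sqrt (Iq (p * p))"
      "\<And>p j. degree p \<le> k \<Longrightarrow> j \<le> k \<Longrightarrow> \<bar>dI k p j\<bar> \<le> C0 * sqrt (Iq (p * p))"
    and B: "B \<ge> 0" "\<And>p. p \<in> coef_set Mb Cb cJ \<Longrightarrow> \<bar>coef1 p\<bar> \<le> B \<and> \<bar>coef2 p\<bar> \<le> B"
    and md: "\<epsilon> \<ge> 0" "coef_modulus Mb Cb cJ \<delta> \<epsilon>" "\<And>K. K \<in> cells M \<Longrightarrow> \<omega> + 8 * Cb * diameter K < \<delta>"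
begin

text \<open>Stands for the squared H^1 seminorm on the element; in two dimensions this is invariant
  under scaling, so no power of the diameter appears.\<close>

definition XX :: "(real^2) set \<Rightarrow> real" where "XX K = Xq k (c K) + Xq k (tr (c K))"

lemma XX_nonneg: "XX K \<ge> 0" unfolding XX_def by (intro add_nonneg_nonneg Xq_nonneg)

lemma Xq_cd_le: "Xq k (cd d (c K)) \<le> XX K"
proof -
  have "d = 1 \<or> d = 2" by (rule exhaust_2)
  then show ?thesis unfolding XX_def using Xq_nonneg[of k "c K"] Xq_nonneg[of k "tr (c K)"] by auto
qed

lemma C0_sqrt_le: "C0 * sqrt (Xq k (cd d (c K))) \<le> C0 * sqrt (XX K)"
  using C0(1) Xq_cd_le by (intro mult_left_mono) auto

lemma qd_bound: assumes "z \<in> ref_square" shows "\<bar>qd k (c K) d z\<bar> \<le> C0 * sqrt (XX K)"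
proof -
  have "z $ d \<in> {-1..1}" "z $ oth d \<in> {-1..1}" using assms by (auto simp: ref_square_iff)
  then have "\<bar>qd k (c K) d z\<bar> \<le> C0 * sqrt (Xq k (cd d (c K)))" unfolding qd_def by (rule C0(2))
  then show ?thesis using C0_sqrt_le[of d K] by linarith
qed

abbreviation \<beta> where "\<beta> K \<equiv> element.\<beta>c (emap M K) \<kappa>"
abbreviation \<gamma> where "\<gamma> K \<equiv> element.\<gamma>c (emap M K) \<kappa>"
abbreviation fpoly where "fpoly K d i \<equiv> smult (\<beta> K d) (dsl k (cd d (c K)) (g i)) + smult (\<gamma> K) (pderiv (sl k (cd d (c K)) (g i)))"

lemma mult_approx_lower:
  fixes a b x :: real
  assumes "\<bar>a\<bar> \<le> p" "\<bar>x - b\<bar> \<le> q"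
  shows "a * x \<ge> a * b - p * q"
proof -
  have "\<bar>a * (x - b)\<bar> \<le> p * q" unfolding abs_mult using assms by (intro mult_mono) auto
  then show ?thesis unfolding right_diff_distrib by linarith
qed

text \<open>The jump is at most C0 sqrt (XX K), and the error of replacing the flux by its frozen
  polynomial \<open>fpoly\<close> is a small multiple of the same quantity; their product is a small
  multiple of XX K.\<close>

lemma inner_term:
  assumes K: "K \<in> cells M" and i: "i \<in> {1..k}" and j: "j \<le> k"
  shows "(nv (rnode (K, d, i, j)) - nv (lnode (K, d, i, j))) * LF (K, d, i, j)
     \<ge> gauss_wt k i * (dI k (dsl k (cd d (c K)) (g i)) j * integral {g j..g (Suc j)} (poly (fpoly K d i)))
        - C0\<^sup>2 * (16 * Cb * B * diameter K + 4 * Cb * \<epsilon>) * XX K"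
proof -
  interpret element "emap M K" "Gi K" "elem M K" "diameter K" Cb cJ using el[OF K] .
  let ?c = "cd d (c K)" and ?R = "sqrt (XX K)" and ?\<eta> = "16 * Cb * B * diameter K + 4 * Cb * \<epsilon>"
  let ?a = "gauss_wt k i * dI k (dsl k ?c (g i)) j" and ?I = "integral {g j..g (Suc j)} (poly (fpoly K d i))"
  have i': "i - 1 \<le> k" "i \<le> k" using i by auto
  have jump: "nv (rnode (K, d, i, j)) - nv (lnode (K, d, i, j)) = ?a"
    unfolding rnode_def lnode_def prod.case nv_eq[OF K i'(1) j] nv_eq[OF K i'(2) j] by (rule Vn_jump[OF i])
  have ja: "\<bar>?a\<bar> \<le> C0 * ?R" using C0(3)[OF i j, of ?c] C0_sqrt_le[of d K] by linarith
  have b: "-1 \<le> g j" "g j \<le> g (Suc j)" "g (Suc j) \<le> 1"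
    using gauss_pt_bounds[of j k] gauss_pt_bounds[of "Suc j" k] gauss_pt_le[of j "Suc j" k] j by auto
  have s: "-1 \<le> g i" "g i \<le> 1" using gauss_pt_bounds[of i k] i by auto
  have "\<bar>LF (K, d, i, j) - integral {g j..g (Suc j)} (\<lambda>t. \<beta>c \<kappa> d * qd k (c K) d (rp d (g i) t) + \<gamma>c \<kappa> * qd k (c K) (oth d) (rp d (g i) t))\<bar>
      \<le> ?\<eta> * (C0 * ?R)"
    unfolding LF_def prod.case face_def gI_def
    by (rule flux_integral_approx(2)[where M = Mb and \<omega> = \<omega> and \<delta> = \<delta>, OF s b small[OF K] cont_coef(1)[OF K]])
      (use coef_le(1)[OF K] osc(1)[OF K] qd_continuous qd_bound B md(2) md(3)[OF K] in auto)
  also have "(\<lambda>t. \<beta>c \<kappa> d * qd k (c K) d (rp d (g i) t) + \<gamma>c \<kappa> * qd k (c K) (oth d) (rp d (g i) t)) = poly (fpoly K d i)"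
    unfolding qd_rp qd_oth_rp fun_eq_iff by simp
  finally have L: "\<bar>LF (K, d, i, j) - ?I\<bar> \<le> ?\<eta> * (C0 * ?R)" .
  have "(C0 * ?R) * (?\<eta> * (C0 * ?R)) = C0\<^sup>2 * ?\<eta> * (?R * ?R)" by (simp add: power2_eq_square)
  also have "?R * ?R = XX K" using XX_nonneg by simp
  finally have e: "(C0 * ?R) * (?\<eta> * (C0 * ?R)) = C0\<^sup>2 * ?\<eta> * XX K" .
  show ?thesis unfolding jump using mult_approx_lower[OF ja L] unfolding e by (simp add: mult.assoc)
qed

lemma inner_element:
  assumes K: "K \<in> cells M"
  shows "(\<Sum>d\<in>UNIV. \<Sum>i\<in>{1..k}. \<Sum>j\<le>k. (nv (rnode (K, d, i, j)) - nv (lnode (K, d, i, j))) * LF (K, d, i, j))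
    \<ge> (\<kappa>0 * cJ / (4 * Cb\<^sup>2) - 2 * k * (k + 1) * C0\<^sup>2 * (16 * Cb * B * diameter K + 4 * Cb * \<epsilon>)) * XX K"
proof -
  interpret element "emap M K" "Gi K" "elem M K" "diameter K" Cb cJ using el[OF K] .
  let ?\<eta> = "C0\<^sup>2 * (16 * Cb * B * diameter K + 4 * Cb * \<epsilon>) * XX K"
  have D: "(\<Sum>i\<in>{1..k}. \<Sum>j\<le>k. (nv (rnode (K, d, i, j)) - nv (lnode (K, d, i, j))) * LF (K, d, i, j))
    \<ge> flux_form k (cd d (c K)) (\<beta> K d) (\<gamma> K) - k * (k + 1) * ?\<eta>" for d
  proof -
    have "(\<Sum>i\<in>{1..k}. \<Sum>j\<le>k. (nv (rnode (K, d, i, j)) - nv (lnode (K, d, i, j))) * LF (K, d, i, j))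
      \<ge> (\<Sum>i\<in>{1..k}. \<Sum>j\<le>k. gauss_wt k i * (dI k (dsl k (cd d (c K)) (g i)) j * integral {g j..g (Suc j)} (poly (fpoly K d i))) - ?\<eta>)"
      by (intro sum_mono) (use inner_term[OF K] in auto)
    also have "(\<Sum>i\<in>{1..k}. \<Sum>j\<le>k. gauss_wt k i * (dI k (dsl k (cd d (c K)) (g i)) j * integral {g j..g (Suc j)} (poly (fpoly K d i))) - ?\<eta>)
      = flux_form k (cd d (c K)) (\<beta> K d) (\<gamma> K) - k * (k + 1) * ?\<eta>"
      unfolding flux_form_def dual_form_def sum_subtractf sum_distrib_left[symmetric] by (simp add: algebra_simps)
    finally show ?thesis .
  qed
  have p: "\<kappa>0 * cJ / (2 * Cb\<^sup>2) > 0" using pos(1) Cb cJ by simp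
  have "flux_form k (c K) (\<beta> K 1) (\<gamma> K) + flux_form k (tr (c K)) (\<beta> K 2) (\<gamma> K)
    \<ge> \<kappa>0 * cJ / (2 * Cb\<^sup>2) / 2 * (Xq k (c K) + Xq k (tr (c K)))"
    by (rule flux_form_coercive[OF k p form_positive[where \<kappa> = \<kappa>, OF pos(3)[OF K] pos(1)]])
  then have F: "flux_form k (cd 1 (c K)) (\<beta> K 1) (\<gamma> K) + flux_form k (cd 2 (c K)) (\<beta> K 2) (\<gamma> K) \<ge> \<kappa>0 * cJ / (4 * Cb\<^sup>2) * XX K"
    unfolding XX_def by simp
  have e: "(\<kappa>0 * cJ / (4 * Cb\<^sup>2) - 2 * k * (k + 1) * C0\<^sup>2 * (16 * Cb * B * diameter K + 4 * Cb * \<epsilon>)) * XX K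
     = \<kappa>0 * cJ / (4 * Cb\<^sup>2) * XX K - 2 * (k * (k + 1) * ?\<eta>)" by (simp add: algebra_simps)
  show ?thesis unfolding e sum_2 using F D[of 1] D[of 2] by linarith
qed

lemma inner_sum:
  "(\<Sum>f\<in>IFs. (nv (rnode f) - nv (lnode f)) * LF f)
    = (\<Sum>K\<in>cells M. \<Sum>d\<in>UNIV. \<Sum>i\<in>{1..k}. \<Sum>j\<le>k. (nv (rnode (K, d, i, j)) - nv (lnode (K, d, i, j))) * LF (K, d, i, j))"
  unfolding IFs_def by (simp only: sum.cartesian_product split_def prod.collapse fst_conv snd_conv)

abbreviation ep where "ep K d s \<equiv> sl k (cd d (c K)) s"
abbreviation eq where "eq K d s \<equiv> Iq (ep K d s * ep K d s)"

lemma edge_bounds: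
  assumes K: "K \<in> cells M" and s: "s = -1 \<or> s = 1" and t: "t \<in> {-1..1}"
  shows "\<bar>u (emap M K (rp d s t))\<bar> \<le> C0 * sqrt (eq K d s)" "u (emap M K (rp d s t)) = poly (ep K d s) t"
    "emap M K (rp d s t) \<in> elem M K"
proof -
  have r: "rp d s t \<in> ref_square" unfolding rp_in_ref using s t by auto
  show e: "u (emap M K (rp d s t)) = poly (ep K d s) t" unfolding u[OF K r] qv_rp ..
  show "\<bar>u (emap M K (rp d s t))\<bar> \<le> C0 * sqrt (eq K d s)" unfolding e by (rule C0(4)[OF degree_sl t])
  show "emap M K (rp d s t) \<in> elem M K" by (rule \<Psi>_in[OF r])
qed

text \<open>The model integrand freezes \<sigma> at the midpoint of the edge; its oscillation along
  the edge is at most 2 \<omega>, since \<omega> is measured from the element centre. The second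
  estimate is an upper bound, for which the model 0 is good enough.\<close>

lemma boundary_term:
  assumes K: "K \<in> cells M" and s: "s = -1 \<or> s = 1" and j: "j \<le> k"
  shows "nv (bnode (K, d, s, j)) * (LINT x:BF (K, d, s, j)|arc_measure. \<sigma> x * u x)
     \<ge> norm (pd ref_square (oth d) (emap M K) 0) * \<sigma> (emap M K (rp d s 0)) * (dI k (ep K d s) j * integral {g j..g (Suc j)} (poly (ep K d s)))
        - C0\<^sup>2 * (8 * Cb * Mb * diameter K + 4 * Cb * \<omega>) * diameter K * eq K d s" (is ?A)
    "(LINT x:BF (K, d, s, j)|arc_measure. \<sigma> x * (u x)\<^sup>2) \<le> (8 * Cb * (diameter K)\<^sup>2 + 2 * Cb * diameter K) * Mb * C0\<^sup>2 * eq K d s" (is ?B)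
proof -
  interpret element "emap M K" "Gi K" "elem M K" "diameter K" Cb cJ using el[OF K] .
  let ?p = "ep K d s" and ?q = "sqrt (eq K d s)" and ?\<sigma> = "\<sigma> (emap M K (rp d s 0))" and ?H = "diameter K"
  let ?I = "integral {g j..g (Suc j)} (poly ?p)" and ?w = "norm (A (oth d) 0)"
  have q0: "eq K d s \<ge> 0" by (rule Iq_sq_nonneg)
  have qq: "?q * ?q = eq K d s" using q0 by simp
  have b: "-1 \<le> g j" "g j \<le> g (Suc j)" "g (Suc j) \<le> 1"
    using gauss_pt_bounds[of j k] gauss_pt_bounds[of "Suc j" k] gauss_pt_le[of j "Suc j" k] j by auto
  have s1: "-1 \<le> s" "s \<le> 1" using s by auto
  note eb = edge_bounds[OF K s]
  have Mb: "Mb \<ge> 0" using coef_le(2)[OF K eb(3)[of 0 d]] by simp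
  have v: "nv (bnode (K, d, s, j)) = dI k ?p j"
    unfolding bnode_def prod.case nv_eq[OF K ie_le j] by (rule Vn_ie[OF s])
  have F: "\<bar>\<sigma> (emap M K (rp d s t)) * u (emap M K (rp d s t))\<bar> \<le> Mb * (C0 * ?q)" if t: "t \<in> {-1..1}" for t
    unfolding abs_mult by (rule mult_mono[OF coef_le(2)[OF K eb(3)[OF t]] eb(1)[OF t] Mb]) simp
  have D: "\<bar>\<sigma> (emap M K (rp d s t)) * u (emap M K (rp d s t)) - ?\<sigma> * poly ?p t\<bar> \<le> 2 * \<omega> * (C0 * ?q)" if t: "t \<in> {g j..g (Suc j)}" for t
  proof -
    have t': "t \<in> {-1..1}" using t b by auto
    have "\<bar>\<sigma> (emap M K (rp d s t)) - ?\<sigma>\<bar> \<le> 2 * \<omega>"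
      using osc(2)[OF K eb(3)[OF t', of d]] osc(2)[OF K eb(3)[of 0 d]] by simp
    then have "\<bar>\<sigma> (emap M K (rp d s t)) - ?\<sigma>\<bar> * \<bar>poly ?p t\<bar> \<le> 2 * \<omega> * (C0 * ?q)"
      using eb(1)[OF t'] unfolding eb(2)[OF t'] by (intro mult_mono) auto
    then show ?thesis unfolding eb(2)[OF t'] abs_mult[symmetric] left_diff_distrib .
  qed
  have "\<bar>(LINT x:BF (K, d, s, j)|arc_measure. \<sigma> x * u x) - ?w * integral {g j..g (Suc j)} (\<lambda>t. ?\<sigma> * poly ?p t)\<bar>
     \<le> 8 * Cb * ?H\<^sup>2 * (Mb * (C0 * ?q)) + 2 * Cb * ?H * (2 * \<omega> * (C0 * ?q))"
    unfolding BF_def prod.case face_def gI_def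
    by (rule line_integral_approx(2)[where f = "\<lambda>x. \<sigma> x * u x" and F = "Mb * (C0 * ?q)" and g = "\<lambda>t. ?\<sigma> * poly ?p t" and D = "2 * \<omega> * (C0 * ?q)",
          OF s1 b small[OF K] _ F _ D])
      (auto intro!: continuous_intros cont_coef(2)[OF K] u_continuous[OF K])
  also have "\<dots> = C0 * (8 * Cb * Mb * ?H + 4 * Cb * \<omega>) * ?H * ?q"
    by (simp add: power2_eq_square algebra_simps)
  finally have L: "\<bar>(LINT x:BF (K, d, s, j)|arc_measure. \<sigma> x * u x) - ?w * (?\<sigma> * ?I)\<bar>
     \<le> C0 * (8 * Cb * Mb * ?H + 4 * Cb * \<omega>) * ?H * ?q" by simp
  have "(C0 * ?q) * (C0 * (8 * Cb * Mb * ?H + 4 * Cb * \<omega>) * ?H * ?q) = C0\<^sup>2 * (8 * Cb * Mb * ?H + 4 * Cb * \<omega>) * ?H * (?q * ?q)"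
    unfolding power2_eq_square by (simp only: mult.assoc mult.commute mult.left_commute)
  then have e: "(C0 * ?q) * (C0 * (8 * Cb * Mb * ?H + 4 * Cb * \<omega>) * ?H * ?q) = C0\<^sup>2 * (8 * Cb * Mb * ?H + 4 * Cb * \<omega>) * ?H * eq K d s"
    unfolding qq .
  show ?A unfolding v using mult_approx_lower[OF C0(5)[OF degree_sl[of k "cd d (c K)" s] j] L] unfolding e
    by (simp add: mult.assoc mult.left_commute)
  have F2: "\<bar>\<sigma> (emap M K (rp d s t)) * (u (emap M K (rp d s t)))\<^sup>2\<bar> \<le> Mb * (C0 * ?q)\<^sup>2" if t: "t \<in> {-1..1}" for t
    unfolding abs_mult power_abs using power_mono[OF eb(1)[OF t, of d] abs_ge_zero, of 2]
    by (intro mult_mono coef_le(2)[OF K eb(3)[OF t]] Mb) auto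
  have F3: "\<bar>\<sigma> (emap M K (rp d s t)) * (u (emap M K (rp d s t)))\<^sup>2 - 0\<bar> \<le> Mb * (C0 * ?q)\<^sup>2" if t: "t \<in> {g j..g (Suc j)}" for t
    using F2[of t] t b by auto
  have "\<bar>(LINT x:BF (K, d, s, j)|arc_measure. \<sigma> x * (u x)\<^sup>2) - ?w * integral {g j..g (Suc j)} (\<lambda>t. 0)\<bar>
     \<le> 8 * Cb * ?H\<^sup>2 * (Mb * (C0 * ?q)\<^sup>2) + 2 * Cb * ?H * (Mb * (C0 * ?q)\<^sup>2)"
    unfolding BF_def prod.case face_def gI_def
    by (rule line_integral_approx(2)[where f = "\<lambda>x. \<sigma> x * (u x)\<^sup>2" and F = "Mb * (C0 * ?q)\<^sup>2" and g = "\<lambda>t. 0" and D = "Mb * (C0 * ?q)\<^sup>2",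
          OF s1 b small[OF K] _ F2 _ F3])
      (auto intro!: continuous_intros cont_coef(2)[OF K] u_continuous[OF K])
  moreover have "8 * Cb * ?H\<^sup>2 * (Mb * (C0 * ?q)\<^sup>2) + 2 * Cb * ?H * (Mb * (C0 * ?q)\<^sup>2) = (8 * Cb * ?H\<^sup>2 + 2 * Cb * ?H) * Mb * C0\<^sup>2 * (?q * ?q)"
    by (simp add: power2_eq_square algebra_simps)
  ultimately show ?B unfolding qq by simp
qed

lemma Gamma_term_sum:
  assumes K: "K \<in> cells M" and s: "s = -1 \<or> s = 1" and H: "diameter K \<le> 1"
  shows "(\<Sum>j\<le>k. LINT x:BF (K, d, s, j)|arc_measure. \<sigma> x * (u x)\<^sup>2) \<le> (k + 1) * 10 * Cb * Mb * C0\<^sup>2 * (diameter K * eq K d s)"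
proof -
  interpret element "emap M K" "Gi K" "elem M K" "diameter K" Cb cJ using el[OF K] .
  have Mb: "Mb \<ge> 0" using coef_le(2)[OF K \<Psi>_in[OF zero_in_ref]] by simp
  have "(diameter K)\<^sup>2 \<le> diameter K" unfolding power2_eq_square using H h by simp
  then have "8 * Cb * (diameter K)\<^sup>2 + 2 * Cb * diameter K \<le> 10 * Cb * diameter K"
    using mult_left_mono[of "(diameter K)\<^sup>2" "diameter K" "8 * Cb"] Cb by simp
  then have m: "(8 * Cb * (diameter K)\<^sup>2 + 2 * Cb * diameter K) * (Mb * C0\<^sup>2 * eq K d s) \<le> 10 * Cb * diameter K * (Mb * C0\<^sup>2 * eq K d s)"
    by (rule mult_right_mono) (simp add: Mb Iq_sq_nonneg)
  have "(\<Sum>j\<le>k. LINT x:BF (K, d, s, j)|arc_measure. \<sigma> x * (u x)\<^sup>2) \<le> (\<Sum>j\<le>k. 10 * Cb * diameter K * (Mb * C0\<^sup>2 * eq K d s))"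
  proof (rule sum_mono)
    fix j assume "j \<in> {..k}"
    then have j: "j \<le> k" by simp
    show "(LINT x:BF (K, d, s, j)|arc_measure. \<sigma> x * (u x)\<^sup>2) \<le> 10 * Cb * diameter K * (Mb * C0\<^sup>2 * eq K d s)"
      using boundary_term(2)[OF K s j, of d] m by (simp add: mult.assoc)
  qed
  also have "\<dots> = (k + 1) * 10 * Cb * Mb * C0\<^sup>2 * (diameter K * eq K d s)" by simp
  finally show ?thesis .
qed

lemma boundary_edge:
  assumes K: "K \<in> cells M" and s: "s = -1 \<or> s = 1" and sh: "\<not> shared M K d s"
  shows "(\<Sum>j\<le>k. nv (bnode (K, d, s, j)) * (LINT x:BF (K, d, s, j)|arc_measure. \<sigma> x * u x))
    \<ge> (cJ * \<sigma>0 / Cb - (k + 1) * C0\<^sup>2 * (8 * Cb * Mb * diameter K + 4 * Cb * \<omega>)) * (diameter K * eq K d s)"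
proof -
  interpret element "emap M K" "Gi K" "elem M K" "diameter K" Cb cJ using el[OF K] .
  let ?p = "ep K d s" and ?\<sigma> = "\<sigma> (emap M K (rp d s 0))" and ?H = "diameter K" and ?w = "norm (A (oth d) 0)"
  let ?\<eta> = "C0\<^sup>2 * (8 * Cb * Mb * ?H + 4 * Cb * \<omega>) * ?H * eq K d s"
  have "(\<Sum>j\<le>k. nv (bnode (K, d, s, j)) * (LINT x:BF (K, d, s, j)|arc_measure. \<sigma> x * u x))
    \<ge> (\<Sum>j\<le>k. ?w * ?\<sigma> * (dI k ?p j * integral {g j..g (Suc j)} (poly ?p)) - ?\<eta>)"
    by (intro sum_mono) (use boundary_term(1)[OF K s] in auto)
  also have "(\<Sum>j\<le>k. ?w * ?\<sigma> * (dI k ?p j * integral {g j..g (Suc j)} (poly ?p)) - ?\<eta>)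
    = ?w * ?\<sigma> * dual_form k ?p ?p - (k + 1) * ?\<eta>"
    unfolding dual_form_def sum_subtractf sum_distrib_left[symmetric] by simp
  finally have 1: "(\<Sum>j\<le>k. nv (bnode (K, d, s, j)) * (LINT x:BF (K, d, s, j)|arc_measure. \<sigma> x * u x))
    \<ge> ?w * ?\<sigma> * dual_form k ?p ?p - (k + 1) * ?\<eta>" .
  have "?\<sigma> \<ge> \<sigma>0" by (rule pos(4), rule unshared_open_edge[OF K s _ _ sh]) auto
  moreover have "?w \<ge> cJ / Cb * ?H" by (rule A_lower[OF zero_in_ref])
  moreover have "dual_form k ?p ?p \<ge> eq K d s" by (rule dual_form_self[OF k degree_sl])
  ultimately have "?w * ?\<sigma> * dual_form k ?p ?p \<ge> cJ / Cb * ?H * \<sigma>0 * eq K d s"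
    using pos(2) h Cb cJ Iq_sq_nonneg[of ?p] by (intro mult_mono) auto
  moreover have "(cJ * \<sigma>0 / Cb - (k + 1) * C0\<^sup>2 * (8 * Cb * Mb * ?H + 4 * Cb * \<omega>)) * (?H * eq K d s)
     = cJ / Cb * ?H * \<sigma>0 * eq K d s - (k + 1) * ?\<eta>" by (simp add: left_diff_distrib)
  ultimately show ?thesis using 1 by linarith
qed

lemma boundary_sum:
  "(\<Sum>e\<in>BEs. F e) = (\<Sum>K\<in>cells M. \<Sum>d\<in>UNIV. \<Sum>s\<in>{-1, 1}. if shared M K d s then 0 else \<Sum>j\<le>k. F (K, d, s, j))"
proof -
  let ?S = "cells M \<times> (UNIV :: 2 set) \<times> {-1, 1 :: real} \<times> {..k}"
  have "BEs = {e \<in> ?S. \<not> shared M (fst e) (fst (snd e)) (fst (snd (snd e)))}" unfolding BEs_def by auto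
  moreover have "finite ?S" using fin by simp
  ultimately have "(\<Sum>e\<in>BEs. F e) = (\<Sum>e\<in>?S. if \<not> shared M (fst e) (fst (snd e)) (fst (snd (snd e))) then F e else 0)"
    using sum.inter_filter[of ?S F "\<lambda>e. \<not> shared M (fst e) (fst (snd e)) (fst (snd (snd e)))"] by simp
  also have "\<dots> = (\<Sum>K\<in>cells M. \<Sum>d\<in>UNIV. \<Sum>s\<in>{-1, 1}. \<Sum>j\<le>k. if \<not> shared M K d s then F (K, d, s, j) else 0)"
    by (simp only: sum.cartesian_product split_def prod.collapse fst_conv snd_conv)
  also have "\<dots> = (\<Sum>K\<in>cells M. \<Sum>d\<in>UNIV. \<Sum>s\<in>{-1, 1}. if shared M K d s then 0 else \<Sum>j\<le>k. F (K, d, s, j))"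
    by (intro sum.cong refl) simp
  finally show ?thesis .
qed

text \<open>Inside an element the gradient is at most of order sqrt (XX K) divided by the diameter,
  and the element fits into a square of side 8 Cb times the diameter. Area times squared gradient is
  free of the diameter.\<close>

lemma H1_bound:
  "(H1_seminorm M u)\<^sup>2 \<le> (16 * Cb\<^sup>2 * C0 / cJ)\<^sup>2 * (\<Sum>K\<in>cells M. XX K)"
proof -
  let ?I = "LINT x:Omega_h M|lebesgue. (norm (grad u x))\<^sup>2"
  define Q where "Q K = cbox (\<chi> i. emap M K 0 $ i - 4 * Cb * diameter K) (\<chi> i. emap M K 0 $ i + 4 * Cb * diameter K)" for K
  define G where "G K = (2 * Cb / cJ / diameter K * (C0 * sqrt (XX K)))\<^sup>2" for K
  define Z where "Z = (\<Union>K\<in>cells M. emap M K ` frontier ref_square)"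
  have sub: "elem M K \<subseteq> Q K" and cQ: "measure lebesgue (Q K) = (8 * Cb * diameter K)\<^sup>2"
    and gb: "z \<in> interior ref_square \<Longrightarrow> (norm (grad u (emap M K z)))\<^sup>2 \<le> G K"
    and nz: "negligible (emap M K ` frontier ref_square)"
    if K: "K \<in> cells M" for K z
  proof -
    interpret element "emap M K" "Gi K" "elem M K" "diameter K" Cb cJ using el[OF K] .
    show sub: "elem M K \<subseteq> Q K"
    proof
      fix x assume "x \<in> elem M K"
      then obtain z where z: "z \<in> ref_square" "x = emap M K z" unfolding elem_def by blast
      have "norm z \<le> \<bar>z $ 1\<bar> + \<bar>z $ 2\<bar>" using norm_le_l1_cart[of z] by (simp add: sum_2)
      also have "\<dots> \<le> 2"
      proof -
        have "\<bar>z $ 1\<bar> \<le> 1" "\<bar>z $ 2\<bar> \<le> 1" using z(1) unfolding ref_square_iff by (auto simp: abs_le_iff minus_le_iff)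
        then show ?thesis by linarith
      qed
      finally have n: "norm z \<le> 2" .
      have "norm (x - emap M K 0) \<le> 2 * Cb * diameter K * norm (z - 0)" unfolding z(2) by (rule \<Psi>_lipschitz[OF zero_in_ref z(1)])
      also have "\<dots> \<le> 2 * Cb * diameter K * 2" using n Cb h by (intro mult_left_mono) auto
      finally have le: "norm (x - emap M K 0) \<le> 4 * Cb * diameter K" by simp
      have "\<bar>x $ i - emap M K 0 $ i\<bar> \<le> 4 * Cb * diameter K" for i
        using component_le_norm_cart[of "x - emap M K 0" i] le by simp
      then show "x \<in> Q K" unfolding Q_def mem_box_cart by (auto simp: abs_le_iff algebra_simps)
    qed
    have ne: "Q K \<noteq> {}" using sub \<Psi>_in[OF zero_in_ref] by blast
    show "measure lebesgue (Q K) = (8 * Cb * diameter K)\<^sup>2"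
      using content_cbox_cart[OF ne[unfolded Q_def]] unfolding Q_def by (simp add: prod_2 power2_eq_square)
    show "z \<in> interior ref_square \<Longrightarrow> (norm (grad u (emap M K z)))\<^sup>2 \<le> G K"
    proof -
      assume z: "z \<in> interior ref_square"
      have zr: "z \<in> ref_square" using z interior_subset by blast
      have "norm (grad u (emap M K z)) \<le> 2 * Cb / cJ / diameter K * (C0 * sqrt (XX K))"
        by (rule grad_bound[where p' = "\<lambda>d. qd k (c K) d z", OF z u[OF K] qv_has_derivative qd_bound[OF zr]])
      then show ?thesis unfolding G_def by (intro power_mono) auto
    qed
    have "negligible (frontier ref_square)" by (rule negligible_convex_frontier[OF convex_ref])
    then show "negligible (emap M K ` frontier ref_square)"
      by (rule negligible_differentiable_image_negligible[OF order_refl])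
        (rule differentiable_on_subset[OF d\<Psi> frontier_subset_compact[OF compact_ref]])
  qed
  have "negligible Z" unfolding Z_def using fin nz by (intro negligible_Union) auto
  then have Zn: "Z \<in> null_sets lebesgue" by (simp add: negligible_iff_null_sets)
  have iQ: "integrable lebesgue (\<lambda>x. G K * indicator (Q K) x)" for K
    unfolding Q_def using fmeasurableD[OF lmeasurable_cbox] lmeasurable_cbox
    by (intro integrable_mult_right integrable_real_indicator) (auto simp: fmeasurable_def)
  have "?I \<le> (LINT x|lebesgue. (\<Sum>K\<in>cells M. G K * indicator (Q K) x))"
    unfolding set_lebesgue_integral_def
  \<comment> \<open>The gradient bound holds inside the elements; their boundaries form the null set
    \<open>Z\<close>. Integrability is asked of the majorant only.\<close>
  proof (rule integral_mono_AE')
    show "integrable lebesgue (\<lambda>x. \<Sum>K\<in>cells M. G K * indicator (Q K) x)" by (intro Bochner_Integration.integrable_sum iQ)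
    have G0: "0 \<le> G K * indicator (Q K) x" for K x unfolding G_def by simp
    show "AE x in lebesgue. 0 \<le> (\<Sum>K\<in>cells M. G K * indicator (Q K) x)" by (intro AE_I2 sum_nonneg G0)
    show "AE x in lebesgue. indicator (Omega_h M) x *\<^sub>R (norm (grad u x))\<^sup>2 \<le> (\<Sum>K\<in>cells M. G K * indicator (Q K) x)"
    proof (rule AE_I'[OF Zn], rule subsetI, rule ccontr)
      fix x assume x: "x \<in> {x \<in> space lebesgue. \<not> indicator (Omega_h M) x *\<^sub>R (norm (grad u x))\<^sup>2 \<le> (\<Sum>K\<in>cells M. G K * indicator (Q K) x)}" "x \<notin> Z"
      then have lt: "\<not> indicator (Omega_h M) x *\<^sub>R (norm (grad u x))\<^sup>2 \<le> (\<Sum>K\<in>cells M. G K * indicator (Q K) x)" by simp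
      have s0: "0 \<le> (\<Sum>K\<in>cells M. G K * indicator (Q K) x)" by (intro sum_nonneg G0)
      have xO: "x \<in> Omega_h M" using lt s0 by (cases "x \<in> Omega_h M") auto
      then obtain K where K: "K \<in> cells M" "x \<in> elem M K" unfolding Omega_h_def by blast
      then obtain z where z: "z \<in> ref_square" "x = emap M K z" unfolding elem_def by blast
      have "z \<notin> frontier ref_square" using x(2) K(1) z(2) unfolding Z_def by blast
      then have zi: "z \<in> interior ref_square" using z(1) closure_subset unfolding frontier_def by blast
      have "(norm (grad u x))\<^sup>2 \<le> G K * indicator (Q K) x" using gb[OF K(1) zi] sub[OF K(1)] K(2) z(2) by auto
      also have "\<dots> \<le> (\<Sum>K\<in>cells M. G K * indicator (Q K) x)" by (rule member_le_sum[OF K(1) G0 fin])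
      finally show False using lt xO by simp
    qed
  qed
  also have "\<dots> = (\<Sum>K\<in>cells M. G K * measure lebesgue (Q K))"
    by (subst Bochner_Integration.integral_sum[OF iQ]) (simp add: Q_def)
  also have "\<dots> = (\<Sum>K\<in>cells M. (16 * Cb\<^sup>2 * C0 / cJ)\<^sup>2 * XX K)"
  proof (rule sum.cong[OF refl])
    fix K assume K: "K \<in> cells M"
    interpret element "emap M K" "Gi K" "elem M K" "diameter K" Cb cJ using el[OF K] .
    have "2 * Cb / cJ / diameter K * (C0 * sqrt (XX K)) * (8 * Cb * diameter K) = 16 * Cb\<^sup>2 * C0 / cJ * sqrt (XX K)"
      using h by (simp add: power2_eq_square)
    then have "G K * measure lebesgue (Q K) = (16 * Cb\<^sup>2 * C0 / cJ * sqrt (XX K))\<^sup>2"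
      unfolding cQ[OF K] G_def power_mult_distrib[symmetric] by simp
    then show "G K * measure lebesgue (Q K) = (16 * Cb\<^sup>2 * C0 / cJ)\<^sup>2 * XX K"
      using power_mult_distrib[of "16 * Cb\<^sup>2 * C0 / cJ" "sqrt (XX K)" 2] real_sqrt_pow2[OF XX_nonneg[of K]] by (simp only:)
  qed
  finally have le: "?I \<le> (16 * Cb\<^sup>2 * C0 / cJ)\<^sup>2 * (\<Sum>K\<in>cells M. XX K)" by (simp add: sum_distrib_left)
  have "?I \<ge> 0" unfolding set_lebesgue_integral_def by (intro Bochner_Integration.integral_nonneg) simp
  then show ?thesis using le unfolding H1_seminorm_def by simp
qed

lemma L2_eq:
  "(L2_norm_Gamma_h M (\<lambda>x. sqrt (\<sigma> x) * u x))\<^sup>2 = (\<Sum>e\<in>BEs. LINT x:BF e|arc_measure. \<sigma> x * (u x)\<^sup>2)"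
proof -
  have G: "(LINT x:Gamma_h M|arc_measure. (sqrt (\<sigma> x) * u x)\<^sup>2) = (LINT x:Gamma_h M|arc_measure. \<sigma> x * (u x)\<^sup>2)"
    unfolding set_lebesgue_integral_def
  proof (rule Bochner_Integration.integral_cong[OF refl])
    fix x
    show "indicator (Gamma_h M) x *\<^sub>R (sqrt (\<sigma> x) * u x)\<^sup>2 = indicator (Gamma_h M) x *\<^sub>R (\<sigma> x * (u x)\<^sup>2)"
    proof (cases "x \<in> Gamma_h M")
      case True
      then have "0 \<le> \<sigma> x" using pos(4)[OF True] pos(2) by simp
      then show ?thesis by (simp add: power_mult_distrib)
    qed simp
  qed
  have "(LINT x:Gamma_h M|arc_measure. (sqrt (\<sigma> x) * u x)\<^sup>2) \<ge> 0"
    unfolding set_lebesgue_integral_def by (intro Bochner_Integration.integral_nonneg) simp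
  then have "(L2_norm_Gamma_h M (\<lambda>x. sqrt (\<sigma> x) * u x))\<^sup>2 = (LINT x:Gamma_h M|arc_measure. \<sigma> x * (u x)\<^sup>2)"
    unfolding L2_norm_Gamma_h_def G by simp
  also have "\<dots> = (\<Sum>e\<in>BEs. LINT x:BF e|arc_measure. \<sigma> x * (u x)\<^sup>2)"
  proof (rule boundary_LINT)
    fix K assume K: "K \<in> cells M"
    show "continuous_on (elem M K) (\<lambda>x. \<sigma> x * (u x)\<^sup>2)" by (intro continuous_intros cont_coef(2)[OF K] u_continuous[OF K])
  next
    fix x assume x: "x \<notin> Bad"
    show "x \<in> Gamma_h M \<longleftrightarrow> (\<exists>e\<in>BEs. x \<in> BF e)"
      unfolding Gamma_h_iff[OF x] by (intro bex_cong refl) (auto simp: BF_def split: prod.split)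
  qed simp
  finally show ?thesis .
qed

text \<open>\<open>in_small\<close> and \<open>bd_small\<close> let the perturbations consume half
  of the leading constants \<kappa>0 cJ / (4 Cb^2) and cJ \<sigma>0 / Cb. The conditions on C pass
  from the remaining discrete energies to the energy norm.\<close>

lemma coercive:
  assumes h1: "\<And>K. K \<in> cells M \<Longrightarrow> diameter K \<le> 1"
    and in_small: "\<And>K. K \<in> cells M \<Longrightarrow> 2 * k * (k + 1) * C0\<^sup>2 * (16 * Cb * B * diameter K + 4 * Cb * \<epsilon>) \<le> \<kappa>0 * cJ / (8 * Cb\<^sup>2)"
    and bd_small: "\<And>K. K \<in> cells M \<Longrightarrow> (k + 1) * C0\<^sup>2 * (8 * Cb * Mb * diameter K + 4 * Cb * \<omega>) \<le> cJ * \<sigma>0 / (2 * Cb)"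
    and C: "C \<ge> 0" "C * (16 * Cb\<^sup>2 * C0 / cJ)\<^sup>2 \<le> \<kappa>0 * cJ / (8 * Cb\<^sup>2)" "C * ((k + 1) * 10 * Cb * Mb * C0\<^sup>2) \<le> cJ * \<sigma>0 / (2 * Cb)"
  shows "a_h k l \<kappa> \<sigma> M u (dual_interp k l M u) \<ge> C * (energy_norm \<sigma> M u)\<^sup>2"
proof -
  define XT where "XT = (\<Sum>K\<in>cells M. XX K)"
  define QT where "QT = (\<Sum>K\<in>cells M. \<Sum>d\<in>UNIV. \<Sum>s\<in>{-1, 1}. if shared M K d s then 0 else diameter K * eq K d s)"
  let ?\<mu> = "\<kappa>0 * cJ / (8 * Cb\<^sup>2)" and ?\<nu> = "cJ * \<sigma>0 / (2 * Cb)" and ?b = "(k + 1) * 10 * Cb * Mb * C0\<^sup>2"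
  have "cJ * \<sigma>0 / Cb = ?\<nu> + ?\<nu>" by simp
  have half_le: "a = b + b \<Longrightarrow> x \<le> b \<Longrightarrow> b \<le> a - x" for a b x :: real by simp
  have dq: "diameter K * eq K d s \<ge> 0" if "K \<in> cells M" for K d s
    using element.h[OF el[OF that]] Iq_sq_nonneg by simp
  have X0: "XT \<ge> 0" unfolding XT_def by (intro sum_nonneg XX_nonneg)
  have Q0: "QT \<ge> 0" unfolding QT_def by (intro sum_nonneg) (simp add: dq)
  have A: "a_h0 k l \<kappa> M u (dual_interp k l M u) \<ge> ?\<mu> * XT"
    unfolding a_h0_eq inner_sum XT_def sum_distrib_left
  proof (rule sum_mono)
    fix K assume K: "K \<in> cells M"
    have "?\<mu> \<le> \<kappa>0 * cJ / (4 * Cb\<^sup>2) - 2 * k * (k + 1) * C0\<^sup>2 * (16 * Cb * B * diameter K + 4 * Cb * \<epsilon>)"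
      using in_small[OF K] by simp
    then have "?\<mu> * XX K \<le> (\<kappa>0 * cJ / (4 * Cb\<^sup>2) - 2 * k * (k + 1) * C0\<^sup>2 * (16 * Cb * B * diameter K + 4 * Cb * \<epsilon>)) * XX K"
      by (rule mult_right_mono[OF _ XX_nonneg])
    then show "?\<mu> * XX K \<le> (\<Sum>d\<in>UNIV. \<Sum>i\<in>{1..k}. \<Sum>j\<le>k. (nv (rnode (K, d, i, j)) - nv (lnode (K, d, i, j))) * LF (K, d, i, j))"
      using inner_element[OF K] by linarith
  qed
  have R: "r_h k l \<sigma> M u (dual_interp k l M u) \<ge> ?\<nu> * QT"
    unfolding r_h_eq boundary_sum QT_def sum_distrib_left
  proof (intro sum_mono)
    fix K d s assume K: "K \<in> cells M" and "s \<in> {-1, 1 :: real}"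
    then have s: "s = -1 \<or> s = 1" by simp
    show "?\<nu> * (if shared M K d s then 0 else diameter K * eq K d s)
      \<le> (if shared M K d s then 0 else \<Sum>j\<le>k. nv (bnode (K, d, s, j)) * (LINT x:BF (K, d, s, j)|arc_measure. \<sigma> x * u x))"
    proof (cases "shared M K d s")
      case False
      have "?\<nu> \<le> cJ * \<sigma>0 / Cb - (k + 1) * C0\<^sup>2 * (8 * Cb * Mb * diameter K + 4 * Cb * \<omega>)"
        by (rule half_le[OF \<open>cJ * \<sigma>0 / Cb = ?\<nu> + ?\<nu>\<close> bd_small[OF K]])
      then have "?\<nu> * (diameter K * eq K d s) \<le> (cJ * \<sigma>0 / Cb - (k + 1) * C0\<^sup>2 * (8 * Cb * Mb * diameter K + 4 * Cb * \<omega>)) * (diameter K * eq K d s)"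
        by (rule mult_right_mono[OF _ dq[OF K]])
      then show ?thesis using boundary_edge[OF K s False] False by simp
    qed simp
  qed
  have L: "(L2_norm_Gamma_h M (\<lambda>x. sqrt (\<sigma> x) * u x))\<^sup>2 \<le> ?b * QT"
    unfolding L2_eq boundary_sum QT_def sum_distrib_left
  proof (intro sum_mono)
    fix K d s assume K: "K \<in> cells M" and "s \<in> {-1, 1 :: real}"
    then have s: "s = -1 \<or> s = 1" by simp
    show "(if shared M K d s then 0 else \<Sum>j\<le>k. LINT x:BF (K, d, s, j)|arc_measure. \<sigma> x * (u x)\<^sup>2)
      \<le> ?b * (if shared M K d s then 0 else diameter K * eq K d s)"
      using Gamma_term_sum[OF K s h1[OF K], of d] by simp
  qed
  have "C * (energy_norm \<sigma> M u)\<^sup>2 = C * (H1_seminorm M u)\<^sup>2 + C * (L2_norm_Gamma_h M (\<lambda>x. sqrt (\<sigma> x) * u x))\<^sup>2"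
    unfolding energy_norm_def by (simp add: distrib_left)
  also have "\<dots> \<le> C * ((16 * Cb\<^sup>2 * C0 / cJ)\<^sup>2 * XT) + C * (?b * QT)"
    using H1_bound L C(1) unfolding XT_def by (intro add_mono mult_left_mono)
  also have "\<dots> = C * (16 * Cb\<^sup>2 * C0 / cJ)\<^sup>2 * XT + C * ?b * QT" by simp
  also have "\<dots> \<le> ?\<mu> * XT + ?\<nu> * QT" using C(2,3) X0 Q0 by (intro add_mono mult_right_mono)
  also have "\<dots> \<le> a_h k l \<kappa> \<sigma> M u (dual_interp k l M u)" unfolding a_h_def using A R by (rule add_mono)
  finally show ?thesis .
qed

end

section \<open>Uniform constants for the family and the conclusion\<close>

text \<open>Neither E nor U need be convex, so x is joined to the centre by the image of a straight
  segment of the reference square. This path has length at most 4 Cb h and is followed in steps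
  short enough for the local Lipschitz bound.\<close>

lemma (in element) oscillation:
  assumes U: "open U" "E \<subseteq> U" and L: "L \<ge> 0"
    and lip: "\<And>x y r. ball x r \<subseteq> U \<Longrightarrow> y \<in> ball x r \<Longrightarrow> \<bar>f y - f x\<bar> \<le> L * norm (y - x)"
    and x: "x \<in> E"
  shows "\<bar>f x - f (\<Psi> 0)\<bar> \<le> 4 * Cb * L * h"
proof -
  define z where "z = G x"
  have z: "z \<in> ref_square" "x = \<Psi> z" unfolding z_def using x by auto
  have nz: "norm z \<le> 2"
  proof -
    have "\<bar>z $ 1\<bar> \<le> 1" "\<bar>z $ 2\<bar> \<le> 1" using z(1) unfolding ref_square_iff by (auto simp: abs_le_iff minus_le_iff)
    then show ?thesis using norm_le_l1_cart[of z] by (simp add: sum_2)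
  qed
  let ?\<Lambda> = "4 * Cb * h"
  define \<gamma> where "\<gamma> s = \<Psi> (s *\<^sub>R z)" for s :: real
  have sr: "s *\<^sub>R z \<in> ref_square" if "0 \<le> s" "s \<le> 1" for s
    using convexD_alt[OF convex_ref zero_in_ref z(1), of s] that by simp
  have \<gamma>E: "\<gamma> s \<in> E" if "0 \<le> s" "s \<le> 1" for s unfolding \<gamma>_def by (rule \<Psi>_in[OF sr[OF that]])
  have \<gamma>L: "norm (\<gamma> t - \<gamma> s) \<le> ?\<Lambda> * (t - s)" if "0 \<le> s" "s \<le> t" "t \<le> 1" for s t
  proof -
    have "norm (\<gamma> t - \<gamma> s) \<le> 2 * Cb * h * norm (t *\<^sub>R z - s *\<^sub>R z)"
      unfolding \<gamma>_def using that by (intro \<Psi>_lipschitz sr) auto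
    also have "norm (t *\<^sub>R z - s *\<^sub>R z) = (t - s) * norm z"
      unfolding scaleR_left_diff_distrib[symmetric] using that by simp
    also have "2 * Cb * h * ((t - s) * norm z) \<le> 2 * Cb * h * ((t - s) * 2)"
      using that nz Cb h by (intro mult_left_mono) auto
    finally show ?thesis by (simp add: algebra_simps)
  qed
  obtain e where e: "e > 0" "(\<Union>x\<in>E. ball x e) \<subseteq> U"
    by (rule compact_subset_open_imp_ball_epsilon_subset[OF compact_E U])
  \<comment> \<open>With n steps each is shorter than e, the radius for which balls around points of
    E stay in U.\<close>
  obtain n :: nat where n: "?\<Lambda> / e < n" using reals_Archimedean2 by blast
  have \<Lambda>0: "?\<Lambda> > 0" using Cb h by simp
  then have n0: "n > 0" using n e(1) by (cases n) (auto simp: field_simps)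
  have step: "\<bar>f (\<gamma> (Suc m / n)) - f (\<gamma> (m / n))\<bar> \<le> L * (?\<Lambda> / n)" if m: "m < n" for m
  proof -
    have b: "0 \<le> real m / n" "real m / n \<le> Suc m / n" "Suc m / n \<le> 1" using m n0 by (auto simp: field_simps)
    have le: "norm (\<gamma> (Suc m / n) - \<gamma> (m / n)) \<le> ?\<Lambda> / n"
    proof -
      have "real (Suc m) / n - real m / n = 1 / n" by (simp add: diff_divide_distrib[symmetric])
      then show ?thesis using \<gamma>L[OF b] by simp
    qed
    have "?\<Lambda> / n < e" using n n0 e(1) by (simp add: field_simps)
    then have "\<gamma> (Suc m / n) \<in> ball (\<gamma> (m / n)) e" using le by (simp add: dist_norm norm_minus_commute)
    moreover have "ball (\<gamma> (m / n)) e \<subseteq> U" using \<gamma>E[of "m / n"] b e(2) by force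
    ultimately have "\<bar>f (\<gamma> (Suc m / n)) - f (\<gamma> (m / n))\<bar> \<le> L * norm (\<gamma> (Suc m / n) - \<gamma> (m / n))" by (intro lip)
    also have "\<dots> \<le> L * (?\<Lambda> / n)" by (rule mult_left_mono[OF le L])
    finally show ?thesis .
  qed
  have "f (\<gamma> 1) - f (\<gamma> 0) = (\<Sum>m<n. f (\<gamma> (Suc m / n)) - f (\<gamma> (m / n)))"
    using n0 by (subst sum_lessThan_telescope[of "\<lambda>m. f (\<gamma> (m / n))"]) simp
  also have "\<bar>\<dots>\<bar> \<le> (\<Sum>m<n. L * (?\<Lambda> / n))" by (rule order.trans[OF sum_abs]) (intro sum_mono step, simp)
  also have "\<dots> = 4 * Cb * L * h" using n0 by simp
  finally show ?thesis unfolding \<gamma>_def z(2) by simp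
qed

lemma jacobian_cross: "jacobian M K z = cross (pd ref_square 1 (emap M K) z) (pd ref_square 2 (emap M K) z)"
  by (simp add: jacobian_def det_2 cross_def)

lemma Ck_on_mono: "Ck_on m S f \<Longrightarrow> n \<le> m \<Longrightarrow> Ck_on n S f"
  unfolding Ck_on_def by auto

text \<open>An injective image of the square contains two distinct points, and boundedness of the
  domain makes the diameter meaningful. The element estimates divide by it.\<close>

lemma diameter_cell_pos:
  assumes \<Omega>: "bounded_domain \<Omega>" and part: "partition_of_domain \<Omega> M" and K: "K \<in> cells M"
  shows "diameter K > 0"
proof -
  note P = part[unfolded partition_of_domain_def]
  have "K \<subseteq> closure \<Omega>" using Union_upper[OF K] unfolding P[THEN conjunct2, THEN conjunct1] .
  moreover have "bounded (closure \<Omega>)" using \<Omega> unfolding bounded_domain_def by (intro bounded_closure) simp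
  ultimately have bK: "bounded K" by (rule bounded_subset[rotated])
  have "curved_quadrilateral K" by (rule bspec[OF P[THEN conjunct2, THEN conjunct2, THEN conjunct1] K])
  then obtain f g where fg: "homeomorphism ref_square K f g" unfolding curved_quadrilateral_def by blast
  have r: "0 \<in> ref_square" "pt 1 1 \<in> ref_square" using zero_in_ref by (auto simp: ref_square_iff forall_2)
  have "f 0 \<noteq> f (pt 1 1)"
  proof
    assume "f 0 = f (pt 1 1)"
    then have "g (f 0) = g (f (pt 1 1))" by (rule arg_cong)
    then have "0 = pt 1 1" unfolding homeomorphism_apply1[OF fg r(1)] homeomorphism_apply1[OF fg r(2)] .
    then have "(0 :: real^2) $ 1 = pt 1 1 $ 1" by (rule arg_cong)
    then show False by simp
  qed
  moreover have "f 0 \<in> K" "f (pt 1 1) \<in> K" using fg r unfolding homeomorphism_def by auto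
  ultimately show ?thesis using diameter_bounded_bound[OF bK, of "f 0" "f (pt 1 1)"] zero_less_dist_iff[of "f 0" "f (pt 1 1)"] by linarith
qed

lemma diameter_le_mesh_size: "finite (cells M) \<Longrightarrow> K \<in> cells M \<Longrightarrow> diameter K \<le> mesh_size M"
  unfolding mesh_size_def by (intro Max_ge) auto

lemma mesh_element:
  assumes diff: "diffeomorphism ref_square (elem M K) (emap M K)" and h: "diameter K > 0"
    and Ck: "Ck_on (max (k + 1) 3) ref_square (emap M K)"
    and bd: "\<And>is x. 1 \<le> length is \<Longrightarrow> length is \<le> max (k + 1) 3 \<Longrightarrow> x \<in> ref_square \<Longrightarrow>
       norm (pds ref_square is (emap M K) x) \<le> Cb * diameter K ^ length is"
    and J: "\<And>x. x \<in> ref_square \<Longrightarrow> cJ * (diameter K)\<^sup>2 \<le> \<bar>jacobian M K x\<bar>"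
    and pos: "Cb > 0" "cJ > 0"
  shows "\<exists>G. element (emap M K) G (elem M K) (diameter K) Cb cJ"
proof -
  obtain G where G: "homeomorphism ref_square (elem M K) (emap M K) G" "emap M K differentiable_on ref_square" "G differentiable_on elem M K"
    using diff unfolding diffeomorphism_def by blast
  have "element (emap M K) G (elem M K) (diameter K) Cb cJ"
  proof
    show "Ck_on 2 ref_square (emap M K)" using Ck by (rule Ck_on_mono) simp
    show "norm (pd ref_square i (emap M K) z) \<le> Cb * diameter K" if "z \<in> ref_square" for i z
      using bd[of "[i]" z] that by simp
    show "norm (pd ref_square j (pd ref_square i (emap M K)) z) \<le> Cb * (diameter K)\<^sup>2" if "z \<in> ref_square" for i j z
      using bd[of "[j, i]" z] that by (simp add: power2_eq_square)
    show "cJ * (diameter K)\<^sup>2 \<le> \<bar>cross (pd ref_square 1 (emap M K) z) (pd ref_square 2 (emap M K) z)\<bar>" if "z \<in> ref_square" for z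
      using J[OF that] unfolding jacobian_cross .
  qed (use G h pos in auto)
  then show ?thesis by blast
qed

text \<open>One pair of constants serves every element of every mesh of the family; passing to
  \<open>max C 1\<close> makes the derivative bound positive.\<close>

lemma shape_regular_elements:
  assumes \<Omega>: "bounded_domain \<Omega>" and mesh: "\<And>i. curved_mesh \<Omega> (T i)" and reg: "shape_regular k l T"
    and kl: "k \<ge> 1" "lagrange_nodes k l"
  obtains Cb cJ :: real where "Cb > 0" "cJ > 0" "\<forall>i. \<exists>Gi. fv_mesh k l (T i) Cb cJ Gi"
proof -
  note R = reg[unfolded shape_regular_def, THEN conjunct2, THEN conjunct2]
  obtain C where C: "\<forall>i. \<forall>K\<in>cells (T i). Ck_on (max (k + 1) 3) ref_square (emap (T i) K) \<and>
        (\<forall>is. 1 \<le> length is \<and> length is \<le> max (k + 1) 3 \<longrightarrow>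
           (\<forall>x\<in>ref_square. norm (pds ref_square is (emap (T i) K) x) \<le> C * diameter K ^ length is))"
    using R[THEN conjunct1] by (elim exE) (rule that)
  obtain cJ C' where cJ: "cJ > 0" "\<forall>i. \<forall>K\<in>cells (T i). \<forall>x\<in>ref_square.
        cJ * (diameter K)\<^sup>2 \<le> \<bar>jacobian (T i) K x\<bar> \<and> \<bar>jacobian (T i) K x\<bar> \<le> C' * (diameter K)\<^sup>2"
    using R[THEN conjunct2] by (elim exE conjE) (rule that)
  have el: "\<exists>G. element (emap (T i) K) G (elem (T i) K) (diameter K) (max C 1) cJ" if K: "K \<in> cells (T i)" for i K
  proof (rule mesh_element)
    show "diffeomorphism ref_square (elem (T i) K) (emap (T i) K)" 
      by (rule bspec[OF mesh[of i, unfolded curved_mesh_def, THEN conjunct2, THEN conjunct1] K])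
    show d: "diameter K > 0" by (rule diameter_cell_pos[OF \<Omega> mesh[of i, unfolded curved_mesh_def, THEN conjunct1] K])
    show "Ck_on (max (k + 1) 3) ref_square (emap (T i) K)" by (rule C[rule_format, OF K, THEN conjunct1])
    fix x :: "real^2" assume x: "x \<in> ref_square"
    show "cJ * (diameter K)\<^sup>2 \<le> \<bar>jacobian (T i) K x\<bar>" by (rule cJ(2)[rule_format, OF K x, THEN conjunct1])
    fix "is" :: "2 list" assume "1 \<le> length is" "length is \<le> max (k + 1) 3"
    then have "norm (pds ref_square is (emap (T i) K) x) \<le> C * diameter K ^ length is"
      by (intro C[rule_format, OF K, THEN conjunct2, rule_format, OF _ x] conjI)
    also have "\<dots> \<le> max C 1 * diameter K ^ length is" using d by (intro mult_right_mono) auto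
    finally show "norm (pds ref_square is (emap (T i) K) x) \<le> max C 1 * diameter K ^ length is" .
  qed (use cJ(1) in auto)
  have "\<exists>Gi. fv_mesh k l (T i) (max C 1) cJ Gi" for i
  proof -
    have "\<forall>K\<in>cells (T i). \<exists>G. element (emap (T i) K) G (elem (T i) K) (diameter K) (max C 1) cJ" using el by blast
    then obtain Gi where Gi: "\<forall>K\<in>cells (T i). element (emap (T i) K) (Gi K) (elem (T i) K) (diameter K) (max C 1) cJ"
      by (rule bchoice[THEN exE])
    have "fv_mesh k l (T i) (max C 1) cJ Gi"
    proof (rule fv_mesh.intro[OF kl])
      note m = mesh[of i, unfolded curved_mesh_def]
      show "finite (cells (T i))" by (rule m[THEN conjunct1, unfolded partition_of_domain_def, THEN conjunct1])
      show "conforming (T i)" "edge_params_agree (T i)" using m by simp_all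
    qed (rule bspec[OF Gi])
    then show ?thesis by blast
  qed
  then show ?thesis using that[of "max C 1" cJ] cJ(1) by simp
qed

lemma ref_constants:
  assumes "k \<ge> 1"
  obtains C0 :: real where "C0 \<ge> 0"
      "\<forall>c. \<forall>s\<in>{-1..1}. \<forall>t\<in>{-1..1}. \<bar>poly (dsl k c s) t\<bar> \<le> C0 * sqrt (Xq k c)"
      "\<forall>c. \<forall>i\<in>{1..k}. \<forall>j\<le>k. \<bar>gauss_wt k i * dI k (dsl k c (gauss_pt k i)) j\<bar> \<le> C0 * sqrt (Xq k c)"
      "\<forall>p. degree p \<le> k \<longrightarrow> (\<forall>t\<in>{-1..1}. \<bar>poly p t\<bar> \<le> C0 * sqrt (Iq (p * p)))"
      "\<forall>p j. degree p \<le> k \<longrightarrow> j \<le> k \<longrightarrow> \<bar>dI k p j\<bar> \<le> C0 * sqrt (Iq (p * p))"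
proof -
  obtain C1 where C1: "C1 \<ge> 0" "\<forall>c. (\<forall>s\<in>{-1..1}. \<forall>t\<in>{-1..1}. \<bar>poly (dsl k c s) t\<bar> \<le> C1 * sqrt (Xq k c)) \<and>
     (\<forall>i\<in>{1..k}. \<forall>j\<le>k. \<bar>gauss_wt k i * dI k (dsl k c (gauss_pt k i)) j\<bar> \<le> C1 * sqrt (Xq k c))"
    using dsl_sup_bound[OF assms] by blast
  obtain C2 where C2: "C2 \<ge> 0" "\<forall>p. degree p \<le> k \<longrightarrow> (\<forall>x\<in>{-1..1}. \<bar>poly p x\<bar> \<le> C2 * sqrt (Iq (p * p)) \<and>
       \<bar>poly (pderiv p) x\<bar> \<le> C2 * sqrt (Iq (p * p)))" using poly_sup_bound[of k] by blast
  obtain C3 where C3: "C3 \<ge> 0" "\<forall>p j. degree p \<le> k \<longrightarrow> j \<le> k \<longrightarrow> \<bar>dI k p j\<bar> \<le> C3 * sqrt (Iq (p * p))"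
    using dI_bound[of k] by blast
  let ?C = "C1 + C2 + C3"
  have up: "x \<le> ?C * sqrt y" if "x \<le> C * sqrt y" "C \<le> ?C" "y \<ge> 0" for x y C :: real
    using that(1) mult_right_mono[OF that(2), of "sqrt y"] that(3) by simp
  have le: "C1 \<le> ?C" "C2 \<le> ?C" "C3 \<le> ?C" using C1(1) C2(1) C3(1) by auto
  show ?thesis
  proof (rule that[of ?C])
    show "0 \<le> ?C" using C1(1) C2(1) C3(1) by simp
    show "\<forall>c. \<forall>s\<in>{-1..1}. \<forall>t\<in>{-1..1}. \<bar>poly (dsl k c s) t\<bar> \<le> ?C * sqrt (Xq k c)"
      by (intro allI ballI up[OF _ le(1) Xq_nonneg]) (use C1(2) in blast)
    show "\<forall>c. \<forall>i\<in>{1..k}. \<forall>j\<le>k. \<bar>gauss_wt k i * dI k (dsl k c (gauss_pt k i)) j\<bar> \<le> ?C * sqrt (Xq k c)"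
      by (intro allI ballI impI up[OF _ le(1) Xq_nonneg]) (use C1(2) in blast)
    show "\<forall>p. degree p \<le> k \<longrightarrow> (\<forall>t\<in>{-1..1}. \<bar>poly p t\<bar> \<le> ?C * sqrt (Iq (p * p)))"
      by (intro allI ballI impI up[OF _ le(2) Iq_sq_nonneg]) (use C2(2) in blast)
    show "\<forall>p j. degree p \<le> k \<longrightarrow> j \<le> k \<longrightarrow> \<bar>dI k p j\<bar> \<le> ?C * sqrt (Iq (p * p))"
      by (intro allI ballI impI up[OF _ le(3) Iq_sq_nonneg]) (use C3(2) in blast)
  qed
qed

lemma small_factor:
  fixes a b :: real
  assumes "b > 0"
  obtains x where "x > 0" "\<forall>y. 0 \<le> y \<longrightarrow> y \<le> x \<longrightarrow> a * y < b"
proof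
  let ?x = "b / (\<bar>a\<bar> + 1)"
  show "?x > 0" using assms by (simp add: add_nonneg_pos)
  show "\<forall>y. 0 \<le> y \<longrightarrow> y \<le> ?x \<longrightarrow> a * y < b"
  proof (intro allI impI)
  fix y assume y: "0 \<le> y" "y \<le> ?x"
  have "a * y \<le> \<bar>a\<bar> * y" using y(1) by (intro mult_right_mono) auto
  also have "\<dots> \<le> \<bar>a\<bar> * ?x" using y(2) by (intro mult_left_mono) auto
  also have "\<dots> < b" using assms by (simp add: field_simps add_nonneg_pos)
  finally show "a * y < b" .
  qed
qed

theorem theorem4p1:
  fixes k :: nat and l :: "nat \<Rightarrow> real"
    and \<Omega> \<Omega>' :: "(real^2) set"
    and \<kappa> \<sigma> \<kappa>' \<sigma>' :: "real^2 \<Rightarrow> real"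
    and T :: "'i \<Rightarrow> mesh"
  assumes "k \<ge> 1"
    and "lagrange_nodes k l"
    and "bounded_domain \<Omega>"
    and "\<And>i. curved_mesh \<Omega> (T i)"
    and "shape_regular k l T"
    and "robin_coefficients \<Omega> \<kappa> \<sigma>"
    and "bounded_domain \<Omega>'"
    and "\<Omega> \<subseteq> \<Omega>'"
    and "\<And>i. Omega_h (T i) \<subseteq> \<Omega>'"
    and "admissible_extensions \<Omega> \<Omega>' T \<kappa> \<sigma> \<kappa>' \<sigma>'"
  shows "\<exists>C>0. \<exists>h\<^sub>0>0. \<forall>i. mesh_size (T i) \<le> h\<^sub>0 \<longrightarrow>
           (\<forall>u\<in>trial_space k (T i).
              a_h k l \<kappa>' \<sigma>' (T i) u (dual_interp k l (T i) u)
                \<ge> C * (energy_norm \<sigma>' (T i) u)\<^sup>2)"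
proof -
  note k = \<open>k \<ge> 1\<close>
  note A = assms(10)[unfolded admissible_extensions_def]
  have W: "W1inf \<Omega>' \<kappa>'" "W1inf \<Omega>' \<sigma>'" by (rule A[THEN conjunct1], rule A[THEN conjunct2, THEN conjunct1])
  obtain \<kappa>0 where \<kappa>0: "\<kappa>0 > 0" "\<forall>i. \<forall>x\<in>Omega_h (T i). \<kappa>0 \<le> \<kappa>' x"
    using A[THEN conjunct2, THEN conjunct2, THEN conjunct2, THEN conjunct1] by (elim exE conjE) (rule that)
  obtain \<sigma>0 where \<sigma>0: "\<sigma>0 > 0" "\<forall>i. \<forall>x\<in>Gamma_h (T i). \<sigma>0 \<le> \<sigma>' x"
    using A[THEN conjunct2, THEN conjunct2, THEN conjunct2, THEN conjunct2] by (elim exE conjE) (rule that)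
  have U: "open \<Omega>'" using assms(7) unfolding bounded_domain_def by blast
  obtain L1 where L1: "L1 \<ge> 0" "\<forall>x\<in>\<Omega>'. \<bar>\<kappa>' x\<bar> \<le> L1"
    "\<forall>x y r. ball x r \<subseteq> \<Omega>' \<longrightarrow> y \<in> ball x r \<longrightarrow> \<bar>\<kappa>' y - \<kappa>' x\<bar> \<le> L1 * norm (y - x)"
    by (rule W1inf_local_lipschitz[OF U W(1)]) (rule that, assumption, intro ballI, assumption, intro allI impI, assumption)
  obtain L2 where L2: "L2 \<ge> 0" "\<forall>x\<in>\<Omega>'. \<bar>\<sigma>' x\<bar> \<le> L2"
    "\<forall>x y r. ball x r \<subseteq> \<Omega>' \<longrightarrow> y \<in> ball x r \<longrightarrow> \<bar>\<sigma>' y - \<sigma>' x\<bar> \<le> L2 * norm (y - x)"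
    by (rule W1inf_local_lipschitz[OF U W(2)]) (rule that, assumption, intro ballI, assumption, intro allI impI, assumption)
  define Mb where "Mb = max L1 L2"
  have Mb: "L1 \<le> Mb" "L2 \<le> Mb" "0 \<le> Mb" unfolding Mb_def using L1(1) by auto
  obtain Cb cJ :: real where CJ: "Cb > 0" "cJ > 0" and Gex: "\<forall>i. \<exists>Gi. fv_mesh k l (T i) Cb cJ Gi"
    by (rule shape_regular_elements[OF assms(3,4,5,1,2)]) (rule that)
  obtain C0 where C0: "C0 \<ge> 0"
      "\<forall>c. \<forall>s\<in>{-1..1}. \<forall>t\<in>{-1..1}. \<bar>poly (dsl k c s) t\<bar> \<le> C0 * sqrt (Xq k c)"
      "\<forall>c. \<forall>i\<in>{1..k}. \<forall>j\<le>k. \<bar>gauss_wt k i * dI k (dsl k c (gauss_pt k i)) j\<bar> \<le> C0 * sqrt (Xq k c)"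
      "\<forall>p. degree p \<le> k \<longrightarrow> (\<forall>t\<in>{-1..1}. \<bar>poly p t\<bar> \<le> C0 * sqrt (Iq (p * p)))"
      "\<forall>p j. degree p \<le> k \<longrightarrow> j \<le> k \<longrightarrow> \<bar>dI k p j\<bar> \<le> C0 * sqrt (Iq (p * p))"
    by (rule ref_constants[OF k]) (rule that)
  obtain B where B: "B \<ge> 0" "\<forall>p\<in>coef_set Mb Cb cJ. \<bar>coef1 p\<bar> \<le> B \<and> \<bar>coef2 p\<bar> \<le> B" using coef_bound[OF CJ(2)] by blast
  \<comment> \<open>The constants that survive absorption in \<open>coercive\<close>;
    \<open>?N\<close> is the number of inner faces of an element times C0^2.\<close>
  let ?\<mu> = "\<kappa>0 * cJ / (8 * Cb\<^sup>2)" and ?\<nu> = "cJ * \<sigma>0 / (2 * Cb)" and ?N = "2 * real k * real (k + 1) * C0\<^sup>2"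
  have \<mu>\<nu>: "?\<mu> > 0" "?\<nu> > 0" "?\<mu> / 2 > 0" using CJ \<kappa>0(1) \<sigma>0(1) by auto
  \<comment> \<open>Order of the choices: \<epsilon> depends on mesh-independent constants only,
    \<delta> is its modulus, and then the mesh size is bounded. Below h1 edges are nearly straight,
    below h2 the scaled coefficients stay within \<delta>, and h3 and h4 make the inner and boundary
    errors absorbable.\<close>
  obtain \<epsilon> where \<epsilon>: "\<epsilon> > 0" "\<forall>y. 0 \<le> y \<longrightarrow> y \<le> \<epsilon> \<longrightarrow> ?N * (4 * Cb) * y < ?\<mu> / 2"
    by (rule small_factor[where a = "?N * (4 * Cb)", OF \<mu>\<nu>(3)]) (rule that)
  obtain \<delta> where \<delta>: "\<delta> > 0" "coef_modulus Mb Cb cJ \<delta> \<epsilon>" using coef_modulus_exists[OF CJ(2) \<epsilon>(1)] by blast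
  obtain h1 where h1: "h1 > 0" "\<forall>y. 0 \<le> y \<longrightarrow> y \<le> h1 \<longrightarrow> 4 * Cb\<^sup>2 * y < cJ"
    by (rule small_factor[where a = "4 * Cb\<^sup>2", OF CJ(2)]) (rule that)
  obtain h2 where h2: "h2 > 0" "\<forall>y. 0 \<le> y \<longrightarrow> y \<le> h2 \<longrightarrow> (4 * Cb * Mb + 8 * Cb) * y < \<delta>"
    by (rule small_factor[where a = "4 * Cb * Mb + 8 * Cb", OF \<delta>(1)]) (rule that)
  obtain h3 where h3: "h3 > 0" "\<forall>y. 0 \<le> y \<longrightarrow> y \<le> h3 \<longrightarrow> ?N * (16 * Cb * B) * y < ?\<mu> / 2"
    by (rule small_factor[where a = "?N * (16 * Cb * B)", OF \<mu>\<nu>(3)]) (rule that)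
  obtain h4 where h4: "h4 > 0" "\<forall>y. 0 \<le> y \<longrightarrow> y \<le> h4 \<longrightarrow> (k + 1) * C0\<^sup>2 * (8 * Cb * Mb + 16 * Cb\<^sup>2 * Mb) * y < ?\<nu>"
    by (rule small_factor[where a = "(k + 1) * C0\<^sup>2 * (8 * Cb * Mb + 16 * Cb\<^sup>2 * Mb)", OF \<mu>\<nu>(2)]) (rule that)
  define h0 where "h0 = min 1 (min h1 (min h2 (min h3 h4)))"
  have h0: "h0 > 0" "h0 \<le> 1" "h0 \<le> h1" "h0 \<le> h2" "h0 \<le> h3" "h0 \<le> h4"
    unfolding h0_def using h1(1) h2(1) h3(1) h4(1) by auto
  obtain c1 where c1: "c1 > 0" "\<forall>y. 0 \<le> y \<longrightarrow> y \<le> c1 \<longrightarrow> (16 * Cb\<^sup>2 * C0 / cJ)\<^sup>2 * y < ?\<mu>"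
    by (rule small_factor[where a = "(16 * Cb\<^sup>2 * C0 / cJ)\<^sup>2", OF \<mu>\<nu>(1)]) (rule that)
  obtain c2 where c2: "c2 > 0" "\<forall>y. 0 \<le> y \<longrightarrow> y \<le> c2 \<longrightarrow> (k + 1) * 10 * Cb * Mb * C0\<^sup>2 * y < ?\<nu>"
    by (rule small_factor[where a = "(k + 1) * 10 * Cb * Mb * C0\<^sup>2", OF \<mu>\<nu>(2)]) (rule that)
  define C where "C = min c1 c2"
  have C: "C > 0" "C \<le> c1" "C \<le> c2" unfolding C_def using c1(1) c2(1) by auto
  \<comment> \<open>The bound of \<open>element.oscillation\<close> for diameters up to h0, with
    \<open>Mb\<close> in place of either Lipschitz constant.\<close>
  define \<omega> where "\<omega> = 4 * Cb * Mb * h0"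
  have main: "a_h k l \<kappa>' \<sigma>' (T i) u (dual_interp k l (T i) u) \<ge> C * (energy_norm \<sigma>' (T i) u)\<^sup>2"
    if hi: "mesh_size (T i) \<le> h0" and u: "u \<in> trial_space k (T i)" for i u
  proof -
    obtain Gi where G: "fv_mesh k l (T i) Cb cJ Gi" using Gex by blast
    interpret fv_mesh k l "T i" Cb cJ Gi by (rule G)
    have "\<forall>K\<in>cells (T i). \<exists>c. \<forall>z\<in>ref_square. u (emap (T i) K z) = qv k c z"
    proof
      fix K assume "K \<in> cells (T i)"
      then obtain p where p: "p \<in> Qk k" "\<forall>x\<in>ref_square. u (emap (T i) K x) = p x" using u unfolding trial_space_def by blast
      obtain c where "\<And>z. p z = qv k c z" using Qk_coeffs[OF p(1)] by blast
      then show "\<exists>c. \<forall>z\<in>ref_square. u (emap (T i) K z) = qv k c z" using p(2) by auto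
    qed
    then obtain c where c: "\<forall>K\<in>cells (T i). \<forall>z\<in>ref_square. u (emap (T i) K z) = qv k (c K) z" by (rule bchoice[THEN exE])
    have sub: "elem (T i) K \<subseteq> \<Omega>'" if "K \<in> cells (T i)" for K using assms(9)[of i] that unfolding Omega_h_def by blast
    have dh: "0 \<le> diameter K" "diameter K \<le> h0" if "K \<in> cells (T i)" for K
      using element.h[OF el[OF that]] diameter_le_mesh_size[OF fin that] hi by auto
    have O: "\<bar>\<kappa>' x - \<kappa>' (emap (T i) K 0)\<bar> \<le> \<omega>" "\<bar>\<sigma>' x - \<sigma>' (emap (T i) K 0)\<bar> \<le> \<omega>" if K: "K \<in> cells (T i)" and x: "x \<in> elem (T i) K" for K x
    proof -
      have m: "4 * Cb * L * diameter K \<le> \<omega>" if "0 \<le> L" "L \<le> Mb" for L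
        unfolding \<omega>_def using that CJ(1) dh[OF K] by (intro mult_mono) auto
      show "\<bar>\<kappa>' x - \<kappa>' (emap (T i) K 0)\<bar> \<le> \<omega>"
        by (rule order.trans[OF element.oscillation[OF el[OF K] U sub[OF K] L1(1) _ x] m[OF L1(1) Mb(1)]])
          (erule (1) L1(3)[rule_format])
      show "\<bar>\<sigma>' x - \<sigma>' (emap (T i) K 0)\<bar> \<le> \<omega>"
        by (rule order.trans[OF element.oscillation[OF el[OF K] U sub[OF K] L2(1) _ x] m[OF L2(1) Mb(2)]])
          (erule (1) L2(3)[rule_format])
    qed
    interpret fv_estimate k l "T i" Cb cJ Gi u c \<kappa>' \<sigma>' Mb \<omega> \<kappa>0 \<sigma>0 C0 B \<delta> \<epsilon>
    proof unfold_locales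
      show "u (emap (T i) K z) = qv k (c K) z" if "K \<in> cells (T i)" "z \<in> ref_square" for K z using c that by blast
      show "continuous_on (elem (T i) K) \<kappa>'" "continuous_on (elem (T i) K) \<sigma>'" if "K \<in> cells (T i)" for K
        using W sub[OF that] continuous_on_subset unfolding W1inf_def by blast+
      show "4 * Cb\<^sup>2 * diameter K < cJ" if "K \<in> cells (T i)" for K using h1(2)[rule_format, OF dh(1)[OF that]] dh(2)[OF that] h0(3) by linarith
      show "\<bar>\<kappa>' x\<bar> \<le> Mb" "\<bar>\<sigma>' x\<bar> \<le> Mb" if "K \<in> cells (T i)" "x \<in> elem (T i) K" for K x
        using bspec[OF L1(2) subsetD[OF sub[OF that(1)] that(2)]] bspec[OF L2(2) subsetD[OF sub[OF that(1)] that(2)]] Mb by linarith+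
      show "\<bar>\<kappa>' x - \<kappa>' (emap (T i) K 0)\<bar> \<le> \<omega>" "\<bar>\<sigma>' x - \<sigma>' (emap (T i) K 0)\<bar> \<le> \<omega>" if "K \<in> cells (T i)" "x \<in> elem (T i) K" for K x
        by (rule O[OF that])+
      show "\<kappa>0 > 0" "\<sigma>0 > 0" by (rule \<kappa>0(1), rule \<sigma>0(1))
      show "\<kappa>0 \<le> \<kappa>' (emap (T i) K 0)" if "K \<in> cells (T i)" for K
        using \<kappa>0(2) that \<Psi>_in[OF zero_in_ref] unfolding Omega_h_def by blast
      show "\<sigma>0 \<le> \<sigma>' x" if "x \<in> Gamma_h (T i)" for x using \<sigma>0(2) that by blast
      show "C0 \<ge> 0" by (rule C0(1))
      show "\<bar>poly (dsl k c' s) t\<bar> \<le> C0 * sqrt (Xq k c')" if "s \<in> {-1..1}" "t \<in> {-1..1}" for c' s t using C0(2) that by blast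
      show "\<bar>gauss_wt k i * dI k (dsl k c' (gauss_pt k i)) j\<bar> \<le> C0 * sqrt (Xq k c')" if "i \<in> {1..k}" "j \<le> k" for c' i j using C0(3) that by blast
      show "\<bar>poly p t\<bar> \<le> C0 * sqrt (Iq (p * p))" if "degree p \<le> k" "t \<in> {-1..1}" for p t using C0(4) that by blast
      show "\<bar>dI k p j\<bar> \<le> C0 * sqrt (Iq (p * p))" if "degree p \<le> k" "j \<le> k" for p j using C0(5) that by blast
      show "B \<ge> 0" by (rule B(1))
      show "\<bar>coef1 p\<bar> \<le> B \<and> \<bar>coef2 p\<bar> \<le> B" if "p \<in> coef_set Mb Cb cJ" for p using B(2) that by blast
      show "\<epsilon> \<ge> 0" using \<epsilon>(1) by simp
      show "coef_modulus Mb Cb cJ \<delta> \<epsilon>" by (rule \<delta>(2))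
      show "\<omega> + 8 * Cb * diameter K < \<delta>" if "K \<in> cells (T i)" for K
      proof -
        have "8 * Cb * diameter K \<le> 8 * Cb * h0" using dh[OF that] CJ(1) by (intro mult_left_mono) auto
        moreover have "4 * Cb * Mb * h0 + 8 * Cb * h0 < \<delta>" using h2(2)[rule_format, of h0] h0 by (simp add: distrib_right)
        ultimately show ?thesis unfolding \<omega>_def by linarith
      qed
    qed
    show ?thesis
    proof (rule coercive)
      fix K assume K: "K \<in> cells (T i)"
      show "diameter K \<le> 1" using dh(2)[OF K] h0(2) by linarith
      have "?N * (16 * Cb * B) * diameter K < ?\<mu> / 2" using h3(2)[rule_format, OF dh(1)[OF K]] dh(2)[OF K] h0(5) by linarith
      moreover have "?N * (4 * Cb) * \<epsilon> < ?\<mu> / 2" using \<epsilon>(2)[rule_format, of \<epsilon>] \<epsilon>(1) by simp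
      moreover have "?N * (16 * Cb * B * diameter K + 4 * Cb * \<epsilon>) = ?N * (16 * Cb * B) * diameter K + ?N * (4 * Cb) * \<epsilon>"
        by (simp only: distrib_left mult.assoc)
      ultimately have "?N * (16 * Cb * B * diameter K + 4 * Cb * \<epsilon>) \<le> ?\<mu>" by linarith
      then show "real (2 * k * (k + 1)) * C0\<^sup>2 * (16 * Cb * B * diameter K + 4 * Cb * \<epsilon>) \<le> ?\<mu>" by (simp only: of_nat_mult of_nat_numeral)
      have "8 * Cb * Mb * diameter K + 4 * Cb * \<omega> \<le> (8 * Cb * Mb + 16 * Cb\<^sup>2 * Mb) * h0"
        unfolding \<omega>_def using mult_left_mono[OF dh(2)[OF K], of "8 * Cb * Mb"] CJ(1) Mb(3) by (simp add: power2_eq_square algebra_simps)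
      then have "(k + 1) * C0\<^sup>2 * (8 * Cb * Mb * diameter K + 4 * Cb * \<omega>) \<le> (k + 1) * C0\<^sup>2 * ((8 * Cb * Mb + 16 * Cb\<^sup>2 * Mb) * h0)"
        by (rule mult_left_mono) simp
      moreover have "(k + 1) * C0\<^sup>2 * (8 * Cb * Mb + 16 * Cb\<^sup>2 * Mb) * h0 < ?\<nu>" using h4(2)[rule_format, of h0] h0 by simp
      ultimately show "real (k + 1) * C0\<^sup>2 * (8 * Cb * Mb * diameter K + 4 * Cb * \<omega>) \<le> ?\<nu>"
        unfolding mult.assoc by linarith
    next
      show "C \<ge> 0" using C(1) by simp
      show "C * (16 * Cb\<^sup>2 * C0 / cJ)\<^sup>2 \<le> ?\<mu>" using c1(2)[rule_format, of C] C by (simp add: mult.commute)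
      show "C * ((k + 1) * 10 * Cb * Mb * C0\<^sup>2) \<le> ?\<nu>" using c2(2)[rule_format, of C] C by (simp add: mult.commute)
    qed
  qed
  show ?thesis
    by (rule exI[of _ C], rule conjI[OF C(1)], rule exI[of _ h0], rule conjI[OF h0(1)]) (use main in blast)
qed

end
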